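(* Let $(\mathcal{S}_1\times\mathcal{S}_2,\mathbb{W}_{S_1S_2})$ be a pair of finite-alphabet sources and $(\mathcal{X}_1\times\mathcal{X}_2,\mathcal{Y}_1\times\mathcal{Y}_2,\mathbb{W}_{Y_1Y_2|X_1X_2})$ a discrete memoryless interference channel. Suppose there exist (i) finite sets $\mathcal{K},\mathcal{U},\mathcal{V}_1,\mathcal{V}_2$; (ii) maps $f_j:\mathcal{S}_j\to\mathcal{K}$ with $K_j=f_j(S_j)$; (iii) $\alpha,\beta\ge0$, $\rho>0$, $\delta>0$; (iv) an integer $l\ge\max\{l^*(\mathcal{U},\mathcal{Y}_j,\rho):j\in\{1,2\}\}$; (v) a pmf $p_Up_{V_1}p_{V_2}p_{X_1|UV_1}p_{X_2|UV_2}\mathbb{W}_{Y_1Y_2|X_1X_2}$ with $p_U$ a type of sequences in $\mathcal{U}^l$, such that for some $a\in\{1,2\}$, $$(1+\delta)H(K_a)\le\alpha+\beta,\qquad H(S_j\mid K_a)+\beta+\mathcal{L}_l(\phi_j,|\mathcal{S}_j|)<I(V_j;Y_j\mid U)-\mathcal{L}(\phi_j,|\mathcal{V}_j|),\qquad\phi_j\le\tfrac12$$ for $j\in\{1,2\}$, where $\phi_j:=g_j(\alpha+\rho,l)+\xi^{[l]}(K_1,K_2)+\tau_{l,\delta}(K_a)$ and $g_j(R,l):=(l+1)^{2|\mathcal{U}||\mathcal{Y}_j|}\exp\{-lE_r(R,p_U,p_{Y_j|U})\}$. Then $(S_1,S_2)$ is transmissible over the interference channel.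
   Context: Source entropies under $\mathbb{W}_{S_1S_2}$; mutual informations and $p_{Y_j|U}$ under the pmf in (v). Logs/exps share a base; $h_b$ is binary entropy. Transmissibility over the IC: for every $\epsilon>0$ there is $N_\epsilon$ such that for all $n\ge N_\epsilon$ there exist encoders $e_j:\mathcal{S}_j^n\to\mathcal{X}_j^n$ and decoders $d_j:\mathcal{Y}_j^n\to\mathcal{S}_j^n$ with $P(d_1(Y_1^n)\ne S_1^n\text{ or }d_2(Y_2^n)\ne S_2^n)\le\epsilon$, where $(S_1^n,S_2^n)\sim\mathbb{W}^n_{S_1S_2}$ and $(Y_1^n,Y_2^n)$ is the memoryless channel output for inputs $e_1(S_1^n),e_2(S_2^n)$. Definitions: $l^*(\mathcal{A},\mathcal{B},\rho):=\min\{l\in\mathbb{N}:\exp(l\rho/2)\ge2(l+1)^{2|\mathcal{A}|+2|\mathcal{A}||\mathcal{B}|}\}$; $p_U$ is a type of sequences in $\mathcal{U}^l$ if $lp_U(u)\in\mathbb{Z}$ for all $u$; $E_r(R,p_U,W_{Y|U}):=\min_{V_{Y|U}}\{D(V_{Y|U}\|W_{Y|U}|p_U)+|I(p_U;V_{Y|U})-R|^+\}$; $\mathcal{L}_l(\mu,N):=\frac1lh_b(\mu)+\mu\log N$, $\mathcal{L}(\mu,N):=\mathcal{L}_1(\mu,N)$; $\xi^{[l]}(K_1,K_2):=1-(1-P(K_1\ne K_2))^l$; $\tau_{l,\delta}(K_a):=2|\mathcal{K}|\exp\{-2\delta^2p_{K_a}(b^* )^2l\}$, $b^*$ a symbol of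 least positive probability under $p_{K_a}$. *)

theory Defs
  imports "HOL-Analysis.Analysis"
begin

text \<open>Finite-alphabet information theory with pmfs represented as real-valued
functions on finite types. All logarithms/exponentials are to a common base b > 1.\<close>

definition pmf_on :: "('a::finite \<Rightarrow> real) \<Rightarrow> bool" where
  "pmf_on p \<longleftrightarrow> (\<forall>x. 0 \<le> p x) \<and> (\<Sum>x\<in>UNIV. p x) = 1"

definition stoch :: "('a \<Rightarrow> 'b::finite \<Rightarrow> real) \<Rightarrow> bool" where
  "stoch W \<longleftrightarrow> (\<forall>a. pmf_on (W a))"

definition push :: "('a::finite \<Rightarrow> real) \<Rightarrow> ('a \<Rightarrow> 'b) \<Rightarrow> 'b \<Rightarrow> real" where
  "push p g y = (\<Sum>x\<in>{x. g x = y}. p x)"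

definition plogq :: "real \<Rightarrow> real \<Rightarrow> real \<Rightarrow> real" where
  "plogq b p q = (if p = 0 then 0 else p * log b q)"

definition info_entropy :: "real \<Rightarrow> ('a::finite \<Rightarrow> real) \<Rightarrow> real" where
  "info_entropy b p = - (\<Sum>x\<in>UNIV. plogq b (p x) (p x))"

definition cond_entropy :: "real \<Rightarrow> ('a::finite \<times> 'c::finite \<Rightarrow> real) \<Rightarrow> real" where
  "cond_entropy b p = - (\<Sum>z\<in>UNIV. plogq b (p z) (p z / push p snd (snd z)))"

definition mutual_info :: "real \<Rightarrow> ('a::finite \<times> 'b::finite \<Rightarrow> real) \<Rightarrow> real" where
  "mutual_info b p = (\<Sum>z\<in>UNIV. plogq b (p z) (p z / (push p fst (fst z) * push p snd (snd z))))"

definition cond_mutual_info :: "real \<Rightarrow> ('a::finite \<times> 'b::finite \<times> 'c::finite \<Rightarrow> real) \<Rightarrow> real" where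
  "cond_mutual_info b p = (\<Sum>z\<in>UNIV. case z of (x, y, w) \<Rightarrow>
      plogq b (p z) (p z * push p (\<lambda>(x,y,w). w) w /
                     (push p (\<lambda>(x,y,w). (x,w)) (x,w) * push p (\<lambda>(x,y,w). (y,w)) (y,w))))"

definition cond_div :: "real \<Rightarrow> ('u::finite \<Rightarrow> 'y::finite \<Rightarrow> real) \<Rightarrow> ('u \<Rightarrow> 'y \<Rightarrow> real) \<Rightarrow> ('u \<Rightarrow> real) \<Rightarrow> real" where
  "cond_div b V W p = (\<Sum>u\<in>UNIV. p u * (\<Sum>y\<in>UNIV. plogq b (V u y) (V u y / W u y)))"

text \<open>random-coding error exponent; the minimum ranges over channels V with
  D(V||W|p) finite (the others contribute +infinity and do not affect the minimum)\<close>
definition Er :: "real \<Rightarrow> real \<Rightarrow> ('u::finite \<Rightarrow> real) \<Rightarrow> ('u \<Rightarrow> 'y::finite \<Rightarrow> real) \<Rightarrow> real" where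
  "Er b R p W = Inf {cond_div b V W p + max 0 (mutual_info b (\<lambda>(u,y). p u * V u y) - R) | V.
       stoch V \<and> (\<forall>u y. 0 < p u \<and> 0 < V u y \<longrightarrow> 0 < W u y)}"

definition hbin :: "real \<Rightarrow> real \<Rightarrow> real" where
  "hbin b \<mu> = - plogq b \<mu> \<mu> - plogq b (1 - \<mu>) (1 - \<mu>)"

definition Ll :: "real \<Rightarrow> nat \<Rightarrow> real \<Rightarrow> nat \<Rightarrow> real" where
  "Ll b l \<mu> N = hbin b \<mu> / real l + \<mu> * log b (real N)"

text \<open>l*(A,B,rho), with A, B given by their cardinalities\<close>
definition lstar :: "real \<Rightarrow> nat \<Rightarrow> nat \<Rightarrow> real \<Rightarrow> nat" where
  "lstar b A B \<rho> = (LEAST l::nat. b powr (real l * \<rho> / 2) \<ge> 2 * (real l + 1) ^ (2*A + 2*A*B))"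

text \<open>xi^[l] given P(K1 ~= K2)\<close>
definition xi :: "nat \<Rightarrow> real \<Rightarrow> real" where
  "xi l pne = 1 - (1 - pne) ^ l"

definition tau :: "real \<Rightarrow> nat \<Rightarrow> real \<Rightarrow> ('k::finite \<Rightarrow> real) \<Rightarrow> real" where
  "tau b l \<delta> pK = 2 * real CARD('k) *
     b powr (- 2 * \<delta>^2 * (Min {pK k | k. 0 < pK k})^2 * real l)"

definition is_type :: "nat \<Rightarrow> ('u \<Rightarrow> real) \<Rightarrow> bool" where
  "is_type l p \<longleftrightarrow> (\<forall>u. \<exists>m::int. real l * p u = real_of_int m)"

definition seqs :: "nat \<Rightarrow> 'a list set" where
  "seqs n = {xs. length xs = n}"

definition err_prob ::
  "('s1::finite \<times> 's2::finite \<Rightarrow> real) \<Rightarrow> ('x1 \<times> 'x2 \<Rightarrow> 'y1::finite \<times> 'y2::finite \<Rightarrow> real) \<Rightarrow> nat \<Rightarrow>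
   ('s1 list \<Rightarrow> 'x1 list) \<Rightarrow> ('s2 list \<Rightarrow> 'x2 list) \<Rightarrow>
   ('y1 list \<Rightarrow> 's1 list) \<Rightarrow> ('y2 list \<Rightarrow> 's2 list) \<Rightarrow> real" where
  "err_prob WS W n e1 e2 d1 d2 =
    (\<Sum>s1\<in>seqs n. \<Sum>s2\<in>seqs n. (\<Prod>i<n. WS (s1!i, s2!i)) *
      (\<Sum>y1\<in>seqs n. \<Sum>y2\<in>seqs n. (\<Prod>i<n. W (e1 s1 ! i, e2 s2 ! i) (y1!i, y2!i)) *
         (if d1 y1 \<noteq> s1 \<or> d2 y2 \<noteq> s2 then 1 else 0)))"

definition transmissible ::
  "('s1::finite \<times> 's2::finite \<Rightarrow> real) \<Rightarrow> ('x1 \<times> 'x2 \<Rightarrow> 'y1::finite \<times> 'y2::finite \<Rightarrow> real) \<Rightarrow> bool" where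
  "transmissible WS W \<longleftrightarrow> (\<forall>\<epsilon>>0. \<exists>N. \<forall>n\<ge>N. \<exists>e1 e2 d1 d2.
      (\<forall>s\<in>seqs n. e1 s \<in> seqs n) \<and> (\<forall>s\<in>seqs n. e2 s \<in> seqs n) \<and>
      (\<forall>y\<in>seqs n. d1 y \<in> seqs n) \<and> (\<forall>y\<in>seqs n. d2 y \<in> seqs n) \<and>
      err_prob WS W n e1 e2 d1 d2 \<le> \<epsilon>)"

definition joint7 ::
  "('u \<Rightarrow> real) \<Rightarrow> ('v1 \<Rightarrow> real) \<Rightarrow> ('v2 \<Rightarrow> real) \<Rightarrow> ('u \<times> 'v1 \<Rightarrow> 'x1 \<Rightarrow> real) \<Rightarrow>
   ('u \<times> 'v2 \<Rightarrow> 'x2 \<Rightarrow> real) \<Rightarrow> ('x1 \<times> 'x2 \<Rightarrow> 'y1 \<times> 'y2 \<Rightarrow> real) \<Rightarrow>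
   'u \<times> 'v1 \<times> 'v2 \<times> 'x1 \<times> 'x2 \<times> 'y1 \<times> 'y2 \<Rightarrow> real" where
  "joint7 pU pV1 pV2 pX1 pX2 W = (\<lambda>(u,v1,v2,x1,x2,y1,y2).
      pU u * pV1 v1 * pV2 v2 * pX1 (u,v1) x1 * pX2 (u,v2) x2 * W (x1,x2) (y1,y2))"

end

theory Submission
 imports Defs "HOL-Combinatorics.Multiset_Permutations"
begin

text \<open>A superletter code: the decoder of each user tests a normalised metric on long blocks, and a
 random-coding argument reduces transmissibility to positivity of the expected log-metric per superletter.
 A superletter consists of \<open>T\<close> slots, each carrying \<open>t\<close> constant-composition codewords of length \<open>l\<close> that
 transmit a random hash of the (nearly) common part. If the failure probability \<open>\<phi>\<close> is not too small
 compared with the output alphabet, a single slot suffices and Chebyshev's inequality controls the hash. For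
 smaller \<open>\<phi>\<close> every source position is hashed in two random slots, so that a set of failed slots leaves only
 few positions unresolved, and a Chernoff bound over all sets of slots applies. The typicality term
 of \<open>\<phi>\<^sub>j\<close> is only used through its non-negativity.\<close>

text \<open>The rate condition concerns one given \<open>l\<close>, so no loss can be removed by
  longer codewords inside a slot: every loss has to fit into the entropy and alphabet terms of the
  condition, which vanish with the failure probability. The receiver cannot see which slots fail, so
  its metric is a mixture over all sets of failed slots with prior weight \<open>\<phi>\<close> per
  slot; the binary entropies pay for that mixture. A single slot leaves a residual of constant
  order, affordable only while \<open>ln (1 / \<phi>) <= y + 1\<close>, where \<open>y\<close> is
  the logarithm of the larger output alphabet. Beyond that, \<open>T\<close> is of order
  \<open>l\<^sup>2 / \<phi>\<close>, so that one residual per superletter becomes negligible after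
  division by \<open>T\<close>. Hashing the slots separately would reproduce the residual
  \<open>T\<close> times. Sharing every position between two slots makes a fraction \<theta> of
  confused slots free only about \<theta> squared of the positions, while their hashes still exclude
  candidates at an exponent linear in \<theta>; this suppresses small sets of confused
  slots.\<close>

section \<open>Sums over words of fixed length and over their blocks\<close>

lemma finite_seqs [simp]: "finite (seqs n :: 'a::finite list set)"
proof -
 have "seqs n = {xs :: 'a list. set xs \<subseteq> UNIV & length xs = n}" by (auto simp: seqs_def)
 then show ?thesis using finite_lists_length_eq[of "UNIV :: 'a set" n] by simp
qed

lemma seqs_iff: "xs \<in> seqs n \<longleftrightarrow> length xs = n" by (simp add: seqs_def)

lemma seqs_0 [simp]: "seqs 0 = {[]}" by (auto simp: seqs_def)

lemma seqs_nonempty [simp]: "seqs n ~= {}"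
 using Ex_list_of_length[of n] by (auto simp: seqs_def)

lemma sum_seqs_append:
 fixes h :: "'a::finite list => real"
 shows "(\<Sum>xs\<in>seqs (m + n). h xs) = (\<Sum>xs\<in>seqs m. \<Sum>ys\<in>seqs n. h (xs @ ys))"
proof -
 have "(\<Sum>xs\<in>seqs m. \<Sum>ys\<in>seqs n. h (xs @ ys)) = (\<Sum>p\<in>seqs m \<times> seqs n. h (fst p @ snd p))"
 by (simp add: sum.cartesian_product case_prod_unfold)
 also have "... = (\<Sum>xs\<in>seqs (m + n). h xs)"
 by (rule sum.reindex_bij_witness[where i="%xs. (take m xs, drop m xs)" and j="%p. fst p @ snd p"])
 (auto simp: seqs_def)
 finally show ?thesis by simp
qed

lemma sum_seqs_1: "(\<Sum>xs\<in>seqs (Suc 0). h xs) = (\<Sum>x\<in>(UNIV::'a::finite set). (h [x] :: real))"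
 by (rule sum.reindex_bij_witness[where i="%x. [x]" and j="hd"]) (auto simp: seqs_def length_Suc_conv)

lemma sum_seqs_Suc:
 fixes h :: "'a::finite list => real"
 shows "(\<Sum>xs\<in>seqs (Suc n). h xs) = (\<Sum>x\<in>UNIV. \<Sum>xs\<in>seqs n. h (x # xs))"
 using sum_seqs_append[of h "Suc 0" n] by (simp add: sum_seqs_1)

lemma sum_seqs_prod:
 fixes g :: "nat => 'a::finite => real"
 shows "(\<Sum>xs\<in>seqs n. \<Prod>i<n. g i (xs ! i)) = (\<Prod>i<n. \<Sum>x\<in>UNIV. g i x)"
proof (induction n arbitrary: g)
 case (Suc n)
 have "(\<Sum>xs\<in>seqs (Suc n). \<Prod>i<Suc n. g i (xs ! i)) = (\<Sum>x\<in>UNIV. \<Sum>xs\<in>seqs n. g 0 x * (\<Prod>i<n. g (Suc i) (xs ! i)))"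
 by (simp add: sum_seqs_Suc prod.lessThan_Suc_shift del: prod.lessThan_Suc)
 also have "... = (\<Sum>x\<in>UNIV. g 0 x) * (\<Prod>i<n. \<Sum>x\<in>UNIV. g (Suc i) x)"
 using Suc.IH[of "%i. g (Suc i)"] by (simp add: sum_distrib_left[symmetric] sum_distrib_right[symmetric])
 finally show ?case by (simp add: prod.lessThan_Suc_shift del: prod.lessThan_Suc)
qed simp

lemma sum_seqs_zip:
 fixes h :: "'a::finite list => 'b::finite list => real"
 shows "(\<Sum>xs\<in>seqs n. \<Sum>ys\<in>seqs n. h xs ys) = (\<Sum>zs\<in>seqs n. h (map fst zs) (map snd zs))"
proof -
 have "(\<Sum>xs\<in>seqs n. \<Sum>ys\<in>seqs n. h xs ys) = (\<Sum>p\<in>seqs n \<times> seqs n. h (fst p) (snd p))"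
 by (simp add: sum.cartesian_product case_prod_unfold)
 also have "... = (\<Sum>zs\<in>seqs n. h (map fst zs) (map snd zs))"
 by (rule sum.reindex_bij_witness[where j="%p. zip (fst p) (snd p)" and i="%zs. (map fst zs, map snd zs)"])
 (auto simp: seqs_def zip_map_fst_snd)
 finally show ?thesis .
qed

definition blk :: "nat => nat => 'a list => 'a list" where
 "blk l t xs = take l (drop (t * l) xs)"

lemma blk_map: "blk l t (map f xs) = map f (blk l t xs)"
 by (simp add: blk_def take_map drop_map)

lemma blk_0_append: "length b = l ==> blk l 0 (b @ xs) = b"
 by (simp add: blk_def)

lemma blk_Suc_append: "length b = l ==> blk l (Suc t) (b @ xs) = blk l t xs"
 by (simp add: blk_def)

lemma length_blk: "t < m ==> length xs = m * l + r ==> length (blk l t xs) = l"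
proof -
 assume "t < m" "length xs = m * l + r"
 then have "Suc t * l <= m * l" by (intro mult_le_mono) auto
 then show ?thesis using \<open>length xs = _\<close> by (simp add: blk_def)
qed

lemma blk_in_seqs: "t < m ==> xs \<in> seqs (m * l + r) ==> blk l t xs \<in> seqs l"
 by (simp add: seqs_iff length_blk)

lemma blk_nth: "t < m ==> i < l ==> length xs = m * l + r ==> blk l t xs ! i = xs ! (t * l + i)"
proof -
 assume a: "t < m" "i < l" "length xs = m * l + r"
 then have "Suc t * l <= m * l" by (intro mult_le_mono) auto
 then show ?thesis using a by (simp add: blk_def)
qed

text \<open>The incomplete last block is a factor of its own because codes are needed for every
  length, not only for multiples of \<open>l\<close>.\<close>

lemma sum_seqs_blocks:
 fixes g :: "nat => 'a::finite list => real"
 shows "(\<Sum>zs\<in>seqs (m * l + r). (\<Prod>t<m. g t (blk l t zs)) * h (drop (m * l) zs))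
 = (\<Prod>t<m. \<Sum>b\<in>seqs l. g t b) * (\<Sum>b\<in>seqs r. h b)"
proof (induction m arbitrary: g)
 case (Suc m)
 have "(\<Sum>zs\<in>seqs (Suc m * l + r). (\<Prod>t<Suc m. g t (blk l t zs)) * h (drop (Suc m * l) zs))
 = (\<Sum>b\<in>seqs l. \<Sum>zs\<in>seqs (m * l + r). g 0 b * ((\<Prod>t<m. g (Suc t) (blk l t zs)) * h (drop (m * l) zs)))"
 unfolding mult_Suc add.assoc sum_seqs_append
 by (intro sum.cong refl)
 (simp add: prod.lessThan_Suc_shift blk_0_append blk_Suc_append seqs_iff mult.assoc del: prod.lessThan_Suc)
 also have "... = (\<Sum>b\<in>seqs l. g 0 b) * ((\<Prod>t<m. \<Sum>b\<in>seqs l. g (Suc t) b) * (\<Sum>b\<in>seqs r. h b))"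
 using Suc.IH[of "%i. g (Suc i)"] by (simp add: sum_distrib_left[symmetric] sum_distrib_right[symmetric])
 finally show ?case by (simp add: prod.lessThan_Suc_shift mult.assoc del: prod.lessThan_Suc)
qed simp

lemma prod_blocks:
 fixes a :: "nat => real"
 shows "(\<Prod>i<m * l + r. a i) = (\<Prod>t<m. \<Prod>i<l. a (t * l + i)) * (\<Prod>i<r. a (m * l + i))"
proof -
 have *: "(\<Prod>i<p + q. a i) = (\<Prod>i<p. a i) * (\<Prod>i<q. a (p + i))" for p q
 by (induction q) (auto simp: mult.assoc)
 have "(\<Prod>i<m * l. a i) = (\<Prod>t<m. \<Prod>i<l. a (t * l + i))"
 proof (induction m)
 case (Suc m)
 have "(\<Prod>i<Suc m * l. a i) = (\<Prod>i<m * l + l. a i)" by (simp add: add.commute)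
 then show ?case by (simp only: * Suc) simp
 qed simp
 then show ?thesis by (simp add: *)
qed

section \<open>Random functions with independent values\<close>

text \<open>Averages over random functions \<open>f\<close> with independent values \<open>f s\<close> drawn from \<open>D s\<close>.\<close>

definition fun_wt :: "'s set => ('s => 'c => real) => ('s => 'c) => real" where
 "fun_wt S D f = (\<Prod>s\<in>S. D s (f s))"

lemma sum_of_bool_eq: "finite C ==> c \<in> C ==> (\<Sum>d\<in>C. f d * of_bool (d = c)) = (f c :: real)"
 by (simp add: of_bool_def if_distrib[of "%x. _ * x"] cong: if_cong)

text \<open>Both indicators are absorbed into the factors at \<open>s\<close> and \<open>s'\<close>
  by \<open>E\<close>. What remains is a product over \<open>S\<close>, so the sum over functions is
  a product of sums, and every factor away from \<open>s\<close> and \<open>s'\<close> is 1.\<close>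

lemma fun_wt_pair_indicator:
 fixes D :: "'s => 'c => real"
 assumes fin: "finite S" "finite C" and D: "!!s. s \<in> S ==> (\<Sum>c\<in>C. D s c) = 1"
 and s: "s \<in> S" "s' \<in> S" "s ~= s'" and c: "c \<in> C" "c' \<in> C"
 shows "(\<Sum>f\<in>PiE S (%_. C). fun_wt S D f * (of_bool (f s = c) * of_bool (f s' = c'))) = D s c * D s' c'"
proof -
 define E where "E x d = D x d * (if x = s then of_bool (d = c) else if x = s' then of_bool (d = c') else 1)" for x d
 have "fun_wt S D f * (of_bool (f s = c) * of_bool (f s' = c')) = (\<Prod>x\<in>S. E x (f x))" for f
 proof -
 have "(\<Prod>x\<in>S. E x (f x)) = fun_wt S D f * (\<Prod>x\<in>S. (if x = s then of_bool (f x = c) else if x = s' then of_bool (f x = c') else 1))"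
 by (simp add: fun_wt_def E_def prod.distrib)
 also have "(\<Prod>x\<in>S. (if x = s then of_bool (f x = c) else if x = s' then of_bool (f x = c') else 1::real))
 = (\<Prod>x\<in>S. (if x = s then of_bool (f s = c) else 1) * (if x = s' then of_bool (f s' = c') else 1))"
 using s by (intro prod.cong) auto
 also have "... = of_bool (f s = c) * of_bool (f s' = c')"
 using s fin by (simp add: prod.distrib prod.delta del: of_bool_eq_1_iff)
 finally show ?thesis by simp
 qed
 then have "(\<Sum>f\<in>PiE S (%_. C). fun_wt S D f * (of_bool (f s = c) * of_bool (f s' = c')))
 = (\<Prod>x\<in>S. \<Sum>d\<in>C. E x d)"
 using fin by (simp add: prod_sum_PiE)
 also have "... = (\<Prod>x\<in>S. (if x = s then D s c else 1) * (if x = s' then D s' c' else 1))"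
 proof (rule prod.cong[OF refl])
 fix x assume "x \<in> S"
 consider "x = s" | "x = s'" "x ~= s" | "x ~= s" "x ~= s'" by blast
 then show "(\<Sum>d\<in>C. E x d) = (if x = s then D s c else 1) * (if x = s' then D s' c' else 1)"
 by cases (use s c fin D \<open>x \<in> S\<close> in \<open>simp_all add: E_def sum_of_bool_eq\<close>)
 qed
 also have "... = D s c * D s' c'" using s fin by (simp add: prod.distrib prod.delta)
 finally show ?thesis .
qed

text \<open>Pairwise independence in full: an arbitrary \<open>h\<close> is a linear combination of
  the indicators treated before.\<close>

lemma fun_wt_pair:
 fixes D :: "'s => 'c => real"
 assumes fin: "finite S" "finite C" and D: "!!s. s \<in> S ==> (\<Sum>c\<in>C. D s c) = 1"
 and s: "s \<in> S" "s' \<in> S" "s ~= s'"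
 shows "(\<Sum>f\<in>PiE S (%_. C). fun_wt S D f * h (f s) (f s')) = (\<Sum>c\<in>C. \<Sum>c'\<in>C. D s c * D s' c' * h c c')"
proof -
 have 1: "h (f s) (f s') = (\<Sum>c\<in>C. \<Sum>c'\<in>C. (of_bool (f s = c) * of_bool (f s' = c')) * h c c')"
 if "f \<in> PiE S (%_. C)" for f
 proof -
 have m: "f s \<in> C" "f s' \<in> C" using that s by auto
 have "(\<Sum>c\<in>C. \<Sum>c'\<in>C. (of_bool (f s = c) * of_bool (f s' = c')) * h c c')
 = (\<Sum>c\<in>C. (\<Sum>c'\<in>C. h c c' * of_bool (c' = f s')) * of_bool (c = f s))"
 by (intro sum.cong refl) (auto simp: sum_distrib_left mult_ac eq_commute intro!: sum.cong)
 then show ?thesis using fin m by (simp add: sum_of_bool_eq)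
 qed
 have "(\<Sum>f\<in>PiE S (%_. C). fun_wt S D f * h (f s) (f s'))
 = (\<Sum>f\<in>PiE S (%_. C). \<Sum>c\<in>C. \<Sum>c'\<in>C. (fun_wt S D f * (of_bool (f s = c) * of_bool (f s' = c'))) * h c c')"
 by (intro sum.cong refl) (subst 1, simp_all add: sum_distrib_left mult.assoc)
 also have "... = (\<Sum>c\<in>C. \<Sum>c'\<in>C. \<Sum>f\<in>PiE S (%_. C). (fun_wt S D f * (of_bool (f s = c) * of_bool (f s' = c'))) * h c c')"
 by (subst sum.swap, intro sum.cong refl, rule sum.swap)
 also have "... = (\<Sum>c\<in>C. \<Sum>c'\<in>C. D s c * D s' c' * h c c')"
 by (intro sum.cong refl) (simp only: sum_distrib_right[symmetric] fun_wt_pair_indicator[OF fin D s])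
 finally show ?thesis .
qed

lemma fun_wt_single:
 fixes D :: "'s => 'c => real"
 assumes fin: "finite S" "finite C" and D: "!!s. s \<in> S ==> (\<Sum>c\<in>C. D s c) = 1"
 and s: "s \<in> S"
 shows "(\<Sum>f\<in>PiE S (%_. C). fun_wt S D f * h (f s)) = (\<Sum>c\<in>C. D s c * h c)"
proof -
 have eq: "fun_wt S D f * h (f s) = (\<Prod>x\<in>S. D x (f x) * (if x = s then h (f x) else 1))" for f
 using s fin by (simp add: fun_wt_def prod.distrib prod.delta)
 have "(\<Sum>f\<in>PiE S (%_. C). fun_wt S D f * h (f s)) = (\<Prod>x\<in>S. \<Sum>c\<in>C. D x c * (if x = s then h c else 1))"
 unfolding eq using fin prod_sum_PiE[of S "%_. C" "%x c. D x c * (if x = s then h c else 1)"] by simp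
 also have "... = (\<Prod>x\<in>S. if x = s then (\<Sum>c\<in>C. D s c * h c) else 1)"
 using D by (intro prod.cong) auto
 also have "... = (\<Sum>c\<in>C. D s c * h c)" using s fin by (simp add: prod.delta)
 finally show ?thesis .
qed

lemma fun_wt_total:
 assumes "finite S" "finite C" "!!s. s \<in> S ==> (\<Sum>c\<in>C. D s c) = (1::real)"
 shows "(\<Sum>f\<in>PiE S (%_. C). fun_wt S D f) = 1"
 using assms by (simp add: fun_wt_def prod_sum_PiE[symmetric])



section \<open>Threshold decoding and random codebooks\<close>

text \<open>Derandomises every random choice below: if all values exceeded \<open>B\<close>, so
  would their average.\<close>

lemma ex_le_weighted_average:
 fixes w g :: "'a => real"
 assumes "finite A" "!!a. a \<in> A ==> 0 <= w a" "(\<Sum>a\<in>A. w a) = 1" "(\<Sum>a\<in>A. w a * g a) <= B"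
 shows "\<exists>a\<in>A. g a <= B"
proof (rule ccontr)
 assume "\<not> ?thesis"
 then have gt: "!!a. a \<in> A ==> B < g a" by auto
 have "\<exists>a\<in>A. 0 < w a"
 proof (rule ccontr)
 assume "\<not> ?thesis"
 then have "!!a. a \<in> A ==> w a = 0" using assms(2) by force
 then show False using assms(3) by simp
 qed
 then obtain a0 where a0: "a0 \<in> A" "0 < w a0" by blast
 have "B = (\<Sum>a\<in>A. w a * B)" using assms(3) by (simp add: sum_distrib_right[symmetric])
 also have "... < (\<Sum>a\<in>A. w a * g a)"
 proof (rule sum_strict_mono_ex1[OF assms(1)])
 show "\<forall>x\<in>A. w x * B <= w x * g x" using assms(2) gt by (simp add: mult_left_mono less_imp_le)
 show "\<exists>x\<in>A. w x * B < w x * g x" using a0 gt by (auto intro!: bexI[of _ a0])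
 qed
 finally show False using assms(4) by simp
qed

text \<open>Threshold decoding with a metric \<open>t\<close>: decode to a source word whose codeword has metric
 above \<open>\<gamma>\<close>.\<close>

definition thr_dec :: "'s set => ('s => 'c) => ('s => 'c => 'y => real) => real => 'y => 's" where
 "thr_dec S f t \<gamma> y = (if \<exists>s\<in>S. \<gamma> < t s (f s) y then SOME s. s \<in> S & \<gamma> < t s (f s) y else SOME s. s \<in> S)"

lemma thr_dec_in: "S ~= {} ==> thr_dec S f t \<gamma> y \<in> S"
 unfolding thr_dec_def by (auto intro: someI2 some_in_eq[THEN iffD2] simp: some_in_eq)

text \<open>Union bound followed by Markov: a wrong decision requires the true word below the
  threshold or a wrong word above it, and the indicator of the latter is at most metric over
  \<open>\<gamma>\<close>.\<close>

lemma thr_dec_error: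
 assumes "finite S" "s0 \<in> S" "0 < \<gamma>" and t: "!!s c. s \<in> S ==> 0 <= t s (f s) y"
 shows "of_bool (thr_dec S f t \<gamma> y ~= s0)
 <= of_bool (t s0 (f s0) y <= \<gamma>) + (\<Sum>s\<in>S - {s0}. t s (f s) y / \<gamma>)"
proof (cases "thr_dec S f t \<gamma> y = s0 \<or> t s0 (f s0) y <= \<gamma>")
 case True
 have "0 <= (\<Sum>s\<in>S - {s0}. t s (f s) y / \<gamma>)" using assms by (intro sum_nonneg) auto
 then show ?thesis using True by auto
next
 case False
 define s where "s = thr_dec S f t \<gamma> y"
 have "\<exists>s\<in>S. \<gamma> < t s (f s) y" using False assms(2) by force
 then have s: "s \<in> S" "\<gamma> < t s (f s) y"
 unfolding s_def thr_dec_def using someI_ex[of "%s. s \<in> S & \<gamma> < t s (f s) y"] by auto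
 have "1 <= t s (f s) y / \<gamma>" using s assms(3) by simp
 also have "... <= (\<Sum>s\<in>S - {s0}. t s (f s) y / \<gamma>)"
 using s False assms by (intro member_le_sum) (auto simp: s_def)
 finally show ?thesis by simp
qed

text \<open>The metric is normalised over source words and codewords together. Given the output, the
  expected metrics of all wrong words therefore add up to at most 1, whatever their number: they
  cost \<open>1 / \<gamma>\<close>, no codebook size enters, and only the failure of the true word
  remains to be bounded.\<close>

lemma random_codebook_one:
 fixes P :: "'s => 's2 => real" and K :: "'c => 'c2 => 'y => real"
 assumes fin: "finite S" "finite C" "finite S2" "finite C2" "finite Y"
 and D: "!!s c. s \<in> S ==> 0 <= D s c" "!!s. s \<in> S ==> (\<Sum>c\<in>C. D s c) = 1"
 and D2: "!!s c. s \<in> S2 ==> 0 <= D2 s c" "!!s. s \<in> S2 ==> (\<Sum>c\<in>C2. D2 s c) = 1"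
 and P: "!!s s2. 0 <= P s s2" "(\<Sum>s\<in>S. \<Sum>s2\<in>S2. P s s2) <= 1"
 and K: "!!c c2 y. 0 <= K c c2 y" "!!c c2. c \<in> C ==> c2 \<in> C2 ==> (\<Sum>y\<in>Y. K c c2 y) = 1"
 and t: "!!s c y. s \<in> S ==> c \<in> C ==> y \<in> Y ==> 0 <= t s c y"
 "!!y. y \<in> Y ==> (\<Sum>s\<in>S. \<Sum>c\<in>C. D s c * t s c y) <= 1"
 and g: "0 < \<gamma>"
 shows "(\<Sum>f\<in>PiE S (%_. C). \<Sum>f2\<in>PiE S2 (%_. C2). fun_wt S D f * fun_wt S2 D2 f2 *
 (\<Sum>s\<in>S. \<Sum>s2\<in>S2. P s s2 * (\<Sum>y\<in>Y. K (f s) (f2 s2) y * of_bool (thr_dec S f t \<gamma> y ~= s))))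
 <= (\<Sum>s\<in>S. \<Sum>s2\<in>S2. P s s2 * (\<Sum>c\<in>C. \<Sum>c2\<in>C2. D s c * D2 s2 c2 * (\<Sum>y\<in>Y. K c c2 y * of_bool (t s c y <= \<gamma>)))) + 1 / \<gamma>"
 (is "?L <= ?A + _")
proof -
 let ?F = "PiE S (%_. C)" and ?F2 = "PiE S2 (%_. C2)"
 let ?w = "fun_wt S D" and ?w2 = "fun_wt S2 D2"
 have w0: "0 <= ?w f" "0 <= ?w2 f2" for f f2
 using D(1) D2(1) by (auto simp: fun_wt_def intro!: prod_nonneg)
 define A1 where "A1 s f f2 s2 = (\<Sum>y\<in>Y. K (f s) (f2 s2) y * of_bool (t s (f s) y <= \<gamma>))" for s f and f2 :: "'s2 => 'c2" and s2
 define A2 where "A2 s f f2 s2 = (\<Sum>s'\<in>S - {s}. \<Sum>y\<in>Y. K (f s) (f2 s2) y * (t s' (f s') y / \<gamma>))" for s f and f2 :: "'s2 => 'c2" and s2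
 have pt: "(\<Sum>y\<in>Y. K (f s) (f2 s2) y * of_bool (thr_dec S f t \<gamma> y ~= s)) <= A1 s f f2 s2 + A2 s f f2 s2"
 if "f \<in> ?F" "s \<in> S" for f f2 s s2
 proof -
 have "(\<Sum>y\<in>Y. K (f s) (f2 s2) y * of_bool (thr_dec S f t \<gamma> y ~= s))
 <= (\<Sum>y\<in>Y. K (f s) (f2 s2) y * (of_bool (t s (f s) y <= \<gamma>) + (\<Sum>s'\<in>S - {s}. t s' (f s') y / \<gamma>)))"
 using that fin g t(1) by (intro sum_mono mult_left_mono thr_dec_error K(1)) auto
 also have "... = A1 s f f2 s2 + A2 s f f2 s2"
 unfolding A1_def A2_def sum.swap[of _ Y "S - {s}"] by (simp add: distrib_left sum.distrib sum_distrib_left)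
 finally show ?thesis .
 qed
 have e1: "(\<Sum>f\<in>?F. \<Sum>f2\<in>?F2. ?w f * ?w2 f2 * A1 s f f2 s2)
 = (\<Sum>c\<in>C. \<Sum>c2\<in>C2. D s c * D2 s2 c2 * (\<Sum>y\<in>Y. K c c2 y * of_bool (t s c y <= \<gamma>)))"
 if "s \<in> S" "s2 \<in> S2" for s s2
 proof -
 have "(\<Sum>f2\<in>?F2. ?w f * ?w2 f2 * A1 s f f2 s2)
 = ?w f * (\<Sum>c2\<in>C2. D2 s2 c2 * (\<Sum>y\<in>Y. K (f s) c2 y * of_bool (t s (f s) y <= \<gamma>)))" for f
 using fun_wt_single[OF fin(3,4) D2(2) that(2), where h="%c2. (\<Sum>y\<in>Y. K (f s) c2 y * of_bool (t s (f s) y <= \<gamma>))"]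
 by (simp add: A1_def sum_distrib_left[symmetric] mult.assoc)
 then show ?thesis
 using fun_wt_single[OF fin(1,2) D(2) that(1), where h="%c. \<Sum>c2\<in>C2. D2 s2 c2 * (\<Sum>y\<in>Y. K c c2 y * of_bool (t s c y <= \<gamma>))"]
 by (simp add: sum_distrib_left mult.assoc)
 qed
 \<comment> \<open>The codeword of a wrong word is independent of the sent one, so it can be
   averaged with the output held fixed, where the normalisation \<open>t(2)\<close> applies.\<close>
 have e2: "(\<Sum>f\<in>?F. \<Sum>f2\<in>?F2. ?w f * ?w2 f2 * A2 s f f2 s2) <= 1 / \<gamma>"
 if "s \<in> S" "s2 \<in> S2" for s s2
 proof -
 have a1: "(\<Sum>f2\<in>?F2. ?w f * ?w2 f2 * A2 s f f2 s2)
 = ?w f * (\<Sum>c2\<in>C2. D2 s2 c2 * (\<Sum>s'\<in>S - {s}. \<Sum>y\<in>Y. K (f s) c2 y * (t s' (f s') y / \<gamma>)))" for f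
 using fun_wt_single[OF fin(3,4) D2(2) that(2), where h="%c2. (\<Sum>s'\<in>S - {s}. \<Sum>y\<in>Y. K (f s) c2 y * (t s' (f s') y / \<gamma>))"]
 by (simp add: A2_def sum_distrib_left[symmetric] mult.assoc)
 have "(\<Sum>f\<in>?F. \<Sum>f2\<in>?F2. ?w f * ?w2 f2 * A2 s f f2 s2) = (\<Sum>f\<in>?F. ?w f * (\<Sum>c2\<in>C2. D2 s2 c2 * (\<Sum>s'\<in>S - {s}. \<Sum>y\<in>Y. K (f s) c2 y * (t s' (f s') y / \<gamma>))))"
 by (simp only: a1)
 also have "... = (\<Sum>s'\<in>S - {s}. \<Sum>f\<in>?F. ?w f * (\<Sum>c2\<in>C2. D2 s2 c2 * (\<Sum>y\<in>Y. K (f s) c2 y * (t s' (f s') y / \<gamma>))))"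
 by (simp only: sum_distrib_left sum.swap[of _ "S - {s}" C2] sum.swap[of _ "S - {s}" ?F])
 also have "... = (\<Sum>s'\<in>S - {s}. \<Sum>c\<in>C. \<Sum>c'\<in>C. D s c * D s' c' * (\<Sum>c2\<in>C2. D2 s2 c2 * (\<Sum>y\<in>Y. K c c2 y * (t s' c' y / \<gamma>))))"
 using that by (intro sum.cong refl fun_wt_pair[OF fin(1,2) D(2)]) auto
 also have "... = (\<Sum>c\<in>C. \<Sum>c2\<in>C2. \<Sum>y\<in>Y. D s c * D2 s2 c2 * K c c2 y * ((\<Sum>s'\<in>S - {s}. \<Sum>c'\<in>C. D s' c' * t s' c' y) / \<gamma>))"
 proof -
 have "(\<Sum>s'\<in>S - {s}. \<Sum>c\<in>C. \<Sum>c'\<in>C. D s c * D s' c' * (\<Sum>c2\<in>C2. D2 s2 c2 * (\<Sum>y\<in>Y. K c c2 y * (t s' c' y / \<gamma>))))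
 = (\<Sum>c\<in>C. \<Sum>s'\<in>S - {s}. \<Sum>c'\<in>C. \<Sum>c2\<in>C2. \<Sum>y\<in>Y. D s c * D2 s2 c2 * K c c2 y * (D s' c' * t s' c' y / \<gamma>))"
 by (subst sum.swap) (simp add: sum_distrib_left mult_ac)
 also have "... = (\<Sum>c\<in>C. \<Sum>c2\<in>C2. \<Sum>y\<in>Y. \<Sum>s'\<in>S - {s}. \<Sum>c'\<in>C. D s c * D2 s2 c2 * K c c2 y * (D s' c' * t s' c' y / \<gamma>))"
 proof (intro sum.cong refl)
 fix c assume "c \<in> C"
 show "(\<Sum>s'\<in>S - {s}. \<Sum>c'\<in>C. \<Sum>c2\<in>C2. \<Sum>y\<in>Y. D s c * D2 s2 c2 * K c c2 y * (D s' c' * t s' c' y / \<gamma>))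
 = (\<Sum>c2\<in>C2. \<Sum>y\<in>Y. \<Sum>s'\<in>S - {s}. \<Sum>c'\<in>C. D s c * D2 s2 c2 * K c c2 y * (D s' c' * t s' c' y / \<gamma>))"
 unfolding sum.cartesian_product
 by (rule sum.reindex_bij_witness[where i="%(c2, y, s, c). (s, c, c2, y)" and j="%(s, c, c2, y). (c2, y, s, c)"]) auto
 qed
 finally show ?thesis by (simp add: sum_distrib_left sum_divide_distrib)
 qed
 also have "... <= (\<Sum>c\<in>C. \<Sum>c2\<in>C2. \<Sum>y\<in>Y. D s c * D2 s2 c2 * K c c2 y * (1 / \<gamma>))"
 proof (intro sum_mono mult_left_mono divide_right_mono)
 fix y assume y: "y \<in> Y"
 have "(\<Sum>s'\<in>S - {s}. \<Sum>c'\<in>C. D s' c' * t s' c' y) <= (\<Sum>s'\<in>S. \<Sum>c'\<in>C. D s' c' * t s' c' y)"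
 using fin D t(1) y by (intro sum_mono2 sum_nonneg mult_nonneg_nonneg) auto
 also have "... <= 1" by (rule t(2)[OF y])
 finally show "(\<Sum>s'\<in>S - {s}. \<Sum>c'\<in>C. D s' c' * t s' c' y) <= 1" .
 qed (use that D D2 K g in \<open>auto intro!: mult_nonneg_nonneg\<close>)
 also have "... = (\<Sum>c\<in>C. D s c * (\<Sum>c2\<in>C2. D2 s2 c2 * (\<Sum>y\<in>Y. K c c2 y))) * (1 / \<gamma>)"
 by (simp add: sum_distrib_left sum_distrib_right mult.assoc sum_divide_distrib)
 also have "... = 1 / \<gamma>" using K(2) D(2)[OF that(1)] D2(2)[OF that(2)] by (simp cong: sum.cong)
 finally show ?thesis .
 qed
 have "?L <= (\<Sum>f\<in>?F. \<Sum>f2\<in>?F2. ?w f * ?w2 f2 * (\<Sum>s\<in>S. \<Sum>s2\<in>S2. P s s2 * (A1 s f f2 s2 + A2 s f f2 s2)))"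
 by (intro sum_mono mult_left_mono pt P(1)) (auto intro!: mult_nonneg_nonneg w0)
 also have "... = (\<Sum>s\<in>S. \<Sum>s2\<in>S2. P s s2 * ((\<Sum>f\<in>?F. \<Sum>f2\<in>?F2. ?w f * ?w2 f2 * A1 s f f2 s2) + (\<Sum>f\<in>?F. \<Sum>f2\<in>?F2. ?w f * ?w2 f2 * A2 s f f2 s2)))"
 proof -
 have "(\<Sum>f\<in>?F. \<Sum>f2\<in>?F2. ?w f * ?w2 f2 * (\<Sum>s\<in>S. \<Sum>s2\<in>S2. P s s2 * (A1 s f f2 s2 + A2 s f f2 s2)))
 = (\<Sum>p\<in>?F \<times> ?F2. \<Sum>q\<in>S \<times> S2. P (fst q) (snd q) * (?w (fst p) * ?w2 (snd p) * A1 (fst q) (fst p) (snd p) (snd q) + ?w (fst p) * ?w2 (snd p) * A2 (fst q) (fst p) (snd p) (snd q)))"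
 by (simp add: sum.cartesian_product' sum_distrib_left algebra_simps)
 also have "... = (\<Sum>q\<in>S \<times> S2. P (fst q) (snd q) * ((\<Sum>p\<in>?F \<times> ?F2. ?w (fst p) * ?w2 (snd p) * A1 (fst q) (fst p) (snd p) (snd q)) + (\<Sum>p\<in>?F \<times> ?F2. ?w (fst p) * ?w2 (snd p) * A2 (fst q) (fst p) (snd p) (snd q))))"
 by (subst sum.swap) (simp add: sum_distrib_left[symmetric] sum.distrib[symmetric])
 finally show ?thesis by (simp add: sum.cartesian_product case_prod_unfold)
 qed
 also have "... <= (\<Sum>s\<in>S. \<Sum>s2\<in>S2. P s s2 * ((\<Sum>c\<in>C. \<Sum>c2\<in>C2. D s c * D2 s2 c2 * (\<Sum>y\<in>Y. K c c2 y * of_bool (t s c y <= \<gamma>))) + 1 / \<gamma>))"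
 by (intro sum_mono mult_left_mono add_mono) (use e1 e2 P(1) in auto)
 also have "... = ?A + (\<Sum>s\<in>S. \<Sum>s2\<in>S2. P s s2) * (1 / \<gamma>)"
 by (simp add: distrib_left sum.distrib sum_distrib_right sum_divide_distrib)
 also have "... <= ?A + 1 / \<gamma>" using P(2) g by (simp add: divide_right_mono)
 finally show ?thesis .
qed

text \<open>The sum of both error averages is bounded, so one pair of codebooks serves both
  receivers. Each receiver sees a marginal channel, \<open>K1\<close> or \<open>K2\<close>, in which
  the other random codeword acts as noise.\<close>

lemma random_codebook:
 fixes P :: "'s1 => 's2 => real" and W :: "'c1 => 'c2 => 'y1 => 'y2 => real"
 assumes fin: "finite S1" "finite C1" "finite S2" "finite C2" "finite Y1" "finite Y2" "S1 ~= {}" "S2 ~= {}"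
 and D1: "!!s c. s \<in> S1 ==> 0 <= D1 s c" "!!s. s \<in> S1 ==> (\<Sum>c\<in>C1. D1 s c) = 1"
 and D2: "!!s c. s \<in> S2 ==> 0 <= D2 s c" "!!s. s \<in> S2 ==> (\<Sum>c\<in>C2. D2 s c) = 1"
 and P: "!!s s2. 0 <= P s s2" "(\<Sum>s\<in>S1. \<Sum>s2\<in>S2. P s s2) <= 1"
 and W: "!!c c2 y y2. 0 <= W c c2 y y2" "!!c c2. c \<in> C1 ==> c2 \<in> C2 ==> (\<Sum>y\<in>Y1. \<Sum>y2\<in>Y2. W c c2 y y2) = 1"
 and t1: "!!s c y. s \<in> S1 ==> c \<in> C1 ==> y \<in> Y1 ==> 0 <= t1 s c y"
 "!!y. y \<in> Y1 ==> (\<Sum>s\<in>S1. \<Sum>c\<in>C1. D1 s c * t1 s c y) <= 1"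
 and t2: "!!s c y. s \<in> S2 ==> c \<in> C2 ==> y \<in> Y2 ==> 0 <= t2 s c y"
 "!!y. y \<in> Y2 ==> (\<Sum>s\<in>S2. \<Sum>c\<in>C2. D2 s c * t2 s c y) <= 1"
 and g: "0 < \<gamma>"
 shows "\<exists>f1 f2 d1 d2. f1 \<in> S1 \<rightarrow> C1 & f2 \<in> S2 \<rightarrow> C2 & (\<forall>y. d1 y \<in> S1) & (\<forall>y. d2 y \<in> S2) \<and>
 (\<Sum>s1\<in>S1. \<Sum>s2\<in>S2. P s1 s2 * (\<Sum>y1\<in>Y1. \<Sum>y2\<in>Y2. W (f1 s1) (f2 s2) y1 y2 * (if d1 y1 ~= s1 \<or> d2 y2 ~= s2 then 1 else 0)))
 <= (\<Sum>s1\<in>S1. \<Sum>s2\<in>S2. P s1 s2 * (\<Sum>c1\<in>C1. \<Sum>c2\<in>C2. D1 s1 c1 * D2 s2 c2 *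
 (\<Sum>y1\<in>Y1. \<Sum>y2\<in>Y2. W c1 c2 y1 y2 * of_bool (t1 s1 c1 y1 <= \<gamma>))))
 + (\<Sum>s1\<in>S1. \<Sum>s2\<in>S2. P s1 s2 * (\<Sum>c1\<in>C1. \<Sum>c2\<in>C2. D1 s1 c1 * D2 s2 c2 *
 (\<Sum>y1\<in>Y1. \<Sum>y2\<in>Y2. W c1 c2 y1 y2 * of_bool (t2 s2 c2 y2 <= \<gamma>)))) + 2 / \<gamma>"
 (is "\<exists>f1 f2 d1 d2. _ & _ & _ & _ & ?err f1 f2 d1 d2 <= ?A1 + ?A2 + _")
proof -
 let ?F1 = "PiE S1 (%_. C1)" and ?F2 = "PiE S2 (%_. C2)"
 let ?w1 = "fun_wt S1 D1" and ?w2 = "fun_wt S2 D2"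
 have w0: "0 <= ?w1 f" "0 <= ?w2 f2" for f f2
 using D1(1) D2(1) by (auto simp: fun_wt_def intro!: prod_nonneg)
 define K1 where "K1 c c2 y = (\<Sum>y2\<in>Y2. W c c2 y y2)" for c c2 y
 define K2 where "K2 c2 c y2 = (\<Sum>y\<in>Y1. W c c2 y y2)" for c2 c y2
 define e1 where "e1 f f2 = (\<Sum>s\<in>S1. \<Sum>s2\<in>S2. P s s2 * (\<Sum>y\<in>Y1. K1 (f s) (f2 s2) y * of_bool (thr_dec S1 f t1 \<gamma> y ~= s)))" for f f2
 define e2 where "e2 f2 f = (\<Sum>s2\<in>S2. \<Sum>s\<in>S1. P s s2 * (\<Sum>y\<in>Y2. K2 (f2 s2) (f s) y * of_bool (thr_dec S2 f2 t2 \<gamma> y ~= s2)))" for f f2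
 have b1: "(\<Sum>f\<in>?F1. \<Sum>f2\<in>?F2. ?w1 f * ?w2 f2 * e1 f f2) <= ?A1 + 1 / \<gamma>"
 proof -
 have "(\<Sum>f\<in>?F1. \<Sum>f2\<in>?F2. ?w1 f * ?w2 f2 * e1 f f2) <= (\<Sum>s\<in>S1. \<Sum>s2\<in>S2. P s s2 * (\<Sum>c\<in>C1. \<Sum>c2\<in>C2. D1 s c * D2 s2 c2 * (\<Sum>y\<in>Y1. K1 c c2 y * of_bool (t1 s c y <= \<gamma>)))) + 1 / \<gamma>"
 unfolding e1_def using fin D1 D2 P W t1 g
 by (intro random_codebook_one) (auto simp: K1_def intro!: sum_nonneg)
 then show ?thesis by (simp add: K1_def sum_distrib_right)
 qed
 have b2: "(\<Sum>f\<in>?F1. \<Sum>f2\<in>?F2. ?w1 f * ?w2 f2 * e2 f2 f) <= ?A2 + 1 / \<gamma>"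
 proof -
 have "(\<Sum>f2\<in>?F2. \<Sum>f\<in>?F1. ?w2 f2 * ?w1 f * e2 f2 f) <= (\<Sum>s2\<in>S2. \<Sum>s\<in>S1. P s s2 * (\<Sum>c2\<in>C2. \<Sum>c\<in>C1. D2 s2 c2 * D1 s c * (\<Sum>y\<in>Y2. K2 c2 c y * of_bool (t2 s2 c2 y <= \<gamma>)))) + 1 / \<gamma>"
 proof -
 have 1: "(\<Sum>s2\<in>S2. \<Sum>s\<in>S1. P s s2) <= 1" using P(2) by (subst sum.swap)
 have 2: "(\<Sum>y\<in>Y2. K2 c2 c y) = 1" if "c \<in> C1" "c2 \<in> C2" for c c2
 unfolding K2_def using W(2)[OF that] by (subst sum.swap)
 show ?thesis unfolding e2_def using fin D1 D2 P(1) W(1) t2 g 1 2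
 by (intro random_codebook_one[where P="%s2 s. P s s2"]) (auto simp: K2_def intro!: sum_nonneg)
 qed
 also have "(\<Sum>s2\<in>S2. \<Sum>s\<in>S1. P s s2 * (\<Sum>c2\<in>C2. \<Sum>c\<in>C1. D2 s2 c2 * D1 s c * (\<Sum>y\<in>Y2. K2 c2 c y * of_bool (t2 s2 c2 y <= \<gamma>)))) = ?A2"
 by (subst sum.swap, intro sum.cong refl arg_cong[where f="%x. _ * x"], subst sum.swap,
 intro sum.cong refl arg_cong2[where f="(*)"] mult.commute)
 (simp_all add: K2_def sum_distrib_right sum.swap[of _ Y2 Y1])
 also have "(\<Sum>f2\<in>?F2. \<Sum>f\<in>?F1. ?w2 f2 * ?w1 f * e2 f2 f) = (\<Sum>f\<in>?F1. \<Sum>f2\<in>?F2. ?w1 f * ?w2 f2 * e2 f2 f)"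
 by (subst sum.swap) (simp add: mult_ac)
 finally show ?thesis .
 qed
 have "\<exists>p\<in>?F1 \<times> ?F2. e1 (fst p) (snd p) + e2 (snd p) (fst p) <= ?A1 + ?A2 + 2 / \<gamma>"
 proof (rule ex_le_weighted_average[where w="%p. ?w1 (fst p) * ?w2 (snd p)"])
 show "finite (?F1 \<times> ?F2)" using fin by (auto intro!: finite_PiE)
 show "(\<Sum>p\<in>?F1 \<times> ?F2. ?w1 (fst p) * ?w2 (snd p)) = 1"
 using fun_wt_total[of S1 C1 D1, OF fin(1,2) D1(2)] fun_wt_total[of S2 C2 D2, OF fin(3,4) D2(2)]
 by (simp add: sum.cartesian_product' sum_distrib_left[symmetric])
 have "(\<Sum>p\<in>?F1 \<times> ?F2. ?w1 (fst p) * ?w2 (snd p) * (e1 (fst p) (snd p) + e2 (snd p) (fst p)))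
 = (\<Sum>f\<in>?F1. \<Sum>f2\<in>?F2. ?w1 f * ?w2 f2 * e1 f f2) + (\<Sum>f\<in>?F1. \<Sum>f2\<in>?F2. ?w1 f * ?w2 f2 * e2 f2 f)"
 by (simp add: sum.cartesian_product' distrib_left sum.distrib)
 then show "(\<Sum>p\<in>?F1 \<times> ?F2. ?w1 (fst p) * ?w2 (snd p) * (e1 (fst p) (snd p) + e2 (snd p) (fst p))) <= ?A1 + ?A2 + 2 / \<gamma>"
 using b1 b2 by simp
 qed (auto intro!: mult_nonneg_nonneg w0)
 then obtain f1 f2 where f: "f1 \<in> ?F1" "f2 \<in> ?F2" "e1 f1 f2 + e2 f2 f1 <= ?A1 + ?A2 + 2 / \<gamma>" by auto
 define d1 where "d1 = thr_dec S1 f1 t1 \<gamma>"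
 define d2 where "d2 = thr_dec S2 f2 t2 \<gamma>"
 have "?err f1 f2 d1 d2 <= (\<Sum>s1\<in>S1. \<Sum>s2\<in>S2. P s1 s2 * (\<Sum>y1\<in>Y1. \<Sum>y2\<in>Y2. W (f1 s1) (f2 s2) y1 y2 * (of_bool (d1 y1 ~= s1) + of_bool (d2 y2 ~= s2))))"
 by (intro sum_mono mult_left_mono P(1) W(1)) auto
 also have "... = e1 f1 f2 + e2 f2 f1"
 proof -
 have "e2 f2 f1 = (\<Sum>s1\<in>S1. \<Sum>s2\<in>S2. P s1 s2 * (\<Sum>y1\<in>Y1. \<Sum>y2\<in>Y2. W (f1 s1) (f2 s2) y1 y2 * of_bool (d2 y2 ~= s2)))"
 unfolding e2_def d2_def K2_def
 by (subst sum.swap, intro sum.cong refl arg_cong[where f="%x. _ * x"])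
 (simp add: sum_distrib_right sum.swap[of _ Y2 Y1])
 moreover have "e1 f1 f2 = (\<Sum>s1\<in>S1. \<Sum>s2\<in>S2. P s1 s2 * (\<Sum>y1\<in>Y1. \<Sum>y2\<in>Y2. W (f1 s1) (f2 s2) y1 y2 * of_bool (d1 y1 ~= s1)))"
 unfolding e1_def d1_def K1_def by (simp add: sum_distrib_right)
 ultimately show ?thesis by (simp only: distrib_left sum.distrib)
 qed
 finally have "?err f1 f2 d1 d2 <= ?A1 + ?A2 + 2 / \<gamma>" using f(3) by linarith
 moreover have "\<forall>y. d1 y \<in> S1" "\<forall>y. d2 y \<in> S2" using fin by (auto simp: d1_def d2_def intro!: thr_dec_in)
 ultimately show ?thesis using f(1,2) by (intro exI[of _ f1] exI[of _ f2] exI[of _ d1] exI[of _ d2]) (auto simp: PiE_def)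
qed



section \<open>Exponential tails and the superletter coding theorem\<close>

text \<open>The moment generating function \<open>f\<close> has value 1 and derivative minus the
  mean at 0, so a positive mean makes it drop below 1 for some small positive
  \<open>h\<close>.\<close>

lemma exponential_tilt_lt_1:
 fixes w x :: "'a => real"
 assumes "finite A" "!!a. a \<in> A ==> 0 <= w a" "(\<Sum>a\<in>A. w a) = 1" "0 < (\<Sum>a\<in>A. w a * x a)"
 shows "\<exists>h>0. \<exists>\<eta>>0. \<forall>\<eta>'\<le>\<eta>. (\<Sum>a\<in>A. w a * exp (- h * x a)) * exp (h * \<eta>') < 1"
proof -
 define f where "f h = (\<Sum>a\<in>A. w a * exp (- h * x a))" for h
 have "(f has_real_derivative (\<Sum>a\<in>A. w a * - x a)) (at 0)"
 unfolding f_def by (auto intro!: derivative_eq_intros sum.cong)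
 moreover have "(\<Sum>a\<in>A. w a * - x a) < 0" using assms(4) by (simp add: sum_negf)
 ultimately obtain d where d: "0 < d" "!!h. 0 < h ==> h < d ==> f (0 + h) < f 0"
 using DERIV_neg_dec_right[of f "\<Sum>a\<in>A. w a * - x a" 0] by auto
 define h where "h = d / 2"
 have h: "0 < h" "h < d" using d by (auto simp: h_def)
 have f1: "f h < 1" using d(2)[OF h] assms(3) by (simp add: f_def)
 obtain a0 where a0: "a0 \<in> A" "w a0 ~= 0" using assms(3) by (metis sum.neutral zero_neq_one)
 have fpos: "0 < f h" unfolding f_def using assms(1,2) a0
 by (intro sum_pos2[of A a0]) (auto simp: less_le)
 \<comment> \<open>Half of the exponent \<open>- ln (f h)\<close> is given away to the threshold;
   the other half keeps the product below 1.\<close>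
 define \<eta> where "\<eta> = - ln (f h) / (2 * h)"
 have lf: "ln (f h) < 0" using fpos f1 by simp
 have eta: "0 < \<eta>" using lf h by (simp add: \<eta>_def divide_neg_pos)
 have "f h * exp (h * \<eta>') < 1" if "\<eta>' <= \<eta>" for \<eta>'
 proof -
 have "f h * exp (h * \<eta>') = exp (ln (f h) + h * \<eta>')" using fpos by (simp add: exp_add)
 also have "ln (f h) + h * \<eta>' <= ln (f h) + h * \<eta>" using that h by simp
 also have "h * \<eta> = - ln (f h) / 2" using h by (simp add: \<eta>_def)
 finally have "f h * exp (h * \<eta>') <= exp (ln (f h) / 2)" by simp
 also have "... < 1" using lf by simp
 finally show ?thesis .
 qed
 then show ?thesis using h eta unfolding f_def by blast
qed

text \<open>Markov's inequality for the power \<open>- h\<close> of the metric. Independent blocks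
  multiply, and the remainder has total mass 1.\<close>

lemma block_chernoff:
 fixes L :: "'z::finite list => real"
 assumes L: "!!b. 0 <= L b" and T: "!!b. 0 <= T b" "(\<Sum>b\<in>seqs r. T b) = 1"
 and \<tau>: "!!b. b \<in> seqs l ==> 0 < \<tau> b" and "0 < B" "0 < h"
 shows "(\<Sum>zs\<in>seqs (m * l + r). (\<Prod>t<m. L (blk l t zs)) * T (drop (m * l) zs) * of_bool ((\<Prod>t<m. \<tau> (blk l t zs)) <= B))
 <= B powr h * (\<Sum>b\<in>seqs l. L b * exp (- h * ln (\<tau> b))) ^ m"
proof -
 have ind: "of_bool ((\<Prod>t<m. \<tau> (blk l t zs)) <= B) <= B powr h * (\<Prod>t<m. exp (- h * ln (\<tau> (blk l t zs))))"
 if "zs \<in> seqs (m * l + r)" for zs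
 proof -
 define p where "p = (\<Prod>t<m. \<tau> (blk l t zs))"
 have pos: "0 < \<tau> (blk l t zs)" if "t < m" for t using \<tau> blk_in_seqs[OF that \<open>zs \<in> _\<close>] by blast
 then have p: "0 < p" unfolding p_def by (intro prod_pos) auto
 have "ln p = (\<Sum>t<m. ln (\<tau> (blk l t zs)))" unfolding p_def by (rule ln_prod) (auto dest!: pos)
 then have "(\<Prod>t<m. exp (- h * ln (\<tau> (blk l t zs)))) = exp (- h * ln p)"
 by (simp add: exp_sum[symmetric] sum_distrib_left sum_negf)
 moreover have "1 <= B powr h * exp (- h * ln p)" if "p <= B"
 proof -
 have "B powr h * exp (- h * ln p) = exp (h * (ln B - ln p))"
 using assms(5) by (simp add: powr_def exp_add[symmetric] right_diff_distrib)
 moreover have "ln p <= ln B" using that p by simp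
 ultimately show ?thesis using \<open>0 < h\<close> by simp
 qed
 ultimately show ?thesis unfolding p_def[symmetric] by (cases "p <= B") auto
 qed
 have "(\<Sum>zs\<in>seqs (m * l + r). (\<Prod>t<m. L (blk l t zs)) * T (drop (m * l) zs) * of_bool ((\<Prod>t<m. \<tau> (blk l t zs)) <= B))
 <= (\<Sum>zs\<in>seqs (m * l + r). (\<Prod>t<m. L (blk l t zs)) * T (drop (m * l) zs) * (B powr h * (\<Prod>t<m. exp (- h * ln (\<tau> (blk l t zs))))))"
 by (intro sum_mono mult_left_mono ind mult_nonneg_nonneg prod_nonneg L T(1)) auto
 also have "... = B powr h * (\<Sum>zs\<in>seqs (m * l + r). (\<Prod>t<m. L (blk l t zs) * exp (- h * ln (\<tau> (blk l t zs)))) * T (drop (m * l) zs))"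
 by (simp add: sum_distrib_left prod.distrib mult_ac)
 also have "... = B powr h * (\<Sum>b\<in>seqs l. L b * exp (- h * ln (\<tau> b))) ^ m"
 using sum_seqs_blocks[where m=m and l=l and r=r and h=T and g="%t b. L b * exp (- h * ln (\<tau> b))"] by (simp add: T(2))
 finally show ?thesis .
qed

text \<open>Positions after the last complete superletter carry no information and use one arbitrary
  fixed letter, here \<open>undefined\<close>; its row of \<open>D\<close> is still a pmf.\<close>

definition sup_letter :: "nat => ('s list => 'u list) => nat => 's list => nat => 'u" where
 "sup_letter l F n s i = (if i < (n div l) * l then F (blk l (i div l) s) ! (i mod l) else undefined)"

definition sup_wt :: "('u => 'c => real) => nat => ('s list => 'u list) => nat => 's list => 'c list => real" where
 "sup_wt D l F n s c = (\<Prod>i<n. D (sup_letter l F n s i) (c ! i))"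

definition seq_wt :: "('u => 'c => real) => 'u list => 'c list => real" where
 "seq_wt D us c = (\<Prod>i<length c. D (us ! i) (c ! i))"

lemma sup_wt_blocks:
 assumes "r < l" "s \<in> seqs (m * l + r)" "c \<in> seqs (m * l + r)"
 shows "sup_wt D l F (m * l + r) s c
 = (\<Prod>t<m. seq_wt D (F (blk l t s)) (blk l t c)) * (\<Prod>i<r. D undefined (drop (m * l) c ! i))"
proof -
 have div: "(m * l + r) div l = m" using assms(1) by simp
 have "sup_letter l F (m * l + r) s (t * l + i) = F (blk l t s) ! i" if "t < m" "i < l" for t i
 proof -
 have "Suc t * l <= m * l" using that by (intro mult_le_mono) auto
 then have "t * l + i < m * l" using that by simp
 then show ?thesis using that by (simp add: sup_letter_def div)
 qed
 moreover have "length c = m * l + r" using assms by (simp add: seqs_iff)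
 ultimately show ?thesis
 unfolding sup_wt_def prod_blocks seq_wt_def
 by (intro arg_cong2[where f="(*)"] prod.cong)
 (auto simp: blk_nth length_blk div sup_letter_def assms)
qed

lemma sum_seqs_zip6:
 fixes h :: "'a::finite list => 'b::finite list => 'c::finite list => 'd::finite list => 'e::finite list => 'f::finite list => real"
 shows "(\<Sum>x1\<in>seqs n. \<Sum>x2\<in>seqs n. \<Sum>x3\<in>seqs n. \<Sum>x4\<in>seqs n. \<Sum>x5\<in>seqs n. \<Sum>x6\<in>seqs n. h x1 x2 x3 x4 x5 x6)
 = (\<Sum>zs\<in>seqs n. h (map fst zs) (map (fst \<circ> snd) zs) (map (fst \<circ> snd \<circ> snd) zs) (map (fst \<circ> snd \<circ> snd \<circ> snd) zs)
 (map (fst \<circ> snd \<circ> snd \<circ> snd \<circ> snd) zs) (map (snd \<circ> snd \<circ> snd \<circ> snd \<circ> snd) zs))"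
proof -
 have "(\<Sum>x1\<in>seqs n. \<Sum>x2\<in>seqs n. \<Sum>x3\<in>seqs n. \<Sum>x4\<in>seqs n. \<Sum>x5\<in>seqs n. \<Sum>x6\<in>seqs n. h x1 x2 x3 x4 x5 x6)
 = (\<Sum>x1\<in>seqs n. \<Sum>x2\<in>seqs n. \<Sum>x3\<in>seqs n. \<Sum>x4\<in>seqs n. \<Sum>z\<in>seqs n. h x1 x2 x3 x4 (map fst z) (map snd z))"
 by (intro sum.cong refl sum_seqs_zip)
 also have "... = (\<Sum>x1\<in>seqs n. \<Sum>x2\<in>seqs n. \<Sum>x3\<in>seqs n. \<Sum>z\<in>seqs n. h x1 x2 x3 (map fst z) (map (fst \<circ> snd) z) (map (snd \<circ> snd) z))"
 by (intro sum.cong refl, subst sum_seqs_zip[of "%x z. h _ _ _ x (map fst z) (map snd z)"]) simp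
 also have "... = (\<Sum>x1\<in>seqs n. \<Sum>x2\<in>seqs n. \<Sum>z\<in>seqs n. h x1 x2 (map fst z) (map (fst \<circ> snd) z) (map (fst \<circ> snd \<circ> snd) z) (map (snd \<circ> snd \<circ> snd) z))"
 by (intro sum.cong refl, subst sum_seqs_zip[of "%x z. h _ _ x (map fst z) (map (fst \<circ> snd) z) (map (snd \<circ> snd) z)"]) (simp add: comp_assoc)
 also have "... = (\<Sum>x1\<in>seqs n. \<Sum>z\<in>seqs n. h x1 (map fst z) (map (fst \<circ> snd) z) (map (fst \<circ> snd \<circ> snd) z) (map (fst \<circ> snd \<circ> snd \<circ> snd) z) (map (snd \<circ> snd \<circ> snd \<circ> snd) z))"
 by (intro sum.cong refl, subst sum_seqs_zip[of "%x z. h _ x (map fst z) (map (fst \<circ> snd) z) (map (fst \<circ> snd \<circ> snd) z) (map (snd \<circ> snd \<circ> snd) z)"]) (simp add: comp_assoc)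
 also have "... = (\<Sum>zs\<in>seqs n. h (map fst zs) (map (fst \<circ> snd) zs) (map (fst \<circ> snd \<circ> snd) zs) (map (fst \<circ> snd \<circ> snd \<circ> snd) zs)
 (map (fst \<circ> snd \<circ> snd \<circ> snd \<circ> snd) zs) (map (snd \<circ> snd \<circ> snd \<circ> snd \<circ> snd) zs))"
 by (subst sum_seqs_zip[of "%x z. h x (map fst z) (map (fst \<circ> snd) z) (map (fst \<circ> snd \<circ> snd) z) (map (fst \<circ> snd \<circ> snd \<circ> snd) z) (map (snd \<circ> snd \<circ> snd \<circ> snd) z)"]) (simp add: comp_assoc)
 finally show ?thesis .
qed

text \<open>The joint law of sources, codewords and outputs over one superletter of length \<open>length s1\<close>.\<close>

definition sup_law :: "('s1 \<times> 's2 => real) => ('u => 'c1 => real) => ('u => 'c2 => real) => ('c1 \<times> 'c2 => 'y1 \<times> 'y2 => real) =>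
 ('s1 list => 'u list) => ('s2 list => 'u list) =>
 's1 list => 's2 list => 'c1 list => 'c2 list => 'y1 list => 'y2 list => real" where
 "sup_law WS D1 D2 W F1 F2 s1 s2 c1 c2 y1 y2 = (\<Prod>i<length s1. WS (s1 ! i, s2 ! i)) * seq_wt D1 (F1 s1) c1 * seq_wt D2 (F2 s2) c2 *
 (\<Prod>i<length y1. W (c1 ! i, c2 ! i) (y1 ! i, y2 ! i))"

lemma pmf_on_nonneg: "pmf_on p ==> 0 <= p x" by (simp add: pmf_on_def)
lemma pmf_on_sum: "pmf_on p ==> sum p UNIV = 1" by (simp add: pmf_on_def)
lemma stoch_nonneg: "stoch W ==> 0 <= W a x" by (simp add: stoch_def pmf_on_def)
lemma stoch_sum: "stoch W ==> sum (W a) UNIV = 1" by (simp add: stoch_def pmf_on_def)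

lemma sum_UNIV_pair: "(\<Sum>x\<in>(UNIV::'a::finite set). \<Sum>y\<in>(UNIV::'b::finite set). f (x, y)) = (sum f UNIV :: real)"
 by (simp add: sum.cartesian_product flip: UNIV_Times_UNIV)

lemma sum_seqs_iid:
 assumes "!!i. i < n ==> pmf_on (p i)"
 shows "(\<Sum>xs\<in>seqs n. \<Prod>i<n. p i (xs ! i)) = 1"
 using assms by (simp add: sum_seqs_prod pmf_on_def)

lemma sum_seqs_pair_iid:
 fixes p :: "nat => 'a::finite \<times> 'b::finite => real"
 assumes "!!i. i < n ==> pmf_on (p i)"
 shows "(\<Sum>xs\<in>seqs n. \<Sum>ys\<in>seqs n. \<Prod>i<n. p i (xs ! i, ys ! i)) = 1"
proof -
 have "(\<Sum>xs\<in>seqs n. \<Sum>ys\<in>seqs n. \<Prod>i<n. p i (xs ! i, ys ! i)) = (\<Sum>zs\<in>seqs n. \<Prod>i<n. p i (zs ! i))"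
 unfolding sum_seqs_zip by (intro sum.cong prod.cong refl) (simp add: seqs_iff)
 then show ?thesis using sum_seqs_iid[of n p, OF assms] by simp
qed



lemma sup_wt_nonneg: "(!!u. pmf_on (D u)) ==> 0 <= sup_wt D l F n s c"
 unfolding sup_wt_def by (intro prod_nonneg) (simp add: pmf_on_nonneg)

lemma seq_wt_nonneg: "(!!u. pmf_on (D u)) ==> 0 <= seq_wt D u c"
 unfolding seq_wt_def by (intro prod_nonneg) (simp add: pmf_on_nonneg)

lemma sum_sup_wt: "(!!u. pmf_on (D u)) ==> (\<Sum>c\<in>seqs n. sup_wt D l F n s c) = 1"
 unfolding sup_wt_def by (rule sum_seqs_iid)

lemma sum_seq_wt: "(!!u. pmf_on (D u)) ==> (\<Sum>c\<in>seqs n. seq_wt D u c) = 1"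
proof -
 assume "!!u. pmf_on (D u)"
 then have "(\<Sum>c\<in>seqs n. \<Prod>i<n. D (u ! i) (c ! i)) = 1" by (intro sum_seqs_iid)
 moreover have "(\<Sum>c\<in>seqs n. seq_wt D u c) = (\<Sum>c\<in>seqs n. \<Prod>i<n. D (u ! i) (c ! i))"
 by (intro sum.cong refl) (simp add: seq_wt_def seqs_iff)
 ultimately show ?thesis by simp
qed

text \<open>Source letters after the last complete superletter get the uniform guess, which keeps
  the metric normalised at the price of a factor bounded independently of \<open>n\<close>.\<close>

definition sup_metric :: "nat => ('s::finite list => 'c list => 'y list => real) => nat => 's list => 'c list => 'y list => real" where
 "sup_metric l t n s c y = (\<Prod>k<n div l. t (blk l k s) (blk l k c) (blk l k y)) * (1 / real CARD('s)) ^ (n mod l)"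

lemma sup_metric_normalised:
 fixes t :: "'s::finite list => 'c::finite list => 'y list => real"
 assumes l: "0 < l" and D: "!!u. pmf_on (D u)"
 and t: "!!s c y. s \<in> seqs l ==> c \<in> seqs l ==> y \<in> seqs l ==> 0 < t s c y"
 "!!y. y \<in> seqs l ==> (\<Sum>s\<in>seqs l. \<Sum>c\<in>seqs l. seq_wt D (F s) c * t s c y) <= 1"
 and y: "y \<in> seqs n"
 shows "(\<Sum>s\<in>seqs n. \<Sum>c\<in>seqs n. sup_wt D l F n s c * sup_metric l t n s c y) <= 1"
proof -
 define m where "m = n div l"
 define r where "r = n mod l"
 have n: "n = m * l + r" "r < l" using l by (auto simp: m_def r_def)
 have dm: "n div l = m" "n mod l = r" by (simp_all add: m_def r_def)
 define g where "g k b = seq_wt D (F (map fst b)) (map snd b) * t (map fst b) (map snd b) (blk l k y)" for k b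
 define h where "h b = (\<Prod>i<r. D undefined (snd (b ! i))) * (1 / real CARD('s)) ^ r" for b :: "('s \<times> 'c) list"
 have "(\<Sum>s\<in>seqs n. \<Sum>c\<in>seqs n. sup_wt D l F n s c * sup_metric l t n s c y)
 = (\<Sum>zs\<in>seqs (m * l + r). (\<Prod>k<m. g k (blk l k zs)) * h (drop (m * l) zs))"
 unfolding sum_seqs_zip n(1)[symmetric]
 proof (intro sum.cong refl)
 fix zs :: "('s \<times> 'c) list" assume zs: "zs \<in> seqs n"
 have "sup_wt D l F n (map fst zs) (map snd zs)
 = (\<Prod>k<m. seq_wt D (F (map fst (blk l k zs))) (map snd (blk l k zs))) * (\<Prod>i<r. D undefined (snd (drop (m * l) zs ! i)))"
 unfolding n(1) using zs n
 by (subst sup_wt_blocks) (auto simp: seqs_iff blk_map drop_map intro!: prod.cong)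
 then show "sup_wt D l F n (map fst zs) (map snd zs) * sup_metric l t n (map fst zs) (map snd zs) y
 = (\<Prod>k<m. g k (blk l k zs)) * h (drop (m * l) zs)"
 by (simp add: sup_metric_def dm g_def h_def blk_map prod.distrib mult_ac)
 qed
 also have "... = (\<Prod>k<m. \<Sum>b\<in>seqs l. g k b) * (\<Sum>b\<in>seqs r. h b)" by (rule sum_seqs_blocks)
 also have "(\<Sum>b\<in>seqs r. h b) = 1"
 proof -
 have "h b = (\<Prod>i<r. D undefined (snd (b ! i)) / real CARD('s))" for b
 by (simp add: h_def prod_dividef power_one_over)
 then have "(\<Sum>b\<in>seqs r. h b) = (\<Prod>i<r. \<Sum>x\<in>(UNIV :: ('s \<times> 'c) set). D undefined (snd x) / real CARD('s))"
 using sum_seqs_prod[of "%i x. D undefined (snd x) / real CARD('s)" r] by simp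
 moreover have "(\<Sum>x\<in>(UNIV :: ('s \<times> 'c) set). D undefined (snd x) / real CARD('s)) = 1"
 using D[of undefined] by (simp add: sum_UNIV_pair[symmetric] pmf_on_sum sum_divide_distrib[symmetric])
 ultimately show ?thesis by simp
 qed
 also have "(\<Prod>k<m. \<Sum>b\<in>seqs l. g k b) <= 1"
 proof (intro prod_le_1 conjI)
 fix k assume "k \<in> {..<m}"
 then have yk: "blk l k y \<in> seqs l" using y n by (intro blk_in_seqs[where m=m and r=r]) auto
 show "0 <= (\<Sum>b\<in>seqs l. g k b)"
 unfolding g_def using yk t(1) D by (intro sum_nonneg mult_nonneg_nonneg seq_wt_nonneg less_imp_le) (auto simp: seqs_iff)
 have "(\<Sum>b\<in>seqs l. g k b) = (\<Sum>s\<in>seqs l. \<Sum>c\<in>seqs l. seq_wt D (F s) c * t s c (blk l k y))"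
 unfolding sum_seqs_zip g_def ..
 also have "... <= 1" by (rule t(2)[OF yk])
 finally show "(\<Sum>b\<in>seqs l. g k b) <= 1" .
 qed
 finally show ?thesis by simp
qed

lemma sum_sup_law:
 fixes WS :: "'s1::finite \<times> 's2::finite => real" and D1 :: "'u => 'c1::finite => real" and D2 :: "'u => 'c2::finite => real"
 and W :: "'c1 \<times> 'c2 => 'y1::finite \<times> 'y2::finite => real"
 assumes WS: "pmf_on WS" and D: "!!u. pmf_on (D1 u)" "!!u. pmf_on (D2 u)" and W: "stoch W"
 shows "(\<Sum>s1\<in>seqs n. \<Sum>s2\<in>seqs n. \<Sum>c1\<in>seqs n. \<Sum>c2\<in>seqs n. \<Sum>y1\<in>seqs n. \<Sum>y2\<in>seqs n. sup_law WS D1 D2 W F1 F2 s1 s2 c1 c2 y1 y2) = 1"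
proof -
 have "(\<Sum>y1\<in>seqs n. \<Sum>y2\<in>seqs n. \<Prod>i<n. W (c1 ! i, c2 ! i) (y1 ! i, y2 ! i)) = 1" for c1 c2
 using W by (intro sum_seqs_pair_iid) (simp add: stoch_def)
 moreover have "(\<Sum>s1\<in>seqs n. \<Sum>s2\<in>seqs n. \<Prod>i<n. WS (s1 ! i, s2 ! i)) = 1"
 using WS by (intro sum_seqs_pair_iid)
 moreover have "(\<Sum>s1\<in>seqs n. \<Sum>s2\<in>seqs n. \<Sum>c1\<in>seqs n. \<Sum>c2\<in>seqs n. \<Sum>y1\<in>seqs n. \<Sum>y2\<in>seqs n. sup_law WS D1 D2 W F1 F2 s1 s2 c1 c2 y1 y2)
 = (\<Sum>s1\<in>seqs n. \<Sum>s2\<in>seqs n. \<Sum>c1\<in>seqs n. \<Sum>c2\<in>seqs n. \<Sum>y1\<in>seqs n. \<Sum>y2\<in>seqs n.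
 (\<Prod>i<n. WS (s1 ! i, s2 ! i)) * seq_wt D1 (F1 s1) c1 * seq_wt D2 (F2 s2) c2 * (\<Prod>i<n. W (c1 ! i, c2 ! i) (y1 ! i, y2 ! i)))"
 by (intro sum.cong refl) (simp add: sup_law_def seqs_iff)
 ultimately show ?thesis
 by (simp add: sum_distrib_left[symmetric] sum_distrib_right[symmetric] sum_seq_wt D)
qed

text \<open>Probability that the true pair fails the metric threshold at block length \<open>m * l + r\<close>; the
 function \<open>\<tau>\<close> is the superletter metric of either receiver.\<close>

lemma sup_threshold_bound:
 fixes WS :: "'s1::finite \<times> 's2::finite => real" and D1 :: "'u => 'c1::finite => real" and D2 :: "'u => 'c2::finite => real"
 and W :: "'c1 \<times> 'c2 => 'y1::finite \<times> 'y2::finite => real"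
 and \<tau> :: "'s1 list => 's2 list => 'c1 list => 'c2 list => 'y1 list => 'y2 list => real"
 assumes WS: "pmf_on WS" and D: "!!u. pmf_on (D1 u)" "!!u. pmf_on (D2 u)" and W: "stoch W"
 and n: "n = m * l + r" "r < l"
 and \<tau>: "!!s1 s2 c1 c2 y1 y2. s1 \<in> seqs l ==> s2 \<in> seqs l ==> c1 \<in> seqs l ==> c2 \<in> seqs l ==> y1 \<in> seqs l ==> y2 \<in> seqs l ==> 0 < \<tau> s1 s2 c1 c2 y1 y2"
 and B: "0 < B" "0 < h"
 shows "(\<Sum>s1\<in>seqs n. \<Sum>s2\<in>seqs n. (\<Prod>i<n. WS (s1 ! i, s2 ! i)) * (\<Sum>c1\<in>seqs n. \<Sum>c2\<in>seqs n. sup_wt D1 l F1 n s1 c1 * sup_wt D2 l F2 n s2 c2 *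
 (\<Sum>y1\<in>seqs n. \<Sum>y2\<in>seqs n. (\<Prod>i<n. W (c1 ! i, c2 ! i) (y1 ! i, y2 ! i)) *
 of_bool ((\<Prod>k<m. \<tau> (blk l k s1) (blk l k s2) (blk l k c1) (blk l k c2) (blk l k y1) (blk l k y2)) <= B))))
 <= B powr h * (\<Sum>s1\<in>seqs l. \<Sum>s2\<in>seqs l. \<Sum>c1\<in>seqs l. \<Sum>c2\<in>seqs l. \<Sum>y1\<in>seqs l. \<Sum>y2\<in>seqs l.
 sup_law WS D1 D2 W F1 F2 s1 s2 c1 c2 y1 y2 * exp (- h * ln (\<tau> s1 s2 c1 c2 y1 y2))) ^ m" (is "?L <= _")
proof -
 let ?p1 = "map fst" and ?p2 = "map (fst \<circ> snd)" and ?p3 = "map (fst \<circ> snd \<circ> snd)" and ?p4 = "map (fst \<circ> snd \<circ> snd \<circ> snd)"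
 and ?p5 = "map (fst \<circ> snd \<circ> snd \<circ> snd \<circ> snd)" and ?p6 = "map (snd \<circ> snd \<circ> snd \<circ> snd \<circ> snd)"
 define L where "L b = sup_law WS D1 D2 W F1 F2 (?p1 b) (?p2 b) (?p3 b) (?p4 b) (?p5 b) (?p6 b)" for b
 define \<tau>' where "\<tau>' b = \<tau> (?p1 b) (?p2 b) (?p3 b) (?p4 b) (?p5 b) (?p6 b)" for b
 define q where "q z = (case z of (s1, s2, c1, c2, y1, y2) => WS (s1, s2) * D1 undefined c1 * D2 undefined c2 * W (c1, c2) (y1, y2))" for z
 define T where "T b = (\<Prod>i<r. q (b ! i))" for b
 have q: "pmf_on q"
 proof -
 have "0 <= q z" for z unfolding q_def
 by (auto split: prod.splits intro!: mult_nonneg_nonneg pmf_on_nonneg[OF WS] pmf_on_nonneg[OF D(1)] pmf_on_nonneg[OF D(2)] stoch_nonneg[OF W])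
 moreover have "sum q UNIV = 1"
 proof -
 have "sum q UNIV = (\<Sum>s1\<in>UNIV. \<Sum>s2\<in>UNIV. \<Sum>c1\<in>UNIV. \<Sum>c2\<in>UNIV. \<Sum>y1\<in>UNIV. \<Sum>y2\<in>UNIV. q (s1, s2, c1, c2, y1, y2))"
 by (simp only: sum_UNIV_pair[symmetric])
 also have "... = 1"
 proof -
 have "(\<Sum>y1\<in>UNIV. \<Sum>y2\<in>UNIV. W c (y1, y2)) = 1" for c
 using stoch_sum[OF W, of c] by (simp add: sum_UNIV_pair)
 moreover have "(\<Sum>y1\<in>UNIV. \<Sum>y2\<in>UNIV. WS (y1, y2)) = 1"
 using pmf_on_sum[OF WS] by (simp add: sum_UNIV_pair)
 ultimately show ?thesis
 by (simp add: q_def sum_distrib_left[symmetric] sum_distrib_right[symmetric] pmf_on_sum D)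
 qed
 finally show ?thesis .
 qed
 ultimately show ?thesis by (simp add: pmf_on_def)
 qed
 have "?L = (\<Sum>s1\<in>seqs n. \<Sum>s2\<in>seqs n. \<Sum>c1\<in>seqs n. \<Sum>c2\<in>seqs n. \<Sum>y1\<in>seqs n. \<Sum>y2\<in>seqs n.
 (\<Prod>i<n. WS (s1 ! i, s2 ! i)) * sup_wt D1 l F1 n s1 c1 * sup_wt D2 l F2 n s2 c2 * (\<Prod>i<n. W (c1 ! i, c2 ! i) (y1 ! i, y2 ! i)) *
 of_bool ((\<Prod>k<m. \<tau> (blk l k s1) (blk l k s2) (blk l k c1) (blk l k c2) (blk l k y1) (blk l k y2)) <= B))"
 by (simp only: sum_distrib_left mult.assoc)
 also have "... = (\<Sum>zs\<in>seqs (m * l + r). (\<Prod>k<m. L (blk l k zs)) * T (drop (m * l) zs) * of_bool ((\<Prod>k<m. \<tau>' (blk l k zs)) <= B))"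
 unfolding sum_seqs_zip6 n(1)
 proof (intro sum.cong refl)
 fix zs :: "('s1 \<times> 's2 \<times> 'c1 \<times> 'c2 \<times> 'y1 \<times> 'y2) list" assume zs: "zs \<in> seqs (m * l + r)"
 then have len: "length zs = m * l + r" by (simp add: seqs_iff)
 have lb: "length (blk l k zs) = l" if "k < m" for k using that len by (rule length_blk)
 have nth: "blk l k zs ! i = zs ! (k * l + i)" if "k < m" "i < l" for k i using that len by (rule blk_nth)
 have idx: "k * l + i < length zs" if "k < m" "i < l" for k i
 proof -
 have "Suc k * l <= m * l" using that by (intro mult_le_mono) auto
 then show ?thesis using that len by simp
 qed
 have A: "(\<Prod>i<m * l + r. WS (?p1 zs ! i, ?p2 zs ! i))
 = (\<Prod>k<m. \<Prod>i<length (?p1 (blk l k zs)). WS (?p1 (blk l k zs) ! i, ?p2 (blk l k zs) ! i)) * (\<Prod>i<r. WS (fst (drop (m * l) zs ! i), fst (snd (drop (m * l) zs ! i))))"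
 unfolding prod_blocks using idx len
 by (intro arg_cong2[where f="(*)"] prod.cong) (auto simp: lb nth)
 have Bq: "(\<Prod>i<m * l + r. W (?p3 zs ! i, ?p4 zs ! i) (?p5 zs ! i, ?p6 zs ! i))
 = (\<Prod>k<m. \<Prod>i<length (?p5 (blk l k zs)). W (?p3 (blk l k zs) ! i, ?p4 (blk l k zs) ! i) (?p5 (blk l k zs) ! i, ?p6 (blk l k zs) ! i)) *
 (\<Prod>i<r. W (fst (snd (snd (drop (m * l) zs ! i))), fst (snd (snd (snd (drop (m * l) zs ! i))))) (snd (snd (snd (snd (drop (m * l) zs ! i))))))"
 unfolding prod_blocks using idx len
 by (intro arg_cong2[where f="(*)"] prod.cong) (auto simp: lb nth)
 have C1: "sup_wt D1 l F1 (m * l + r) (?p1 zs) (?p3 zs) = (\<Prod>k<m. seq_wt D1 (F1 (?p1 (blk l k zs))) (?p3 (blk l k zs))) * (\<Prod>i<r. D1 undefined (fst (snd (snd (drop (m * l) zs ! i)))))"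
 using len n(2) by (subst sup_wt_blocks) (auto simp: seqs_iff blk_map drop_map intro!: prod.cong)
 have C2: "sup_wt D2 l F2 (m * l + r) (?p2 zs) (?p4 zs) = (\<Prod>k<m. seq_wt D2 (F2 (?p2 (blk l k zs))) (?p4 (blk l k zs))) * (\<Prod>i<r. D2 undefined (fst (snd (snd (snd (drop (m * l) zs ! i))))))"
 using len n(2) by (subst sup_wt_blocks) (auto simp: seqs_iff blk_map drop_map intro!: prod.cong)
 have "T (drop (m * l) zs) = (\<Prod>i<r. WS (fst (drop (m * l) zs ! i), fst (snd (drop (m * l) zs ! i)))) *
 (\<Prod>i<r. D1 undefined (fst (snd (snd (drop (m * l) zs ! i))))) * (\<Prod>i<r. D2 undefined (fst (snd (snd (snd (drop (m * l) zs ! i)))))) *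
 (\<Prod>i<r. W (fst (snd (snd (drop (m * l) zs ! i))), fst (snd (snd (snd (drop (m * l) zs ! i))))) (snd (snd (snd (snd (drop (m * l) zs ! i))))))"
 by (simp add: T_def q_def case_prod_unfold prod.distrib)
 moreover have "(\<Prod>k<m. L (blk l k zs)) = (\<Prod>k<m. \<Prod>i<length (?p1 (blk l k zs)). WS (?p1 (blk l k zs) ! i, ?p2 (blk l k zs) ! i)) *
 (\<Prod>k<m. seq_wt D1 (F1 (?p1 (blk l k zs))) (?p3 (blk l k zs))) * (\<Prod>k<m. seq_wt D2 (F2 (?p2 (blk l k zs))) (?p4 (blk l k zs))) *
 (\<Prod>k<m. \<Prod>i<length (?p5 (blk l k zs)). W (?p3 (blk l k zs) ! i, ?p4 (blk l k zs) ! i) (?p5 (blk l k zs) ! i, ?p6 (blk l k zs) ! i))"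
 by (simp only: L_def sup_law_def prod.distrib)
 ultimately show "(\<Prod>i<m * l + r. WS (?p1 zs ! i, ?p2 zs ! i)) * sup_wt D1 l F1 (m * l + r) (?p1 zs) (?p3 zs) * sup_wt D2 l F2 (m * l + r) (?p2 zs) (?p4 zs) *
 (\<Prod>i<m * l + r. W (?p3 zs ! i, ?p4 zs ! i) (?p5 zs ! i, ?p6 zs ! i)) *
 of_bool ((\<Prod>k<m. \<tau> (blk l k (?p1 zs)) (blk l k (?p2 zs)) (blk l k (?p3 zs)) (blk l k (?p4 zs)) (blk l k (?p5 zs)) (blk l k (?p6 zs))) <= B)
 = (\<Prod>k<m. L (blk l k zs)) * T (drop (m * l) zs) * of_bool ((\<Prod>k<m. \<tau>' (blk l k zs)) <= B)"
 unfolding A Bq C1 C2 by (simp only: blk_map \<tau>'_def mult_ac)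
 qed
 also have "... <= B powr h * (\<Sum>b\<in>seqs l. L b * exp (- h * ln (\<tau>' b))) ^ m"
 proof (rule block_chernoff)
 show "0 <= L b" for b unfolding L_def sup_law_def
 by (intro mult_nonneg_nonneg prod_nonneg seq_wt_nonneg D ballI pmf_on_nonneg[OF WS] stoch_nonneg[OF W])
 show "0 <= T b" for b unfolding T_def by (intro prod_nonneg) (simp add: pmf_on_nonneg q)
 show "(\<Sum>b\<in>seqs r. T b) = 1" unfolding T_def by (rule sum_seqs_iid) (rule q)
 show "0 < \<tau>' b" if "b \<in> seqs l" for b unfolding \<tau>'_def using that by (intro \<tau>) (auto simp: seqs_iff)
 qed (use B in auto)
 also have "(\<Sum>b\<in>seqs l. L b * exp (- h * ln (\<tau>' b))) = (\<Sum>s1\<in>seqs l. \<Sum>s2\<in>seqs l. \<Sum>c1\<in>seqs l. \<Sum>c2\<in>seqs l. \<Sum>y1\<in>seqs l. \<Sum>y2\<in>seqs l.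
 sup_law WS D1 D2 W F1 F2 s1 s2 c1 c2 y1 y2 * exp (- h * ln (\<tau> s1 s2 c1 c2 y1 y2)))"
 unfolding sum_seqs_zip6 L_def \<tau>'_def ..
 finally show ?thesis .
qed

lemma sup_tilt:
 fixes WS :: "'s1::finite \<times> 's2::finite => real" and D1 :: "'u => 'c1::finite => real" and D2 :: "'u => 'c2::finite => real"
 and W :: "'c1 \<times> 'c2 => 'y1::finite \<times> 'y2::finite => real"
 assumes WS: "pmf_on WS" and D: "!!u. pmf_on (D1 u)" "!!u. pmf_on (D2 u)" and W: "stoch W"
 and E: "0 < (\<Sum>s1\<in>seqs l. \<Sum>s2\<in>seqs l. \<Sum>c1\<in>seqs l. \<Sum>c2\<in>seqs l. \<Sum>y1\<in>seqs l. \<Sum>y2\<in>seqs l.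
 sup_law WS D1 D2 W F1 F2 s1 s2 c1 c2 y1 y2 * X s1 s2 c1 c2 y1 y2)"
 shows "\<exists>h>0. \<exists>\<eta>>0. \<forall>\<eta>'\<le>\<eta>. (\<Sum>s1\<in>seqs l. \<Sum>s2\<in>seqs l. \<Sum>c1\<in>seqs l. \<Sum>c2\<in>seqs l. \<Sum>y1\<in>seqs l. \<Sum>y2\<in>seqs l.
 sup_law WS D1 D2 W F1 F2 s1 s2 c1 c2 y1 y2 * exp (- h * X s1 s2 c1 c2 y1 y2)) * exp (h * \<eta>') < 1"
 using sum_sup_law[OF WS D W, where n=l and ?F1.0=F1 and ?F2.0=F2] E unfolding sum_seqs_zip6
 by (intro exponential_tilt_lt_1)
 (auto simp: sup_law_def intro!: mult_nonneg_nonneg prod_nonneg seq_wt_nonneg D pmf_on_nonneg[OF WS] stoch_nonneg[OF W])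

lemma sup_tail_bound:
 fixes WS :: "'s1::finite \<times> 's2::finite => real" and D1 :: "'u => 'c1::finite => real" and D2 :: "'u => 'c2::finite => real"
 and W :: "'c1 \<times> 'c2 => 'y1::finite \<times> 'y2::finite => real"
 and \<tau> :: "'s1 list => 's2 list => 'c1 list => 'c2 list => 'y1 list => 'y2 list => real"
 assumes WS: "pmf_on WS" and D: "!!u. pmf_on (D1 u)" "!!u. pmf_on (D2 u)" and W: "stoch W" and l: "0 < l"
 and \<tau>: "!!s1 s2 c1 c2 y1 y2. s1 \<in> seqs l ==> s2 \<in> seqs l ==> c1 \<in> seqs l ==> c2 \<in> seqs l ==> y1 \<in> seqs l ==> y2 \<in> seqs l ==> 0 < \<tau> s1 s2 c1 c2 y1 y2"
 and h: "0 < h" and K: "1 <= K"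
 and a: "a = (\<Sum>s1\<in>seqs l. \<Sum>s2\<in>seqs l. \<Sum>c1\<in>seqs l. \<Sum>c2\<in>seqs l. \<Sum>y1\<in>seqs l. \<Sum>y2\<in>seqs l.
 sup_law WS D1 D2 W F1 F2 s1 s2 c1 c2 y1 y2 * exp (- h * ln (\<tau> s1 s2 c1 c2 y1 y2)))"
 and tn: "!!s1 s2 c1 c2 y1 y2. tn s1 s2 c1 c2 y1 y2 =
 (\<Prod>k<n div l. \<tau> (blk l k s1) (blk l k s2) (blk l k c1) (blk l k c2) (blk l k y1) (blk l k y2)) * (1 / K) ^ (n mod l)"
 shows "(\<Sum>s1\<in>seqs n. \<Sum>s2\<in>seqs n. (\<Prod>i<n. WS (s1 ! i, s2 ! i)) * (\<Sum>c1\<in>seqs n. \<Sum>c2\<in>seqs n. sup_wt D1 l F1 n s1 c1 * sup_wt D2 l F2 n s2 c2 *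
 (\<Sum>y1\<in>seqs n. \<Sum>y2\<in>seqs n. (\<Prod>i<n. W (c1 ! i, c2 ! i) (y1 ! i, y2 ! i)) * of_bool (tn s1 s2 c1 c2 y1 y2 <= exp (\<eta> * real (n div l))))))
 <= (K ^ l) powr h * (a * exp (h * \<eta>)) ^ (n div l)" (is "?L <= _")
proof -
 define m where "m = n div l"
 define r where "r = n mod l"
 have n: "n = m * l + r" "r < l" using l by (auto simp: m_def r_def)
 \<comment> \<open>The uniform guess lowers the metric by at most \<open>K ^ l\<close>; the loss is
   moved into the threshold, where it only affects the constant in front.\<close>
 define B where "B = exp (\<eta> * real m) * K ^ l"
 have B: "0 < B" using K by (simp add: B_def)
 have imp: "of_bool (tn s1 s2 c1 c2 y1 y2 <= exp (\<eta> * real (n div l))) \<le>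
 (of_bool ((\<Prod>k<m. \<tau> (blk l k s1) (blk l k s2) (blk l k c1) (blk l k c2) (blk l k y1) (blk l k y2)) <= B) :: real)"
 for s1 s2 c1 c2 y1 y2
 proof -
 have "K ^ r <= K ^ l" using K n(2) by (intro power_increasing) auto
 then have "exp (\<eta> * real m) * K ^ r <= B" by (simp add: B_def)
 moreover have "0 < K ^ r" using K by simp
 ultimately show ?thesis unfolding tn m_def[symmetric] r_def[symmetric]
 by (auto simp: power_one_over pos_divide_le_eq)
 qed
 have "?L <= (\<Sum>s1\<in>seqs n. \<Sum>s2\<in>seqs n. (\<Prod>i<n. WS (s1 ! i, s2 ! i)) * (\<Sum>c1\<in>seqs n. \<Sum>c2\<in>seqs n. sup_wt D1 l F1 n s1 c1 * sup_wt D2 l F2 n s2 c2 *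
 (\<Sum>y1\<in>seqs n. \<Sum>y2\<in>seqs n. (\<Prod>i<n. W (c1 ! i, c2 ! i) (y1 ! i, y2 ! i)) *
 of_bool ((\<Prod>k<m. \<tau> (blk l k s1) (blk l k s2) (blk l k c1) (blk l k c2) (blk l k y1) (blk l k y2)) <= B))))"
 by (intro sum_mono mult_left_mono imp)
 (auto intro!: prod_nonneg mult_nonneg_nonneg sup_wt_nonneg D pmf_on_nonneg[OF WS] stoch_nonneg[OF W])
 also have "... <= B powr h * a ^ m"
 unfolding a by (rule sup_threshold_bound[OF WS D W n \<tau> B h])
 also have "B powr h * a ^ m = (K ^ l) powr h * (a * exp (h * \<eta>)) ^ m"
 proof -
 have "B powr h = exp (\<eta> * real m) powr h * (K ^ l) powr h" unfolding B_def by (rule powr_mult)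
 moreover have "exp (\<eta> * real m) powr h = exp (h * \<eta>) ^ m"
 by (simp add: powr_def exp_of_nat_mult[symmetric] mult_ac)
 ultimately show ?thesis by (simp add: power_mult_distrib)
 qed
 finally show ?thesis by (simp add: m_def)
qed

lemma blk_div_in_seqs: "k < n div l ==> s \<in> seqs n ==> blk l k s \<in> seqs l"
 using blk_in_seqs[of k "n div l" s l "n mod l"] by simp

text \<open>A threshold \<open>exp (\<eta> * m)\<close> for \<open>m\<close> superletters makes
  wrong words exponentially unlikely, and the positive mean of the log-metric keeps the true word
  above it. Codeword letters may contain more than the channel input; \<open>X1\<close> and
  \<open>X2\<close> extract that input.\<close>

theorem superletter_coding:
 fixes WS :: "'s1::finite \<times> 's2::finite => real" and D1 :: "'u => 'c1::finite => real" and D2 :: "'u => 'c2::finite => real"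
 and W :: "'x1 \<times> 'x2 => 'y1::finite \<times> 'y2::finite => real" and X1 :: "'c1 => 'x1" and X2 :: "'c2 => 'x2"
 defines "V \<equiv> %(c1, c2). W (X1 c1, X2 c2)"
 assumes WS: "pmf_on WS" and D: "!!u. pmf_on (D1 u)" "!!u. pmf_on (D2 u)" and W: "stoch W" and l: "0 < l"
 and t1: "!!s c y. s \<in> seqs l ==> c \<in> seqs l ==> y \<in> seqs l ==> 0 < t1 s c y"
 "!!y. y \<in> seqs l ==> (\<Sum>s\<in>seqs l. \<Sum>c\<in>seqs l. seq_wt D1 (F1 s) c * t1 s c y) <= 1"
 and t2: "!!s c y. s \<in> seqs l ==> c \<in> seqs l ==> y \<in> seqs l ==> 0 < t2 s c y"
 "!!y. y \<in> seqs l ==> (\<Sum>s\<in>seqs l. \<Sum>c\<in>seqs l. seq_wt D2 (F2 s) c * t2 s c y) <= 1"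
 and E1: "0 < (\<Sum>s1\<in>seqs l. \<Sum>s2\<in>seqs l. \<Sum>c1\<in>seqs l. \<Sum>c2\<in>seqs l. \<Sum>y1\<in>seqs l. \<Sum>y2\<in>seqs l.
 sup_law WS D1 D2 V F1 F2 s1 s2 c1 c2 y1 y2 * ln (t1 s1 c1 y1))"
 and E2: "0 < (\<Sum>s1\<in>seqs l. \<Sum>s2\<in>seqs l. \<Sum>c1\<in>seqs l. \<Sum>c2\<in>seqs l. \<Sum>y1\<in>seqs l. \<Sum>y2\<in>seqs l.
 sup_law WS D1 D2 V F1 F2 s1 s2 c1 c2 y1 y2 * ln (t2 s2 c2 y2))"
 shows "transmissible WS W"
proof -
 have V: "stoch V" using W by (auto simp: V_def stoch_def split: prod.splits)
 define E where "E X h = (\<Sum>s1\<in>seqs l. \<Sum>s2\<in>seqs l. \<Sum>c1\<in>seqs l. \<Sum>c2\<in>seqs l. \<Sum>y1\<in>seqs l. \<Sum>y2\<in>seqs l.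
 sup_law WS D1 D2 V F1 F2 s1 s2 c1 c2 y1 y2 * exp (- h * ln (X s1 s2 c1 c2 y1 y2)))" for X :: "'s1 list => 's2 list => 'c1 list => 'c2 list => 'y1 list => 'y2 list => real" and h
 let ?T1 = "%s1 s2 c1 c2 y1 y2. t1 s1 c1 y1" and ?T2 = "%s1 s2 c1 c2 y1 y2. t2 s2 c2 y2"
 obtain h1 e1 where h1: "0 < h1" "0 < e1" "!!\<eta>. \<eta> <= e1 ==> E ?T1 h1 * exp (h1 * \<eta>) < 1"
 using sup_tilt[OF WS D V E1] unfolding E_def by blast
 obtain h2 e2 where h2: "0 < h2" "0 < e2" "!!\<eta>. \<eta> <= e2 ==> E ?T2 h2 * exp (h2 * \<eta>) < 1"
 using sup_tilt[OF WS D V E2] unfolding E_def by blast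
 \<comment> \<open>Each tilt tolerates every smaller margin, so the two receivers can share one
   threshold.\<close>
 define \<eta> where "\<eta> = min e1 e2"
 have eta: "0 < \<eta>" "\<eta> <= e1" "\<eta> <= e2" using h1 h2 by (auto simp: \<eta>_def)
 define \<theta>1 where "\<theta>1 = E ?T1 h1 * exp (h1 * \<eta>)"
 define \<theta>2 where "\<theta>2 = E ?T2 h2 * exp (h2 * \<eta>)"
 have E0: "0 <= E X h" for X h unfolding E_def sup_law_def
 by (intro sum_nonneg mult_nonneg_nonneg prod_nonneg seq_wt_nonneg D ballI pmf_on_nonneg[OF WS] stoch_nonneg[OF V]) auto
 have \<theta>: "0 <= \<theta>1" "\<theta>1 < 1" "0 <= \<theta>2" "\<theta>2 < 1" using h1(3)[OF eta(2)] h2(3)[OF eta(3)] E0 by (auto simp: \<theta>1_def \<theta>2_def)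
 define K1 where "K1 = real CARD('s1)"
 define K2 where "K2 = real CARD('s2)"
 have K: "1 <= K1" "1 <= K2" by (simp_all add: K1_def K2_def Suc_le_eq)
 define b where "b m = (K1 ^ l) powr h1 * \<theta>1 ^ m + (K2 ^ l) powr h2 * \<theta>2 ^ m + 2 * exp (- \<eta>) ^ m" for m
 have code: "\<exists>x1 x2 d1 d2. (\<forall>s\<in>seqs n. x1 s \<in> seqs n) & (\<forall>s\<in>seqs n. x2 s \<in> seqs n) \<and>
 (\<forall>y\<in>seqs n. d1 y \<in> seqs n) & (\<forall>y\<in>seqs n. d2 y \<in> seqs n) & err_prob WS W n x1 x2 d1 d2 <= b (n div l)" for n
 proof -
 define g where "g = exp (\<eta> * real (n div l))"
 define P where "P s1 s2 = (\<Prod>i<n. WS (s1 ! i, s2 ! i))" for s1 s2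
 define Vn where "Vn c1 c2 y1 y2 = (\<Prod>i<n. V (c1 ! i, c2 ! i) (y1 ! i, y2 ! i))" for c1 c2 y1 y2
 let ?t1 = "sup_metric l t1 n" and ?t2 = "sup_metric l t2 n"
 let ?D1 = "sup_wt D1 l F1 n" and ?D2 = "sup_wt D2 l F2 n"
 let ?A1 = "\<Sum>s1\<in>seqs n. \<Sum>s2\<in>seqs n. P s1 s2 * (\<Sum>c1\<in>seqs n. \<Sum>c2\<in>seqs n. ?D1 s1 c1 * ?D2 s2 c2 *
 (\<Sum>y1\<in>seqs n. \<Sum>y2\<in>seqs n. Vn c1 c2 y1 y2 * of_bool (?t1 s1 c1 y1 <= g)))"
 let ?A2 = "\<Sum>s1\<in>seqs n. \<Sum>s2\<in>seqs n. P s1 s2 * (\<Sum>c1\<in>seqs n. \<Sum>c2\<in>seqs n. ?D1 s1 c1 * ?D2 s2 c2 *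
 (\<Sum>y1\<in>seqs n. \<Sum>y2\<in>seqs n. Vn c1 c2 y1 y2 * of_bool (?t2 s2 c2 y2 <= g)))"
 have nn: "n div l * l + n mod l = n" by simp
 have "\<exists>f1 f2 d1 d2. f1 \<in> seqs n \<rightarrow> seqs n & f2 \<in> seqs n \<rightarrow> seqs n & (\<forall>y. d1 y \<in> seqs n) & (\<forall>y. d2 y \<in> seqs n) \<and>
 (\<Sum>s1\<in>seqs n. \<Sum>s2\<in>seqs n. P s1 s2 * (\<Sum>y1\<in>seqs n. \<Sum>y2\<in>seqs n. Vn (f1 s1) (f2 s2) y1 y2 * (if d1 y1 ~= s1 \<or> d2 y2 ~= s2 then 1 else 0)))
 <= ?A1 + ?A2 + 2 / g"
 proof (rule random_codebook)
 show "(\<Sum>s\<in>seqs n. \<Sum>s2\<in>seqs n. P s s2) <= 1" unfolding P_def using WS by (subst sum_seqs_pair_iid) auto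
 show "(\<Sum>y\<in>seqs n. \<Sum>y2\<in>seqs n. Vn c c2 y y2) = 1" for c c2 unfolding Vn_def
 using V by (intro sum_seqs_pair_iid) (simp add: stoch_def)
 show "0 <= P s s2" for s s2 unfolding P_def by (intro prod_nonneg ballI pmf_on_nonneg[OF WS])
 show "0 <= Vn c c2 y y2" for c c2 y y2 unfolding Vn_def by (intro prod_nonneg ballI stoch_nonneg[OF V])
 show "0 <= ?t1 s c y" if "s \<in> seqs n" "c \<in> seqs n" "y \<in> seqs n" for s c y
 unfolding sup_metric_def using that by (auto intro!: mult_nonneg_nonneg prod_nonneg less_imp_le[OF t1(1)] blk_div_in_seqs)
 show "0 <= ?t2 s c y" if "s \<in> seqs n" "c \<in> seqs n" "y \<in> seqs n" for s c y
 unfolding sup_metric_def using that by (auto intro!: mult_nonneg_nonneg prod_nonneg less_imp_le[OF t2(1)] blk_div_in_seqs)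
 show "(\<Sum>s\<in>seqs n. \<Sum>c\<in>seqs n. ?D1 s c * ?t1 s c y) <= 1" if "y \<in> seqs n" for y
 by (rule sup_metric_normalised[OF l D(1) t1 that])
 show "(\<Sum>s\<in>seqs n. \<Sum>c\<in>seqs n. ?D2 s c * ?t2 s c y) <= 1" if "y \<in> seqs n" for y
 by (rule sup_metric_normalised[OF l D(2) t2 that])
 qed (auto simp: g_def sup_wt_nonneg D sum_sup_wt)
 then obtain f1 f2 d1 d2 where f: "f1 \<in> seqs n \<rightarrow> seqs n" "f2 \<in> seqs n \<rightarrow> seqs n" "\<forall>y. d1 y \<in> seqs n" "\<forall>y. d2 y \<in> seqs n"
 "(\<Sum>s1\<in>seqs n. \<Sum>s2\<in>seqs n. P s1 s2 * (\<Sum>y1\<in>seqs n. \<Sum>y2\<in>seqs n. Vn (f1 s1) (f2 s2) y1 y2 * (if d1 y1 ~= s1 \<or> d2 y2 ~= s2 then 1 else 0)))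
 <= ?A1 + ?A2 + 2 / g" by blast
 have A1: "?A1 <= (K1 ^ l) powr h1 * \<theta>1 ^ (n div l)"
 unfolding P_def Vn_def g_def \<theta>1_def
 by (rule sup_tail_bound[OF WS D V l _ h1(1) K(1), where \<tau>="?T1"]) (auto simp: t1 E_def sup_metric_def K1_def)
 have A2: "?A2 <= (K2 ^ l) powr h2 * \<theta>2 ^ (n div l)"
 unfolding P_def Vn_def g_def \<theta>2_def
 by (rule sup_tail_bound[OF WS D V l _ h2(1) K(2), where \<tau>="?T2"]) (auto simp: t2 E_def sup_metric_def K2_def)
 have "exp (- \<eta>) ^ (n div l) = exp (- (\<eta> * real (n div l)))"
 by (simp add: exp_of_nat_mult[symmetric] mult.commute)
 then have "2 / g = 2 * exp (- \<eta>) ^ (n div l)"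
 by (simp add: g_def exp_minus divide_inverse)
 then have bnd: "?A1 + ?A2 + 2 / g <= b (n div l)" using A1 A2 by (simp add: b_def)
 define x1 where "x1 s = map X1 (f1 s)" for s
 define x2 where "x2 s = map X2 (f2 s)" for s
 have "err_prob WS W n x1 x2 d1 d2 = (\<Sum>s1\<in>seqs n. \<Sum>s2\<in>seqs n. P s1 s2 * (\<Sum>y1\<in>seqs n. \<Sum>y2\<in>seqs n. Vn (f1 s1) (f2 s2) y1 y2 * (if d1 y1 ~= s1 \<or> d2 y2 ~= s2 then 1 else 0)))"
 proof -
 have "(\<Prod>i<n. W (x1 s1 ! i, x2 s2 ! i) (y1 ! i, y2 ! i)) = Vn (f1 s1) (f2 s2) y1 y2"
 if "s1 \<in> seqs n" "s2 \<in> seqs n" for s1 s2 y1 y2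
 proof -
 have "length (f1 s1) = n" "length (f2 s2) = n" using f(1,2) that by (auto simp: seqs_iff Pi_iff)
 then show ?thesis unfolding Vn_def x1_def x2_def V_def by (intro prod.cong) auto
 qed
 then show ?thesis unfolding err_prob_def P_def by (intro sum.cong refl arg_cong2[where f="(*)"]) auto
 qed
 then have "err_prob WS W n x1 x2 d1 d2 <= b (n div l)" using f(5) bnd by linarith
 moreover have "\<forall>s\<in>seqs n. x1 s \<in> seqs n" "\<forall>s\<in>seqs n. x2 s \<in> seqs n" using f(1,2) by (auto simp: x1_def x2_def seqs_iff Pi_iff)
 ultimately show ?thesis using f(3,4) by blast
 qed
 have "b \<longlonglongrightarrow> (K1 ^ l) powr h1 * 0 + (K2 ^ l) powr h2 * 0 + 2 * 0"
 unfolding b_def using \<theta> eta by (intro tendsto_intros LIMSEQ_realpow_zero) auto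
 then have b0: "b \<longlonglongrightarrow> 0" by simp
 show ?thesis unfolding transmissible_def
 proof (intro allI impI)
 fix \<epsilon> :: real assume "0 < \<epsilon>"
 then obtain M where M: "!!m. M <= m ==> b m < \<epsilon>"
 using order_tendstoD(2)[OF b0] by (auto simp: eventually_sequentially)
 have "b (n div l) <= \<epsilon>" if "M * l <= n" for n
 using M[of "n div l"] that l by (simp add: less_eq_div_iff_mult_less_eq less_imp_le)
 then have "\<exists>e1 e2 d1 d2. (\<forall>s\<in>seqs n. e1 s \<in> seqs n) & (\<forall>s\<in>seqs n. e2 s \<in> seqs n) \<and>
 (\<forall>y\<in>seqs n. d1 y \<in> seqs n) & (\<forall>y\<in>seqs n. d2 y \<in> seqs n) & err_prob WS W n e1 e2 d1 d2 <= \<epsilon>"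
 if "M * l <= n" for n
 using code[of n] that by (blast intro: order_trans)
 then show "\<exists>N. \<forall>n\<ge>N. \<exists>e1 e2 d1 d2. (\<forall>s\<in>seqs n. e1 s \<in> seqs n) & (\<forall>s\<in>seqs n. e2 s \<in> seqs n) \<and>
 (\<forall>y\<in>seqs n. d1 y \<in> seqs n) & (\<forall>y\<in>seqs n. d2 y \<in> seqs n) & err_prob WS W n e1 e2 d1 d2 <= \<epsilon>"
 by blast
 qed
qed



section \<open>One receiver: information density and source kernel\<close>

lemma sum_seqs_prod_sum:
 fixes p x :: "nat => 'a::finite => real"
 assumes "!!i. i < n ==> sum (p i) UNIV = 1"
 shows "(\<Sum>zs\<in>seqs n. (\<Prod>i<n. p i (zs ! i)) * (\<Sum>i<n. x i (zs ! i))) = (\<Sum>i<n. \<Sum>z\<in>UNIV. p i z * x i z)"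
 using assms
proof (induction n arbitrary: p x)
 case (Suc n)
 have IH: "(\<Sum>zs\<in>seqs n. (\<Prod>i<n. p (Suc i) (zs ! i)) * (\<Sum>i<n. x (Suc i) (zs ! i))) = (\<Sum>i<n. \<Sum>z\<in>UNIV. p (Suc i) z * x (Suc i) z)"
 using Suc.prems by (intro Suc.IH) auto
 have one: "(\<Sum>zs\<in>seqs n. \<Prod>i<n. p (Suc i) (zs ! i)) = 1"
 using Suc.prems sum_seqs_prod[where n=n and g="%i. p (Suc i)"] by simp
 have "(\<Sum>zs\<in>seqs (Suc n). (\<Prod>i<Suc n. p i (zs ! i)) * (\<Sum>i<Suc n. x i (zs ! i)))
 = (\<Sum>z\<in>UNIV. \<Sum>zs\<in>seqs n. p 0 z * x 0 z * (\<Prod>i<n. p (Suc i) (zs ! i)) + p 0 z * ((\<Prod>i<n. p (Suc i) (zs ! i)) * (\<Sum>i<n. x (Suc i) (zs ! i))))"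
 by (simp add: sum_seqs_Suc prod.lessThan_Suc_shift sum.lessThan_Suc_shift algebra_simps del: prod.lessThan_Suc sum.lessThan_Suc)
 also have "... = (\<Sum>z\<in>UNIV. p 0 z * x 0 z) + (\<Sum>z\<in>UNIV. p 0 z) * (\<Sum>i<n. \<Sum>z\<in>UNIV. p (Suc i) z * x (Suc i) z)"
 by (simp add: sum.distrib sum_distrib_left[symmetric] sum_distrib_right[symmetric] one IH)
 finally show ?case using Suc.prems[of 0] by (simp add: sum.lessThan_Suc_shift del: sum.lessThan_Suc)
qed simp

lemma sum_seqs_zip4:
 fixes h :: "'a::finite list => 'b::finite list => 'c::finite list => 'd::finite list => real"
 shows "(\<Sum>x1\<in>seqs n. \<Sum>x2\<in>seqs n. \<Sum>x3\<in>seqs n. \<Sum>x4\<in>seqs n. h x1 x2 x3 x4)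
 = (\<Sum>zs\<in>seqs n. h (map fst zs) (map (fst \<circ> snd) zs) (map (fst \<circ> snd \<circ> snd) zs) (map (snd \<circ> snd \<circ> snd) zs))"
proof -
 have "(\<Sum>x1\<in>seqs n. \<Sum>x2\<in>seqs n. \<Sum>x3\<in>seqs n. \<Sum>x4\<in>seqs n. h x1 x2 x3 x4)
 = (\<Sum>x1\<in>seqs n. \<Sum>x2\<in>seqs n. \<Sum>z\<in>seqs n. h x1 x2 (map fst z) (map snd z))"
 by (intro sum.cong refl sum_seqs_zip)
 also have "... = (\<Sum>x1\<in>seqs n. \<Sum>z\<in>seqs n. h x1 (map fst z) (map (fst \<circ> snd) z) (map (snd \<circ> snd) z))"
 by (intro sum.cong refl, subst sum_seqs_zip[of "%x z. h _ x (map fst z) (map snd z)"]) simp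
 also have "... = (\<Sum>zs\<in>seqs n. h (map fst zs) (map (fst \<circ> snd) zs) (map (fst \<circ> snd \<circ> snd) zs) (map (snd \<circ> snd \<circ> snd) zs))"
 by (subst sum_seqs_zip[of "%x z. h x (map fst z) (map (fst \<circ> snd) z) (map (snd \<circ> snd) z)"]) (simp add: comp_assoc)
 finally show ?thesis .
qed

text \<open>The setting of one receiver; primed objects belong to the interfering user. The function
 \<open>\<kappa>\<close> selects one of the two nearly common parts \<open>f s\<close>, \<open>f' s'\<close>, and \<open>Cb\<close> is a block code for it.\<close>

locale receiver =
 fixes WS :: "'s::finite \<times> 't::finite => real"
 and pV :: "'v::finite => real" and pX :: "'u::finite \<times> 'v => 'x::finite => real"
 and D' :: "'u => 'd::finite => real"
 and W :: "('v \<times> 'x) \<times> 'd => 'y::finite \<times> 'z::finite => real"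
 and f :: "'s => 'k::finite" and f' :: "'t => 'k" and \<kappa> :: "'s \<times> 't => 'k"
 and l :: nat and Cb :: "'k list => 'u list" and pU :: "'u => real"
 assumes WS: "pmf_on WS" and pV: "pmf_on pV" and pX: "stoch pX" and D': "!!u. pmf_on (D' u)" and W: "stoch W"
 and \<kappa>: "(\<forall>z. \<kappa> z = f (fst z)) \<or> (\<forall>z. \<kappa> z = f' (snd z))"
 and Cb: "!!k u. k \<in> seqs l ==> real (card {i. i < l & Cb k ! i = u}) = real l * pU u"
begin

text \<open>A codeword letter is the pair of the auxiliary and the channel letter. The stochastic
  map \<open>pX\<close> thus becomes part of the random codebook and the encoder stays
  deterministic.\<close>

definition D :: "'u => 'v \<times> 'x => real" where "D u c = pV (fst c) * pX (u, fst c) (snd c)"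
definition q :: "'u => ('v \<times> 'x) \<times> 'd \<times> 'y \<times> 'z => real" where
 "q u = (%(c, d, y, z). D u c * D' u d * W (c, d) (y, z))"
definition PVY :: "'u => 'v => 'y => real" where
 "PVY u v y = (\<Sum>x\<in>UNIV. \<Sum>d\<in>UNIV. \<Sum>z\<in>UNIV. pX (u, v) x * D' u d * W ((v, x), d) (y, z))"
definition PY :: "'u => 'y => real" where "PY u y = (\<Sum>v\<in>UNIV. pV v * PVY u v y)"
text \<open>The exponential of the information density between \<open>v\<close> and \<open>y\<close>
  given \<open>u\<close>; its mean logarithm is the conditional mutual information \<open>I\<close>
  in nats.\<close>

definition \<omega> :: "'u => 'v => 'y => real" where "\<omega> u v y = PVY u v y / PY u y"
definition Iu :: "'u => real" where "Iu u = (\<Sum>v\<in>UNIV. \<Sum>y\<in>UNIV. pV v * PVY u v y * ln (\<omega> u v y))"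
definition I :: real where "I = (\<Sum>u\<in>UNIV. pU u * Iu u)"
definition PSK :: "'s => 'k => real" where "PSK s k = (\<Sum>t\<in>UNIV. WS (s, t) * of_bool (\<kappa> (s, t) = k))"
text \<open>Conditional probability of the source letter given the common letter; it is 0 by the
  convention for division when \<open>k\<close> has probability 0.\<close>

definition a :: "'s => 'k => real" where "a s k = PSK s k / (\<Sum>s\<in>UNIV. PSK s k)"
definition HS :: real where "HS = - (\<Sum>z\<in>UNIV. WS z * ln (a (fst z) (\<kappa> z)))"
definition \<xi> :: real where "\<xi> = 1 - (1 - (\<Sum>z\<in>UNIV. WS z * of_bool (f (fst z) ~= f' (snd z)))) ^ l"

lemma pmf_D: "pmf_on (D u)"
proof -
 have "sum (D u) UNIV = (\<Sum>v\<in>UNIV. \<Sum>x\<in>UNIV. pV v * pX (u, v) x)"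
 by (simp add: D_def sum_UNIV_pair[symmetric])
 also have "... = 1" by (simp add: sum_distrib_left[symmetric] stoch_sum[OF pX] pmf_on_sum[OF pV])
 finally show ?thesis by (simp add: pmf_on_def D_def pmf_on_nonneg[OF pV] stoch_nonneg[OF pX])
qed

lemma pmf_q: "pmf_on (q u)"
proof -
 have "(\<Sum>y\<in>UNIV. \<Sum>z\<in>UNIV. W c (y, z)) = 1" for c
 using stoch_sum[OF W, of c] by (simp add: sum_UNIV_pair)
 then have "sum (q u) UNIV = 1"
 by (simp add: sum_UNIV_pair[symmetric] q_def sum_distrib_left[symmetric] sum_distrib_right[symmetric] pmf_on_sum pmf_D D')
 (use pmf_on_sum[OF pmf_D[of u]] in \<open>simp add: sum_UNIV_pair[symmetric]\<close>)
 moreover have "0 <= q u z" for z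
 by (auto simp: q_def split: prod.splits intro!: mult_nonneg_nonneg pmf_on_nonneg[OF pmf_D] pmf_on_nonneg[OF D'] stoch_nonneg[OF W])
 ultimately show ?thesis by (simp add: pmf_on_def)
qed

lemma PVY_nonneg: "0 <= PVY u v y"
 unfolding PVY_def by (intro sum_nonneg mult_nonneg_nonneg pmf_on_nonneg[OF D'] stoch_nonneg[OF W] stoch_nonneg[OF pX])

lemma PVY_le: "pV v * PVY u v y <= PY u y"
 unfolding PY_def by (rule member_le_sum) (auto simp: PVY_nonneg pmf_on_nonneg[OF pV])

lemma PY_nonneg: "0 <= PY u y"
 unfolding PY_def by (intro sum_nonneg mult_nonneg_nonneg PVY_nonneg pmf_on_nonneg[OF pV])

lemma \<omega>_nonneg: "0 <= \<omega> u v y" by (simp add: \<omega>_def PVY_nonneg PY_nonneg)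

lemma q_PVY: "(\<Sum>x\<in>UNIV. \<Sum>d\<in>UNIV. \<Sum>z\<in>UNIV. q u ((v, x), d, y, z)) = pV v * PVY u v y"
 by (simp add: q_def D_def PVY_def sum_distrib_left mult.assoc)

lemma q_PY: "(\<Sum>c\<in>UNIV. \<Sum>d\<in>UNIV. \<Sum>z\<in>UNIV. q u (c, d, y, z)) = PY u y"
 by (simp add: sum_UNIV_pair[symmetric, where 'a='v] q_PVY PY_def)

text \<open>On the support of the law the logarithm of the density is genuine and not the default
  value \<open>ln 0 = 0\<close>.\<close>

lemma q_pos: assumes "0 < q u (c, d, y, z)" shows "0 < \<omega> u (fst c) y"
proof -
 have w: "0 < D u c" "0 < D' u d" "0 < W (c, d) (y, z)"
 using assms pmf_on_nonneg[OF pmf_D, of u c] pmf_on_nonneg[OF D', of u d] stoch_nonneg[OF W, of "(c, d)" "(y, z)"]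
 by (auto simp: q_def less_le)
 then have p: "0 < pV (fst c)" "0 < pX (u, fst c) (snd c)"
 using pmf_on_nonneg[OF pV, of "fst c"] stoch_nonneg[OF pX, of "(u, fst c)" "snd c"] by (auto simp: D_def less_le)
 have "0 < pX (u, fst c) (snd c) * D' u d * W ((fst c, snd c), d) (y, z)" using w p by simp
 also have "... <= (\<Sum>z\<in>UNIV. pX (u, fst c) (snd c) * D' u d * W ((fst c, snd c), d) (y, z))"
 by (rule member_le_sum) (auto intro!: mult_nonneg_nonneg pmf_on_nonneg[OF D'] stoch_nonneg[OF W] stoch_nonneg[OF pX])
 also have "... <= (\<Sum>d\<in>UNIV. \<Sum>z\<in>UNIV. pX (u, fst c) (snd c) * D' u d * W ((fst c, snd c), d) (y, z))"
 by (rule member_le_sum[where f="%d. \<Sum>z\<in>UNIV. pX (u, fst c) (snd c) * D' u d * W ((fst c, snd c), d) (y, z)"])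
 (auto intro!: sum_nonneg mult_nonneg_nonneg pmf_on_nonneg[OF D'] stoch_nonneg[OF W] stoch_nonneg[OF pX])
 also have "... <= PVY u (fst c) y" unfolding PVY_def
 by (rule member_le_sum[where f="%x. \<Sum>d\<in>UNIV. \<Sum>z\<in>UNIV. pX (u, fst c) x * D' u d * W ((fst c, x), d) (y, z)"])
 (auto intro!: sum_nonneg mult_nonneg_nonneg pmf_on_nonneg[OF D'] stoch_nonneg[OF W] stoch_nonneg[OF pX])
 finally have "0 < PVY u (fst c) y" .
 moreover from this have "0 < pV (fst c) * PVY u (fst c) y" using p by simp
 then have "0 < PY u y" using PVY_le[of "fst c" u y] by linarith
 ultimately show ?thesis by (simp add: \<omega>_def)
qed

lemma q_Iu: "(\<Sum>e\<in>UNIV. q u e * ln (\<omega> u (fst (fst e)) (fst (snd (snd e))))) = Iu u"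
proof -
 have "(\<Sum>e\<in>UNIV. q u e * ln (\<omega> u (fst (fst e)) (fst (snd (snd e)))))
 = (\<Sum>v\<in>UNIV. \<Sum>x\<in>UNIV. \<Sum>d\<in>UNIV. \<Sum>y\<in>UNIV. \<Sum>z\<in>UNIV. q u ((v, x), d, y, z) * ln (\<omega> u v y))"
 by (simp add: sum_UNIV_pair[symmetric])
 also have "... = (\<Sum>v\<in>UNIV. \<Sum>y\<in>UNIV. (\<Sum>x\<in>UNIV. \<Sum>d\<in>UNIV. \<Sum>z\<in>UNIV. q u ((v, x), d, y, z)) * ln (\<omega> u v y))"
 proof (intro sum.cong refl)
 fix v
 have "(\<Sum>x\<in>UNIV. \<Sum>d\<in>UNIV. \<Sum>y\<in>UNIV. \<Sum>z\<in>UNIV. q u ((v, x), d, y, z) * ln (\<omega> u v y))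
 = (\<Sum>x\<in>UNIV. \<Sum>y\<in>UNIV. \<Sum>d\<in>UNIV. \<Sum>z\<in>UNIV. q u ((v, x), d, y, z) * ln (\<omega> u v y))"
 by (intro sum.cong refl sum.swap)
 also have "... = (\<Sum>y\<in>UNIV. \<Sum>x\<in>UNIV. \<Sum>d\<in>UNIV. \<Sum>z\<in>UNIV. q u ((v, x), d, y, z) * ln (\<omega> u v y))"
 by (rule sum.swap)
 finally show "(\<Sum>x\<in>UNIV. \<Sum>d\<in>UNIV. \<Sum>y\<in>UNIV. \<Sum>z\<in>UNIV. q u ((v, x), d, y, z) * ln (\<omega> u v y))
 = (\<Sum>y\<in>UNIV. (\<Sum>x\<in>UNIV. \<Sum>d\<in>UNIV. \<Sum>z\<in>UNIV. q u ((v, x), d, y, z)) * ln (\<omega> u v y))"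
 by (simp add: sum_distrib_right)
 qed
 finally show ?thesis by (simp add: q_PVY Iu_def)
qed

text \<open>Counting letters in a codeword turns the sum over positions into \<open>l\<close> times the \<open>pU\<close>-average.\<close>

definition inner :: "'u list => (('v \<times> 'x) list => 'y list => real) => real" where
 "inner us X = (\<Sum>c\<in>seqs l. \<Sum>d\<in>seqs l. \<Sum>y\<in>seqs l. \<Sum>z\<in>seqs l. (\<Prod>i<l. q (us ! i) (c ! i, d ! i, y ! i, z ! i)) * X c y)"

end



context receiver
begin

definition A :: "'s list => 'k list => real" where "A s k = (\<Prod>i<l. a (s ! i) (k ! i))"
definition tq :: "real => ('k list => 'y list => real) => 's list => 'y list => real" where
 "tq \<mu> Q s y = (1 - \<mu>) * (\<Sum>k\<in>seqs l. A s k * Q k y) + \<mu> / real CARD('s) ^ l"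
definition tr :: "real => 'u list => ('v \<times> 'x) list => 'y list => real" where
 "tr \<mu> us c y = (1 - \<mu>) * (\<Prod>i<l. \<omega> (us ! i) (fst (c ! i)) (y ! i)) + \<mu>"
definition F :: "'s list => 'u list" where "F s = Cb (map f s)"
definition F' :: "'t list => 'u list" where "F' t = Cb (map f' t)"
definition tm :: "real => ('k list => 'y list => real) => 's list => ('v \<times> 'x) list => 'y list => real" where
 "tm \<mu> Q s c y = tq \<mu> Q s y * tr \<mu> (F s) c y"
definition \<kappa>s :: "'s list => 't list => 'k list" where "\<kappa>s s t = map \<kappa> (zip s t)"
lemma PSK_nonneg: "0 <= PSK s k" unfolding PSK_def by (intro sum_nonneg) (simp add: pmf_on_nonneg[OF WS])

lemma a_nonneg: "0 <= a s k" unfolding a_def by (intro divide_nonneg_nonneg sum_nonneg PSK_nonneg)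

lemma a_le_1: "a s k <= 1"
proof -
 have "PSK s k <= (\<Sum>s\<in>UNIV. PSK s k)" by (rule member_le_sum) (auto simp: PSK_nonneg)
 then show ?thesis unfolding a_def using PSK_nonneg[of s k] by (auto simp: divide_le_eq_1)
qed

lemma ln_a_le_0: "ln (a s k) <= 0"
 using a_nonneg[of s k] a_le_1[of s k] by (cases "a s k = 0") (auto simp: less_le)

lemma a_pos: assumes "0 < WS (s, t)" shows "0 < a s (\<kappa> (s, t))"
proof -
 have "WS (s, t) * of_bool (\<kappa> (s, t) = \<kappa> (s, t)) <= PSK s (\<kappa> (s, t))" unfolding PSK_def
 by (rule member_le_sum[where f="%t'. WS (s, t') * of_bool (\<kappa> (s, t') = \<kappa> (s, t))"]) (auto simp: pmf_on_nonneg[OF WS])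
 then have p: "0 < PSK s (\<kappa> (s, t))" using assms by simp
 have "PSK s (\<kappa> (s, t)) <= (\<Sum>x\<in>UNIV. PSK x (\<kappa> (s, t)))" by (rule member_le_sum) (auto simp: PSK_nonneg)
 with p have "0 < (\<Sum>x\<in>UNIV. PSK x (\<kappa> (s, t)))" by (rule less_le_trans)
 with p show ?thesis unfolding a_def by (rule divide_pos_pos)
qed

lemma sum_a_le_1: "(\<Sum>s\<in>UNIV. a s k) <= 1"
 unfolding a_def sum_divide_distrib[symmetric] by simp

definition outer :: "'s list => 't list => (('v \<times> 'x) list => 'y list => real) => real" where
 "outer s t X = (\<Sum>c\<in>seqs l. \<Sum>d\<in>seqs l. \<Sum>y\<in>seqs l. \<Sum>z\<in>seqs l.
 seq_wt D (F s) c * seq_wt D' (F' t) d * (\<Prod>i<l. W (c ! i, d ! i) (y ! i, z ! i)) * X c y)"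

end



section \<open>Type classes and their sizes\<close>

lemma prod_by_counts:
 fixes h :: "'a::finite => real"
 shows "(\<Prod>i<length xs. h (xs ! i)) = (\<Prod>x\<in>UNIV. h x ^ count (mset xs) x)"
proof (induction xs)
 case (Cons x xs)
 have "(\<Prod>z\<in>UNIV. h z ^ count (mset (x # xs)) z) = (\<Prod>z\<in>UNIV. (if z = x then h x else 1) * h z ^ count (mset xs) z)"
 by (intro prod.cong) auto
 also have "... = h x * (\<Prod>z\<in>UNIV. h z ^ count (mset xs) z)" by (simp add: prod.distrib prod.delta)
 finally show ?case using Cons.IH by (simp add: prod.lessThan_Suc_shift del: prod.lessThan_Suc)
qed simp

lemma count_mset_card: "count (mset xs) x = card {i. i < length xs & xs ! i = x}"
proof -
 have "count (mset xs) x = length (filter (%y. y = x) xs)"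
 by (induction xs) auto
 then show ?thesis by (simp only: length_filter_conv_card)
qed

lemma count_zip_swap: "length xs = length ys ==> count (mset (zip ys xs)) (y, x) = count (mset (zip xs ys)) (x, y)"
 by (induction xs ys rule: list_induct2) auto

lemma count_zip_fst: "length xs = length ys ==> (\<Sum>y\<in>UNIV. count (mset (zip xs ys)) (x, y)) = count (mset xs) (x::'a::finite)"
 for ys :: "'b::finite list"
proof (induction xs ys rule: list_induct2)
 case (Cons a xs b ys)
 have "(\<Sum>y\<in>UNIV. count (mset (zip (a # xs) (b # ys))) (x, y)) = (\<Sum>y\<in>UNIV. (if y = b then (if a = x then 1 else 0) else 0) + count (mset (zip xs ys)) (x, y))"
 by (intro sum.cong) auto
 then show ?case using Cons by (simp add: sum.distrib)
qed simp

text \<open>Change of measure: on words with given joint counts the likelihood ratio between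
  \<open>P\<close> and \<open>V\<close> is one constant \<open>C\<close>, and the total mass under
  \<open>V\<close> is at most 1.\<close>

lemma shell_sum_le:
 fixes P V :: "'a::finite => 'b::finite => real" and N :: "'a \<times> 'b => nat"
 assumes xs: "xs \<in> seqs l" and V: "!!x y. 0 <= V x y" "!!x. (\<Sum>y\<in>UNIV. V x y) <= 1"
 and pos: "!!x y. 0 < N (x, y) ==> 0 < V x y" and P: "!!x y. 0 <= P x y"
 shows "(\<Sum>ys\<in>{ys\<in>seqs l. count (mset (zip xs ys)) = N}. \<Prod>i<l. P (xs ! i) (ys ! i)) <= (\<Prod>z\<in>UNIV. (P (fst z) (snd z) / V (fst z) (snd z)) ^ N z)"
proof -
 have lx: "length xs = l" using xs by (simp add: seqs_iff)
 define C where "C = (\<Prod>z\<in>UNIV. (P (fst z) (snd z) / V (fst z) (snd z)) ^ N z)"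
 have C0: "0 <= C" unfolding C_def by (intro prod_nonneg) (simp add: P V)
 have eq: "(\<Prod>i<l. P (xs ! i) (ys ! i)) = C * (\<Prod>i<l. V (xs ! i) (ys ! i))"
 if "ys \<in> {ys\<in>seqs l. count (mset (zip xs ys)) = N}" for ys
 proof -
 have ly: "length ys = l" and c: "count (mset (zip xs ys)) = N" using that by (auto simp: seqs_iff)
 have g: "(\<Prod>i<l. h (xs ! i) (ys ! i)) = (\<Prod>z\<in>UNIV. h (fst z) (snd z) ^ N z)" for h :: "'a => 'b => real"
 using prod_by_counts[of "%z. h (fst z) (snd z)" "zip xs ys"] lx ly c by simp
 have "C * (\<Prod>z\<in>UNIV. V (fst z) (snd z) ^ N z) = (\<Prod>z\<in>UNIV. P (fst z) (snd z) ^ N z)"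
 unfolding C_def prod.distrib[symmetric]
 proof (intro prod.cong refl)
 fix z show "(P (fst z) (snd z) / V (fst z) (snd z)) ^ N z * V (fst z) (snd z) ^ N z = P (fst z) (snd z) ^ N z"
 using pos[of "fst z" "snd z"] by (cases "N z = 0") (auto simp: power_mult_distrib[symmetric])
 qed
 then show ?thesis by (simp add: g)
 qed
 have "(\<Sum>ys\<in>{ys\<in>seqs l. count (mset (zip xs ys)) = N}. \<Prod>i<l. P (xs ! i) (ys ! i))
 = C * (\<Sum>ys\<in>{ys\<in>seqs l. count (mset (zip xs ys)) = N}. \<Prod>i<l. V (xs ! i) (ys ! i))"
 by (simp add: eq sum_distrib_left)
 also have "... <= C * (\<Sum>ys\<in>seqs l. \<Prod>i<l. V (xs ! i) (ys ! i))"
 by (intro mult_left_mono sum_mono2 C0) (auto intro: prod_nonneg V)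
 also have "(\<Sum>ys\<in>seqs l. \<Prod>i<l. V (xs ! i) (ys ! i)) = (\<Prod>i<l. \<Sum>y\<in>UNIV. V (xs ! i) y)"
 by (rule sum_seqs_prod)
 also have "C * ... <= C * 1"
 by (intro mult_left_mono prod_le_1 C0) (auto intro: sum_nonneg V)
 finally show ?thesis by (simp add: C_def)
qed

text \<open>The comparison of multinomial probabilities behind the lower bound on the size of a type class.\<close>

lemma fact_power_le: "fact n * n ^ k <= fact k * (n::nat) ^ n"
proof (cases "n <= k")
 case True
 have "fact n * n ^ (k - n) <= (fact k :: nat)" using True
 proof (induction k rule: dec_induct)
 case (step j)
 have "fact n * n ^ (Suc j - n) = fact n * n ^ (j - n) * n" using step.hyps by (simp add: Suc_diff_le)
 also have "... <= fact j * Suc j" using step by (intro mult_le_mono) auto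
 finally show ?case by (simp add: mult.commute)
 qed simp
 then have "fact n * n ^ (k - n) * n ^ n <= fact k * n ^ n" by (rule mult_le_mono1)
 then show ?thesis using True by (simp add: mult.assoc power_add[symmetric])
next
 case False
 have "fact n <= fact k * n ^ (n - k)" if "k <= n" for n using that
 proof (induction n rule: dec_induct)
 case (step j)
 have "fact (Suc j) = Suc j * fact j" by simp
 also have "... <= Suc j * (fact k * Suc j ^ (j - k))"
 using step by (intro mult_le_mono2) (meson le_trans mult_le_mono2 power_mono le_SucI order_refl zero_le)
 also have "... = fact k * Suc j ^ (Suc j - k)" using step.hyps by (simp add: Suc_diff_le mult_ac)
 finally show ?case .
 qed simp
 from this[of n] False have "fact n * n ^ k <= fact k * n ^ (n - k) * n ^ k" by (intro mult_le_mono1) simp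
 then show ?thesis using False by (simp add: mult.assoc power_add[symmetric])
qed

definition tclass :: "nat => ('a::finite => nat) => 'a list set" where
 "tclass l n = {xs\<in>seqs l. count (mset xs) = n}"

lemma finite_tclass [simp]: "finite (tclass l n)" by (simp add: tclass_def)

lemma card_tclass:
 assumes "(\<Sum>x\<in>UNIV. n x) = l"
 shows "(\<Prod>x\<in>UNIV. fact (n x)) * card (tclass l n) = (fact l :: nat)"
proof -
 define M where "M = Abs_multiset n"
 have cM: "count M = n" unfolding M_def by (rule Abs_multiset_inverse) simp
 have "sum n (set_mset M) = sum n UNIV"
 by (rule sum.mono_neutral_left) (auto simp: cM[symmetric] not_in_iff)
 then have size: "size M = l" using assms by (simp add: size_multiset_overloaded_eq cM)
 have "tclass l n = permutations_of_multiset M"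
 unfolding tclass_def permutations_of_multiset_def seqs_iff mem_Collect_eq
 by (metis cM count_inject size size_mset)
 moreover have "(\<Prod>x\<in>set_mset M. fact (count M x) :: nat) = (\<Prod>x\<in>UNIV. fact (n x))"
 by (intro prod.mono_neutral_cong_left) (auto simp: cM not_in_iff)
 ultimately show ?thesis using card_permutations_of_multiset_aux[of M] size by (simp add: mult.commute)
qed

text \<open>Among all type classes the law \<open>n / l\<close> gives the largest probability to its
  own class. After writing class sizes as multinomials this is \<open>fact_power_le\<close> letter
  by letter.\<close>

lemma tclass_prob_max:
 fixes n k :: "'a::finite => nat"
 assumes n: "(\<Sum>x\<in>UNIV. n x) = l" and k: "(\<Sum>x\<in>UNIV. k x) = l" and l: "0 < l"
 shows "real (card (tclass l k)) * (\<Prod>x\<in>UNIV. (real (n x) / real l) ^ k x)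
 <= real (card (tclass l n)) * (\<Prod>x\<in>UNIV. (real (n x) / real l) ^ n x)"
proof -
 let ?F = "%k. \<Prod>x\<in>UNIV. fact (k x) :: real"
 have c: "real (card (tclass l k)) = fact l / ?F k" if "(\<Sum>x\<in>UNIV. k x) = l" for k :: "'a => nat"
 proof -
 have "?F k * real (card (tclass l k)) = fact l"
 using arg_cong[OF card_tclass[OF that], of real] by simp
 moreover have "?F k ~= 0" by simp
 ultimately show ?thesis by (simp add: field_simps)
 qed
 have "?F n * (\<Prod>x\<in>UNIV. real (n x) ^ k x) <= ?F k * (\<Prod>x\<in>UNIV. real (n x) ^ n x)"
 unfolding prod.distrib[symmetric]
 proof (intro prod_mono conjI)
 fix x
 show "fact (n x) * real (n x) ^ k x <= fact (k x) * real (n x) ^ n x"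
 using of_nat_mono[OF fact_power_le[of "n x" "k x"], where 'a=real] by simp
 qed auto
 moreover have "0 < ?F n" "0 < ?F k" by (auto intro: prod_pos)
 ultimately have "(\<Prod>x\<in>UNIV. real (n x) ^ k x) / ?F k <= (\<Prod>x\<in>UNIV. real (n x) ^ n x) / ?F n"
 by (simp add: divide_le_eq pos_le_divide_eq mult.commute)
 then have "fact l * ((\<Prod>x\<in>UNIV. real (n x) ^ k x) / ?F k) / real l ^ l <= fact l * ((\<Prod>x\<in>UNIV. real (n x) ^ n x) / ?F n) / real l ^ l"
 by (intro divide_right_mono mult_left_mono) auto
 moreover have "(\<Prod>x\<in>UNIV. (real (n x) / real l) ^ k x) = (\<Prod>x\<in>UNIV. real (n x) ^ k x) / real l ^ l"
 using k by (simp add: power_divide prod_dividef power_sum[symmetric])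
 moreover have "(\<Prod>x\<in>UNIV. (real (n x) / real l) ^ n x) = (\<Prod>x\<in>UNIV. real (n x) ^ n x) / real l ^ l"
 using n by (simp add: power_divide prod_dividef power_sum[symmetric])
 ultimately show ?thesis by (simp add: c[OF n] c[OF k])
qed

lemma card_count_functions: "card {f :: 'a::finite => nat. \<forall>x. f x <= l} = (l + 1) ^ CARD('a)"
 and finite_count_functions: "finite {f :: 'a::finite => nat. \<forall>x. f x <= l}"
proof -
 have "{f :: 'a => nat. \<forall>x. f x <= l} = PiE UNIV (%_. {..l})" by (auto simp: PiE_UNIV_domain)
 then show "card {f :: 'a::finite => nat. \<forall>x. f x <= l} = (l + 1) ^ CARD('a)" "finite {f :: 'a::finite => nat. \<forall>x. f x <= l}"
 by (simp_all add: card_PiE finite_PiE)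
qed

lemma count_mset_le: "count (mset xs) x <= length xs"
 by (metis count_le_size size_mset)

lemma sum_count_mset: "(\<Sum>x\<in>UNIV. count (mset xs) x) = length (xs :: 'a::finite list)"
proof (induction xs)
 case (Cons a xs)
 have "(\<Sum>x\<in>UNIV. count (mset (a # xs)) x) = (\<Sum>x\<in>UNIV. (if x = a then 1 else 0) + count (mset xs) x)"
 by (intro sum.cong) auto
 then show ?case using Cons.IH by (simp add: sum.distrib)
qed simp

text \<open>There are at most \<open>(l + 1) ^ CARD('a)\<close> types, and the class of
  \<open>n\<close> is the most probable one, so its probability is at least the reciprocal of that
  number.\<close>

lemma tclass_lower:
 fixes n :: "'a::finite => nat"
 assumes n: "(\<Sum>x\<in>UNIV. n x) = l" and l: "0 < l"
 shows "1 <= real (l + 1) ^ CARD('a) * (real (card (tclass l n)) * (\<Prod>x\<in>UNIV. (real (n x) / real l) ^ n x))"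
proof -
 define p where "p x = real (n x) / real l" for x
 define K where "K = {f :: 'a => nat. \<forall>x. f x <= l}"
 have "(\<Sum>x\<in>UNIV. p x) = 1" using n l by (simp add: p_def sum_divide_distrib[symmetric] of_nat_sum[symmetric] del: of_nat_sum)
 then have "1 = (\<Sum>xs\<in>seqs l. \<Prod>i<l. p (xs ! i))" using sum_seqs_prod[where n=l and g="%_. p"] by simp
 also have "... = (\<Sum>k\<in>K. \<Sum>xs\<in>{xs\<in>seqs l. count (mset xs) = k}. \<Prod>i<l. p (xs ! i))"
 by (rule sum.group[symmetric]) (auto simp: K_def finite_count_functions seqs_iff intro: count_mset_le)
 also have "... <= (\<Sum>k\<in>K. real (card (tclass l n)) * (\<Prod>x\<in>UNIV. p x ^ n x))"
 proof (rule sum_mono)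
 fix k assume "k \<in> K"
 have "(\<Sum>xs\<in>{xs\<in>seqs l. count (mset xs) = k}. \<Prod>i<l. p (xs ! i)) = (\<Sum>xs\<in>tclass l k. \<Prod>x\<in>UNIV. p x ^ k x)"
 unfolding tclass_def by (intro sum.cong refl) (use prod_by_counts[of p] in \<open>auto simp: seqs_iff\<close>)
 also have "... = real (card (tclass l k)) * (\<Prod>x\<in>UNIV. p x ^ k x)" by simp
 also have "... <= real (card (tclass l n)) * (\<Prod>x\<in>UNIV. p x ^ n x)"
 proof (cases "(\<Sum>x\<in>UNIV. k x) = l")
 case True then show ?thesis unfolding p_def by (intro tclass_prob_max n l)
 next
 case False
 then have "tclass l k = {}" using sum_count_mset by (auto simp: tclass_def seqs_iff)
 then show ?thesis by (auto intro!: mult_nonneg_nonneg prod_nonneg simp: p_def)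
 qed
 finally show "(\<Sum>xs\<in>{xs\<in>seqs l. count (mset xs) = k}. \<Prod>i<l. p (xs ! i)) <= real (card (tclass l n)) * (\<Prod>x\<in>UNIV. p x ^ n x)" .
 qed
 also have "... = real (l + 1) ^ CARD('a) * (real (card (tclass l n)) * (\<Prod>x\<in>UNIV. p x ^ n x))"
 by (simp add: K_def card_count_functions)
 finally show ?thesis by (simp add: p_def)
qed

lemma tclass_pos: "(\<Sum>x\<in>UNIV. n x) = l ==> 0 < card (tclass l n)"
 using card_tclass[of n l] by (metis fact_nonzero mult_0_right neq0_conv)

section \<open>Empirical channels, shells and the error exponent\<close>

text \<open>Empirical joint law, empirical channel and empirical mutual information of a pair of sequences
 with joint counts \<open>N\<close> whose first sequence has counts \<open>n\<close>.\<close>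

definition emp_joint :: "nat => ('u \<times> 'y => nat) => 'u \<times> 'y => real" where
 "emp_joint l N z = real (N z) / real l"

text \<open>A letter that does not occur gets the uniform row, so that every row is a pmf.\<close>

definition emp_chan :: "('u => nat) => ('u \<times> 'y::finite => nat) => 'u => 'y => real" where
 "emp_chan n N u y = (if n u = 0 then 1 / real CARD('y) else real (N (u, y)) / real (n u))"

lemma stoch_emp_chan:
 assumes "!!u. (\<Sum>y\<in>UNIV. N (u, y)) = n u" shows "stoch (emp_chan n N)"
proof -
 have "(\<Sum>y\<in>UNIV. emp_chan n N u y) = 1" for u
 proof (cases "n u = 0")
 case False
 have "(\<Sum>y\<in>UNIV. real (N (u, y))) = real (n u)" using assms[of u] by (simp flip: of_nat_sum)
 then show ?thesis using False by (simp add: emp_chan_def sum_divide_distrib[symmetric])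
 qed (simp add: emp_chan_def)
 then show ?thesis by (simp add: stoch_def pmf_on_def) (simp add: emp_chan_def)
qed

lemma emp_joint_eq:
 assumes "!!u. (\<Sum>y\<in>UNIV. N (u, y)) = n u"
 shows "real (n u) / real l * emp_chan n N u y = emp_joint l N (u, y)"
proof -
 have "N (u, y) = 0" if "n u = 0" using assms[of u] that by simp
 then show ?thesis by (simp add: emp_chan_def emp_joint_def)
qed

lemma prod_power_eq_powr:
 assumes b: "1 < b" and "finite A" and pos: "!!z. z \<in> A ==> N z = 0 \<or> 0 < x z"
 shows "(\<Prod>z\<in>A. x z ^ N z) = b powr (\<Sum>z\<in>A. real (N z) * log b (x z))"
proof -
 have "b powr (\<Sum>z\<in>A. real (N z) * log b (x z)) = (\<Prod>z\<in>A. b powr (real (N z) * log b (x z)))"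
 using b \<open>finite A\<close> by (simp add: powr_sum)
 also have "... = (\<Prod>z\<in>A. x z ^ N z)"
 proof (rule prod.cong[OF refl])
 fix z assume "z \<in> A"
 from pos[OF \<open>z \<in> A\<close>] show "b powr (real (N z) * log b (x z)) = x z ^ N z"
 proof (elim disjE)
 assume "0 < x z"
 then have "b powr (real (N z) * log b (x z)) = (b powr log b (x z)) powr real (N z)" by (simp add: powr_powr mult.commute)
 then show ?thesis using b \<open>0 < x z\<close> by (simp add: powr_realpow)
 qed (use b in simp)
 qed
 finally show ?thesis by simp
qed



lemma push_fst_pair: "push (p :: 'a::finite \<times> 'b::finite => real) fst x = (\<Sum>y\<in>UNIV. p (x, y))"
proof -
 have "{z :: 'a \<times> 'b. fst z = x} = Pair x ` UNIV" by auto
 then show ?thesis by (simp add: push_def sum.reindex inj_on_def)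
qed

lemma push_snd_pair: "push (p :: 'a::finite \<times> 'b::finite => real) snd y = (\<Sum>x\<in>UNIV. p (x, y))"
proof -
 have "{z :: 'a \<times> 'b. snd z = y} = (%x. (x, y)) ` UNIV" by auto
 then show ?thesis by (simp add: push_def sum.reindex inj_on_def)
qed

definition joint_counts :: "nat => ('u::finite => nat) => ('u \<times> 'y::finite => nat) set" where
 "joint_counts l n = {N. (\<forall>z. N z <= l) & (\<forall>u. (\<Sum>y\<in>UNIV. N (u, y)) = n u)}"

lemma finite_joint_counts [simp]: "finite (joint_counts l n)"
 by (rule finite_subset[OF _ finite_count_functions[of l]]) (auto simp: joint_counts_def)

lemma card_joint_counts:
 "card (joint_counts l n :: ('u::finite \<times> 'y::finite => nat) set) <= (l + 1) ^ (CARD('u) * CARD('y))"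
proof -
 have "card (joint_counts l n :: ('u \<times> 'y => nat) set) <= card {f :: 'u \<times> 'y => nat. \<forall>x. f x <= l}"
 by (intro card_mono finite_count_functions) (auto simp: joint_counts_def)
 then show ?thesis by (simp only: card_count_functions card_prod UNIV_Times_UNIV[symmetric] card_cartesian_product)
qed

lemma joint_counts_zip:
 assumes "us \<in> tclass l n" "ys \<in> seqs l"
 shows "count (mset (zip us ys)) \<in> joint_counts l n"
proof -
 have len: "length us = l" "length ys = l" "count (mset us) = n" using assms by (auto simp: tclass_def seqs_iff)
 then show ?thesis using count_zip_fst[of us ys] count_mset_le[of "zip us ys"]
 by (auto simp: joint_counts_def)
qed

text \<open>The constant likelihood ratio of a shell against its empirical channel is a power of the
  base with the divergence in the exponent.\<close>

lemma cond_div_emp: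
 assumes b: "1 < b" and l: "0 < l" and N: "N \<in> joint_counts l n"
 and P: "!!u y. 0 < N (u, y) ==> 0 < P u y"
 shows "(\<Prod>z\<in>UNIV. (P (fst z) (snd z) / emp_chan n N (fst z) (snd z)) ^ N z)
 = b powr (- real l * cond_div b (emp_chan n N) P (%u. real (n u) / real l))"
proof -
 have m: "!!u. (\<Sum>y\<in>UNIV. N (u, y)) = n u" using N by (simp add: joint_counts_def)
 have V: "0 < emp_chan n N u y" if "0 < N (u, y)" for u y
 proof -
 have "N (u, y) <= n u" unfolding m[symmetric] by (rule member_le_sum) auto
 then show ?thesis using that by (simp add: emp_chan_def)
 qed
 have "(\<Prod>z\<in>UNIV. (P (fst z) (snd z) / emp_chan n N (fst z) (snd z)) ^ N z)
 = b powr (\<Sum>z\<in>UNIV. real (N z) * log b (P (fst z) (snd z) / emp_chan n N (fst z) (snd z)))"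
 proof (intro prod_power_eq_powr b)
 fix z show "N z = 0 \<or> 0 < P (fst z) (snd z) / emp_chan n N (fst z) (snd z)"
 using V[of "fst z" "snd z"] P[of "fst z" "snd z"] by (cases "N z = 0") auto
 qed simp
 also have "(\<Sum>z\<in>UNIV. real (N z) * log b (P (fst z) (snd z) / emp_chan n N (fst z) (snd z)))
 = (\<Sum>u\<in>UNIV. \<Sum>y\<in>UNIV. real (N (u, y)) * log b (P u y / emp_chan n N u y))"
 by (simp add: sum_UNIV_pair[symmetric])
 also have "... = (\<Sum>u\<in>UNIV. \<Sum>y\<in>UNIV. - real (n u) * plogq b (emp_chan n N u y) (emp_chan n N u y / P u y))"
 proof (intro sum.cong refl)
 fix u y
 show "real (N (u, y)) * log b (P u y / emp_chan n N u y) = - real (n u) * plogq b (emp_chan n N u y) (emp_chan n N u y / P u y)"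
 proof (cases "N (u, y) = 0")
 case True
 then show ?thesis by (simp add: plogq_def emp_chan_def)
 next
 case False
 then have p: "0 < emp_chan n N u y" "0 < P u y" using V P by auto
 have "N (u, y) <= n u" unfolding m[symmetric] by (rule member_le_sum) auto
 then have "real (n u) * emp_chan n N u y = real (N (u, y))" using False by (simp add: emp_chan_def)
 moreover have "log b (P u y / emp_chan n N u y) = - log b (emp_chan n N u y / P u y)"
 using p b by (simp add: log_divide)
 ultimately show ?thesis using p by (simp add: plogq_def)
 qed
 qed
 also have "... = - real l * cond_div b (emp_chan n N) P (%u. real (n u) / real l)"
 using l by (simp add: cond_div_def sum_distrib_left mult.assoc sum_negf)
 finally show ?thesis .
qed

lemma shell_prob:
 assumes b: "1 < b" and l: "0 < l" and us: "us \<in> tclass l n" and N: "N \<in> joint_counts l n"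
 and P: "!!u y. 0 <= P u y" "!!u y. 0 < N (u, y) ==> 0 < P u y"
 shows "(\<Sum>ys\<in>{ys\<in>seqs l. count (mset (zip us ys)) = N}. \<Prod>i<l. P (us ! i) (ys ! i))
 <= b powr (- real l * cond_div b (emp_chan n N) P (%u. real (n u) / real l))"
proof -
 have m: "!!u. (\<Sum>y\<in>UNIV. N (u, y)) = n u" using N by (simp add: joint_counts_def)
 have "stoch (emp_chan n N)" by (rule stoch_emp_chan[OF m])
 moreover have "0 < emp_chan n N u y" if "0 < N (u, y)" for u y
 proof -
 have "N (u, y) <= n u" unfolding m[symmetric] by (rule member_le_sum) auto
 then show ?thesis using that by (simp add: emp_chan_def)
 qed
 ultimately have "(\<Sum>ys\<in>{ys\<in>seqs l. count (mset (zip us ys)) = N}. \<Prod>i<l. P (us ! i) (ys ! i))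
 <= (\<Prod>z\<in>UNIV. (P (fst z) (snd z) / emp_chan n N (fst z) (snd z)) ^ N z)"
 using us by (intro shell_sum_le) (auto simp: tclass_def stoch_nonneg stoch_sum P)
 also have "... = b powr (- real l * cond_div b (emp_chan n N) P (%u. real (n u) / real l))"
 by (rule cond_div_emp[OF b l N P(2)])
 finally show ?thesis .
qed

definition emp_mi :: "real => nat => ('u::finite \<times> 'y::finite => nat) => real" where
 "emp_mi b l N = mutual_info b (emp_joint l N)"

lemma emp_mi_prod:
 fixes N :: "'u::finite \<times> 'y::finite => nat"
 assumes b: "1 < b" and l: "0 < l" and N: "N \<in> joint_counts l n"
 defines "nY \<equiv> %y. \<Sum>u\<in>UNIV. N (u, y)"
 shows "(\<Prod>z\<in>UNIV. (real (n (fst z)) / real l / (real (N z) / real (nY (snd z)))) ^ N z) = b powr (- real l * emp_mi b l N)"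
proof -
 have m: "!!u. (\<Sum>y\<in>UNIV. N (u, y)) = n u" using N by (simp add: joint_counts_def)
 have le: "N (u, y) <= n u" "N (u, y) <= nY y" for u y
 unfolding m[symmetric] nY_def by (rule member_le_sum; simp)+
 have pos: "0 < n u" "0 < nY y" if "0 < N (u, y)" for u y using le[of u y] that by auto
 have "(\<Prod>z\<in>UNIV. (real (n (fst z)) / real l / (real (N z) / real (nY (snd z)))) ^ N z)
 = b powr (\<Sum>z\<in>UNIV. real (N z) * log b (real (n (fst z)) / real l / (real (N z) / real (nY (snd z)))))"
 proof (intro prod_power_eq_powr b)
 fix z :: "'u \<times> 'y"
 show "N z = 0 \<or> 0 < real (n (fst z)) / real l / (real (N z) / real (nY (snd z)))"
 using pos[of "fst z" "snd z"] l by (cases "N z = 0") auto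
 qed simp
 also have "(\<Sum>z\<in>UNIV. real (N z) * log b (real (n (fst z)) / real l / (real (N z) / real (nY (snd z)))))
 = (\<Sum>z\<in>UNIV. - real l * plogq b (emp_joint l N z) (emp_joint l N z / (push (emp_joint l N) fst (fst z) * push (emp_joint l N) snd (snd z))))"
 proof (rule sum.cong[OF refl])
 fix z :: "'u \<times> 'y"
 obtain u y where z: "z = (u, y)" by (cases z)
 have p: "push (emp_joint l N) fst u = real (n u) / real l"
 unfolding push_fst_pair emp_joint_def m[symmetric] by (simp add: sum_divide_distrib)
 have q: "push (emp_joint l N) snd y = real (nY y) / real l"
 unfolding push_snd_pair emp_joint_def nY_def by (simp add: sum_divide_distrib)
 show "real (N z) * log b (real (n (fst z)) / real l / (real (N z) / real (nY (snd z))))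
 = - real l * plogq b (emp_joint l N z) (emp_joint l N z / (push (emp_joint l N) fst (fst z) * push (emp_joint l N) snd (snd z)))"
 proof (cases "N z = 0")
 case True
 then show ?thesis by (simp add: plogq_def emp_joint_def)
 next
 case False
 then have w: "0 < real (N z)" "0 < real (n u)" "0 < real (nY y)" "0 < real l" using pos[of u y] l by (auto simp: z)
 have "log b (real (n u) / real l / (real (N z) / real (nY y))) = - log b (real (N z) / real l / (real (n u) / real l * (real (nY y) / real l)))"
 using w b by (simp add: log_divide log_mult)
 then show ?thesis using w by (simp add: z p q plogq_def) (simp add: emp_joint_def)
 qed
 qed
 also have "... = - real l * emp_mi b l N"
 by (simp add: emp_mi_def mutual_info_def sum_distrib_left sum_negf)
 finally show ?thesis .
qed

text \<open>The roles are exchanged: now \<open>ys\<close> is fixed and \<open>us\<close> is random.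
  \<open>shell_sum_le\<close> is applied with the backward empirical channel against the memoryless
  law of \<open>n\<close>, which gives every word of the class the same weight
  \<open>\<omega>\<close>; \<open>tclass_lower\<close> turns \<open>\<omega>\<close> into the
  reciprocal of the class size up to a polynomial.\<close>

lemma tclass_shell_card:
 fixes N :: "'u::finite \<times> 'y::finite => nat"
 assumes b: "1 < b" and l: "0 < l" and n: "(\<Sum>u\<in>UNIV. n u) = l" and N: "N \<in> joint_counts l n" and ys: "ys \<in> seqs l"
 shows "real (card {us\<in>tclass l n. count (mset (zip us ys)) = N})
 <= real (card (tclass l n)) * (real (l + 1) ^ CARD('u) * b powr (- real l * emp_mi b l N))"
proof -
 define nY where "nY y = (\<Sum>u\<in>UNIV. N (u, y))" for y
 define \<omega> where "\<omega> = (\<Prod>u\<in>UNIV. (real (n u) / real l) ^ n u)"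
 let ?S = "{us\<in>tclass l n. count (mset (zip us ys)) = N}"
 let ?N = "%z. N (snd z, fst z)"
 have \<omega>0: "0 <= \<omega>" unfolding \<omega>_def by (intro prod_nonneg) auto
 have low: "1 <= real (l + 1) ^ CARD('u) * (real (card (tclass l n)) * \<omega>)"
 unfolding \<omega>_def by (rule tclass_lower[OF n l])
 have len: "length us = l" "length ys = l" if "us \<in> seqs l" for us using that ys by (auto simp: seqs_iff)
 have sub: "?S \<subseteq> {us\<in>seqs l. count (mset (zip ys us)) = ?N}"
 using len count_zip_swap by (fastforce simp: tclass_def)
 have fin: "finite {us\<in>seqs l. count (mset (zip ys us)) = ?N}" by simp
 have "real (card ?S) * \<omega> = (\<Sum>us\<in>?S. \<Prod>i<l. real (n (us ! i)) / real l)"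
 proof -
 have "(\<Prod>i<l. real (n (us ! i)) / real l) = \<omega>" if "us \<in> ?S" for us
 using that prod_by_counts[of "%u. real (n u) / real l" us] by (auto simp: tclass_def seqs_iff \<omega>_def)
 then show ?thesis by simp
 qed
 also have "... <= (\<Sum>us\<in>{us\<in>seqs l. count (mset (zip ys us)) = ?N}. \<Prod>i<l. real (n (us ! i)) / real l)"
 by (rule sum_mono2[OF fin sub]) (auto intro: prod_nonneg)
 also have "... <= (\<Prod>z\<in>UNIV. (real (n (snd z)) / real l / (real (N (snd z, fst z)) / real (nY (fst z)))) ^ N (snd z, fst z))"
 proof (rule shell_sum_le[where P="%y u. real (n u) / real l" and V="%y u. real (N (u, y)) / real (nY y)" and N="?N", OF ys, unfolded fst_conv snd_conv])
 show "(\<Sum>u\<in>UNIV. real (N (u, y)) / real (nY y)) <= 1" for y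
 by (simp add: sum_divide_distrib[symmetric] nY_def flip: of_nat_sum)
 show "0 < real (N (u, y)) / real (nY y)" if "0 < N (u, y)" for u y
 proof -
 have "N (u, y) <= nY y" unfolding nY_def by (rule member_le_sum) auto
 then show ?thesis using that by simp
 qed
 qed auto
 also have "... = (\<Prod>z\<in>UNIV. (real (n (fst z)) / real l / (real (N z) / real (nY (snd z)))) ^ N z)"
 by (rule prod.reindex_bij_witness[where i=prod.swap and j=prod.swap]) auto
 also have "... = b powr (- real l * emp_mi b l N)" unfolding nY_def by (rule emp_mi_prod[OF b l N])
 finally have "real (card ?S) * \<omega> <= b powr (- real l * emp_mi b l N)" .
 then have "real (card ?S) * \<omega> * (real (l + 1) ^ CARD('u) * real (card (tclass l n)))
 <= b powr (- real l * emp_mi b l N) * (real (l + 1) ^ CARD('u) * real (card (tclass l n)))"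
 by (intro mult_right_mono) auto
 moreover have "real (card ?S) * 1 <= real (card ?S) * (real (l + 1) ^ CARD('u) * (real (card (tclass l n)) * \<omega>))"
 using low by (intro mult_left_mono) auto
 ultimately show ?thesis by (simp add: mult_ac)
qed

lemma plogq_div_ge:
 assumes b: "1 < b" and "0 <= v" "0 <= w" "0 < v ==> 0 < w"
 shows "(v - w) / ln b <= plogq b v (v / w)"
proof (cases "v = 0")
 case True
 then show ?thesis using assms by (simp add: plogq_def divide_nonpos_pos)
next
 case False
 then have p: "0 < v" "0 < w" using assms by auto
 have "ln (w / v) <= w / v - 1" using p by (intro ln_le_minus_one) simp
 then have "v * (1 - w / v) <= v * ln (v / w)" using p by (intro mult_left_mono) (auto simp: ln_divide_pos)
 then have "(v - w) / ln b <= v * ln (v / w) / ln b"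
 using p b by (intro divide_right_mono) (auto simp: algebra_simps)
 then show ?thesis using p by (simp add: plogq_def log_def)
qed

lemma cond_div_nonneg:
 assumes b: "1 < b" and V: "stoch V" and W: "!!u y. 0 <= W u y" "!!u. (\<Sum>y\<in>UNIV. W u y) <= 1" and p: "!!u. 0 <= p u"
 and ac: "!!u y. 0 < p u ==> 0 < V u y ==> 0 < W u y"
 shows "0 <= cond_div b V W p"
 unfolding cond_div_def
proof (intro sum_nonneg)
 fix u
 show "0 <= p u * (\<Sum>y\<in>UNIV. plogq b (V u y) (V u y / W u y))"
 proof (cases "p u = 0")
 case False
 have "0 <= (\<Sum>y\<in>UNIV. V u y - W u y) / ln b"
 using b W(2)[of u] by (simp add: sum_subtractf stoch_sum[OF V])
 also have "... <= (\<Sum>y\<in>UNIV. plogq b (V u y) (V u y / W u y))" unfolding sum_divide_distrib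
 using False p[of u] by (intro sum_mono plogq_div_ge b W ac stoch_nonneg[OF V]) auto
 finally show ?thesis using p by simp
 qed simp
qed

text \<open>An infimum of reals is a lower bound only for sets bounded below; non-negativity of the
  divergence provides the bound.\<close>

lemma Er_le:
 assumes b: "1 < b" and V: "stoch V" and W: "!!u y. 0 <= W u y" "!!u. (\<Sum>y\<in>UNIV. W u y) <= 1" and p: "!!u. 0 <= p u"
 and ac: "!!u y. 0 < p u ==> 0 < V u y ==> 0 < W u y"
 shows "Er b R p W <= cond_div b V W p + max 0 (mutual_info b (%(u,y). p u * V u y) - R)"
 unfolding Er_def
proof (rule cInf_lower)
 show "cond_div b V W p + max 0 (mutual_info b (%(u,y). p u * V u y) - R)
 \<in> {cond_div b V W p + max 0 (mutual_info b (%(u,y). p u * V u y) - R) | V.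
 stoch V & (\<forall>u y. 0 < p u & 0 < V u y --> 0 < W u y)}" using V ac by blast
 have "0 <= x" if "x \<in> {cond_div b V W p + max 0 (mutual_info b (%(u,y). p u * V u y) - R) | V.
 stoch V & (\<forall>u y. 0 < p u & 0 < V u y --> 0 < W u y)}" for x
 using that cond_div_nonneg[OF b _ W p] by force
 then show "bdd_below {cond_div b V W p + max 0 (mutual_info b (%(u,y). p u * V u y) - R) | V.
 stoch V & (\<forall>u y. 0 < p u & 0 < V u y --> 0 < W u y)}" by (rule bdd_belowI)
qed



section \<open>Maximum mutual information decoding of constant-composition codes\<close>

definition mi_seq :: "real => nat => 'u::finite list => 'y::finite list => real" where
 "mi_seq b l us ys = emp_mi b l (count (mset (zip us ys)))"

text \<open>The probability that a competitor drawn uniformly from the class looks at least as good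
  to the decoder as \<open>us\<close>.\<close>

definition mi_frac :: "real => nat => ('u::finite => nat) => 'u list => 'y::finite list => real" where
 "mi_frac b l n us ys = real (card {us'\<in>tclass l n. mi_seq b l us ys <= mi_seq b l us' ys}) / real (card (tclass l n))"

text \<open>Union over the polynomially many joint types whose empirical mutual information is at
  least that of \<open>us\<close> and \<open>ys\<close>.\<close>

lemma mi_frac_le:
 fixes us :: "'u::finite list" and ys :: "'y::finite list"
 assumes b: "1 < b" and l: "0 < l" and n: "(\<Sum>u\<in>UNIV. n u) = l" and ys: "ys \<in> seqs l"
 shows "mi_frac b l n us ys <= real (l + 1) ^ (CARD('u) + CARD('u) * CARD('y)) * b powr (- real l * mi_seq b l us ys)"
proof -
 let ?T = "tclass l n" and ?B = "b powr (- real l * mi_seq b l us ys)"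
 let ?J = "{N\<in>joint_counts l n :: ('u \<times> 'y => nat) set. mi_seq b l us ys <= emp_mi b l N}"
 have T: "0 < real (card ?T)" using tclass_pos[OF n] by simp
 have "{us'\<in>?T. mi_seq b l us ys <= mi_seq b l us' ys} \<subseteq> (\<Union>N\<in>?J. {us'\<in>?T. count (mset (zip us' ys)) = N})"
 using joint_counts_zip[OF _ ys] by (auto simp: mi_seq_def)
 then have "card {us'\<in>?T. mi_seq b l us ys <= mi_seq b l us' ys} <= (\<Sum>N\<in>?J. card {us'\<in>?T. count (mset (zip us' ys)) = N})"
 by (intro order_trans[OF card_mono card_UN_le]) auto
 then have "real (card {us'\<in>?T. mi_seq b l us ys <= mi_seq b l us' ys}) <= (\<Sum>N\<in>?J. real (card {us'\<in>?T. count (mset (zip us' ys)) = N}))"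
 by (simp flip: of_nat_sum)
 also have "... <= (\<Sum>N\<in>?J. real (card ?T) * (real (l + 1) ^ CARD('u) * ?B))"
 proof (rule sum_mono)
 fix N assume N: "N \<in> ?J"
 have "b powr (- real l * emp_mi b l N) <= ?B" using N b by (auto intro!: mult_left_mono powr_mono)
 then have "real (card ?T) * (real (l + 1) ^ CARD('u) * b powr (- real l * emp_mi b l N)) <= real (card ?T) * (real (l + 1) ^ CARD('u) * ?B)"
 by (intro mult_left_mono) auto
 then show "real (card {us'\<in>?T. count (mset (zip us' ys)) = N}) <= real (card ?T) * (real (l + 1) ^ CARD('u) * ?B)"
 using tclass_shell_card[OF b l n _ ys, of N] N by (auto intro: order_trans)
 qed
 also have "... = real (card ?J) * (real (card ?T) * (real (l + 1) ^ CARD('u) * ?B))" by simp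
 also have "... <= real (l + 1) ^ (CARD('u) * CARD('y)) * (real (card ?T) * (real (l + 1) ^ CARD('u) * ?B))"
 proof (intro mult_right_mono)
 have "card ?J <= card (joint_counts l n :: ('u \<times> 'y => nat) set)" by (intro card_mono) auto
 also have "... <= (l + 1) ^ (CARD('u) * CARD('y))" by (rule card_joint_counts)
 finally show "real (card ?J) <= real (l + 1) ^ (CARD('u) * CARD('y))" by (simp only: of_nat_le_iff flip: of_nat_power)
 qed auto
 finally have "mi_frac b l n us ys <= real (l + 1) ^ (CARD('u) * CARD('y)) * (real (card ?T) * (real (l + 1) ^ CARD('u) * ?B)) / real (card ?T)"
 unfolding mi_frac_def using T by (intro divide_right_mono) auto
 then show ?thesis using T by (simp add: power_add mult_ac card_gt_0_iff)
qed

definition seq_prob :: "('u => 'y => real) => 'u list => 'y list => real" where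
 "seq_prob P us ys = (\<Prod>i<length ys. P (us ! i) (ys ! i))"

text \<open>Each joint type \<open>N\<close> contributes its shell probability, with exponent the
  divergence, times the union bound clipped at 1, with exponent the positive part of mutual
  information minus rate. Their sum is an admissible value in the minimum that defines
  \<open>Er\<close>, and there are polynomially many types.\<close>

lemma mmi_bound:
 fixes P :: "'u::finite => 'y::finite => real"
 assumes b: "1 < b" and l: "0 < l" and n: "(\<Sum>u\<in>UNIV. n u) = l" and P: "stoch P" and us: "us \<in> tclass l n"
 and M: "real M * real (l + 1) ^ (CARD('u) + CARD('u) * CARD('y)) <= b powr (real l * R)"
 shows "(\<Sum>ys\<in>seqs l. seq_prob P us ys * min 1 (real M * mi_frac b l n us ys))
 <= real (l + 1) ^ (CARD('u) * CARD('y)) * b powr (- real l * Er b R (%u. real (n u) / real l) P)"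
proof -
 let ?p = "%u. real (n u) / real l" and ?J = "joint_counts l n :: ('u \<times> 'y => nat) set"
 define E where "E = Er b R ?p P"
 have P0: "0 <= seq_prob P us ys" for ys unfolding seq_prob_def by (intro prod_nonneg) (simp add: stoch_nonneg[OF P])
 have min_le: "min 1 (real M * mi_frac b l n us ys) <= b powr (- real l * max 0 (mi_seq b l us ys - R))" if ys: "ys \<in> seqs l" for ys :: "'y list"
 proof -
 have "real M * mi_frac b l n us ys <= real M * (real (l + 1) ^ (CARD('u) + CARD('u) * CARD('y)) * b powr (- real l * mi_seq b l us ys))"
 by (rule mult_left_mono[OF mi_frac_le[OF b l n ys]]) simp
 also have "... <= b powr (real l * R) * b powr (- real l * mi_seq b l us ys)"
 unfolding mult.assoc[symmetric] by (intro mult_right_mono M) simp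
 also have "... = b powr (- real l * (mi_seq b l us ys - R))" by (simp add: powr_add[symmetric] algebra_simps)
 finally show ?thesis by (auto simp: max_def min_def)
 qed
 have "(\<Sum>ys\<in>seqs l. seq_prob P us ys * min 1 (real M * mi_frac b l n us ys))
 <= (\<Sum>ys\<in>seqs l. seq_prob P us ys * b powr (- real l * max 0 (mi_seq b l us ys - R)))"
 by (intro sum_mono mult_left_mono min_le P0)
 also have "... = (\<Sum>N\<in>?J. \<Sum>ys\<in>{ys\<in>seqs l. count (mset (zip us ys)) = N}. seq_prob P us ys * b powr (- real l * max 0 (mi_seq b l us ys - R)))"
 by (rule sum.group[symmetric]) (auto intro: joint_counts_zip[OF us])
 also have "... <= (\<Sum>N\<in>?J. b powr (- real l * E))"
 proof (rule sum_mono)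
 fix N assume N: "N \<in> ?J"
 then have m: "!!u. (\<Sum>y\<in>UNIV. N (u, y)) = n u" by (simp add: joint_counts_def)
 have "(\<Sum>ys\<in>{ys\<in>seqs l. count (mset (zip us ys)) = N}. seq_prob P us ys * b powr (- real l * max 0 (mi_seq b l us ys - R)))
 = (\<Sum>ys\<in>{ys\<in>seqs l. count (mset (zip us ys)) = N}. \<Prod>i<l. P (us ! i) (ys ! i)) * b powr (- real l * max 0 (emp_mi b l N - R))"
 unfolding sum_distrib_right by (intro sum.cong refl) (auto simp: mi_seq_def seq_prob_def seqs_iff)
 also have "... <= b powr (- real l * E)"
 proof (cases "\<forall>u y. 0 < N (u, y) --> 0 < P u y")
 case True
 have le: "N (u, y) <= n u" for u y unfolding m[symmetric] by (rule member_le_sum) auto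
 have "Er b R ?p P <= cond_div b (emp_chan n N) P ?p + max 0 (mutual_info b (%(u, y). ?p u * emp_chan n N u y) - R)"
 proof (rule Er_le[OF b stoch_emp_chan[OF m]])
 show "0 < P u y" if "0 < ?p u" "0 < emp_chan n N u y" for u y
 using that True by (auto simp: emp_chan_def zero_less_divide_iff)
 qed (use P in \<open>auto simp: stoch_nonneg stoch_sum\<close>)
 also have "(%(u, y). ?p u * emp_chan n N u y) = emp_joint l N"
 using emp_joint_eq[OF m] by auto
 finally have E: "E <= cond_div b (emp_chan n N) P ?p + max 0 (emp_mi b l N - R)" by (simp add: E_def emp_mi_def)
 have "(\<Sum>ys\<in>{ys\<in>seqs l. count (mset (zip us ys)) = N}. \<Prod>i<l. P (us ! i) (ys ! i)) * b powr (- real l * max 0 (emp_mi b l N - R))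
 <= b powr (- real l * cond_div b (emp_chan n N) P ?p) * b powr (- real l * max 0 (emp_mi b l N - R))"
 using True by (intro mult_right_mono shell_prob[OF b l us N] stoch_nonneg[OF P]) auto
 also have "... = b powr (- real l * (cond_div b (emp_chan n N) P ?p + max 0 (emp_mi b l N - R)))"
 by (simp add: powr_add[symmetric] algebra_simps)
 also have "... <= b powr (- real l * E)" using E b by (intro powr_mono) (auto intro: mult_left_mono)
 finally show ?thesis .
 next
 \<comment> \<open>A joint type that contains a forbidden transition is outside the range of the
   minimum in \<open>Er\<close>, but its shell has probability 0.\<close>
 case False
 then obtain u y where uy: "0 < N (u, y)" "P u y = 0" using stoch_nonneg[OF P] by (meson not_le order_antisym)
 have "(\<Prod>i<l. P (us ! i) (ys ! i)) = 0" if "ys \<in> {ys\<in>seqs l. count (mset (zip us ys)) = N}" for ys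
 proof -
 have len: "length us = l" "length ys = l" using that us by (auto simp: tclass_def seqs_iff)
 have "(u, y) \<in> set (zip us ys)" using uy that by (metis (mono_tags, lifting) count_greater_zero_iff mem_Collect_eq set_mset_mset)
 then obtain i where "i < l" "us ! i = u" "ys ! i = y" using len by (auto simp: set_zip)
 then show ?thesis using uy by (intro prod_zero) auto
 qed
 then have "(\<Sum>ys\<in>{ys\<in>seqs l. count (mset (zip us ys)) = N}. \<Prod>i<l. P (us ! i) (ys ! i)) = 0"
 by (intro sum.neutral ballI)
 then show ?thesis by (simp only: mult_zero_left powr_ge_zero)
 qed
 finally show "(\<Sum>ys\<in>{ys\<in>seqs l. count (mset (zip us ys)) = N}. seq_prob P us ys * b powr (- real l * max 0 (mi_seq b l us ys - R))) <= b powr (- real l * E)" .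
 qed
 also have "... = real (card ?J) * b powr (- real l * E)" by simp
 also have "... <= real (l + 1) ^ (CARD('u) * CARD('y)) * b powr (- real l * E)"
 proof (rule mult_right_mono)
 show "real (card ?J) <= real (l + 1) ^ (CARD('u) * CARD('y))"
 using card_joint_counts[of l n, where 'y='y] by (simp only: of_nat_le_iff flip: of_nat_power)
 qed simp
 finally show ?thesis by (simp add: E_def)
qed

text \<open>The union bound clipped according to \<open>us\<close> and \<open>ys\<close> alone:
  where the expected number of better competitors reaches 1 the penalty is 1, elsewhere the
  competitors are counted. Being a sum over single competitors it needs only pairwise independence,
  and its mean is at most \<open>min 1 (M * mi_frac)\<close>.\<close>

definition mmi_pen :: "real => nat => ('u::finite => nat) => nat => (nat => 'u list) => nat => 'y::finite list => real" where
 "mmi_pen b l n M c m ys = of_bool (1 <= real M * mi_frac b l n (c m) ys)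
 + of_bool (real M * mi_frac b l n (c m) ys < 1) * (\<Sum>m'\<in>{..<M} - {m}. of_bool (mi_seq b l (c m) ys <= mi_seq b l (c m') ys))"

text \<open>Only a strict maximum counts as decoded; ties are already charged as errors by the
  penalty.\<close>

definition mmi_dec :: "real => nat => nat => (nat => 'u::finite list) => 'y::finite list => nat" where
 "mmi_dec b l M c ys = (SOME m. m < M & (\<forall>m'<M. m' ~= m --> mi_seq b l (c m') ys < mi_seq b l (c m) ys))"

lemma mmi_dec_pen:
 assumes "m < M" shows "of_bool (mmi_dec b l M c ys ~= m) <= mmi_pen b l n M c m ys"
proof (cases "real M * mi_frac b l n (c m) ys < 1 & (\<forall>m'<M. m' ~= m --> mi_seq b l (c m') ys < mi_seq b l (c m) ys)")
 case True
 then have "mmi_dec b l M c ys = m" unfolding mmi_dec_def using assms by (intro some_equality) (auto, metis less_asym)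
 moreover have "0 <= mmi_pen b l n M c m ys" unfolding mmi_pen_def by (auto intro!: add_nonneg_nonneg mult_nonneg_nonneg sum_nonneg)
 ultimately show ?thesis by simp
next
 case False
 show ?thesis
 proof (cases "real M * mi_frac b l n (c m) ys < 1")
 case True
 with False obtain m' where m': "m' < M" "m' ~= m" "mi_seq b l (c m) ys <= mi_seq b l (c m') ys" by (auto simp: not_less)
 have "(1::real) = of_bool (mi_seq b l (c m) ys <= mi_seq b l (c m') ys)" using m' by simp
 also have "... <= (\<Sum>m'\<in>{..<M} - {m}. of_bool (mi_seq b l (c m) ys <= mi_seq b l (c m') ys))"
 using m' by (intro member_le_sum[where f="%m'. of_bool (mi_seq b l (c m) ys <= mi_seq b l (c m') ys)"]) auto
 finally show ?thesis using True by (simp add: mmi_pen_def)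
 next
 case False
 then show ?thesis by (simp add: mmi_pen_def)
 qed
qed

lemma mmi_average:
 fixes P :: "'u::finite => 'y::finite => real"
 assumes b: "1 < b" and l: "0 < l" and n: "(\<Sum>u\<in>UNIV. n u) = l" and P: "stoch P" and m: "m < M"
 and M: "real M * real (l + 1) ^ (CARD('u) + CARD('u) * CARD('y)) <= b powr (real l * R)"
 defines "D \<equiv> %(_::nat) (_::'u list). 1 / real (card (tclass l n))"
 shows "(\<Sum>c\<in>PiE {..<M} (%_. tclass l n). fun_wt {..<M} D c * (\<Sum>ys\<in>seqs l. seq_prob P (c m) ys * mmi_pen b l n M c m ys))
 <= real (l + 1) ^ (CARD('u) * CARD('y)) * b powr (- real l * Er b R (%u. real (n u) / real l) P)"
 (is "_ <= ?B")
proof -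
 let ?T = "tclass l n" and ?S = "{..<M}"
 let ?A = "PiE ?S (%_. ?T)"
 have T: "0 < real (card ?T)" using tclass_pos[OF n] by simp
 have D1: "(\<Sum>c\<in>?T. D s c) = 1" for s using T by (simp add: D_def card_gt_0_iff)
 define g :: "'u list => 'y list => real" where "g us ys = of_bool (1 <= real M * mi_frac b l n us ys)" for us and ys :: "'y list"
 define h :: "'u list => 'u list => 'y list => real" where "h us us' ys = of_bool (real M * mi_frac b l n us ys < 1) * of_bool (mi_seq b l us ys <= mi_seq b l us' ys)" for us us' and ys :: "'y list"
 have P0: "0 <= seq_prob P us ys" for us ys unfolding seq_prob_def by (intro prod_nonneg) (simp add: stoch_nonneg[OF P])
 have "(\<Sum>c\<in>?A. fun_wt ?S D c * (\<Sum>ys\<in>seqs l. seq_prob P (c m) ys * mmi_pen b l n M c m ys))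
 = (\<Sum>c\<in>?A. fun_wt ?S D c * (\<Sum>ys\<in>seqs l. seq_prob P (c m) ys * g (c m) ys))
 + (\<Sum>m'\<in>?S - {m}. \<Sum>c\<in>?A. fun_wt ?S D c * (\<Sum>ys\<in>seqs l. seq_prob P (c m) ys * h (c m) (c m') ys))"
 proof -
 have "(\<Sum>ys\<in>seqs l. seq_prob P (c m) ys * mmi_pen b l n M c m ys)
 = (\<Sum>ys\<in>seqs l. seq_prob P (c m) ys * g (c m) ys) + (\<Sum>m'\<in>?S - {m}. \<Sum>ys\<in>seqs l. seq_prob P (c m) ys * h (c m) (c m') ys)" for c
 unfolding mmi_pen_def g_def h_def
 by (simp only: distrib_left sum.distrib sum_distrib_left sum.swap[of _ "?S - {m}" "seqs l"])
 then show ?thesis by (simp only: distrib_left sum.distrib sum_distrib_left sum.swap[of _ "?S - {m}" ?A])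
 qed
 also have "(\<Sum>c\<in>?A. fun_wt ?S D c * (\<Sum>ys\<in>seqs l. seq_prob P (c m) ys * g (c m) ys))
 = (\<Sum>us\<in>?T. D m us * (\<Sum>ys\<in>seqs l. seq_prob P us ys * g us ys))"
 using m by (intro fun_wt_single D1[unfolded D_def] finite_tclass) (auto simp: D1)
 also have "(\<Sum>m'\<in>?S - {m}. \<Sum>c\<in>?A. fun_wt ?S D c * (\<Sum>ys\<in>seqs l. seq_prob P (c m) ys * h (c m) (c m') ys))
 = (\<Sum>m'\<in>?S - {m}. \<Sum>us\<in>?T. \<Sum>us'\<in>?T. D m us * D m' us' * (\<Sum>ys\<in>seqs l. seq_prob P us ys * h us us' ys))"
 using m by (intro sum.cong refl fun_wt_pair[where h="%us us'. \<Sum>ys\<in>seqs l. seq_prob P us ys * h us us' ys"]) (auto simp: D1)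
 also have "... = real (M - 1) * (\<Sum>us\<in>?T. D m us * (\<Sum>ys\<in>seqs l. seq_prob P us ys * (of_bool (real M * mi_frac b l n us ys < 1) * mi_frac b l n us ys)))"
 proof -
 have "(\<Sum>us'\<in>?T. D m us * D m' us' * (\<Sum>ys\<in>seqs l. seq_prob P us ys * h us us' ys))
 = D m us * (\<Sum>ys\<in>seqs l. seq_prob P us ys * (of_bool (real M * mi_frac b l n us ys < 1) * mi_frac b l n us ys))" for us m'
 proof -
 have "(\<Sum>us'\<in>?T. D m' us' * h us us' ys) = of_bool (real M * mi_frac b l n us ys < 1) * mi_frac b l n us ys" for ys
 proof -
 have "(\<Sum>us'\<in>?T. of_bool (mi_seq b l us ys <= mi_seq b l us' ys) :: real) = real (card {us'\<in>?T. mi_seq b l us ys <= mi_seq b l us' ys})"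
 by (simp add: of_bool_def sum.If_cases Int_def)
 then have frac: "mi_frac b l n us ys = (\<Sum>us'\<in>?T. D m' us' * of_bool (mi_seq b l us ys <= mi_seq b l us' ys))"
 by (simp only: mi_frac_def D_def sum_distrib_left[symmetric]) simp
 have "(\<Sum>us'\<in>?T. D m' us' * h us us' ys) = of_bool (real M * mi_frac b l n us ys < 1) * (\<Sum>us'\<in>?T. D m' us' * of_bool (mi_seq b l us ys <= mi_seq b l us' ys))"
 unfolding h_def by (simp only: sum_distrib_left mult_ac)
 then show ?thesis by (simp only: frac[symmetric])
 qed
 then have "(\<Sum>ys\<in>seqs l. seq_prob P us ys * (of_bool (real M * mi_frac b l n us ys < 1) * mi_frac b l n us ys))
 = (\<Sum>ys\<in>seqs l. seq_prob P us ys * (\<Sum>us'\<in>?T. D m' us' * h us us' ys))" by simp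
 also have "... = (\<Sum>us'\<in>?T. D m' us' * (\<Sum>ys\<in>seqs l. seq_prob P us ys * h us us' ys))"
 unfolding sum_distrib_left by (subst sum.swap) (simp only: mult_ac)
 finally show ?thesis by (simp only: sum_distrib_left mult.assoc)
 qed
 then show ?thesis using m by simp
 qed
 also have "(\<Sum>us\<in>?T. D m us * (\<Sum>ys\<in>seqs l. seq_prob P us ys * g us ys)) + ...
 = (\<Sum>us\<in>?T. D m us * (\<Sum>ys\<in>seqs l. seq_prob P us ys * (g us ys + real (M - 1) * (of_bool (real M * mi_frac b l n us ys < 1) * mi_frac b l n us ys))))"
 by (simp only: distrib_left sum.distrib sum_distrib_left mult_ac)
 also have "... <= (\<Sum>us\<in>?T. D m us * ?B)"
 proof (intro sum_mono mult_left_mono)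
 fix us assume us: "us \<in> ?T"
 have "(\<Sum>ys\<in>seqs l. seq_prob P us ys * (g us ys + real (M - 1) * (of_bool (real M * mi_frac b l n us ys < 1) * mi_frac b l n us ys)))
 <= (\<Sum>ys\<in>seqs l. seq_prob P us ys * min 1 (real M * mi_frac b l n us ys))"
 proof (intro sum_mono mult_left_mono P0)
 fix ys :: "'y list"
 have "0 <= mi_frac b l n us ys" by (simp add: mi_frac_def)
 then have "real (M - 1) * mi_frac b l n us ys <= real M * mi_frac b l n us ys" by (intro mult_right_mono) auto
 then show "g us ys + real (M - 1) * (of_bool (real M * mi_frac b l n us ys < 1) * mi_frac b l n us ys) <= min 1 (real M * mi_frac b l n us ys)"
 by (auto simp: g_def)
 qed
 also have "... <= ?B" by (rule mmi_bound[OF b l n P us M])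
 finally show "(\<Sum>ys\<in>seqs l. seq_prob P us ys * (g us ys + real (M - 1) * (of_bool (real M * mi_frac b l n us ys < 1) * mi_frac b l n us ys))) <= ?B" .
 qed (simp add: D_def)
 also have "... = ?B" by (simp only: sum_distrib_right[symmetric] D1 mult_1)
 finally show ?thesis .
qed

text \<open>The message law \<open>\<pi>\<close> is arbitrary: hash values need not be uniform, and
  an error averaged over the law that occurs is enough.\<close>

theorem constant_composition_code:
 fixes P1 :: "'u::finite => 'y::finite => real" and P2 :: "'u => 'z::finite => real"
 assumes b: "1 < b" and l: "0 < l" and n: "(\<Sum>u\<in>UNIV. n u) = l" and P: "stoch P1" "stoch P2"
 and M: "real M * real (l + 1) ^ (CARD('u) + CARD('u) * CARD('y)) <= b powr (real l * R)"
 "real M * real (l + 1) ^ (CARD('u) + CARD('u) * CARD('z)) <= b powr (real l * R)"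
 and \<pi>: "!!m. m < M ==> 0 <= \<pi> m" "(\<Sum>m<M. \<pi> m) <= 1"
 defines "B1 \<equiv> real (l + 1) ^ (CARD('u) * CARD('y)) * b powr (- real l * Er b R (%u. real (n u) / real l) P1)"
 and "B2 \<equiv> real (l + 1) ^ (CARD('u) * CARD('z)) * b powr (- real l * Er b R (%u. real (n u) / real l) P2)"
 shows "\<exists>c d1 d2. (\<forall>m<M. c m \<in> tclass l n) \<and>
 (\<Sum>m<M. \<pi> m * (\<Sum>ys\<in>seqs l. seq_prob P1 (c m) ys * of_bool (d1 ys ~= m))) <= 2 * B1 \<and>
 (\<Sum>m<M. \<pi> m * (\<Sum>ys\<in>seqs l. seq_prob P2 (c m) ys * of_bool (d2 ys ~= m))) <= 2 * B2"
proof -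
 let ?T = "tclass l n" and ?S = "{..<M}"
 let ?A = "PiE ?S (%_. ?T)"
 define D where "D = (%(_::nat) (_::'u list). 1 / real (card (tclass l n)))"
 have T: "0 < real (card ?T)" using tclass_pos[OF n] by simp
 have D1: "(\<Sum>c\<in>?T. D s c) = 1" for s using T by (simp add: D_def card_gt_0_iff)
 have B: "0 < B1" "0 < B2" using b by (simp_all add: B1_def B2_def)
 define e1 where "e1 c = (\<Sum>m<M. \<pi> m * (\<Sum>ys\<in>seqs l. seq_prob P1 (c m) ys * mmi_pen b l n M c m ys))" for c
 define e2 where "e2 c = (\<Sum>m<M. \<pi> m * (\<Sum>ys\<in>seqs l. seq_prob P2 (c m) ys * mmi_pen b l n M c m ys))" for c
 have w0: "0 <= fun_wt ?S D c" for c unfolding fun_wt_def by (intro prod_nonneg) (simp add: D_def)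
 have avg: "(\<Sum>c\<in>?A. fun_wt ?S D c * (\<Sum>m<M. \<pi> m * X m c)) <= B"
 if "!!m. m < M ==> (\<Sum>c\<in>?A. fun_wt ?S D c * X m c) <= B" "0 < B" for X B
 proof -
 have "(\<Sum>c\<in>?A. fun_wt ?S D c * (\<Sum>m<M. \<pi> m * X m c)) = (\<Sum>m<M. \<pi> m * (\<Sum>c\<in>?A. fun_wt ?S D c * X m c))"
 unfolding sum_distrib_left by (subst sum.swap) (simp only: mult_ac)
 also have "... <= (\<Sum>m<M. \<pi> m * B)" by (intro sum_mono mult_left_mono that \<pi>) auto
 also have "... <= 1 * B" unfolding sum_distrib_right[symmetric] using \<pi> that(2) by (intro mult_right_mono) auto
 finally show ?thesis by simp
 qed
 have E1: "(\<Sum>c\<in>?A. fun_wt ?S D c * e1 c) <= B1" unfolding e1_def B1_def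
 by (rule avg, rule mmi_average[OF b l n P(1) _ M(1), folded D_def], assumption) (use b in simp)
 have E2: "(\<Sum>c\<in>?A. fun_wt ?S D c * e2 c) <= B2" unfolding e2_def B2_def
 by (rule avg, rule mmi_average[OF b l n P(2) _ M(2), folded D_def], assumption) (use b in simp)
 \<comment> \<open>Each receiver's error is measured in units of its own bound; a codebook whose two
   ratios sum to at most 2 has both errors within twice their bounds.\<close>
 have "(\<Sum>c\<in>?A. fun_wt ?S D c * (e1 c / B1 + e2 c / B2)) = (\<Sum>c\<in>?A. fun_wt ?S D c * e1 c) / B1 + (\<Sum>c\<in>?A. fun_wt ?S D c * e2 c) / B2"
 by (simp add: distrib_left sum.distrib sum_divide_distrib)
 also have "... <= 1 + 1" using E1 E2 B by (intro add_mono) (auto simp: divide_le_eq_1)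
 finally have "\<exists>c\<in>?A. e1 c / B1 + e2 c / B2 <= 2"
 by (intro ex_le_weighted_average[where w="fun_wt ?S D"]) (auto simp: w0 fun_wt_total[OF _ _ D1] intro!: finite_PiE)
 then obtain c where c: "c \<in> ?A" "e1 c / B1 + e2 c / B2 <= 2" by blast
 have pen0': "0 <= mmi_pen b l n M c m (ys :: 'y list)" "0 <= mmi_pen b l n M c m (ys' :: 'z list)" for m ys ys'
 unfolding mmi_pen_def by (auto intro!: add_nonneg_nonneg mult_nonneg_nonneg sum_nonneg)
 have sp: "0 <= seq_prob P1 us ys" "0 <= seq_prob P2 us zs" for us ys zs
 unfolding seq_prob_def by (auto intro!: prod_nonneg simp: stoch_nonneg P)
 have e0: "0 <= e1 c" "0 <= e2 c" unfolding e1_def e2_def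
 by (auto intro!: sum_nonneg mult_nonneg_nonneg \<pi> sp pen0')
 then have q: "0 <= e1 c / B1" "0 <= e2 c / B2" using B by auto
 have le: "e1 c <= 2 * B1" "e2 c <= 2 * B2"
 proof -
 have "e1 c / B1 <= 2" "e2 c / B2 <= 2" using c(2) q by linarith+
 then show "e1 c <= 2 * B1" "e2 c <= 2 * B2" using B by (auto simp: divide_le_eq)
 qed
 have "(\<Sum>m<M. \<pi> m * (\<Sum>ys\<in>seqs l. seq_prob P1 (c m) ys * of_bool (mmi_dec b l M c ys ~= m))) <= e1 c"
 unfolding e1_def by (intro sum_mono mult_left_mono sp \<pi> mmi_dec_pen) auto
 moreover have "(\<Sum>m<M. \<pi> m * (\<Sum>ys\<in>seqs l. seq_prob P2 (c m) ys * of_bool (mmi_dec b l M c ys ~= m))) <= e2 c"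
 unfolding e2_def by (intro sum_mono mult_left_mono sp \<pi> mmi_dec_pen) auto
 moreover have "\<forall>m<M. c m \<in> ?T" using c(1) by auto
 ultimately show ?thesis using le by (meson order_trans)
qed



text \<open>Hoeffding's bound on the moment generating function of a Bernoulli variable: the difference of
 the exponents vanishes to second order at \<open>0\<close> and has second derivative \<open>1/4 - q(1-q) \<ge> 0\<close>.\<close>

lemma pmf_on_le_1: "pmf_on p ==> p x <= 1"
 by (metis UNIV_I finite_class.finite_UNIV member_le_sum pmf_on_nonneg pmf_on_sum)

section \<open>Push-forwards, the block-length condition and single-letter identities\<close>

lemma plogq_eq: "plogq b p q = p * log b q" by (simp add: plogq_def)

lemma push_eq: "push p g y = (\<Sum>x\<in>UNIV. p x * of_bool (g x = y))"
 for p :: "'a::finite => real"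
 by (simp add: push_def of_bool_def sum.If_cases if_distrib[of "%r. _ * r"] cong: if_cong)

lemma sum_push: "(\<Sum>y\<in>UNIV. push p g y * h y) = (\<Sum>x\<in>UNIV. p x * h (g x))"
 for p :: "'a::finite => real" and g :: "'a => 'b::finite"
proof -
 have "(\<Sum>y\<in>UNIV. push p g y * h y) = (\<Sum>y\<in>UNIV. \<Sum>x\<in>{x\<in>UNIV. g x = y}. p x * h (g x))"
 unfolding push_def sum_distrib_right by (intro sum.cong) auto
 also have "... = (\<Sum>x\<in>UNIV. p x * h (g x))" by (rule sum.group) auto
 finally show ?thesis .
qed

lemma push_reindex:
 fixes p :: "'a::finite => real" and j :: "'c::finite => 'a"
 assumes "inj j" "!!x. g x = y \<longleftrightarrow> x \<in> range j"
 shows "push p g y = (\<Sum>c\<in>UNIV. p (j c))"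
proof -
 have "{x. g x = y} = range j" using assms(2) by auto
 then show ?thesis using assms(1) by (simp add: push_def sum.reindex)
qed

lemma pmf_on_push: "pmf_on p ==> pmf_on (push p g)"
 for p :: "'a::finite => real" and g :: "'a => 'b::finite"
 using sum_push[of p g "%_. 1"] by (simp add: pmf_on_def) (auto simp: push_def intro!: sum_nonneg)

lemma sum_seqs_push:
 fixes p :: "'a::finite => real" and g :: "'a => 'b::finite"
 shows "(\<Sum>zs\<in>seqs l. (\<Prod>i<l. p (zs ! i)) * h (map g zs)) = (\<Sum>k\<in>seqs l. (\<Prod>i<l. push p g (k ! i)) * h k)"
proof -
 have "(\<Sum>k\<in>seqs l. (\<Prod>i<l. push p g (k ! i)) * h k)
 = (\<Sum>k\<in>seqs l. (\<Sum>zs\<in>{zs\<in>seqs l. map g zs = k}. (\<Prod>i<l. p (zs ! i)) * h (map g zs)))"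
 proof (intro sum.cong refl)
 fix k :: "'b list" assume k: "k \<in> seqs l"
 have "(\<Prod>i<l. push p g (k ! i)) = (\<Sum>zs\<in>seqs l. \<Prod>i<l. p (zs ! i) * of_bool (g (zs ! i) = k ! i))"
 unfolding push_eq by (rule sum_seqs_prod[where g="%i z. p z * of_bool (g z = k ! i)", symmetric])
 also have "... = (\<Sum>zs\<in>seqs l. if map g zs = k then \<Prod>i<l. p (zs ! i) else 0)"
 proof (intro sum.cong refl)
 fix zs :: "'a list" assume zs: "zs \<in> seqs l"
 show "(\<Prod>i<l. p (zs ! i) * of_bool (g (zs ! i) = k ! i)) = (if map g zs = k then \<Prod>i<l. p (zs ! i) else 0)"
 proof (cases "map g zs = k")
 case True
 then have "g (zs ! i) = k ! i" if "i < l" for i using that zs by (auto simp: seqs_iff)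
 then show ?thesis using True by simp
 next
 case False
 then obtain i where "i < l" "g (zs ! i) ~= k ! i" using k zs by (auto simp: seqs_iff list_eq_iff_nth_eq)
 then have "(\<Prod>i<l. p (zs ! i) * of_bool (g (zs ! i) = k ! i)) = 0" by (intro prod_zero) auto
 then show ?thesis using False by (simp only: if_False)
 qed
 qed
 also have "... = (\<Sum>zs\<in>{zs\<in>seqs l. map g zs = k}. \<Prod>i<l. p (zs ! i))"
 by (simp add: sum.inter_filter)
 finally show "(\<Prod>i<l. push p g (k ! i)) * h k = (\<Sum>zs\<in>{zs\<in>seqs l. map g zs = k}. (\<Prod>i<l. p (zs ! i)) * h (map g zs))"
 by (simp add: sum_distrib_right)
 qed
 also have "... = (\<Sum>zs\<in>seqs l. (\<Prod>i<l. p (zs ! i)) * h (map g zs))"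
 by (rule sum.group) (auto simp: seqs_iff)
 finally show ?thesis by simp
qed

text \<open>Needed because the conditional law obtained by dividing by \<open>pU\<close> is not a
  channel at letters with \<open>pU u = 0\<close>, where \<open>PY\<close> is; \<open>Er\<close>
  depends only on letters of positive probability.\<close>

lemma Er_cong:
 assumes "!!u. 0 <= p u" "!!u y. 0 < p u ==> W u y = W' u y"
 shows "Er b R p W = Er b R p W'"
proof -
 have "cond_div b V W p = cond_div b V W' p" for V
 unfolding cond_div_def
 proof (intro sum.cong refl)
 fix u
 show "p u * (\<Sum>y\<in>UNIV. plogq b (V u y) (V u y / W u y)) = p u * (\<Sum>y\<in>UNIV. plogq b (V u y) (V u y / W' u y))"
 using assms by (cases "p u = 0") (auto simp: less_le)
 qed
 moreover have "(\<forall>u y. 0 < p u & 0 < V u y --> 0 < W u y) = (\<forall>u y. 0 < p u & 0 < V u y --> 0 < W' u y)" for V :: "'a => 'b => real"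
 using assms(2) by auto
 ultimately show ?thesis by (simp add: Er_def)
qed

text \<open>An exponential outgrows a polynomial; hence the \<open>LEAST\<close> in
  \<open>lstar\<close> is attained.\<close>

lemma lstar_ex:
 assumes b: "1 < (b::real)" and \<rho>: "0 < \<rho>"
 shows "\<exists>l::nat. 2 * (real l + 1) ^ k <= b powr (real l * \<rho> / 2)"
proof -
 define c where "c = \<rho> / 2 * ln b"
 have c: "0 < c" using b \<rho> by (simp add: c_def)
 have "eventually (%x. x ^ k / exp x < c ^ k * exp (- c) / 2) at_top"
 using tendsto_power_div_exp_0[of k] c by (intro order_tendstoD) auto
 then obtain N where N: "!!x. N <= x ==> x ^ k / exp x < c ^ k * exp (- c) / 2" by (auto simp: eventually_at_top_linorder)
 obtain l :: nat where "N / c <= real l" using real_arch_simple by blast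
 then have "N <= c * (real l + 1)" using c by (simp add: pos_divide_le_eq mult.commute algebra_simps)
 from N[OF this] have "(c * (real l + 1)) ^ k < c ^ k * exp (- c) / 2 * exp (c * (real l + 1))"
 by (simp add: pos_divide_less_eq)
 then have "c ^ k * (2 * (real l + 1) ^ k) < c ^ k * (exp (- c) * exp (c * (real l + 1)))"
 by (simp add: power_mult_distrib)
 then have "2 * (real l + 1) ^ k < exp (- c) * exp (c * (real l + 1))" using c by simp
 also have "... = exp (c * real l)" by (simp add: exp_add[symmetric] algebra_simps)
 also have "... = b powr (real l * \<rho> / 2)" using b by (simp add: powr_def c_def mult_ac)
 finally show ?thesis by (intro exI[of _ l]) simp
qed

text \<open>The definition gives the inequality at the least length \<open>m\<close> only. With
  \<open>t = m / l\<close>, concavity of the logarithm between 1 and \<open>1 + l\<close> gives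
  \<open>t * ln (1 + l) <= ln (1 + m)\<close>, so the inequality at \<open>m\<close> implies
  \<open>t\<close> times its logarithmic form at \<open>l\<close>.\<close>

lemma lstar_ge:
 assumes b: "1 < b" and \<rho>: "0 < \<rho>" and l: "lstar b A B \<rho> <= l"
 shows "0 < l" "2 * (real l + 1) ^ (2*A + 2*A*B) <= b powr (real l * \<rho> / 2)"
proof -
 define k where "k = 2*A + 2*A*B"
 define m where "m = lstar b A B \<rho>"
 have m: "2 * (real m + 1) ^ k <= b powr (real m * \<rho> / 2)"
 using LeastI_ex[OF lstar_ex[OF b \<rho>, of k]] by (simp add: m_def lstar_def k_def)
 have m0: "0 < m" using m b by (cases "m = 0") auto
 then show l0: "0 < l" using l by (simp add: m_def)
 define t where "t = real m / real l"
 have ml: "m <= l" using l by (simp add: m_def)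
 have t: "0 < t" "t <= 1" "t * real l = real m" using m0 l0 ml by (auto simp: t_def)
 have cv: "convex_on {0<..} (%x. - ln x :: real)" using minus_log_convex[of "exp 1"] by (simp add: log_def)
 have conv: "- ln ((1 - t) *\<^sub>R 1 + t *\<^sub>R (1 + real l)) <= (1 - t) * - ln 1 + t * - ln (1 + real l)"
 using t by (intro convex_onD[OF cv]) auto
 have eq: "(1 - t) *\<^sub>R 1 + t *\<^sub>R (1 + real l) = 1 + real m" using t by (simp add: algebra_simps)
 have c: "t * ln (1 + real l) <= ln (1 + real m)" using conv unfolding eq by simp
 have "ln (2 * (real m + 1) ^ k) <= ln (b powr (real m * \<rho> / 2))" using m b by (intro ln_mono) auto
 then have "ln 2 + real k * ln (1 + real m) <= real m * \<rho> / 2 * ln b"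
 using b by (simp add: ln_mult_pos ln_realpow ln_powr add.commute)
 moreover have "real k * (t * ln (1 + real l)) <= real k * ln (1 + real m)" using c by (intro mult_left_mono) auto
 moreover have "t * ln 2 <= ln (2::real)" using t by (intro mult_left_le_one_le) auto
 ultimately have "t * ln 2 + real k * (t * ln (1 + real l)) <= real m * \<rho> / 2 * ln b" by linarith
 then have "t * (ln 2 + real k * ln (1 + real l)) <= t * (real l * \<rho> / 2 * ln b)"
 unfolding t(3)[symmetric] by (simp add: algebra_simps)
 then have "ln 2 + real k * ln (1 + real l) <= real l * \<rho> / 2 * ln b" using t by simp
 then have "ln (2 * (real l + 1) ^ k) <= ln (b powr (real l * \<rho> / 2))"
 using b by (simp add: ln_mult_pos ln_realpow ln_powr add.commute)
 then have "2 * (real l + 1) ^ k <= b powr (real l * \<rho> / 2)" using b by (subst (asm) ln_le_cancel_iff) auto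
 then show "2 * (real l + 1) ^ (2*A + 2*A*B) <= b powr (real l * \<rho> / 2)" by (simp add: k_def)
qed

context receiver
begin

lemma stoch_PY: "stoch PY"
proof -
 have "(\<Sum>y\<in>UNIV. PY u y) = sum (q u) UNIV" for u
 proof -
 have "(\<Sum>y\<in>UNIV. PY u y) = (\<Sum>y\<in>UNIV. \<Sum>c\<in>UNIV. \<Sum>d\<in>UNIV. \<Sum>z\<in>UNIV. q u (c, d, y, z))" by (simp add: q_PY)
 also have "... = (\<Sum>c\<in>UNIV. \<Sum>y\<in>UNIV. \<Sum>d\<in>UNIV. \<Sum>z\<in>UNIV. q u (c, d, y, z))" by (rule sum.swap)
 also have "... = (\<Sum>c\<in>UNIV. \<Sum>d\<in>UNIV. \<Sum>y\<in>UNIV. \<Sum>z\<in>UNIV. q u (c, d, y, z))" by (intro sum.cong refl sum.swap)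
 also have "... = sum (q u) UNIV" by (simp add: sum_UNIV_pair[symmetric])
 finally show ?thesis .
 qed
 then show ?thesis by (simp add: stoch_def pmf_on_def PY_nonneg pmf_on_sum[OF pmf_q])
qed

lemma sum_PVY: "(\<Sum>y\<in>UNIV. PVY u v y) = 1"
proof -
 have "(\<Sum>y\<in>UNIV. PVY u v y) = (\<Sum>x\<in>UNIV. \<Sum>y\<in>UNIV. \<Sum>d\<in>UNIV. \<Sum>z\<in>UNIV. pX (u, v) x * D' u d * W ((v, x), d) (y, z))"
 unfolding PVY_def by (rule sum.swap)
 also have "... = (\<Sum>x\<in>UNIV. \<Sum>d\<in>UNIV. \<Sum>y\<in>UNIV. \<Sum>z\<in>UNIV. pX (u, v) x * D' u d * W ((v, x), d) (y, z))"
 by (intro sum.cong refl sum.swap)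
 also have "... = (\<Sum>x\<in>UNIV. pX (u, v) x * (\<Sum>d\<in>UNIV. D' u d * (\<Sum>y\<in>UNIV. \<Sum>z\<in>UNIV. W ((v, x), d) (y, z))))"
 by (simp only: sum_distrib_left mult.assoc)
 also have "... = 1" by (simp only: sum_UNIV_pair stoch_sum[OF W] mult_1_right pmf_on_sum[OF D'] stoch_sum[OF pX])
 finally show ?thesis .
qed

text \<open>Apply \<open>ln x <= x - 1\<close> to the density divided by the alphabet size; since
  \<open>pV v\<close> times the density is at most 1, the correction sums to at most 1.\<close>

lemma Iu_le: "Iu u <= ln (real CARD('v))"
proof -
 let ?n = "real CARD('v)"
 have n: "0 < ?n" by simp
 have "pV v * PVY u v y * ln (\<omega> u v y) <= pV v * PVY u v y * (ln ?n - 1) + PVY u v y / ?n" for v y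
 proof (cases "pV v * PVY u v y = 0")
 case True
 show ?thesis unfolding True using PVY_nonneg[of u v y] by simp
 next
 case False
 then have p: "0 < pV v" "0 < PVY u v y" using pmf_on_nonneg[OF pV, of v] PVY_nonneg[of u v y] by (auto simp: less_le)
 then have "0 < pV v * PVY u v y" by simp
 then have py: "0 < PY u y" using PVY_le[of v u y] by linarith
 have w: "0 < \<omega> u v y" using p py by (simp add: \<omega>_def)
 have "ln (\<omega> u v y) - ln ?n = ln (\<omega> u v y / ?n)" using w n by (simp add: ln_divide_pos)
 also have "... <= \<omega> u v y / ?n - 1" using w n by (intro ln_le_minus_one) simp
 finally have "pV v * PVY u v y * ln (\<omega> u v y) <= pV v * PVY u v y * (ln ?n - 1 + \<omega> u v y / ?n)"
 using p by (intro mult_left_mono) auto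
 also have "... = pV v * PVY u v y * (ln ?n - 1) + pV v * PVY u v y / PY u y * PVY u v y / ?n"
 by (simp add: \<omega>_def algebra_simps)
 also have "pV v * PVY u v y / PY u y * PVY u v y / ?n <= 1 * PVY u v y / ?n"
 using PVY_le[of v u y] py p by (intro divide_right_mono mult_right_mono) auto
 finally show ?thesis by simp
 qed
 then have "Iu u <= (\<Sum>v\<in>UNIV. \<Sum>y\<in>UNIV. pV v * PVY u v y * (ln ?n - 1) + PVY u v y / ?n)"
 unfolding Iu_def by (intro sum_mono)
 also have "... = (\<Sum>v\<in>UNIV. pV v * (\<Sum>y\<in>UNIV. PVY u v y) * (ln ?n - 1) + (\<Sum>y\<in>UNIV. PVY u v y) / ?n)"
 by (simp only: sum.distrib sum_distrib_left sum_distrib_right sum_divide_distrib)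
 also have "... = ln ?n" by (simp add: sum_PVY sum.distrib sum_distrib_right[symmetric] pmf_on_sum[OF pV])
 finally show ?thesis .
qed

lemma I_le: assumes "pmf_on pU" shows "I <= ln (real CARD('v))"
proof -
 have "I <= (\<Sum>u\<in>UNIV. pU u * ln (real CARD('v)))" unfolding I_def
 by (intro sum_mono mult_left_mono Iu_le pmf_on_nonneg[OF assms])
 also have "... = ln (real CARD('v))" by (simp add: sum_distrib_right[symmetric] pmf_on_sum[OF assms])
 finally show ?thesis .
qed

lemma PSK_push: "PSK s k = push WS (%z. (fst z, \<kappa> z)) (s, k)"
proof -
 have "push WS (%z. (fst z, \<kappa> z)) (s, k) = (\<Sum>s'\<in>UNIV. \<Sum>t\<in>UNIV. WS (s', t) * of_bool (s' = s & \<kappa> (s', t) = k))"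
 unfolding push_eq by (simp add: sum_UNIV_pair[symmetric])
 also have "... = (\<Sum>s'\<in>UNIV. if s' = s then \<Sum>t\<in>UNIV. WS (s, t) * of_bool (\<kappa> (s, t) = k) else 0)"
 by (intro sum.cong refl) auto
 finally show ?thesis by (simp add: PSK_def)
qed

lemma HS_nonneg: "0 <= HS"
 unfolding HS_def by (simp add: sum_nonpos mult_nonneg_nonpos pmf_on_nonneg[OF WS] ln_a_le_0)

lemma HS_cond_entropy:
 assumes b: "1 < b" shows "HS = ln b * cond_entropy b (push WS (%z. (fst z, \<kappa> z)))"
proof -
 let ?p = "push WS (%z. (fst z, \<kappa> z))"
 have "HS = - (\<Sum>w\<in>UNIV. ?p w * ln (a (fst w) (snd w)))" unfolding HS_def sum_push by simp
 also have "... = - (\<Sum>w\<in>UNIV. ln b * plogq b (?p w) (?p w / push ?p snd (snd w)))"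
 proof -
 have "a (fst w) (snd w) = ?p w / push ?p snd (snd w)" for w
 unfolding a_def push_snd_pair PSK_push by simp
 then show ?thesis using b by (simp add: plogq_eq log_def)
 qed
 finally show ?thesis by (simp add: cond_entropy_def sum_distrib_left)
qed

end



context receiver
begin

lemma I_cond_mutual_info:
 assumes b: "1 < b" and pU: "pmf_on pU" and R: "!!v y u. R (v, y, u) = pU u * pV v * PVY u v y"
 shows "I = ln b * cond_mutual_info b R"
proof -
 have w: "push R (%(x,y,w). w) u = pU u" for u
 proof -
 have "push R (%(x,y,w). w) u = (\<Sum>c\<in>UNIV. R (case c of (v, y) => (v, y, u)))"
 by (rule push_reindex) (auto simp: inj_on_def)
 also have "... = (\<Sum>v\<in>UNIV. \<Sum>y\<in>UNIV. pU u * pV v * PVY u v y)" by (simp add: sum_UNIV_pair[symmetric] R)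
 also have "... = pU u" by (simp add: sum_distrib_left[symmetric] sum_PVY pmf_on_sum[OF pV])
 finally show ?thesis .
 qed
 have xw: "push R (%(x,y,w). (x,w)) (v, u) = pU u * pV v" for v u
 proof -
 have "push R (%(x,y,w). (x,w)) (v, u) = (\<Sum>y\<in>UNIV. R (v, y, u))"
 by (rule push_reindex) (auto simp: inj_on_def)
 then show ?thesis by (simp add: R sum_distrib_left[symmetric] sum_PVY)
 qed
 have yw: "push R (%(x,y,w). (y,w)) (y, u) = pU u * PY u y" for y u
 proof -
 have "push R (%(x,y,w). (y,w)) (y, u) = (\<Sum>v\<in>UNIV. R (v, y, u))"
 by (rule push_reindex) (auto simp: inj_on_def)
 then show ?thesis by (simp add: R PY_def sum_distrib_left mult.assoc)
 qed
 have term_eq: "ln b * plogq b (R (v, y, u)) (R (v, y, u) * pU u / (pU u * pV v * (pU u * PY u y)))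
 = pU u * (pV v * PVY u v y * ln (\<omega> u v y))" for v y u
 proof (cases "R (v, y, u) = 0")
 case True
 then have "pU u = 0 \<or> pV v * PVY u v y = 0" by (auto simp: R)
 then have "pU u * (pV v * PVY u v y * ln (\<omega> u v y)) = 0" by (elim disjE) (simp_all only: mult_zero_left mult_zero_right)
 then show ?thesis by (simp add: plogq_def True)
 next
 case False
 then have nz: "pU u ~= 0" "pV v ~= 0" "PVY u v y ~= 0" by (auto simp: R)
 then have "R (v, y, u) * pU u / (pU u * pV v * (pU u * PY u y)) = \<omega> u v y" by (simp add: R \<omega>_def)
 then show ?thesis using b by (simp add: plogq_eq log_def R mult.assoc)
 qed
 have "ln b * cond_mutual_info b R = (\<Sum>v\<in>UNIV. \<Sum>y\<in>UNIV. \<Sum>u\<in>UNIV. pU u * (pV v * PVY u v y * ln (\<omega> u v y)))"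
 unfolding cond_mutual_info_def sum_distrib_left by (simp only: sum_UNIV_pair[symmetric] prod.case w xw yw term_eq)
 also have "... = (\<Sum>v\<in>UNIV. \<Sum>u\<in>UNIV. \<Sum>y\<in>UNIV. pU u * (pV v * PVY u v y * ln (\<omega> u v y)))"
 by (intro sum.cong refl sum.swap)
 also have "... = (\<Sum>u\<in>UNIV. \<Sum>v\<in>UNIV. \<Sum>y\<in>UNIV. pU u * (pV v * PVY u v y * ln (\<omega> u v y)))" by (rule sum.swap)
 also have "... = I" by (simp only: I_def Iu_def sum_distrib_left)
 finally show ?thesis by simp
qed

end

lemma push_swap: "push (%(x, y). p (y, x)) g z = push p (%(y, x). g (x, y)) z"
 for p :: "'a::finite \<times> 'b::finite => real"
 unfolding push_eq by (rule sum.reindex_bij_witness[where i=prod.swap and j=prod.swap]) auto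

text \<open>Mirrors the network, so that the second user can be treated as a first user.\<close>

lemma sup_law_swap:
 fixes WS :: "'s::finite \<times> 't::finite => real" and W :: "'c::finite \<times> 'd::finite => 'y::finite \<times> 'z::finite => real"
 shows "(\<Sum>s\<in>seqs l. \<Sum>t\<in>seqs l. \<Sum>c\<in>seqs l. \<Sum>d\<in>seqs l. \<Sum>y\<in>seqs l. \<Sum>z\<in>seqs l. sup_law WS D1 D2 W F1 F2 s t c d y z * X t d z)
 = (\<Sum>t\<in>seqs l. \<Sum>s\<in>seqs l. \<Sum>d\<in>seqs l. \<Sum>c\<in>seqs l. \<Sum>z\<in>seqs l. \<Sum>y\<in>seqs l.
 sup_law (%(t, s). WS (s, t)) D2 D1 (%(d, c) (z, y). W (c, d) (y, z)) F2 F1 t s d c z y * X t d z)"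
proof -
 have "(\<Sum>s\<in>seqs l. \<Sum>t\<in>seqs l. \<Sum>c\<in>seqs l. \<Sum>d\<in>seqs l. \<Sum>y\<in>seqs l. \<Sum>z\<in>seqs l. sup_law WS D1 D2 W F1 F2 s t c d y z * X t d z)
 = (\<Sum>t\<in>seqs l. \<Sum>s\<in>seqs l. \<Sum>c\<in>seqs l. \<Sum>d\<in>seqs l. \<Sum>y\<in>seqs l. \<Sum>z\<in>seqs l. sup_law WS D1 D2 W F1 F2 s t c d y z * X t d z)"
 by (rule sum.swap)
 also have "... = (\<Sum>t\<in>seqs l. \<Sum>s\<in>seqs l. \<Sum>d\<in>seqs l. \<Sum>c\<in>seqs l. \<Sum>y\<in>seqs l. \<Sum>z\<in>seqs l. sup_law WS D1 D2 W F1 F2 s t c d y z * X t d z)"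
 by (intro sum.cong refl sum.swap)
 also have "... = (\<Sum>t\<in>seqs l. \<Sum>s\<in>seqs l. \<Sum>d\<in>seqs l. \<Sum>c\<in>seqs l. \<Sum>z\<in>seqs l. \<Sum>y\<in>seqs l. sup_law WS D1 D2 W F1 F2 s t c d y z * X t d z)"
 by (intro sum.cong refl sum.swap)
 also have "... = (\<Sum>t\<in>seqs l. \<Sum>s\<in>seqs l. \<Sum>d\<in>seqs l. \<Sum>c\<in>seqs l. \<Sum>z\<in>seqs l. \<Sum>y\<in>seqs l.
 sup_law (%(t, s). WS (s, t)) D2 D1 (%(d, c) (z, y). W (c, d) (y, z)) F2 F1 t s d c z y * X t d z)"
 by (intro sum.cong refl) (simp add: sup_law_def seqs_iff mult_ac)
 finally show ?thesis .
qed

text \<open>Binning of a typical set: each bin has at most \<open>b powr (l \<beta>)\<close> elements, and the bin index is the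
 common message.\<close>

lemma push_bij:
 fixes p :: "'a::finite => real" and j :: "'c::finite => 'a"
 assumes "!!c. g (j c) = y" "!!c. k (j c) = c" "!!x. g x = y ==> j (k x) = x"
 shows "push p g y = (\<Sum>c\<in>UNIV. p (j c))"
 unfolding push_def by (rule sum.reindex_bij_witness[where i=j and j=k]) (auto simp: assms)

lemma composition_type:
 assumes "pmf_on p" "is_type l p"
 obtains n :: "'u::finite => nat" where "!!u. real (n u) = real l * p u" "(\<Sum>u\<in>UNIV. n u) = l"
proof -
 define n where "n u = nat \<lfloor>real l * p u\<rfloor>" for u
 have n: "real (n u) = real l * p u" for u
 proof -
 obtain m :: int where m: "real l * p u = of_int m" using assms(2) by (auto simp: is_type_def)
 have "0 <= real l * p u" using pmf_on_nonneg[OF assms(1)] by simp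
 then show ?thesis using m by (simp add: n_def)
 qed
 have "real (\<Sum>u\<in>UNIV. n u) = real l" using pmf_on_sum[OF assms(1)] by (simp add: n sum_distrib_left[symmetric])
 then show thesis using n that by (metis of_nat_eq_iff)
qed



section \<open>The metric of a superletter made of slots\<close>

text \<open>The metric for a superletter that consists of \<open>T\<close> slots of \<open>w\<close> channel uses. The codeword of slot
 \<open>B\<close> depends only on the source letters in \<open>pool B\<close>, and \<open>H B\<close> is the message it carries.\<close>

locale slots = receiver WS pV pX D' W f f' \<kappa> l Cb pU
 for WS :: "'s::finite \<times> 't::finite => real"
 and pV :: "'v::finite => real" and pX :: "'u::finite \<times> 'v => 'x::finite => real"
 and D' :: "'u => 'd::finite => real"
 and W :: "('v \<times> 'x) \<times> 'd => 'y::finite \<times> 'z::finite => real"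
 and f :: "'s => 'k::finite" and f' :: "'t => 'k" and \<kappa> :: "'s \<times> 't => 'k"
 and l :: nat and Cb :: "'k list => 'u list" and pU :: "'u => real" +
 fixes T w :: nat and pool :: "nat => nat set" and H :: "nat => 'k list => 'm" and dec :: "nat => 'y list => 'm"
 and ak :: "'s => 'k => real" and Pt :: "'k => real" and \<phi> :: real and Xf :: "'k list => real" and lam :: real
 assumes l: "l = T * w"
 and pool: "!!B. B < T ==> pool B \<subseteq> {..<l}"
 and Cbpool: "!!B i k k'. B < T ==> i < w ==> k \<in> seqs l ==> k' \<in> seqs l ==> (\<forall>c\<in>pool B. k ! c = k' ! c)
 ==> Cb k ! (B * w + i) = Cb k' ! (B * w + i)"
 and comp: "!!B k u. B < T ==> k \<in> seqs l ==> real (card {i. i < w & Cb k ! (B * w + i) = u}) = real w * pU u"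
 and ak: "!!s k. 0 < ak s k" "!!k. (\<Sum>s\<in>UNIV. ak s k) <= 1"
 and Pt: "pmf_on Pt" and \<phi>: "0 < \<phi>" "\<phi> <= 1/2"
 and X: "!!k W. k \<in> seqs l ==> 0 < (\<Prod>c<l. Pt (k ! c)) ==> W \<subseteq> {..<T} ==>
 (\<Sum>k'\<in>seqs l. (\<Prod>c<l. Pt (k' ! c)) * of_bool (\<forall>B<T. B \<notin> W --> H B k' = H B k))
 <= (\<Prod>c<l. Pt (k ! c)) * exp (Xf k + real (card W) * lam)"
 and supp: "!!z. 0 < WS z ==> 0 < Pt (\<kappa> z)"
begin

definition PT :: "'k list => real" where "PT k = (\<Prod>c<l. Pt (k ! c))"
definition pass :: "nat set => (nat => 'm) => 'k list => real" where
 "pass V v k = of_bool (\<forall>B<T. B \<notin> V --> H B k = v B)"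
definition Zs :: "nat set => (nat => 'm) => real" where "Zs V v = (\<Sum>k\<in>seqs l. PT k * pass V v k)"
text \<open>The prior of the set of failed slots: each slot fails independently with probability
  \<open>\<phi>\<close>.\<close>

definition pri :: "nat set => real" where "pri V = (\<Prod>B<T. if B \<in> V then \<phi> else 1 - \<phi>)"
definition AK :: "'s list => 'k list => real" where "AK s k = (\<Prod>c<l. ak (s ! c) (k ! c))"
definition vd :: "'y list => nat => 'm" where "vd y = (%B. dec B (blk w B y))"
text \<open>A Bayesian guess of the source word. For every set \<open>V\<close> of slots to be
  disregarded it takes the posterior of the common word given the decoded messages of the other
  slots, passes it through the kernel \<open>AK\<close>, and mixes over \<open>V\<close> with
  weights \<open>pri V\<close>. \<open>Zs\<close> normalises each posterior.\<close>

definition sq :: "'s list => 'y list => real" where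
 "sq s y = (\<Sum>V\<in>Pow {..<T}. pri V * (\<Sum>k\<in>seqs l. AK s k * (PT k * pass V (vd y) k / Zs V (vd y))))"
definition \<omega>B :: "'u list => ('v \<times> 'x) list => 'y list => nat => real" where
 "\<omega>B us c y B = (\<Prod>i<w. \<omega> (us ! (B * w + i)) (fst (c ! (B * w + i))) (y ! (B * w + i)))"
text \<open>Slot by slot a mixture of the information density and the constant 1. In a slot where
  the users send different codewords the density may vanish; the constant branch keeps the factor at
  least \<open>\<phi>\<close>.\<close>

definition sr :: "'u list => ('v \<times> 'x) list => 'y list => real" where
 "sr us c y = (\<Prod>B<T. (1 - \<phi>) * \<omega>B us c y B + \<phi>)"
definition sm :: "'s list => ('v \<times> 'x) list => 'y list => real" where
 "sm s c y = sq s y * sr (F s) c y"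

lemma PT_nonneg: "0 <= PT k" unfolding PT_def by (intro prod_nonneg) (simp add: pmf_on_nonneg[OF Pt])

lemma sum_PT: "(\<Sum>k\<in>seqs l. PT k) = 1" unfolding PT_def using sum_seqs_iid[of l "%_. Pt"] Pt by simp

lemma pass_nonneg: "0 <= pass V v k" by (simp add: pass_def)

lemma Zs_nonneg: "0 <= Zs V v" unfolding Zs_def by (intro sum_nonneg mult_nonneg_nonneg PT_nonneg pass_nonneg)

lemma pri_pos: "0 < pri V" unfolding pri_def using \<phi> by (intro prod_pos) auto

lemma sum_pri: "(\<Sum>V\<in>Pow {..<T}. pri V) = 1"
proof -
 have "(\<Sum>V\<in>Pow {..<T}. pri V) = (\<Sum>V\<in>Pow {..<T}. (\<Prod>B\<in>V. \<phi>) * (\<Prod>B\<in>{..<T} - V. 1 - \<phi>))"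
 proof (intro sum.cong refl)
 fix V assume "V \<in> Pow {..<T}"
 then have "pri V = (\<Prod>B\<in>V \<union> ({..<T} - V). if B \<in> V then \<phi> else 1 - \<phi>)"
 unfolding pri_def by (intro prod.cong) auto
 also have "... = (\<Prod>B\<in>V. if B \<in> V then \<phi> else 1 - \<phi>) * (\<Prod>B\<in>{..<T} - V. if B \<in> V then \<phi> else 1 - \<phi>)"
 using \<open>V \<in> Pow {..<T}\<close> by (intro prod.union_disjoint) (auto intro: finite_subset)
 also have "... = (\<Prod>B\<in>V. \<phi>) * (\<Prod>B\<in>{..<T} - V. 1 - \<phi>)"
 by (intro arg_cong2[where f="(*)"] prod.cong) auto
 finally show "pri V = (\<Prod>B\<in>V. \<phi>) * (\<Prod>B\<in>{..<T} - V. 1 - \<phi>)" .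
 qed
 also have "... = (\<Prod>B<T. \<phi> + (1 - \<phi>))" by (rule prod_add[symmetric]) simp
 finally show ?thesis by simp
qed

lemma AK_pos: "0 < AK s k" unfolding AK_def by (intro prod_pos) (simp add: ak)

lemma sum_AK: "(\<Sum>s\<in>seqs l. AK s k) <= 1"
 unfolding AK_def sum_seqs_prod[where n=l and g="%i s. ak s (k ! i)"]
 by (intro prod_le_1) (auto intro: sum_nonneg less_imp_le[OF ak(1)] ak(2))

lemma sq_term_nonneg: "0 <= pri V * (\<Sum>k\<in>seqs l. AK s k * (PT k * pass V (vd y) k / Zs V (vd y)))"
 by (intro mult_nonneg_nonneg sum_nonneg divide_nonneg_nonneg)
 (auto intro: less_imp_le[OF pri_pos] less_imp_le[OF AK_pos] PT_nonneg pass_nonneg Zs_nonneg)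

lemma sq_ge: assumes "V \<subseteq> {..<T}" "k \<in> seqs l"
 shows "pri V * (AK s k * (PT k * pass V (vd y) k / Zs V (vd y))) <= sq s y"
proof -
 have "AK s k * (PT k * pass V (vd y) k / Zs V (vd y)) <= (\<Sum>k\<in>seqs l. AK s k * (PT k * pass V (vd y) k / Zs V (vd y)))"
 using assms by (intro member_le_sum[where f="%k. AK s k * (PT k * pass V (vd y) k / Zs V (vd y))"])
 (auto intro!: mult_nonneg_nonneg divide_nonneg_nonneg less_imp_le[OF AK_pos] PT_nonneg pass_nonneg Zs_nonneg)
 then have "pri V * (AK s k * (PT k * pass V (vd y) k / Zs V (vd y))) <= pri V * (\<Sum>k\<in>seqs l. AK s k * (PT k * pass V (vd y) k / Zs V (vd y)))"
 by (intro mult_left_mono less_imp_le[OF pri_pos])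
 also have "... <= sq s y" unfolding sq_def using assms(1)
 by (intro member_le_sum[where f="%V. pri V * (\<Sum>k\<in>seqs l. AK s k * (PT k * pass V (vd y) k / Zs V (vd y)))"] sq_term_nonneg) auto
 finally show ?thesis .
qed

text \<open>Disregarding all slots leaves the unconstrained prior, so the mixture never
  degenerates.\<close>

lemma sq_pos: "0 < sq s y"
proof -
 have "\<exists>k\<in>seqs l. PT k ~= 0"
 proof (rule ccontr)
 assume "\<not> ?thesis"
 then have "(\<Sum>k\<in>seqs l. PT k) = 0" by (intro sum.neutral) auto
 then show False using sum_PT by simp
 qed
 then obtain k where k: "k \<in> seqs l" "0 < PT k" using PT_nonneg by (auto simp: less_le)
 have p: "pass {..<T} v k' = 1" for v k' by (simp add: pass_def)
 have "Zs {..<T} (vd y) = 1" by (simp add: Zs_def p sum_PT)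
 then have "0 < pri {..<T} * (AK s k * (PT k * pass {..<T} (vd y) k / Zs {..<T} (vd y)))"
 using k pri_pos AK_pos by (simp add: p)
 also have "... <= sq s y" using k by (intro sq_ge) auto
 finally show ?thesis .
qed

lemma \<omega>B_nonneg: "0 <= \<omega>B us c y B" unfolding \<omega>B_def by (intro prod_nonneg) (simp add: \<omega>_nonneg)

lemma sr_factor_ge: "\<phi> <= (1 - \<phi>) * \<omega>B us c y B + \<phi>" using \<phi> \<omega>B_nonneg by simp

lemma sr_pos: "0 < sr us c y" unfolding sr_def using \<phi> sr_factor_ge by (intro prod_pos ballI) (meson less_le_trans)

lemma sm_pos: "0 < sm s c y" unfolding sm_def using sq_pos sr_pos by simp

lemma sum_sq: "(\<Sum>s\<in>seqs l. sq s y) <= 1"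
proof -
 have inner: "(\<Sum>s\<in>seqs l. \<Sum>k\<in>seqs l. AK s k * (PT k * pass V (vd y) k / Zs V (vd y))) <= 1" for V
 proof -
 have "(\<Sum>s\<in>seqs l. \<Sum>k\<in>seqs l. AK s k * (PT k * pass V (vd y) k / Zs V (vd y)))
 = (\<Sum>k\<in>seqs l. (\<Sum>s\<in>seqs l. AK s k) * (PT k * pass V (vd y) k / Zs V (vd y)))"
 by (subst sum.swap) (simp only: sum_distrib_right)
 also have "... <= (\<Sum>k\<in>seqs l. 1 * (PT k * pass V (vd y) k / Zs V (vd y)))"
 by (intro sum_mono mult_right_mono sum_AK divide_nonneg_nonneg mult_nonneg_nonneg PT_nonneg pass_nonneg Zs_nonneg)
 also have "... = Zs V (vd y) / Zs V (vd y)" by (simp only: Zs_def mult_1 sum_divide_distrib)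
 also have "... <= 1" by simp
 finally show ?thesis .
 qed
 have "(\<Sum>s\<in>seqs l. sq s y) = (\<Sum>V\<in>Pow {..<T}. pri V * (\<Sum>s\<in>seqs l. \<Sum>k\<in>seqs l. AK s k * (PT k * pass V (vd y) k / Zs V (vd y))))"
 unfolding sq_def by (subst sum.swap) (simp only: sum_distrib_left)
 also have "... <= (\<Sum>V\<in>Pow {..<T}. pri V * 1)"
 by (intro sum_mono mult_left_mono inner less_imp_le[OF pri_pos])
 finally show ?thesis by (simp add: sum_pri)
qed

lemma \<omega>_normalised: "(\<Sum>c\<in>UNIV. D u c * \<omega> u (fst c) y) <= 1"
proof -
 have "(\<Sum>c\<in>UNIV. D u c * \<omega> u (fst c) y) = (\<Sum>v\<in>UNIV. \<Sum>x\<in>UNIV. pX (u, v) x * (pV v * \<omega> u v y))"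
 by (simp add: sum_UNIV_pair[symmetric] D_def mult_ac)
 also have "... = (\<Sum>v\<in>UNIV. pV v * \<omega> u v y)"
 by (simp add: sum_distrib_right[symmetric] stoch_sum[OF pX])
 also have "... = PY u y / PY u y"
 by (simp add: \<omega>_def PY_def sum_divide_distrib[symmetric])
 finally show ?thesis by simp
qed

lemma sum_seqs_slots:
 fixes g :: "nat => 'a::finite list => real"
 shows "(\<Sum>zs\<in>seqs l. \<Prod>B<T. g B (blk w B zs)) = (\<Prod>B<T. \<Sum>b\<in>seqs w. g B b)"
 using sum_seqs_blocks[where m=T and l=w and r=0 and g=g and h="%_. 1"] by (simp add: l)

lemma blk_slot: "B < T ==> i < w ==> xs \<in> seqs l ==> blk w B xs ! i = xs ! (B * w + i)"
 using blk_nth[of B T i w xs 0] by (simp add: seqs_iff l)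

lemma prod_slots: "(\<Prod>i<l. h i) = (\<Prod>B<T. \<Prod>i<w. h (B * w + i))" for h :: "nat => real"
 using prod_blocks[of h T w 0] by (simp add: l)

lemma slot_less: "B < T ==> i < w ==> B * w + i < l"
proof -
 assume "B < T" "i < w"
 then have "Suc B * w <= T * w" by (intro mult_le_mono) auto
 then show ?thesis using \<open>i < w\<close> by (simp add: l)
qed

text \<open>Both branches of a slot are normalised separately: the density by
  \<open>\<omega>_normalised\<close>, the constant because the codeword law sums to 1.\<close>

lemma sr_normalised: assumes y: "y \<in> seqs l" shows "(\<Sum>c\<in>seqs l. seq_wt D us c * sr us c y) <= 1"
proof -
 define g where "g B b = (\<Prod>i<w. D (us ! (B * w + i)) (b ! i)) * ((1 - \<phi>) * (\<Prod>i<w. \<omega> (us ! (B * w + i)) (fst (b ! i)) (y ! (B * w + i))) + \<phi>)"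
 for B and b :: "('v \<times> 'x) list"
 have "(\<Sum>c\<in>seqs l. seq_wt D us c * sr us c y) = (\<Sum>c\<in>seqs l. \<Prod>B<T. g B (blk w B c))"
 proof (intro sum.cong refl)
 fix c :: "('v \<times> 'x) list" assume c: "c \<in> seqs l"
 have "seq_wt D us c = (\<Prod>B<T. \<Prod>i<w. D (us ! (B * w + i)) (c ! (B * w + i)))"
 using c by (simp add: seq_wt_def seqs_iff prod_slots)
 then have "seq_wt D us c * sr us c y = (\<Prod>B<T. (\<Prod>i<w. D (us ! (B * w + i)) (c ! (B * w + i))) * ((1 - \<phi>) * \<omega>B us c y B + \<phi>))"
 by (simp only: sr_def prod.distrib)
 also have "... = (\<Prod>B<T. g B (blk w B c))"
 unfolding g_def \<omega>B_def by (intro prod.cong refl) (simp add: blk_slot c)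
 finally show "seq_wt D us c * sr us c y = (\<Prod>B<T. g B (blk w B c))" .
 qed
 also have "... = (\<Prod>B<T. \<Sum>b\<in>seqs w. g B b)" by (rule sum_seqs_slots)
 also have "... <= 1"
 proof (intro prod_le_1 conjI)
 fix B
 show "0 <= (\<Sum>b\<in>seqs w. g B b)" unfolding g_def using \<phi>
 by (intro sum_nonneg mult_nonneg_nonneg add_nonneg_nonneg prod_nonneg) (auto simp: \<omega>_nonneg pmf_on_nonneg[OF pmf_D])
 have "(\<Sum>b\<in>seqs w. g B b) = (1 - \<phi>) * (\<Sum>b\<in>seqs w. \<Prod>i<w. D (us ! (B * w + i)) (b ! i) * \<omega> (us ! (B * w + i)) (fst (b ! i)) (y ! (B * w + i)))
 + \<phi> * (\<Sum>b\<in>seqs w. \<Prod>i<w. D (us ! (B * w + i)) (b ! i))"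
 unfolding g_def sum_distrib_left sum.distrib[symmetric] by (intro sum.cong refl) (simp add: prod.distrib algebra_simps)
 also have "(\<Sum>b\<in>seqs w. \<Prod>i<w. D (us ! (B * w + i)) (b ! i)) = 1"
 by (rule sum_seqs_iid[of w "%i. D (us ! (B * w + i))"]) (rule pmf_D)
 also have "(\<Sum>b\<in>seqs w. \<Prod>i<w. D (us ! (B * w + i)) (b ! i) * \<omega> (us ! (B * w + i)) (fst (b ! i)) (y ! (B * w + i)))
 = (\<Prod>i<w. \<Sum>c\<in>UNIV. D (us ! (B * w + i)) c * \<omega> (us ! (B * w + i)) (fst c) (y ! (B * w + i)))"
 by (rule sum_seqs_prod[where g="%i c. D (us ! (B * w + i)) c * \<omega> (us ! (B * w + i)) (fst c) (y ! (B * w + i))"])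
 also have "(1 - \<phi>) * ... + \<phi> * 1 <= (1 - \<phi>) * 1 + \<phi> * 1"
 using \<phi> by (intro add_mono mult_left_mono prod_le_1 conjI \<omega>_normalised sum_nonneg mult_nonneg_nonneg \<omega>_nonneg pmf_on_nonneg[OF pmf_D]) auto
 finally show "(\<Sum>b\<in>seqs w. g B b) <= 1" by simp
 qed
 finally show ?thesis .
qed

lemma sm_normalised: assumes y: "y \<in> seqs l" shows "(\<Sum>s\<in>seqs l. \<Sum>c\<in>seqs l. seq_wt D (F s) c * sm s c y) <= 1"
proof -
 have "(\<Sum>s\<in>seqs l. \<Sum>c\<in>seqs l. seq_wt D (F s) c * sm s c y) = (\<Sum>s\<in>seqs l. sq s y * (\<Sum>c\<in>seqs l. seq_wt D (F s) c * sr (F s) c y))"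
 by (simp add: sm_def sum_distrib_left mult_ac)
 also have "... <= (\<Sum>s\<in>seqs l. sq s y * 1)"
 by (intro sum_mono mult_left_mono sr_normalised y less_imp_le[OF sq_pos])
 finally show ?thesis using sum_sq[of y] by simp
qed

end



context slots
begin

text \<open>The actual law of one channel use, where the two users may follow different common
  words; it equals \<open>q\<close> at positions where they agree.\<close>

definition \<rho> :: "'s list => 't list => nat => ('v \<times> 'x) \<times> 'd \<times> 'y \<times> 'z => real" where
 "\<rho> s t i = (%(c, d, y, z). D (F s ! i) c * D' (F' t ! i) d * W (c, d) (y, z))"

lemma pmf_\<rho>: "pmf_on (\<rho> s t i)"
proof -
 have "(\<Sum>y\<in>UNIV. \<Sum>z\<in>UNIV. W c (y, z)) = 1" for c
 using stoch_sum[OF W, of c] by (simp add: sum_UNIV_pair)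
 then have "sum (\<rho> s t i) UNIV = 1"
 by (simp add: sum_UNIV_pair[symmetric] \<rho>_def sum_distrib_left[symmetric] sum_distrib_right[symmetric] pmf_on_sum pmf_D D')
 (use pmf_on_sum[OF pmf_D[of "F s ! i"]] in \<open>simp add: sum_UNIV_pair[symmetric]\<close>)
 moreover have "0 <= \<rho> s t i z" for z
 by (auto simp: \<rho>_def split: prod.splits intro!: mult_nonneg_nonneg pmf_on_nonneg[OF pmf_D] pmf_on_nonneg[OF D'] stoch_nonneg[OF W])
 ultimately show ?thesis by (simp add: pmf_on_def)
qed

lemma \<rho>_match: "F s ! i = F' t ! i ==> \<rho> s t i = q (F s ! i)" by (simp add: \<rho>_def q_def)

lemma outer_zip: "outer s t X = (\<Sum>es\<in>seqs l. (\<Prod>i<l. \<rho> s t i (es ! i)) * X (map fst es) (map (fst \<circ> snd \<circ> snd) es))"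
 unfolding outer_def sum_seqs_zip4
 by (intro sum.cong refl arg_cong2[where f="(*)"]) (simp add: seqs_iff seq_wt_def \<rho>_def prod.distrib[symmetric] split_def)

definition match :: "'s list => 't list => nat => bool" where
 "match s t B \<longleftrightarrow> (\<forall>c\<in>pool B. f (s ! c) = f' (t ! c))"

text \<open>A slot depends only on the letters of its pool, and on a matching pool both users'
  letters are those of the common word, whichever user \<kappa> selects.\<close>

lemma match_F:
 assumes "match s t B" "B < T" "i < w" "s \<in> seqs l" "t \<in> seqs l"
 shows "F s ! (B * w + i) = Cb (\<kappa>s s t) ! (B * w + i)" "F' t ! (B * w + i) = Cb (\<kappa>s s t) ! (B * w + i)"
proof -
 have len: "map f s \<in> seqs l" "map f' t \<in> seqs l" "\<kappa>s s t \<in> seqs l" using assms by (auto simp: \<kappa>s_def seqs_iff)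
 have eq: "map f s ! c = \<kappa>s s t ! c" "map f' t ! c = \<kappa>s s t ! c" if "c \<in> pool B" for c
 proof -
 have "c < l" using pool[OF assms(2)] that by auto
 then show "map f s ! c = \<kappa>s s t ! c" "map f' t ! c = \<kappa>s s t ! c"
 using assms that \<kappa> by (auto simp: match_def \<kappa>s_def seqs_iff)
 qed
 show "F s ! (B * w + i) = Cb (\<kappa>s s t) ! (B * w + i)" unfolding F_def
 by (rule Cbpool[OF assms(2,3) len(1) len(3)]) (simp add: eq)
 show "F' t ! (B * w + i) = Cb (\<kappa>s s t) ! (B * w + i)" unfolding F'_def
 by (rule Cbpool[OF assms(2,3) len(2) len(3)]) (simp add: eq)
qed

text \<open>The decoding failure of a slot computed with \<open>PY\<close>, that is, as if both
  users sent the codeword of the same word \<open>k\<close>.\<close>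

definition pf :: "nat => 'k list => real" where
 "pf B k = (\<Sum>y\<in>seqs w. (\<Prod>i<w. PY (Cb k ! (B * w + i)) (y ! i)) * of_bool (dec B y ~= H B k))"

lemma pf_nonneg: "0 <= pf B k" unfolding pf_def by (intro sum_nonneg mult_nonneg_nonneg prod_nonneg) (auto simp: PY_nonneg)

lemma slot_marginal:
 assumes "B < T"
 shows "(\<Sum>es\<in>seqs l. (\<Prod>i<l. \<rho> s t i (es ! i)) * g (blk w B es)) = (\<Sum>es\<in>seqs w. (\<Prod>i<w. \<rho> s t (B * w + i) (es ! i)) * g es)"
proof -
 define G where "G B' b = (\<Prod>i<w. \<rho> s t (B' * w + i) (b ! i)) * (if B' = B then g b else 1)" for B' b
 have "(\<Sum>es\<in>seqs l. (\<Prod>i<l. \<rho> s t i (es ! i)) * g (blk w B es)) = (\<Sum>es\<in>seqs l. \<Prod>B'<T. G B' (blk w B' es))"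
 proof (intro sum.cong refl)
 fix es :: "(('v \<times> 'x) \<times> 'd \<times> 'y \<times> 'z) list" assume es: "es \<in> seqs l"
 have "(\<Prod>B'<T. G B' (blk w B' es)) = (\<Prod>B'<T. \<Prod>i<w. \<rho> s t (B' * w + i) (blk w B' es ! i)) * (\<Prod>B'<T. if B' = B then g (blk w B' es) else 1)"
 by (simp add: G_def prod.distrib)
 also have "(\<Prod>B'<T. if B' = B then g (blk w B' es) else 1) = g (blk w B es)" using assms by (simp add: prod.delta)
 also have "(\<Prod>B'<T. \<Prod>i<w. \<rho> s t (B' * w + i) (blk w B' es ! i)) = (\<Prod>i<l. \<rho> s t i (es ! i))"
 unfolding prod_slots by (intro prod.cong refl) (simp add: blk_slot es)
 finally show "(\<Prod>i<l. \<rho> s t i (es ! i)) * g (blk w B es) = (\<Prod>B'<T. G B' (blk w B' es))" by simp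
 qed
 also have "... = (\<Prod>B'<T. \<Sum>b\<in>seqs w. G B' b)" by (rule sum_seqs_slots)
 also have "... = (\<Prod>B'<T. if B' = B then (\<Sum>b\<in>seqs w. G B b) else 1)"
 proof (intro prod.cong refl)
 fix B'
 have "(\<Sum>b\<in>seqs w. \<Prod>i<w. \<rho> s t (B' * w + i) (b ! i)) = 1" by (rule sum_seqs_iid[of w "%i. \<rho> s t (B' * w + i)"]) (rule pmf_\<rho>)
 then show "(\<Sum>b\<in>seqs w. G B' b) = (if B' = B then (\<Sum>b\<in>seqs w. G B b) else 1)" by (simp add: G_def)
 qed
 finally show ?thesis using assms by (simp add: prod.delta G_def)
qed

lemma y_marginal:
 "(\<Sum>es\<in>seqs w. (\<Prod>i<w. q (u i) (es ! i)) * h (map (fst \<circ> snd \<circ> snd) es)) = (\<Sum>y\<in>seqs w. (\<Prod>i<w. PY (u i) (y ! i)) * h y)"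
proof -
 have "(\<Sum>es\<in>seqs w. (\<Prod>i<w. q (u i) (es ! i)) * h (map (fst \<circ> snd \<circ> snd) es))
 = (\<Sum>es\<in>seqs w. \<Sum>y\<in>seqs w. (\<Prod>i<w. q (u i) (es ! i) * of_bool (fst (snd (snd (es ! i))) = y ! i)) * h y)"
 proof (intro sum.cong refl)
 fix es :: "(('v \<times> 'x) \<times> 'd \<times> 'y \<times> 'z) list" assume es: "es \<in> seqs w"
 let ?m = "map (fst \<circ> snd \<circ> snd) es"
 have "(\<Sum>y\<in>seqs w. (\<Prod>i<w. q (u i) (es ! i) * of_bool (fst (snd (snd (es ! i))) = y ! i)) * h y)
 = (\<Sum>y\<in>seqs w. if y = ?m then (\<Prod>i<w. q (u i) (es ! i)) * h y else 0)"
 proof (intro sum.cong refl)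
 fix y :: "'y list" assume y: "y \<in> seqs w"
 show "(\<Prod>i<w. q (u i) (es ! i) * of_bool (fst (snd (snd (es ! i))) = y ! i)) * h y = (if y = ?m then (\<Prod>i<w. q (u i) (es ! i)) * h y else 0)"
 proof (cases "y = ?m")
 case True then show ?thesis using es by (auto simp: seqs_iff intro!: arg_cong2[where f="(*)"] prod.cong)
 next
 case False
 then obtain i where "i < w" "y ! i ~= ?m ! i" using y es by (auto simp: seqs_iff list_eq_iff_nth_eq)
 then have "(\<Prod>i<w. q (u i) (es ! i) * of_bool (fst (snd (snd (es ! i))) = y ! i)) = 0"
 using es by (intro prod_zero) (auto simp: seqs_iff intro!: bexI[of _ i])
 then show ?thesis using False by (simp only: if_False mult_zero_left)
 qed
 qed
 also have "... = (\<Prod>i<w. q (u i) (es ! i)) * h ?m" using es by (simp add: seqs_iff)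
 finally show "(\<Prod>i<w. q (u i) (es ! i)) * h ?m = (\<Sum>y\<in>seqs w. (\<Prod>i<w. q (u i) (es ! i) * of_bool (fst (snd (snd (es ! i))) = y ! i)) * h y)" by simp
 qed
 also have "... = (\<Sum>y\<in>seqs w. (\<Sum>es\<in>seqs w. \<Prod>i<w. q (u i) (es ! i) * of_bool (fst (snd (snd (es ! i))) = y ! i)) * h y)"
 by (subst sum.swap) (simp only: sum_distrib_right)
 also have "... = (\<Sum>y\<in>seqs w. (\<Prod>i<w. PY (u i) (y ! i)) * h y)"
 proof (intro sum.cong refl arg_cong2[where f="(*)"])
 fix y :: "'y list"
 have "(\<Sum>e\<in>UNIV. q u' e * of_bool (fst (snd (snd e)) = y')) = PY u' y'" for u' y'
 proof -
 have inner: "(\<Sum>y''\<in>UNIV. \<Sum>z\<in>UNIV. q u' (c, d, y'', z) * of_bool (y'' = y')) = (\<Sum>z\<in>UNIV. q u' (c, d, y', z))" for c d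
 proof -
 have "(\<Sum>y''\<in>UNIV. \<Sum>z\<in>UNIV. q u' (c, d, y'', z) * of_bool (y'' = y')) = (\<Sum>y''\<in>UNIV. if y'' = y' then \<Sum>z\<in>UNIV. q u' (c, d, y', z) else 0)"
 by (intro sum.cong) auto
 then show ?thesis by simp
 qed
 have "(\<Sum>e\<in>UNIV. q u' e * of_bool (fst (snd (snd e)) = y'))
 = (\<Sum>c\<in>UNIV. \<Sum>d\<in>UNIV. \<Sum>y''\<in>UNIV. \<Sum>z\<in>UNIV. q u' (c, d, y'', z) * of_bool (y'' = y'))"
 by (simp only: sum_UNIV_pair[symmetric] fst_conv snd_conv)
 also have "... = (\<Sum>c\<in>UNIV. \<Sum>d\<in>UNIV. \<Sum>z\<in>UNIV. q u' (c, d, y', z))" by (simp only: inner)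
 finally have "(\<Sum>e\<in>UNIV. q u' e * of_bool (fst (snd (snd e)) = y')) = ..." .
 then show ?thesis by (simp add: q_PY)
 qed
 then show "(\<Sum>es\<in>seqs w. \<Prod>i<w. q (u i) (es ! i) * of_bool (fst (snd (snd (es ! i))) = y ! i)) = (\<Prod>i<w. PY (u i) (y ! i))"
 by (simp add: sum_seqs_prod[where g="%i e. q (u i) e * of_bool (fst (snd (snd e)) = y ! i)"])
 qed
 finally show ?thesis .
qed

lemma sum_slot_letters:
 assumes "B < T" "k \<in> seqs l" shows "(\<Sum>i<w. g (Cb k ! (B * w + i))) = real w * (\<Sum>u\<in>UNIV. pU u * g u)"
proof -
 have "(\<Sum>i<w. g (Cb k ! (B * w + i))) = (\<Sum>u\<in>UNIV. \<Sum>i\<in>{i. i \<in> {..<w} & Cb k ! (B * w + i) = u}. g (Cb k ! (B * w + i)))"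
 by (subst sum.group) auto
 also have "... = (\<Sum>u\<in>UNIV. real (card {i. i < w & Cb k ! (B * w + i) = u}) * g u)"
 by (intro sum.cong refl) simp
 also have "... = real w * (\<Sum>u\<in>UNIV. pU u * g u)" by (simp add: comp[OF assms] sum_distrib_left mult.assoc)
 finally show ?thesis .
qed

definition lnAK :: "'s list => 't list => real" where "lnAK s t = (\<Sum>i<l. ln (ak (s ! i) (\<kappa> (s ! i, t ! i))))"

text \<open>A lower estimate of what slot \<open>B\<close> adds to the log-metric. A matching slot
  pays \<open>ln (1 - \<phi>)\<close> once in \<open>pri\<close> and once in \<open>sr\<close>, and
  \<open>ln \<phi> - lam\<close> more if its message is decoded wrongly. A mismatched slot pays
  \<open>ln \<phi>\<close> in both places and \<open>lam\<close> for the lost hash.\<close>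

definition low :: "'s list => 't list => (('v \<times> 'x) \<times> 'd \<times> 'y \<times> 'z) list => nat => real" where
 "low s t es B = (if match s t B
 then 2 * ln (1 - \<phi>) + (\<Sum>i<w. ln (\<omega> (Cb (\<kappa>s s t) ! (B * w + i)) (fst (fst (es ! (B * w + i)))) (fst (snd (snd (es ! (B * w + i)))))))
 + of_bool (dec B (blk w B (map (fst \<circ> snd \<circ> snd) es)) ~= H B (\<kappa>s s t)) * (ln \<phi> - lam)
 else 2 * ln \<phi> - lam)"

text \<open>The mixture \<open>sq\<close> is bounded below by a single summand: the true common word
  together with the set \<open>V\<close> of slots that really failed. Assumption \<open>X\<close>
  bounds the normaliser of that summand.\<close>

lemma ln_sm_ge:
 assumes st: "s \<in> seqs l" "t \<in> seqs l" "0 < (\<Prod>i<l. WS (s ! i, t ! i))"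
 and es: "es \<in> seqs l" "0 < (\<Prod>i<l. \<rho> s t i (es ! i))" and lam: "0 <= lam"
 shows "(\<Sum>B<T. low s t es B) + lnAK s t - Xf (\<kappa>s s t) <= ln (sm s (map fst es) (map (fst \<circ> snd \<circ> snd) es))"
proof -
 define k where "k = \<kappa>s s t"
 define c where "c = map fst es"
 define y where "y = map (fst \<circ> snd \<circ> snd) es"
 have in_s: "k \<in> seqs l" "c \<in> seqs l" "y \<in> seqs l" using st es by (auto simp: k_def c_def y_def \<kappa>s_def seqs_iff)
 have ki: "k ! i = \<kappa> (s ! i, t ! i)" if "i < l" for i using that st by (simp add: k_def \<kappa>s_def seqs_iff)
 have Wpos: "0 < WS (s ! i, t ! i)" if "i < l" for i
 using st(3) that pmf_on_nonneg[OF WS, of "(s ! i, t ! i)"] by (auto simp: less_le prod_zero_iff)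
 have rpos: "0 < \<rho> s t i (es ! i)" if "i < l" for i
 using es(2) that pmf_on_nonneg[OF pmf_\<rho>, of s t i "es ! i"] by (auto simp: less_le prod_zero_iff)
 have PTk: "0 < PT k" unfolding PT_def using ki supp[OF Wpos] by (intro prod_pos) simp
 \<comment> \<open>With exactly these slots disregarded, every remaining decoded message is the hash
   of \<open>k\<close>, so \<open>k\<close> passes the test and \<open>Zs\<close> is the sum
   controlled by \<open>X\<close>.\<close>
 define V where "V = {B. B < T & (\<not> match s t B \<or> dec B (blk w B y) ~= H B k)}"
 have V: "V \<subseteq> {..<T}" by (auto simp: V_def)
 have AKk: "ln (AK s k) = lnAK s t"
 unfolding AK_def lnAK_def using ak(1) ki by (subst ln_prod) (auto intro!: sum.cong simp: less_imp_neq[symmetric])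
 have pass1: "pass V (vd y) k = 1" by (auto simp: pass_def V_def vd_def)
 have Zeq: "Zs V (vd y) = (\<Sum>k'\<in>seqs l. (\<Prod>c<l. Pt (k' ! c)) * of_bool (\<forall>B<T. B \<notin> V --> H B k' = H B k))"
 proof -
 have "pass V (vd y) k' = of_bool (\<forall>B<T. B \<notin> V --> H B k' = H B k)" for k'
 unfolding pass_def by (intro arg_cong[where f=of_bool]) (auto simp: V_def vd_def)
 then show ?thesis by (simp add: Zs_def PT_def)
 qed
 have Zle: "Zs V (vd y) <= PT k * exp (Xf k + real (card V) * lam)"
 using X[OF in_s(1) _ V] PTk by (simp add: Zeq PT_def)
 have "PT k * pass V (vd y) k <= Zs V (vd y)" unfolding Zs_def
 using in_s by (intro member_le_sum[where f="%k. PT k * pass V (vd y) k"]) (auto intro: mult_nonneg_nonneg PT_nonneg pass_nonneg)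
 then have Zpos: "0 < Zs V (vd y)" using PTk pass1 by simp
 have "exp (- (Xf k + real (card V) * lam)) <= PT k / Zs V (vd y)"
 proof -
 have "Zs V (vd y) * exp (- (Xf k + real (card V) * lam)) <= PT k * exp (Xf k + real (card V) * lam) * exp (- (Xf k + real (card V) * lam))"
 by (intro mult_right_mono Zle) simp
 also have "... = PT k" by (simp only: mult.assoc exp_add[symmetric]) simp
 finally show ?thesis using Zpos by (simp add: le_divide_eq mult.commute)
 qed
 then have "pri V * (AK s k * exp (- (Xf k + real (card V) * lam))) <= pri V * (AK s k * (PT k * pass V (vd y) k / Zs V (vd y)))"
 unfolding pass1 mult_1_right by (intro mult_left_mono less_imp_le[OF pri_pos] less_imp_le[OF AK_pos])
 also have "... <= sq s y" by (rule sq_ge[OF V in_s(1)])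
 finally have "ln (pri V * (AK s k * exp (- (Xf k + real (card V) * lam)))) <= ln (sq s y)"
 using pri_pos AK_pos by (intro ln_mono) auto
 then have lsq: "ln (pri V) + lnAK s t - Xf k - real (card V) * lam <= ln (sq s y)"
 using pri_pos[of V] AK_pos[of s k] by (simp add: ln_mult_pos AKk)
 have lpri: "ln (pri V) = (\<Sum>B<T. if B \<in> V then ln \<phi> else ln (1 - \<phi>))"
 unfolding pri_def using \<phi> by (subst ln_prod) (auto intro!: sum.cong)
 have lsr: "ln (sr (F s) c y) = (\<Sum>B<T. ln ((1 - \<phi>) * \<omega>B (F s) c y B + \<phi>))"
 proof -
 have "(1 - \<phi>) * \<omega>B (F s) c y B + \<phi> ~= 0" for B using sr_factor_ge[of "F s" c y B] \<phi> by linarith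
 then show ?thesis unfolding sr_def by (subst ln_prod) auto
 qed
 have cV: "real (card V) * lam = (\<Sum>B<T. of_bool (B \<in> V) * lam)"
 proof -
 have "(\<Sum>B<T. of_bool (B \<in> V) :: real) = real (card V)"
 by (simp add: of_bool_def sum.If_cases inf_commute Int_absorb2[OF V])
 then show ?thesis by (simp add: sum_distrib_right)
 qed
 have l1: "ln (1 - \<phi>) <= 0" "ln \<phi> <= ln (1 - \<phi>)" using \<phi> by (auto intro!: ln_mono)
 have low_le: "low s t es B <= (if B \<in> V then ln \<phi> else ln (1 - \<phi>)) - of_bool (B \<in> V) * lam + ln ((1 - \<phi>) * \<omega>B (F s) c y B + \<phi>)"
 if B: "B < T" for B
 proof (cases "match s t B")
 case False
 then have BV: "B \<in> V" using B by (simp add: V_def)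
 have "ln \<phi> <= ln ((1 - \<phi>) * \<omega>B (F s) c y B + \<phi>)" using sr_factor_ge[of "F s" c y B] \<phi> by (intro ln_mono) auto
 then show ?thesis using False BV by (simp add: low_def)
 next
 case True
 note mF = match_F[OF True B _ st(1,2)]
 have om: "0 < \<omega> (F s ! (B * w + i)) (fst (c ! (B * w + i))) (y ! (B * w + i))" if i: "i < w" for i
 proof -
 have j: "B * w + i < l" by (rule slot_less[OF B i])
 have "\<rho> s t (B * w + i) = q (F s ! (B * w + i))" by (rule \<rho>_match) (simp add: mF[OF i])
 then have "0 < q (F s ! (B * w + i)) (es ! (B * w + i))" using rpos[OF j] by simp
 then have "0 < \<omega> (F s ! (B * w + i)) (fst (fst (es ! (B * w + i)))) (fst (snd (snd (es ! (B * w + i)))))"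
 by (metis q_pos prod.collapse)
 then show ?thesis using j es(1) by (simp add: c_def y_def seqs_iff)
 qed
 have omB: "0 < \<omega>B (F s) c y B" unfolding \<omega>B_def using om by (intro prod_pos) auto
 have "ln (\<omega>B (F s) c y B) = (\<Sum>i<w. ln (\<omega> (F s ! (B * w + i)) (fst (c ! (B * w + i))) (y ! (B * w + i))))"
 unfolding \<omega>B_def using om by (subst ln_prod) (auto simp: less_imp_neq[symmetric])
 also have "... = (\<Sum>i<w. ln (\<omega> (Cb (\<kappa>s s t) ! (B * w + i)) (fst (fst (es ! (B * w + i)))) (fst (snd (snd (es ! (B * w + i)))))))"
 using es(1) slot_less[OF B] by (intro sum.cong refl) (simp add: mF c_def y_def seqs_iff)
 finally have lom: "ln (\<omega>B (F s) c y B) = ..." .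
 have "ln ((1 - \<phi>) * \<omega>B (F s) c y B) <= ln ((1 - \<phi>) * \<omega>B (F s) c y B + \<phi>)"
 using omB \<phi> by (intro ln_mono) auto
 then have "ln (1 - \<phi>) + ln (\<omega>B (F s) c y B) <= ln ((1 - \<phi>) * \<omega>B (F s) c y B + \<phi>)"
 using omB \<phi> by (simp add: ln_mult_pos)
 moreover have "B \<in> V \<longleftrightarrow> dec B (blk w B y) ~= H B k" using True B by (simp add: V_def)
 ultimately show ?thesis using True l1 by (auto simp: low_def lom[symmetric] k_def y_def)
 qed
 have "(\<Sum>B<T. low s t es B) <= (\<Sum>B<T. (if B \<in> V then ln \<phi> else ln (1 - \<phi>)) - of_bool (B \<in> V) * lam + ln ((1 - \<phi>) * \<omega>B (F s) c y B + \<phi>))"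
 by (intro sum_mono low_le) simp
 also have "... = ln (pri V) - real (card V) * lam + ln (sr (F s) c y)"
 by (simp add: sum.distrib sum_subtractf lpri lsr cV)
 finally have "(\<Sum>B<T. low s t es B) + lnAK s t - Xf k <= ln (sq s y) + ln (sr (F s) c y)" using lsq by linarith
 also have "... = ln (sm s c y)" unfolding sm_def using sq_pos sr_pos by (simp add: ln_mult_pos)
 finally show ?thesis by (simp add: k_def c_def y_def)
qed

text \<open>Every slot has composition \<open>pU\<close>, so a matching slot has expected density
  \<open>w * I\<close> for every common word; the estimate is then linear in the indicators of
  mismatch and in the decoding failures.\<close>

lemma outer_ln_sm:
 assumes st: "s \<in> seqs l" "t \<in> seqs l" "0 < (\<Prod>i<l. WS (s ! i, t ! i))" and lam: "0 <= lam" and I0: "0 <= I"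
 shows "2 * real T * ln (1 - \<phi>) + real T * (real w * I)
 + (\<Sum>B<T. of_bool (\<not> match s t B)) * (2 * ln \<phi> - lam - real w * I) + (\<Sum>B<T. pf B (\<kappa>s s t)) * (ln \<phi> - lam)
 + lnAK s t - Xf (\<kappa>s s t)
 <= outer s t (%c y. ln (sm s c y))"
proof -
 let ?P = "%es. \<Prod>i<l. \<rho> s t i (es ! i)" and ?k = "\<kappa>s s t"
 have P0: "0 <= ?P es" for es by (intro prod_nonneg) (simp add: pmf_on_nonneg[OF pmf_\<rho>])
 have P1: "(\<Sum>es\<in>seqs l. ?P es) = 1" by (rule sum_seqs_iid) (rule pmf_\<rho>)
 have kin: "?k \<in> seqs l" using st by (simp add: \<kappa>s_def seqs_iff)
 have l1: "ln (1 - \<phi>) <= 0" "ln \<phi> <= 0" using \<phi> by auto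
 have E: "(\<Sum>es\<in>seqs l. ?P es * low s t es B) \<ge> 2 * ln (1 - \<phi>) + real w * I + of_bool (\<not> match s t B) * (2 * ln \<phi> - lam - real w * I) + pf B ?k * (ln \<phi> - lam)"
 if B: "B < T" for B
 proof (cases "match s t B")
 case False
 have "(\<Sum>es\<in>seqs l. ?P es * low s t es B) = (\<Sum>es\<in>seqs l. ?P es) * (2 * ln \<phi> - lam)"
 using False by (simp only: low_def if_False sum_distrib_right)
 moreover have "pf B ?k * (ln \<phi> - lam) <= 0" using pf_nonneg l1 lam by (intro mult_nonneg_nonpos) auto
 ultimately show ?thesis using False l1 by (simp add: P1)
 next
 case True
 note mF = match_F[OF True B _ st(1,2)]
 have rq: "\<rho> s t (B * w + i) = q (Cb ?k ! (B * w + i))" if "i < w" for i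
 using \<rho>_match[of s "B * w + i" t] mF[OF that] by simp
 have rqp: "(\<Prod>i<w. \<rho> s t (B * w + i) (es ! i)) = (\<Prod>i<w. q (Cb ?k ! (B * w + i)) (es ! i))" for es
 by (intro prod.cong refl) (simp add: rq)
 let ?x = "%i e. ln (\<omega> (Cb ?k ! (B * w + i)) (fst (fst e)) (fst (snd (snd e))))"
 let ?d = "%b. of_bool (dec B (map (fst \<circ> snd \<circ> snd) b) ~= H B ?k) :: real"
 have "(\<Sum>es\<in>seqs l. ?P es * low s t es B) = (\<Sum>es\<in>seqs l. ?P es * (2 * ln (1 - \<phi>) + ((\<Sum>i<w. ?x i (blk w B es ! i)) + ?d (blk w B es) * (ln \<phi> - lam))))"
 using True B by (intro sum.cong refl) (simp add: low_def blk_slot blk_map[symmetric] add.assoc)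
 also have "... = 2 * ln (1 - \<phi>) + (\<Sum>es\<in>seqs l. ?P es * ((\<Sum>i<w. ?x i (blk w B es ! i)) + ?d (blk w B es) * (ln \<phi> - lam)))"
 by (simp only: distrib_left[of "?P _"] sum.distrib sum_distrib_right[symmetric] P1 mult_1)
 also have "(\<Sum>es\<in>seqs l. ?P es * ((\<Sum>i<w. ?x i (blk w B es ! i)) + ?d (blk w B es) * (ln \<phi> - lam)))
 = (\<Sum>es\<in>seqs w. (\<Prod>i<w. \<rho> s t (B * w + i) (es ! i)) * ((\<Sum>i<w. ?x i (es ! i)) + ?d es * (ln \<phi> - lam)))"
 by (rule slot_marginal[OF B, where g="%b. (\<Sum>i<w. ?x i (b ! i)) + ?d b * (ln \<phi> - lam)"])
 also have "... = (\<Sum>es\<in>seqs w. (\<Prod>i<w. q (Cb ?k ! (B * w + i)) (es ! i)) * (\<Sum>i<w. ?x i (es ! i)))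
 + (\<Sum>es\<in>seqs w. (\<Prod>i<w. q (Cb ?k ! (B * w + i)) (es ! i)) * ?d es) * (ln \<phi> - lam)"
 by (simp only: rqp distrib_left sum.distrib sum_distrib_right mult.assoc)
 also have "(\<Sum>es\<in>seqs w. (\<Prod>i<w. q (Cb ?k ! (B * w + i)) (es ! i)) * (\<Sum>i<w. ?x i (es ! i)))
 = (\<Sum>i<w. \<Sum>e\<in>UNIV. q (Cb ?k ! (B * w + i)) e * ?x i e)"
 by (rule sum_seqs_prod_sum) (rule pmf_on_sum[OF pmf_q])
 also have "... = (\<Sum>i<w. Iu (Cb ?k ! (B * w + i)))" by (simp add: q_Iu)
 also have "... = real w * I" unfolding I_def by (rule sum_slot_letters[OF B kin])
 also have "(\<Sum>es\<in>seqs w. (\<Prod>i<w. q (Cb ?k ! (B * w + i)) (es ! i)) * ?d es) = pf B ?k"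
 unfolding pf_def by (rule y_marginal)
 finally show ?thesis using True by simp
 qed
 have "2 * real T * ln (1 - \<phi>) + real T * (real w * I)
 + (\<Sum>B<T. of_bool (\<not> match s t B)) * (2 * ln \<phi> - lam - real w * I) + (\<Sum>B<T. pf B ?k) * (ln \<phi> - lam)
 = (\<Sum>B<T. 2 * ln (1 - \<phi>) + real w * I + of_bool (\<not> match s t B) * (2 * ln \<phi> - lam - real w * I) + pf B ?k * (ln \<phi> - lam))"
 by (simp add: sum.distrib sum_distrib_right) (simp add: algebra_simps)
 also have "... <= (\<Sum>B<T. \<Sum>es\<in>seqs l. ?P es * low s t es B)" by (intro sum_mono E) simp
 also have "... = (\<Sum>es\<in>seqs l. ?P es * (\<Sum>B<T. low s t es B))" by (subst sum.swap) (simp only: sum_distrib_left)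
 finally have 1: "2 * real T * ln (1 - \<phi>) + real T * (real w * I)
 + (\<Sum>B<T. of_bool (\<not> match s t B)) * (2 * ln \<phi> - lam - real w * I) + (\<Sum>B<T. pf B ?k) * (ln \<phi> - lam) <= ..." .
 have "(\<Sum>es\<in>seqs l. ?P es * (\<Sum>B<T. low s t es B)) + (lnAK s t - Xf ?k) = (\<Sum>es\<in>seqs l. ?P es * ((\<Sum>B<T. low s t es B) + lnAK s t - Xf ?k))"
 by (simp only: add_diff_eq[symmetric] distrib_left sum.distrib sum_distrib_right[symmetric] P1) simp
 also have "... <= outer s t (%c y. ln (sm s c y))"
 unfolding outer_zip
 proof (intro sum_mono)
 fix es :: "(('v \<times> 'x) \<times> 'd \<times> 'y \<times> 'z) list" assume es: "es \<in> seqs l"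
 show "?P es * ((\<Sum>B<T. low s t es B) + lnAK s t - Xf ?k) <= ?P es * ln (sm s (map fst es) (map (fst \<circ> snd \<circ> snd) es))"
 proof (cases "?P es = 0")
 case False
 then have "0 < ?P es" using P0[of es] by (metis less_le)
 then show ?thesis using ln_sm_ge[OF st es _ lam] by (intro mult_left_mono) auto
 qed (simp only: mult_zero_left order_refl)
 qed
 finally show ?thesis using 1 by linarith
qed

definition HA :: real where "HA = - (\<Sum>z\<in>UNIV. WS z * ln (ak (fst z) (\<kappa> z)))"

lemma exp_lnAK: "(\<Sum>s\<in>seqs l. \<Sum>t\<in>seqs l. (\<Prod>i<l. WS (s ! i, t ! i)) * lnAK s t) = - (real l * HA)"
proof -
 have "(\<Sum>s\<in>seqs l. \<Sum>t\<in>seqs l. (\<Prod>i<l. WS (s ! i, t ! i)) * lnAK s t)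
 = (\<Sum>zs\<in>seqs l. (\<Prod>i<l. WS (zs ! i)) * (\<Sum>i<l. ln (ak (fst (zs ! i)) (\<kappa> (zs ! i)))))"
 unfolding sum_seqs_zip lnAK_def by (intro sum.cong refl arg_cong2[where f="(*)"] prod.cong) (auto simp: seqs_iff)
 also have "... = (\<Sum>i<l. \<Sum>z\<in>UNIV. WS z * ln (ak (fst z) (\<kappa> z)))"
 by (rule sum_seqs_prod_sum) (rule pmf_on_sum[OF WS])
 finally show ?thesis by (simp add: HA_def)
qed

lemma sum_\<kappa>s: "(\<Sum>s\<in>seqs l. \<Sum>t\<in>seqs l. (\<Prod>i<l. WS (s ! i, t ! i)) * h (\<kappa>s s t)) = (\<Sum>k\<in>seqs l. (\<Prod>i<l. push WS \<kappa> (k ! i)) * h k)"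
proof -
 have "(\<Sum>s\<in>seqs l. \<Sum>t\<in>seqs l. (\<Prod>i<l. WS (s ! i, t ! i)) * h (\<kappa>s s t)) = (\<Sum>zs\<in>seqs l. (\<Prod>i<l. WS (zs ! i)) * h (map \<kappa> zs))"
 unfolding sum_seqs_zip \<kappa>s_def
 by (intro sum.cong refl arg_cong2[where f="(*)"] prod.cong) (auto simp: seqs_iff zip_map_fst_snd)
 then show ?thesis by (simp only: sum_seqs_push)
qed

text \<open>The balance of one superletter: information gained minus the losses through the mixture,
  mismatched slots, wrongly decoded slots, the source kernel and the words left unresolved by the
  hash.\<close>

theorem expected_ln_sm:
 assumes lam: "0 <= lam" and I0: "0 <= I"
 and mis: "(\<Sum>s\<in>seqs l. \<Sum>t\<in>seqs l. (\<Prod>i<l. WS (s ! i, t ! i)) * (\<Sum>B<T. of_bool (\<not> match s t B))) <= m"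
 and fail: "(\<Sum>k\<in>seqs l. (\<Prod>i<l. push WS \<kappa> (k ! i)) * (\<Sum>B<T. pf B k)) <= e"
 and EX: "(\<Sum>k\<in>seqs l. (\<Prod>i<l. push WS \<kappa> (k ! i)) * Xf k) <= x"
 shows "2 * real T * ln (1 - \<phi>) + real l * I - m * (2 * ln (1 / \<phi>) + lam + real w * I) - e * (ln (1 / \<phi>) + lam) - real l * HA - x
 <= (\<Sum>s\<in>seqs l. \<Sum>t\<in>seqs l. \<Sum>c\<in>seqs l. \<Sum>d\<in>seqs l. \<Sum>y\<in>seqs l. \<Sum>z\<in>seqs l.
 sup_law WS D D' W F F' s t c d y z * ln (sm s c y))"
proof -
 let ?P = "%s t. \<Prod>i<l. WS (s ! i, t ! i)"
 let ?c = "2 * ln \<phi> - lam - real w * I"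
 have P0: "0 <= ?P s t" for s t by (intro prod_nonneg) (simp add: pmf_on_nonneg[OF WS])
 have Psum: "(\<Sum>s\<in>seqs l. \<Sum>t\<in>seqs l. ?P s t) = 1" using WS by (intro sum_seqs_pair_iid)
 have l1: "ln \<phi> <= 0" "ln (1 / \<phi>) = - ln \<phi>" using \<phi> by (auto simp: ln_div)
 let ?A = "%s t. 2 * real T * ln (1 - \<phi>) + real T * (real w * I)"
 have "(\<Sum>s\<in>seqs l. \<Sum>t\<in>seqs l. ?P s t * (?A s t + (\<Sum>B<T. of_bool (\<not> match s t B)) * ?c + (\<Sum>B<T. pf B (\<kappa>s s t)) * (ln \<phi> - lam)
 + lnAK s t - Xf (\<kappa>s s t))) <= (\<Sum>s\<in>seqs l. \<Sum>t\<in>seqs l. ?P s t * outer s t (%c y. ln (sm s c y)))"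
 proof (intro sum_mono)
 fix s :: "'s list" and t :: "'t list" assume st: "s \<in> seqs l" "t \<in> seqs l"
 show "?P s t * (?A s t + (\<Sum>B<T. of_bool (\<not> match s t B)) * ?c + (\<Sum>B<T. pf B (\<kappa>s s t)) * (ln \<phi> - lam) + lnAK s t - Xf (\<kappa>s s t))
 <= ?P s t * outer s t (%c y. ln (sm s c y))"
 proof (cases "?P s t = 0")
 case False
 then have "0 < ?P s t" using P0[of s t] by (metis less_le)
 then show ?thesis using outer_ln_sm[OF st _ lam I0] by (intro mult_left_mono) auto
 qed (simp only: mult_zero_left order_refl)
 qed
 also have "... = (\<Sum>s\<in>seqs l. \<Sum>t\<in>seqs l. \<Sum>c\<in>seqs l. \<Sum>d\<in>seqs l. \<Sum>y\<in>seqs l. \<Sum>z\<in>seqs l.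
 sup_law WS D D' W F F' s t c d y z * ln (sm s c y))"
 unfolding outer_def sum_distrib_left by (intro sum.cong refl) (simp add: sup_law_def seqs_iff mult_ac)
 finally have main: "(\<Sum>s\<in>seqs l. \<Sum>t\<in>seqs l. ?P s t * (?A s t + (\<Sum>B<T. of_bool (\<not> match s t B)) * ?c + (\<Sum>B<T. pf B (\<kappa>s s t)) * (ln \<phi> - lam)
 + lnAK s t - Xf (\<kappa>s s t))) <= ..." .
 have "(\<Sum>s\<in>seqs l. \<Sum>t\<in>seqs l. ?P s t * (?A s t + (\<Sum>B<T. of_bool (\<not> match s t B)) * ?c + (\<Sum>B<T. pf B (\<kappa>s s t)) * (ln \<phi> - lam)
 + lnAK s t - Xf (\<kappa>s s t)))
 = (2 * real T * ln (1 - \<phi>) + real T * (real w * I)) * (\<Sum>s\<in>seqs l. \<Sum>t\<in>seqs l. ?P s t)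
 + ?c * (\<Sum>s\<in>seqs l. \<Sum>t\<in>seqs l. ?P s t * (\<Sum>B<T. of_bool (\<not> match s t B)))
 + (ln \<phi> - lam) * (\<Sum>s\<in>seqs l. \<Sum>t\<in>seqs l. ?P s t * (\<Sum>B<T. pf B (\<kappa>s s t)))
 + (\<Sum>s\<in>seqs l. \<Sum>t\<in>seqs l. ?P s t * lnAK s t) - (\<Sum>s\<in>seqs l. \<Sum>t\<in>seqs l. ?P s t * Xf (\<kappa>s s t))"
 unfolding sum_distrib_left[of ?c] sum_distrib_left[of "ln \<phi> - lam"] sum_distrib_left[of "2 * real T * ln (1 - \<phi>) + real T * (real w * I)"] sum.distrib[symmetric] sum_subtractf[symmetric]
 by (intro sum.cong refl) algebra
 also have "... = 2 * real T * ln (1 - \<phi>) + real l * I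
 + ?c * (\<Sum>s\<in>seqs l. \<Sum>t\<in>seqs l. ?P s t * (\<Sum>B<T. of_bool (\<not> match s t B)))
 + (ln \<phi> - lam) * (\<Sum>k\<in>seqs l. (\<Prod>i<l. push WS \<kappa> (k ! i)) * (\<Sum>B<T. pf B k))
 - real l * HA - (\<Sum>k\<in>seqs l. (\<Prod>i<l. push WS \<kappa> (k ! i)) * Xf k)"
 by (simp only: Psum exp_lnAK sum_\<kappa>s[of "%k. \<Sum>B<T. pf B k"] sum_\<kappa>s[of Xf]) (simp add: l)
 finally have eq: "(\<Sum>s\<in>seqs l. \<Sum>t\<in>seqs l. ?P s t * (?A s t + (\<Sum>B<T. of_bool (\<not> match s t B)) * ?c + (\<Sum>B<T. pf B (\<kappa>s s t)) * (ln \<phi> - lam)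
 + lnAK s t - Xf (\<kappa>s s t))) = ..." .
 have "?c * m <= ?c * (\<Sum>s\<in>seqs l. \<Sum>t\<in>seqs l. ?P s t * (\<Sum>B<T. of_bool (\<not> match s t B)))"
 using mis l1 lam I0 by (intro mult_left_mono_neg) (auto simp: add_nonneg_nonneg intro: order_trans[of _ 0])
 moreover have "(ln \<phi> - lam) * e <= (ln \<phi> - lam) * (\<Sum>k\<in>seqs l. (\<Prod>i<l. push WS \<kappa> (k ! i)) * (\<Sum>B<T. pf B k))"
 using fail l1 lam by (intro mult_left_mono_neg) auto
 moreover have "2 * real T * ln (1 - \<phi>) + real l * I - m * (2 * ln (1 / \<phi>) + lam + real w * I) - e * (ln (1 / \<phi>) + lam) - real l * HA - x
 = 2 * real T * ln (1 - \<phi>) + real l * I + ?c * m + (ln \<phi> - lam) * e - real l * HA - x"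
 by (simp add: l1 algebra_simps)
 ultimately show ?thesis using main eq EX by linarith
qed

end



section \<open>Random hash functions\<close>

text \<open>Random hashing: slot \<open>B\<close> hashes the letters of its pool, the positions \<open>c\<close> with \<open>B \<in> e c\<close>.\<close>

definition restr :: "nat => nat set => 'k list => 'k list" where
 "restr n P k = map (%c. if c \<in> P then k ! c else undefined) [0..<n]"

lemma restr_in: "restr n P k \<in> seqs n" by (simp add: restr_def seqs_iff)

lemma restr_eq: "P \<subseteq> {..<n} ==> restr n P k = restr n P k' \<longleftrightarrow> (\<forall>c\<in>P. k ! c = k' ! c)"
 by (auto simp: restr_def list_eq_iff_nth_eq subset_iff)

text \<open>The floor \<open>1 / M\<close> allows a slot to be disregarded later at the price of a
  factor \<open>M\<close>. It only doubles the collision probability: \<open>1 / M\<close> from true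
  collisions and \<open>1 / M\<close> from the floor.\<close>

lemma hash_pair_bound:
 fixes x x' :: "'k::finite list"
 assumes C: "finite C" "C ~= {}" and x: "x \<in> seqs n" "x' \<in> seqs n"
 defines "M \<equiv> real (card C)"
 shows "(\<Sum>g\<in>PiE (seqs n) (%_. C). fun_wt (seqs n) (%_ _. 1 / M) g * max (of_bool (g x' = g x)) (1 / M)) <= (if x' = x then 1 else 2 / M)"
proof -
 have M: "0 < M" "1 / M <= 1" using C by (auto simp: M_def card_gt_0_iff Suc_le_eq divide_le_eq_1)
 have D: "(\<Sum>c\<in>C. 1 / M) = 1" using M by (simp add: M_def)
 show ?thesis
 proof (cases "x' = x")
 case True
 have "(\<Sum>g\<in>PiE (seqs n :: 'k list set) (%_. C). fun_wt (seqs n :: 'k list set) (%_ _. 1 / M) g) = 1"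
 using C D by (intro fun_wt_total) auto
 then show ?thesis using True M by simp
 next
 case False
 have "(\<Sum>g\<in>PiE (seqs n) (%_. C). fun_wt (seqs n) (%_ _. 1 / M) g * max (of_bool (g x' = g x)) (1 / M))
 = (\<Sum>c\<in>C. \<Sum>c'\<in>C. 1 / M * (1 / M) * max (of_bool (c = c')) (1 / M))"
 using False x C D by (intro fun_wt_pair[where h="%c c'. max (of_bool (c = c')) (1 / M)"]) auto
 also have "... <= (\<Sum>c\<in>C. \<Sum>c'\<in>C. 1 / M * (1 / M) * (of_bool (c' = c) + 1 / M))"
 using M by (intro sum_mono mult_left_mono) (auto simp: max_def)
 also have "... = (\<Sum>c\<in>C. 1 / M * (1 / M) * (1 + 1))"
 proof (intro sum.cong refl)
 fix c assume "c \<in> C"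
 then have "(\<Sum>c'\<in>C. of_bool (c' = c) + 1 / M) = 1 + 1"
 using C D sum_of_bool_eq[of C c "%_. 1"] by (simp add: sum.distrib)
 then show "(\<Sum>c'\<in>C. 1 / M * (1 / M) * (of_bool (c' = c) + 1 / M)) = 1 / M * (1 / M) * (1 + 1)"
 by (simp only: sum_distrib_left[symmetric])
 qed
 also have "... = 2 / M" using M by (simp add: M_def)
 finally show ?thesis using False by simp
 qed
qed

text \<open>The words are grouped by the set \<open>A\<close> of slots whose pools distinguish them
  from \<open>k\<close>. A position can vary only if all its slots lie in \<open>A\<close>, and then
  its letters have total mass 1, written as \<open>Pt (k ! c)\<close> times its reciprocal; every
  other position is forced to equal \<open>k\<close>.\<close>

lemma patterns_bound:
 fixes Pt :: "'k::finite => real" and e :: "nat => nat set"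
 assumes Pt: "pmf_on Pt" and r: "0 <= r" and k: "k \<in> seqs n" "0 < (\<Prod>c<n. Pt (k ! c))"
 defines "pool \<equiv> %B. {c. c < n & B \<in> e c}"
 shows "(\<Sum>k'\<in>seqs n. (\<Prod>c<n. Pt (k' ! c)) * (\<Prod>B<T. if restr n (pool B) k' = restr n (pool B) k then 1 else r))
 <= (\<Prod>c<n. Pt (k ! c)) * (\<Sum>A\<in>Pow {..<T}. r ^ card A * (\<Prod>c<n. if e c \<inter> {..<T} \<subseteq> A then 1 / Pt (k ! c) else 1))"
proof -
 have Ptp: "0 < Pt (k ! c)" if "c < n" for c
 using k(2) that pmf_on_nonneg[OF Pt, of "k ! c"] by (auto simp: less_le prod_zero_iff)
 define df where "df k' = {B. B < T & restr n (pool B) k' ~= restr n (pool B) k}" for k'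
 have pr: "(\<Prod>B<T. if restr n (pool B) k' = restr n (pool B) k then 1 else r) = r ^ card (df k')" for k'
 proof -
 have "(\<Prod>B<T. if restr n (pool B) k' = restr n (pool B) k then 1 else r) = (\<Prod>B\<in>df k'. r)"
 unfolding df_def by (intro prod.mono_neutral_cong_right) auto
 then show ?thesis by simp
 qed
 have "(\<Sum>k'\<in>seqs n. (\<Prod>c<n. Pt (k' ! c)) * (\<Prod>B<T. if restr n (pool B) k' = restr n (pool B) k then 1 else r))
 = (\<Sum>A\<in>Pow {..<T}. \<Sum>k'\<in>{k'\<in>seqs n. df k' = A}. (\<Prod>c<n. Pt (k' ! c)) * r ^ card (df k'))"
 unfolding pr by (rule sum.group[symmetric]) (auto simp: df_def)
 also have "... <= (\<Sum>A\<in>Pow {..<T}. r ^ card A * ((\<Prod>c<n. Pt (k ! c)) * (\<Prod>c<n. if e c \<inter> {..<T} \<subseteq> A then 1 / Pt (k ! c) else 1)))"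
 proof (intro sum_mono)
 fix A assume A: "A \<in> Pow {..<T}"
 define g where "g c x = Pt x * (if e c \<inter> {..<T} \<subseteq> A then 1 else of_bool (x = k ! c))" for c x
 have g0: "0 <= g c x" for c x by (simp add: g_def pmf_on_nonneg[OF Pt])
 have "(\<Sum>k'\<in>{k'\<in>seqs n. df k' = A}. (\<Prod>c<n. Pt (k' ! c)) * r ^ card (df k')) = r ^ card A * (\<Sum>k'\<in>{k'\<in>seqs n. df k' = A}. \<Prod>c<n. Pt (k' ! c))"
 by (simp add: sum_distrib_left mult.commute)
 also have "(\<Sum>k'\<in>{k'\<in>seqs n. df k' = A}. \<Prod>c<n. Pt (k' ! c)) = (\<Sum>k'\<in>{k'\<in>seqs n. df k' = A}. \<Prod>c<n. g c (k' ! c))"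
 proof (intro sum.cong refl prod.cong)
 fix k' c assume k': "k' \<in> {k'\<in>seqs n. df k' = A}" and c: "c \<in> {..<n}"
 show "Pt (k' ! c) = g c (k' ! c)"
 proof (cases "e c \<inter> {..<T} \<subseteq> A")
 case False
 then obtain B where B: "B \<in> e c" "B < T" "B \<notin> A" by auto
 then have "restr n (pool B) k' = restr n (pool B) k" using k' by (auto simp: df_def)
 then have "\<forall>c\<in>pool B. k' ! c = k ! c" by (subst (asm) restr_eq) (auto simp: pool_def)
 then have "k' ! c = k ! c" using B c by (auto simp: pool_def)
 then show ?thesis using False by (simp add: g_def)
 qed (simp add: g_def)
 qed
 also have "r ^ card A * ... <= r ^ card A * (\<Sum>k'\<in>seqs n. \<Prod>c<n. g c (k' ! c))"
 using r by (intro mult_left_mono sum_mono2) (auto intro: prod_nonneg g0)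
 also have "(\<Sum>k'\<in>seqs n. \<Prod>c<n. g c (k' ! c)) = (\<Prod>c<n. \<Sum>x\<in>UNIV. g c x)" by (rule sum_seqs_prod)
 also have "... = (\<Prod>c<n. Pt (k ! c) * (if e c \<inter> {..<T} \<subseteq> A then 1 / Pt (k ! c) else 1))"
 proof (intro prod.cong refl)
 fix c assume "c \<in> {..<n}"
 then have p: "Pt (k ! c) ~= 0" using Ptp[of c] by simp
 have "(\<Sum>x\<in>UNIV. Pt x * of_bool (x = k ! c)) = Pt (k ! c)" by (rule sum_of_bool_eq) auto
 then show "(\<Sum>x\<in>UNIV. g c x) = Pt (k ! c) * (if e c \<inter> {..<T} \<subseteq> A then 1 / Pt (k ! c) else 1)"
 using p pmf_on_sum[OF Pt] by (cases "e c \<inter> {..<T} \<subseteq> A") (simp_all add: g_def)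
 qed
 finally show "(\<Sum>k'\<in>{k'\<in>seqs n. df k' = A}. (\<Prod>c<n. Pt (k' ! c)) * r ^ card (df k'))
 <= r ^ card A * ((\<Prod>c<n. Pt (k ! c)) * (\<Prod>c<n. if e c \<inter> {..<T} \<subseteq> A then 1 / Pt (k ! c) else 1))"
 by (simp only: prod.distrib)
 qed
 also have "... = (\<Prod>c<n. Pt (k ! c)) * (\<Sum>A\<in>Pow {..<T}. r ^ card A * (\<Prod>c<n. if e c \<inter> {..<T} \<subseteq> A then 1 / Pt (k ! c) else 1))"
 unfolding sum_distrib_left by (intro sum.cong refl) (simp only: mult_ac)
 finally show ?thesis .
qed

text \<open>Jensen's inequality, proved from the tangent of \<open>ln\<close> at
  \<open>m\<close>.\<close>

lemma weighted_ln_le: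
 fixes p x :: "'a => real"
 assumes "finite A" "!!a. a \<in> A ==> 0 <= p a" "(\<Sum>a\<in>A. p a) = 1" "!!a. a \<in> A ==> 0 < x a" "(\<Sum>a\<in>A. p a * x a) <= m" "0 < m"
 shows "(\<Sum>a\<in>A. p a * ln (x a)) <= ln m"
proof -
 have "(\<Sum>a\<in>A. p a * ln (x a)) <= (\<Sum>a\<in>A. p a * (x a / m + (ln m - 1)))"
 proof (intro sum_mono mult_left_mono assms(2))
 fix a assume a: "a \<in> A"
 have "ln (x a / m) <= x a / m - 1" using assms(4)[OF a] assms(6) by (intro ln_le_minus_one) simp
 then show "ln (x a) <= x a / m + (ln m - 1)" using assms(4)[OF a] assms(6) by (simp add: ln_divide_pos)
 qed
 also have "... = (\<Sum>a\<in>A. p a * x a) / m + (ln m - 1)"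
 unfolding distrib_left sum.distrib sum_distrib_right[symmetric] assms(3) by (simp add: sum_divide_distrib)
 also have "... <= 1 + (ln m - 1)" using assms(5,6) by (intro add_mono) (auto simp: divide_le_eq_1)
 finally show ?thesis by simp
qed

text \<open>By Jensen the mean of \<open>ln (\<Theta> g k)\<close> over random hashes is at most the
  logarithm of the mean of \<Theta>, which \<open>patterns_bound\<close> controls. Averaging also
  over \<open>k\<close> with weights \<open>Q\<close> lets one family of hashes be chosen.\<close>

theorem hash_exists:
 fixes Pt :: "'k::finite => real" and e :: "nat => nat set" and C :: "'m set" and Q :: "'k list => real"
 assumes Pt: "pmf_on Pt" and C: "finite C" "C ~= {}" and Q: "!!k. 0 <= Q k" "!!k. k \<in> seqs n ==> 0 < Q k ==> 0 < (\<Prod>c<n. Pt (k ! c))"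
 defines "pool \<equiv> %B. {c. c < n & B \<in> e c}"
 shows "\<exists>(H :: nat => 'k list => 'm) Xf. (\<forall>B<T. \<forall>k. H B k \<in> C)
 & (\<forall>B<T. \<forall>k k'. (\<forall>c\<in>pool B. k ! c = k' ! c) --> H B k = H B k')
 & (\<forall>k V. k \<in> seqs n --> 0 < (\<Prod>c<n. Pt (k ! c)) --> V \<subseteq> {..<T} -->
 (\<Sum>k'\<in>seqs n. (\<Prod>c<n. Pt (k' ! c)) * of_bool (\<forall>B<T. B \<notin> V --> H B k' = H B k))
 <= (\<Prod>c<n. Pt (k ! c)) * exp (Xf k + real (card V) * ln (real (card C))))
 & (\<Sum>k\<in>seqs n. Q k * Xf k) <= (\<Sum>k\<in>seqs n. Q k * ln (\<Sum>A\<in>Pow {..<T}. (2 / real (card C)) ^ card A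
 * (\<Prod>c<n. if e c \<inter> {..<T} \<subseteq> A then 1 / Pt (k ! c) else 1)))"
proof -
 define M where "M = real (card C)"
 have M: "1 <= M" using C by (simp add: M_def card_gt_0_iff Suc_le_eq)
 let ?PT = "%k. \<Prod>c<n. Pt (k ! c)"
 have PT0: "0 <= ?PT k" for k by (intro prod_nonneg) (simp add: pmf_on_nonneg[OF Pt])
 define H where "H g B k = g B (restr n (pool B) k)" for g :: "nat => 'k list => 'm" and B k
 \<comment> \<open>One quantity serves all sets \<open>V\<close> simultaneously: the indicator of
   agreement outside \<open>V\<close> is at most this product times
   \<open>M ^ card V\<close>.\<close>
 define \<Theta> where "\<Theta> g k = (\<Sum>k'\<in>seqs n. ?PT k' / ?PT k * (\<Prod>B<T. max (of_bool (H g B k' = H g B k)) (1 / M)))" for g k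
 define GS where "GS = PiE {..<T} (%_. PiE (seqs n :: 'k list set) (%_. C))"
 define wt where "wt g = (\<Prod>B<T. fun_wt (seqs n) (%_ _. 1 / M) (g B))" for g :: "nat => 'k list => 'm"
 define R where "R k = (\<Sum>A\<in>Pow {..<T}. (2 / M) ^ card A * (\<Prod>c<n. if e c \<inter> {..<T} \<subseteq> A then 1 / Pt (k ! c) else 1))" for k
 have finG: "finite GS" unfolding GS_def using C by (intro finite_PiE) auto
 have wt0: "0 <= wt g" for g unfolding wt_def fun_wt_def using M by (intro prod_nonneg) auto
 have wt1: "(\<Sum>g\<in>GS. wt g) = 1"
 proof -
 have "(\<Sum>g\<in>GS. wt g) = (\<Prod>B<T. \<Sum>g\<in>PiE (seqs n :: 'k list set) (%_. C). fun_wt (seqs n) (%_ _. 1 / M) g)"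
 unfolding GS_def wt_def using C by (subst prod_sum_PiE[symmetric]) (auto intro: finite_PiE)
 also have "... = 1" using C M by (intro prod.neutral ballI fun_wt_total) (auto simp: M_def)
 finally show ?thesis .
 qed
 have E\<Theta>: "(\<Sum>g\<in>GS. wt g * \<Theta> g k) <= R k" if k: "k \<in> seqs n" "0 < ?PT k" for k
 proof -
 have "(\<Sum>g\<in>GS. wt g * \<Theta> g k) = (\<Sum>k'\<in>seqs n. ?PT k' / ?PT k * (\<Sum>g\<in>GS. wt g * (\<Prod>B<T. max (of_bool (H g B k' = H g B k)) (1 / M))))"
 unfolding \<Theta>_def sum_distrib_left by (subst sum.swap) (simp only: mult_ac)
 also have "... <= (\<Sum>k'\<in>seqs n. ?PT k' / ?PT k * (\<Prod>B<T. if restr n (pool B) k' = restr n (pool B) k then 1 else 2 / M))"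
 proof (intro sum_mono mult_left_mono)
 fix k' :: "'k list" assume "k' \<in> seqs n"
 have "(\<Sum>g\<in>GS. wt g * (\<Prod>B<T. max (of_bool (H g B k' = H g B k)) (1 / M)))
 = (\<Sum>g\<in>GS. \<Prod>B<T. fun_wt (seqs n) (%_ _. 1 / M) (g B) * max (of_bool (g B (restr n (pool B) k') = g B (restr n (pool B) k))) (1 / M))"
 by (simp only: wt_def H_def prod.distrib)
 also have "... = (\<Prod>B<T. \<Sum>g\<in>PiE (seqs n) (%_. C). fun_wt (seqs n) (%_ _. 1 / M) g * max (of_bool (g (restr n (pool B) k') = g (restr n (pool B) k))) (1 / M))"
 unfolding GS_def using C by (subst prod_sum_PiE[symmetric]) (auto intro: finite_PiE)
 also have "... <= (\<Prod>B<T. if restr n (pool B) k' = restr n (pool B) k then 1 else 2 / M)"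
 proof (intro prod_mono conjI)
 fix B
 show "0 <= (\<Sum>g\<in>PiE (seqs n) (%_. C). fun_wt (seqs n) (%_ _. 1 / M) g * max (of_bool (g (restr n (pool B) k') = g (restr n (pool B) k))) (1 / M))"
 unfolding fun_wt_def using M by (intro sum_nonneg mult_nonneg_nonneg prod_nonneg) auto
 qed (unfold M_def, intro hash_pair_bound C restr_in)
 finally show "(\<Sum>g\<in>GS. wt g * (\<Prod>B<T. max (of_bool (H g B k' = H g B k)) (1 / M))) <= ..." .
 qed (simp add: PT0)
 also have "... = (\<Sum>k'\<in>seqs n. ?PT k' * (\<Prod>B<T. if restr n (pool B) k' = restr n (pool B) k then 1 else 2 / M)) / ?PT k"
 by (simp only: sum_divide_distrib times_divide_eq_left)
 also have "... <= ?PT k * R k / ?PT k"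
 unfolding R_def pool_def using M k by (intro divide_right_mono patterns_bound Pt PT0) auto
 also have "... = R k" using k(2) by (simp only: nonzero_mult_div_cancel_left less_imp_neq[symmetric] not_False_eq_True)
 finally show ?thesis .
 qed
 have \<Theta>1: "1 <= \<Theta> g k" if k: "k \<in> seqs n" "0 < ?PT k" for g k
 proof -
 have "?PT k / ?PT k = 1" using k(2) by (simp only: divide_self_if less_imp_neq[symmetric] if_False)
 then have "1 = ?PT k / ?PT k * (\<Prod>B<T. max (of_bool (H g B k = H g B k)) (1 / M))" using M by (simp only: simp_thms of_bool_eq max_def mult_1 prod.neutral_const) simp
 also have "... <= \<Theta> g k" unfolding \<Theta>_def using k M
 by (intro member_le_sum[where f="%k'. ?PT k' / ?PT k * (\<Prod>B<T. max (of_bool (H g B k' = H g B k)) (1 / M))"])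
 (auto intro!: mult_nonneg_nonneg divide_nonneg_nonneg PT0 prod_nonneg simp: max_def)
 finally show ?thesis .
 qed
 have ln\<Theta>: "(\<Sum>g\<in>GS. wt g * ln (\<Theta> g k)) <= ln (R k)" if k: "k \<in> seqs n" "0 < ?PT k" for k
 proof (rule weighted_ln_le[OF finG wt0 wt1 _ E\<Theta>[OF k]])
 show "0 < \<Theta> g k" for g using \<Theta>1[OF k, of g] by linarith
 have "1 = (\<Sum>g\<in>GS. wt g * 1)" using wt1 by simp
 also have "... <= (\<Sum>g\<in>GS. wt g * \<Theta> g k)" by (intro sum_mono mult_left_mono \<Theta>1 k wt0)
 finally show "0 < R k" using E\<Theta>[OF k] by linarith
 qed
 have "(\<Sum>g\<in>GS. wt g * (\<Sum>k\<in>seqs n. Q k * ln (\<Theta> g k))) = (\<Sum>k\<in>seqs n. Q k * (\<Sum>g\<in>GS. wt g * ln (\<Theta> g k)))"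
 unfolding sum_distrib_left by (subst sum.swap) (simp only: mult_ac)
 also have "... <= (\<Sum>k\<in>seqs n. Q k * ln (R k))"
 proof (intro sum_mono)
 fix k :: "'k list" assume k: "k \<in> seqs n"
 show "Q k * (\<Sum>g\<in>GS. wt g * ln (\<Theta> g k)) <= Q k * ln (R k)"
 proof (cases "Q k = 0")
 case False
 then have "0 < ?PT k" using Q(1)[of k] Q(2)[OF k] by simp
 then show ?thesis using Q(1) ln\<Theta>[OF k] by (intro mult_left_mono)
 qed simp
 qed
 finally have "\<exists>g\<in>GS. (\<Sum>k\<in>seqs n. Q k * ln (\<Theta> g k)) <= (\<Sum>k\<in>seqs n. Q k * ln (R k))"
 by (intro ex_le_weighted_average[where w=wt] finG wt0 wt1)
 then obtain g where g: "g \<in> GS" "(\<Sum>k\<in>seqs n. Q k * ln (\<Theta> g k)) <= (\<Sum>k\<in>seqs n. Q k * ln (R k))" by blast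
 have cancel: "x * (u * v) = y * (x / y * u) * v" if "y ~= 0" for x y u v :: real
 using that by simp
 have Z: "(\<Sum>k'\<in>seqs n. ?PT k' * of_bool (\<forall>B<T. B \<notin> V --> H g B k' = H g B k)) <= ?PT k * exp (ln (\<Theta> g k) + real (card V) * ln M)"
 if k: "k \<in> seqs n" "0 < ?PT k" and V: "V \<subseteq> {..<T}" for k V
 proof -
 have pt: "of_bool (\<forall>B<T. B \<notin> V --> H g B k' = H g B k) <= (\<Prod>B<T. max (of_bool (H g B k' = H g B k)) (1 / M)) * M ^ card V" for k'
 proof (cases "\<forall>B<T. B \<notin> V --> H g B k' = H g B k")
 case True
 have "1 = (\<Prod>B<T. if B \<in> V then 1 / M else 1) * M ^ card V"
 proof -
 have "(\<Prod>B<T. if B \<in> V then 1 / M else 1) = (\<Prod>B\<in>V. 1 / M)"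
 using V by (intro prod.mono_neutral_cong_right) auto
 then show ?thesis using M by (simp add: power_one_over)
 qed
 also have "... <= (\<Prod>B<T. max (of_bool (H g B k' = H g B k)) (1 / M)) * M ^ card V"
 using True M by (intro mult_right_mono prod_mono) auto
 finally show ?thesis using True by simp
 next
 case False
 have "0 <= (\<Prod>B<T. max (of_bool (H g B k' = H g B k)) (1 / M)) * M ^ card V"
 using M by (intro mult_nonneg_nonneg prod_nonneg) (auto simp: max_def)
 then show ?thesis using False by (simp only: of_bool_eq)
 qed
 have "(\<Sum>k'\<in>seqs n. ?PT k' * of_bool (\<forall>B<T. B \<notin> V --> H g B k' = H g B k))
 <= (\<Sum>k'\<in>seqs n. ?PT k' * ((\<Prod>B<T. max (of_bool (H g B k' = H g B k)) (1 / M)) * M ^ card V))"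
 by (intro sum_mono mult_left_mono pt PT0)
 also have "... = ?PT k * \<Theta> g k * M ^ card V"
 unfolding \<Theta>_def sum_distrib_left sum_distrib_right by (intro sum.cong refl cancel less_imp_neq[OF k(2), symmetric])
 also have "... = ?PT k * exp (ln (\<Theta> g k) + real (card V) * ln M)"
 using \<Theta>1[OF k, of g] M by (simp add: exp_add exp_of_nat_mult)
 finally show ?thesis .
 qed
 show ?thesis
 proof (rule exI[of _ "H g"], rule exI[of _ "%k. ln (\<Theta> g k)"], intro conjI allI impI)
 show "H g B k \<in> C" if "B < T" for B k using g(1) that by (auto simp: H_def GS_def PiE_iff restr_in)
 show "H g B k = H g B k'" if "B < T" "\<forall>c\<in>pool B. k ! c = k' ! c" for B k k'
 proof -
 have "restr n (pool B) k = restr n (pool B) k'" using that by (subst restr_eq) (auto simp: pool_def)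
 then show ?thesis by (simp add: H_def)
 qed
 qed (use Z g(2) in \<open>simp_all add: R_def M_def\<close>)
qed



section \<open>The expected logarithm of the number of confusable words\<close>

text \<open>A Chernoff bound for the soft positive part: the left side is about the positive part of
  \<open>v\<close>, and the free parameter \<open>s\<close> allows any exponential rate up to
  1.\<close>

lemma ln_1_plus_exp_le:
 fixes v s :: real
 assumes s: "0 < s" "s <= 1"
 shows "ln (1 + exp v) <= exp (s * v) / s"
proof (cases "v <= 0")
 case True
 have "ln (1 + exp v) <= exp v" by (rule ln_add_one_self_le_self2) (use exp_gt_zero[of v] in linarith)
 also have "... <= exp (s * v)" using True s by (simp add: mult_le_cancel_right1 mult_right_le_one_le mult_le_cancel_right2)
 also have "... <= exp (s * v) / s" using s by (simp add: le_divide_eq mult_left_le)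
 finally show ?thesis .
next
 case False
 have "ln (1 + exp v) = ln (exp v * (1 + exp (- v)))" by (simp add: distrib_left exp_minus add.commute)
 also have "... = v + ln (1 + exp (- v))" by (subst ln_mult_pos) (auto intro: add_pos_pos)
 also have "ln (1 + exp (- v)) <= exp (- v)" by (rule ln_add_one_self_le_self2) (use exp_gt_zero[of "- v"] in linarith)
 also have "exp (- v) <= 1" using False by simp
 also have "v + 1 <= (1 + s * v) / s" using s by (simp add: field_simps)
 also have "... <= exp (s * v) / s" using s by (intro divide_right_mono exp_ge_add_one_self) auto
 finally show ?thesis by simp
qed

text \<open>The sum is bounded through the product of the terms \<open>1 + exp (z a - C)\<close>, so
  every summand can have its own tilt \<open>s a\<close>. The allowance \<open>C\<close> is paid
  once and lowers all exponents.\<close>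

lemma ln_1_plus_sum_le:
 fixes z s :: "'a => real"
 assumes A: "finite A" and s: "!!a. a \<in> A ==> 0 < s a" "!!a. a \<in> A ==> s a <= 1" and C: "0 <= C"
 shows "ln (1 + (\<Sum>a\<in>A. exp (z a))) <= C + (\<Sum>a\<in>A. exp (s a * (z a - C)) / s a)"
proof -
 have p: "1 + (\<Sum>a\<in>A. y a) <= (\<Prod>a\<in>A. 1 + y a)" if "!!a. a \<in> A ==> 0 <= y a" for y :: "'a => real"
 using A that
 proof (induction A rule: finite_induct)
 case (insert a A)
 have P: "1 + (\<Sum>a\<in>A. y a) <= (\<Prod>a\<in>A. 1 + y a)" using insert by auto
 have S: "0 <= (\<Sum>a\<in>A. y a)" using insert by (intro sum_nonneg) auto
 have "1 + (y a + (\<Sum>a\<in>A. y a)) <= (1 + y a) * (1 + (\<Sum>a\<in>A. y a))" using insert.prems[of a] S by (simp add: distrib_left distrib_right)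
 also have "... <= (1 + y a) * (\<Prod>a\<in>A. 1 + y a)" using insert.prems[of a] P by (intro mult_left_mono) auto
 finally show ?case using insert by simp
 qed simp
 have pos: "0 < 1 + exp (v::real)" for v by (intro add_pos_pos) auto
 have "1 + (\<Sum>a\<in>A. exp (z a)) <= exp C * (1 + (\<Sum>a\<in>A. exp (z a - C)))"
 using C by (simp add: distrib_left sum_distrib_left exp_add[symmetric])
 also have "... <= exp C * (\<Prod>a\<in>A. 1 + exp (z a - C))" by (intro mult_left_mono p) auto
 finally have "ln (1 + (\<Sum>a\<in>A. exp (z a))) <= ln (exp C * (\<Prod>a\<in>A. 1 + exp (z a - C)))"
 by (intro ln_mono add_pos_nonneg sum_nonneg) auto
 also have "... = C + (\<Sum>a\<in>A. ln (1 + exp (z a - C)))"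
 using A by (subst ln_mult_pos) (auto intro!: prod_pos pos ln_prod simp: less_imp_neq[OF pos, symmetric])
 also have "... <= C + (\<Sum>a\<in>A. exp (s a * (z a - C)) / s a)"
 by (intro add_left_mono sum_mono ln_1_plus_exp_le s)
 finally show ?thesis .
qed

text \<open>By convexity the exponential lies below its chord on the interval from 0 to
  \<open>L\<close>; afterwards only the mean of \<open>x\<close> matters.\<close>

lemma exp_chord:
 fixes x s L :: real
 assumes x: "0 <= x" "x <= L" and L: "0 < L"
 shows "exp (s * x) <= 1 + x / L * (exp (s * L) - 1)"
proof -
 have "exp ((1 - x / L) *\<^sub>R 0 + (x / L) *\<^sub>R (s * L)) <= (1 - x / L) * exp 0 + (x / L) * exp (s * L)"
 using x L by (intro convex_onD[OF exp_convex]) auto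
 moreover have "(1 - x / L) *\<^sub>R 0 + (x / L) *\<^sub>R (s * L) = s * x" using L by (simp add: field_simps)
 ultimately show ?thesis by (simp add: algebra_simps)
qed

lemma sum_Pow_card:
 fixes F :: "nat => real"
 shows "(\<Sum>A\<in>Pow {..<T} - {{}}. F (card A)) = (\<Sum>r=1..T. real (T choose r) * F r)"
proof -
 have "(\<Sum>A\<in>Pow {..<T} - {{}}. F (card A)) = (\<Sum>r=1..T. \<Sum>A\<in>{A \<in> Pow {..<T} - {{}}. card A = r}. F (card A))"
 proof (rule sum.group[symmetric])
 show "card ` (Pow {..<T} - {{}}) \<subseteq> {1..T}"
 proof
 fix r assume "r \<in> card ` (Pow {..<T} - {{}})"
 then obtain A where A: "A \<subseteq> {..<T}" "A ~= {}" "r = card A" by auto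
 then have "finite A" by (auto intro: finite_subset)
 then show "r \<in> {1..T}" using A card_mono[of "{..<T}" A] by (simp add: card_gt_0_iff Suc_le_eq)
 qed
 qed auto
 also have "... = (\<Sum>r=1..T. real (T choose r) * F r)"
 proof (intro sum.cong refl)
 fix r assume r: "r \<in> {1..T}"
 then have "{A \<in> Pow {..<T} - {{}}. card A = r} = {A. A \<subseteq> {..<T} & card A = r}" by auto
 then show "(\<Sum>A\<in>{A \<in> Pow {..<T} - {{}}. card A = r}. F (card A)) = real (T choose r) * F r"
 using n_subsets[of "{..<T}" r] by simp
 qed
 finally show ?thesis .
qed

text \<open>Every source position is hashed in the two slots of a random pair, so a set of \<open>r\<close> confused slots
 out of \<open>T\<close> only resolves an expected fraction \<open>(r / T)\<^sup>2\<close> of the positions.\<close>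

theorem random_pairs:
 fixes P i :: "'k::finite => real" and s :: "nat => real"
 assumes P: "pmf_on P" and i: "!!x. 0 < P x ==> 0 <= i x" "!!x. 0 < P x ==> i x <= L" "(\<Sum>x\<in>UNIV. P x * i x) <= h"
 and L: "0 < L" and T: "0 < T" and C: "0 <= C" and s: "!!r. 0 < r ==> r <= T ==> 0 < s r" "!!r. 0 < r ==> r <= T ==> s r <= 1"
 shows "\<exists>e. (\<forall>c. e c \<subseteq> {..<T} & e c ~= {} & card (e c) <= 2) \<and>
 (\<Sum>k\<in>seqs n. (\<Prod>c<n. P (k ! c)) * ln (\<Sum>A\<in>Pow {..<T}. exp (- real (card A) * \<mu>) *
 (\<Prod>c<n. if e c \<inter> {..<T} \<subseteq> A then exp (i (k ! c)) else 1)))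
 <= C + (\<Sum>r=1..T. real (T choose r) * (exp (s r * (- real r * \<mu> - C) + real n * (real r / real T)\<^sup>2 * (h / L * (exp (s r * L) - 1))) / s r))"
proof -
 let ?G = "PiE {..<n} (%_. {..<T} \<times> {..<T})"
 let ?PP = "%k. \<Prod>c<n. P (k ! c)"
 define wt where "wt = fun_wt {..<n} (%_ (_ :: nat \<times> nat). 1 / (real T)\<^sup>2)"
 \<comment> \<open>The two slots are drawn with replacement, so a set of \<open>r\<close> slots
   contains both with probability exactly \<open>(r / T)\<^sup>2\<close>. Indices beyond
   \<open>n\<close> get slot 0 to keep the sets nonempty.\<close>
 define e where "e g c = (if c < n then {fst (g c), snd (g c)} else {0 :: nat})" for g :: "nat => nat \<times> nat" and c :: nat
 define z where "z g k A = - real (card A) * \<mu> + (\<Sum>c<n. if e g c \<inter> {..<T} \<subseteq> A then i (k ! c) else 0)" for g k A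
 define F where "F r = exp (s r * (- real r * \<mu> - C) + real n * (real r / real T)\<^sup>2 * (h / L * (exp (s r * L) - 1))) / s r" for r
 let ?S = "Pow {..<T} - {{}}"
 have finG: "finite ?G" by (intro finite_PiE) auto
 have PP0: "0 <= ?PP k" for k by (intro prod_nonneg) (simp add: pmf_on_nonneg[OF P])
 have wt0: "0 <= wt g" for g by (auto simp: wt_def fun_wt_def intro!: prod_nonneg)
 have wt1: "(\<Sum>g\<in>?G. wt g) = 1"
 unfolding wt_def using T by (intro fun_wt_total) (auto simp: card_cartesian_product power2_eq_square)
 have sA: "0 < s (card A)" "s (card A) <= 1" if "A \<in> ?S" for A
 proof -
 have "finite A" using that by (auto intro: finite_subset)
 then have "0 < card A" "card A <= T" using that card_mono[of "{..<T}" A] by (auto simp: card_gt_0_iff)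
 then show "0 < s (card A)" "s (card A) <= 1" using s by auto
 qed
 have lnz: "ln (\<Sum>A\<in>Pow {..<T}. exp (- real (card A) * \<mu>) * (\<Prod>c<n. if e g c \<inter> {..<T} \<subseteq> A then exp (i (k ! c)) else 1))
 <= C + (\<Sum>A\<in>?S. exp (s (card A) * (z g k A - C)) / s (card A))" if g: "g \<in> ?G" for g k
 proof -
 have ex: "exp (- real (card A) * \<mu>) * (\<Prod>c<n. if e g c \<inter> {..<T} \<subseteq> A then exp (i (k ! c)) else 1) = exp (z g k A)" for A
 unfolding z_def exp_add exp_sum[OF finite_lessThan] by (intro arg_cong2[where f="(*)"] prod.cong) auto
 \<comment> \<open>Every position belongs to some slot, so the empty set of confused slots frees no
   position and contributes exactly 1, the 1 in \<open>ln_1_plus_sum_le\<close>.\<close>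
 have ne: "\<not> e g c \<inter> {..<T} \<subseteq> {}" if "c < n" for c
 proof -
 have "g c \<in> {..<T} \<times> {..<T}" using g that by (simp only: PiE_iff lessThan_iff Ball_def)
 then show ?thesis using that by (auto simp: e_def)
 qed
 then have "z g k {} = 0" unfolding z_def by (auto intro!: sum.neutral)
 then have "(\<Sum>A\<in>Pow {..<T}. exp (z g k A)) = 1 + (\<Sum>A\<in>?S. exp (z g k A))"
 by (subst sum.remove[of _ "{}"]) auto
 then show ?thesis unfolding ex using C sA by (simp only:) (intro ln_1_plus_sum_le; simp)
 qed
 have avg: "(\<Sum>g\<in>?G. wt g * (\<Sum>k\<in>seqs n. ?PP k * exp (s (card A) * (z g k A - C)))) <= F (card A) * s (card A)" if A: "A \<in> ?S" for A
 proof -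
 let ?s = "s (card A)" and ?\<theta> = "real (card A) / real T"
 have s0: "0 < ?s" using sA[OF A] by simp
 have Asub: "A \<subseteq> {..<T}" using A by auto
 define gg where "gg p x = (if {fst p, snd p} \<inter> {..<T} \<subseteq> A then exp (?s * i x) else 1)" for p :: "nat \<times> nat" and x
 have zz: "exp (?s * (z g k A - C)) = exp (?s * (- real (card A) * \<mu> - C)) * (\<Prod>c<n. gg (g c) (k ! c))" for g k
 proof -
 have "?s * (z g k A - C) = ?s * (- real (card A) * \<mu> - C) + (\<Sum>c<n. if e g c \<inter> {..<T} \<subseteq> A then ?s * i (k ! c) else 0)"
 unfolding z_def by (simp add: algebra_simps sum_distrib_left if_distrib cong: if_cong)
 then show ?thesis
 unfolding exp_add exp_sum[OF finite_lessThan] by (auto simp: gg_def e_def exp_add exp_sum intro!: prod.cong)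
 qed
 have inner: "(\<Sum>g\<in>?G. wt g * (\<Prod>c<n. gg (g c) (k ! c))) = (\<Prod>c<n. 1 + ?\<theta>\<^sup>2 * (exp (?s * i (k ! c)) - 1))" for k
 proof -
 have "(\<Sum>g\<in>?G. wt g * (\<Prod>c<n. gg (g c) (k ! c))) = (\<Sum>g\<in>?G. \<Prod>c<n. 1 / (real T)\<^sup>2 * gg (g c) (k ! c))"
 by (simp only: wt_def fun_wt_def prod.distrib)
 also have "... = (\<Prod>c<n. \<Sum>p\<in>{..<T} \<times> {..<T}. 1 / (real T)\<^sup>2 * gg p (k ! c))"
 by (rule prod_sum_PiE[symmetric]) auto
 also have "... = (\<Prod>c<n. 1 + ?\<theta>\<^sup>2 * (exp (?s * i (k ! c)) - 1))"
 proof (intro prod.cong refl)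
 fix c
 let ?E = "exp (?s * i (k ! c))"
 have "(\<Sum>p\<in>{..<T} \<times> {..<T}. gg p (k ! c)) = (\<Sum>p\<in>{..<T} \<times> {..<T}. 1 + of_bool (p \<in> A \<times> A) * (?E - 1))"
 by (intro sum.cong refl) (auto simp: gg_def)
 also have "... = real (T * T) + (\<Sum>p\<in>A \<times> A. ?E - 1)"
 proof -
 have "(\<Sum>p\<in>{..<T} \<times> {..<T}. of_bool (p \<in> A \<times> A) * (?E - 1)) = (\<Sum>p\<in>A \<times> A. ?E - 1)"
 using Asub by (intro sum.mono_neutral_cong_right) auto
 then show ?thesis by (simp add: sum.distrib card_cartesian_product)
 qed
 also have "... = (real T)\<^sup>2 * (1 + ?\<theta>\<^sup>2 * (?E - 1))"
 using T by (simp add: card_cartesian_product power2_eq_square field_simps)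
 finally show "(\<Sum>p\<in>{..<T} \<times> {..<T}. 1 / (real T)\<^sup>2 * gg p (k ! c)) = 1 + ?\<theta>\<^sup>2 * (?E - 1)"
 unfolding sum_distrib_left[symmetric] using T by simp
 qed
 finally show ?thesis .
 qed
 let ?x = "?\<theta>\<^sup>2 * (h / L * (exp (?s * L) - 1))"
 \<comment> \<open>The chord bound makes the factor linear in \<open>i x\<close>, so that only the
   mean bound \<open>h\<close> enters.\<close>
 have letter: "(\<Sum>x\<in>UNIV. P x * (1 + ?\<theta>\<^sup>2 * (exp (?s * i x) - 1))) <= exp ?x"
 proof -
 have "(\<Sum>x\<in>UNIV. P x * (1 + ?\<theta>\<^sup>2 * (exp (?s * i x) - 1))) <= (\<Sum>x\<in>UNIV. P x * (1 + ?\<theta>\<^sup>2 * (i x / L * (exp (?s * L) - 1))))"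
 proof (intro sum_mono)
 fix x
 show "P x * (1 + ?\<theta>\<^sup>2 * (exp (?s * i x) - 1)) <= P x * (1 + ?\<theta>\<^sup>2 * (i x / L * (exp (?s * L) - 1)))"
 proof (cases "P x = 0")
 case False
 then have "0 < P x" using pmf_on_nonneg[OF P, of x] by simp
 then have "exp (?s * i x) <= 1 + i x / L * (exp (?s * L) - 1)" using i L by (intro exp_chord) auto
 then show ?thesis using \<open>0 < P x\<close> by (intro mult_left_mono add_left_mono) auto
 qed simp
 qed
 also have "... = (\<Sum>x\<in>UNIV. P x + (P x * i x) * (?\<theta>\<^sup>2 / L * (exp (?s * L) - 1)))"
 by (intro sum.cong refl) (simp only: distrib_left mult_1_right times_divide_eq_left times_divide_eq_right mult_ac)
 also have "... = 1 + (\<Sum>x\<in>UNIV. P x * i x) * (?\<theta>\<^sup>2 / L * (exp (?s * L) - 1))"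
 by (simp only: sum.distrib sum_distrib_right[symmetric] pmf_on_sum[OF P])
 also have "... <= 1 + h * (?\<theta>\<^sup>2 / L * (exp (?s * L) - 1))"
 using i(3) L s0 by (intro add_left_mono mult_right_mono) auto
 also have "... = 1 + ?x" by simp
 also have "... <= exp ?x" by (rule exp_ge_add_one_self)
 finally show ?thesis .
 qed
 have th: "?\<theta>\<^sup>2 <= 1"
 proof -
 have "card A <= T" using card_mono[OF _ Asub] by simp
 then show ?thesis using T by (intro power_le_one) (auto simp: divide_le_eq_1)
 qed
 have fac: "0 <= 1 + ?\<theta>\<^sup>2 * (exp v - 1)" for v :: real
 proof -
 have "1 + ?\<theta>\<^sup>2 * (exp v - 1) = (1 - ?\<theta>\<^sup>2) + ?\<theta>\<^sup>2 * exp v" by (simp add: algebra_simps)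
 also have "0 <= ..." using th by (intro add_nonneg_nonneg mult_nonneg_nonneg) auto
 finally show ?thesis .
 qed
 have "(\<Sum>g\<in>?G. wt g * (\<Sum>k\<in>seqs n. ?PP k * exp (?s * (z g k A - C))))
 = exp (?s * (- real (card A) * \<mu> - C)) * (\<Sum>k\<in>seqs n. ?PP k * (\<Sum>g\<in>?G. wt g * (\<Prod>c<n. gg (g c) (k ! c))))"
 unfolding zz sum_distrib_left by (subst sum.swap) (simp only: mult_ac)
 also have "(\<Sum>k\<in>seqs n. ?PP k * (\<Sum>g\<in>?G. wt g * (\<Prod>c<n. gg (g c) (k ! c))))
 = (\<Prod>c<n. \<Sum>x\<in>UNIV. P x * (1 + ?\<theta>\<^sup>2 * (exp (?s * i x) - 1)))"
 unfolding inner prod.distrib[symmetric] by (rule sum_seqs_prod[where g="%_ x. P x * (1 + ?\<theta>\<^sup>2 * (exp (?s * i x) - 1))"])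
 also have "exp (?s * (- real (card A) * \<mu> - C)) * ... <= exp (?s * (- real (card A) * \<mu> - C)) * (\<Prod>c<n. exp ?x)"
 by (intro mult_left_mono prod_mono conjI letter sum_nonneg mult_nonneg_nonneg fac) (auto simp: pmf_on_nonneg[OF P])
 also have "... = F (card A) * ?s" using s0 unfolding F_def exp_add mult.assoc[of "real n"] exp_of_nat_mult by simp
 finally show ?thesis .
 qed
 have "(\<Sum>g\<in>?G. wt g * (\<Sum>k\<in>seqs n. ?PP k * (\<Sum>A\<in>?S. exp (s (card A) * (z g k A - C)) / s (card A))))
 = (\<Sum>A\<in>?S. (\<Sum>g\<in>?G. wt g * (\<Sum>k\<in>seqs n. ?PP k * exp (s (card A) * (z g k A - C)))) / s (card A))"
 proof -
 have "(\<Sum>g\<in>?G. wt g * (\<Sum>k\<in>seqs n. ?PP k * (\<Sum>A\<in>?S. exp (s (card A) * (z g k A - C)) / s (card A))))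
 = (\<Sum>g\<in>?G. \<Sum>A\<in>?S. \<Sum>k\<in>seqs n. wt g * (?PP k * exp (s (card A) * (z g k A - C))) / s (card A))"
 unfolding sum_distrib_left by (intro sum.cong refl, subst sum.swap) (simp add: mult.assoc)
 also have "... = (\<Sum>A\<in>?S. \<Sum>g\<in>?G. \<Sum>k\<in>seqs n. wt g * (?PP k * exp (s (card A) * (z g k A - C))) / s (card A))"
 by (rule sum.swap)
 finally show ?thesis unfolding sum_distrib_left sum_divide_distrib .
 qed
 also have "... <= (\<Sum>A\<in>?S. F (card A))"
 proof (intro sum_mono)
 fix A assume A: "A \<in> ?S"
 show "(\<Sum>g\<in>?G. wt g * (\<Sum>k\<in>seqs n. ?PP k * exp (s (card A) * (z g k A - C)))) / s (card A) <= F (card A)"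
 using avg[OF A] sA(1)[OF A] by (simp only: divide_le_eq if_True)
 qed
 also have "... = (\<Sum>r=1..T. real (T choose r) * F r)" by (rule sum_Pow_card)
 finally have "\<exists>g\<in>?G. (\<Sum>k\<in>seqs n. ?PP k * (\<Sum>A\<in>?S. exp (s (card A) * (z g k A - C)) / s (card A))) <= (\<Sum>r=1..T. real (T choose r) * F r)"
 by (intro ex_le_weighted_average[where w=wt] finG wt0 wt1)
 then obtain g where g: "g \<in> ?G" "(\<Sum>k\<in>seqs n. ?PP k * (\<Sum>A\<in>?S. exp (s (card A) * (z g k A - C)) / s (card A))) <= (\<Sum>r=1..T. real (T choose r) * F r)"
 by blast
 have one: "(\<Sum>k\<in>seqs n. ?PP k) = 1" using sum_seqs_iid[of n "%_. P"] P by simp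
 have "(\<Sum>k\<in>seqs n. ?PP k * ln (\<Sum>A\<in>Pow {..<T}. exp (- real (card A) * \<mu>) * (\<Prod>c<n. if e g c \<inter> {..<T} \<subseteq> A then exp (i (k ! c)) else 1)))
 <= (\<Sum>k\<in>seqs n. ?PP k * (C + (\<Sum>A\<in>?S. exp (s (card A) * (z g k A - C)) / s (card A))))"
 by (intro sum_mono mult_left_mono lnz g PP0)
 also have "... = C + (\<Sum>k\<in>seqs n. ?PP k * (\<Sum>A\<in>?S. exp (s (card A) * (z g k A - C)) / s (card A)))"
 unfolding distrib_left sum.distrib sum_distrib_right[symmetric] one by simp
 also have "... <= C + (\<Sum>r=1..T. real (T choose r) * F r)" using g(2) by simp
 finally have "(\<Sum>k\<in>seqs n. ?PP k * ln (\<Sum>A\<in>Pow {..<T}. exp (- real (card A) * \<mu>) * (\<Prod>c<n. if e g c \<inter> {..<T} \<subseteq> A then exp (i (k ! c)) else 1)))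
 <= C + (\<Sum>r=1..T. real (T choose r) * F r)" .
 moreover have "e g c \<subseteq> {..<T} & e g c ~= {} & card (e g c) <= 2" for c
 proof (cases "c < n")
 case True
 then have "g c \<in> {..<T} \<times> {..<T}" using g(1) by (simp only: PiE_iff lessThan_iff Ball_def)
 then show ?thesis using True by (auto simp: e_def card_insert_if)
 qed (use T in \<open>auto simp: e_def\<close>)
 ultimately show ?thesis unfolding F_def by blast
qed

lemma expectation_sum_seqs:
 fixes P x :: "'k::finite => real"
 assumes P: "pmf_on P"
 shows "(\<Sum>k\<in>seqs n. (\<Prod>c<n. P (k ! c)) * (\<Sum>c<n. x (k ! c))) = real n * (\<Sum>a\<in>UNIV. P a * x a)"
 using sum_seqs_prod_sum[where n=n and p="%_. P" and x="%_. x"] P by (simp add: pmf_on_sum)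

lemma variance_sum_seqs:
 fixes P x :: "'k::finite => real"
 assumes P: "pmf_on P" and m: "(\<Sum>a\<in>UNIV. P a * x a) = 0"
 shows "(\<Sum>k\<in>seqs n. (\<Prod>c<n. P (k ! c)) * (\<Sum>c<n. x (k ! c))\<^sup>2) = real n * (\<Sum>a\<in>UNIV. P a * (x a)\<^sup>2)"
proof (induction n)
 case (Suc n)
 let ?Q = "%k. \<Prod>c<n. P (k ! c)" and ?S = "%k. \<Sum>c<n. x (k ! c)"
 have one: "(\<Sum>k\<in>seqs n. ?Q k) = 1" using sum_seqs_iid[of n "%_. P"] P by simp
 have mean: "(\<Sum>k\<in>seqs n. ?Q k * ?S k) = 0" using expectation_sum_seqs[OF P, of n x] m by simp
 have "(\<Sum>k\<in>seqs (Suc n). (\<Prod>c<Suc n. P (k ! c)) * (\<Sum>c<Suc n. x (k ! c))\<^sup>2)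
 = (\<Sum>a\<in>UNIV. \<Sum>k\<in>seqs n. P a * (x a)\<^sup>2 * ?Q k + 2 * (P a * x a) * (?Q k * ?S k) + P a * (?Q k * (?S k)\<^sup>2))"
 by (simp add: sum_seqs_Suc prod.lessThan_Suc_shift sum.lessThan_Suc_shift power2_sum algebra_simps del: prod.lessThan_Suc sum.lessThan_Suc)
 also have "... = (\<Sum>a\<in>UNIV. P a * (x a)\<^sup>2) + real n * (\<Sum>a\<in>UNIV. P a * (x a)\<^sup>2)"
 using pmf_on_sum[OF P] by (simp add: sum.distrib sum_distrib_left[symmetric] sum_distrib_right[symmetric] one mean Suc.IH)
 finally show ?case by (simp add: algebra_simps)
qed simp

text \<open>With margin \<open>E\<close> above the mean the soft positive part is at most
  \<open>ln 2\<close> plus the squared deviation over \<open>4 * E\<close>, so the variance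
  suffices; for values between 0 and \<open>L\<close> the variance is at most
  \<open>h * L\<close>.\<close>

lemma one_slot_bound:
 fixes P i :: "'k::finite => real"
 assumes P: "pmf_on P" and i: "!!x. 0 < P x ==> 0 <= i x" "!!x. 0 < P x ==> i x <= L" "(\<Sum>x\<in>UNIV. P x * i x) <= h"
 and E: "0 < E" and L: "0 < L" and \<mu>: "real n * h + E <= \<mu>"
 shows "(\<Sum>k\<in>seqs n. (\<Prod>c<n. P (k ! c)) * ln (1 + exp ((\<Sum>c<n. i (k ! c)) - \<mu>))) <= ln 2 + real n * (h * L) / (4 * E)"
proof -
 let ?PP = "%k. \<Prod>c<n. P (k ! c)"
 define m where "m = (\<Sum>x\<in>UNIV. P x * i x)"
 define x where "x a = i a - m" for a
 have PP0: "0 <= ?PP k" for k by (intro prod_nonneg) (simp add: pmf_on_nonneg[OF P])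
 have one: "(\<Sum>k\<in>seqs n. ?PP k) = 1" using sum_seqs_iid[of n "%_. P"] P by simp
 have mx: "(\<Sum>a\<in>UNIV. P a * x a) = 0"
 unfolding x_def right_diff_distrib sum_subtractf sum_distrib_right[symmetric] pmf_on_sum[OF P] by (simp add: m_def)
 have pt: "ln (1 + exp ((\<Sum>c<n. i (k ! c)) - \<mu>)) <= ln 2 + (\<Sum>c<n. x (k ! c))\<^sup>2 / (4 * E)" for k
 proof -
 let ?D = "\<Sum>c<n. x (k ! c)"
 have "(\<Sum>c<n. i (k ! c)) = ?D + real n * m" by (simp add: x_def sum_subtractf)
 moreover have "real n * m <= real n * h" using i(3) by (intro mult_left_mono) (auto simp: m_def)
 ultimately have v: "(\<Sum>c<n. i (k ! c)) - \<mu> <= ?D - E" using \<mu> by linarith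
 \<comment> \<open>This square yields \<open>D - E <= D\<^sup>2 / (4 * E)\<close>, which turns the
   excess over the margin into a second moment.\<close>
 have "0 <= (?D - 2 * E)\<^sup>2" by simp
 then have "4 * E * (?D - E) <= ?D\<^sup>2" by (simp add: power2_eq_square algebra_simps)
 then have q: "?D - E <= ?D\<^sup>2 / (4 * E)" using E by (simp add: field_simps)
 have q0: "0 <= ?D\<^sup>2 / (4 * E)" using E by simp
 have "1 + exp ((\<Sum>c<n. i (k ! c)) - \<mu>) <= exp (?D\<^sup>2 / (4 * E)) + exp (?D\<^sup>2 / (4 * E))"
 using v q q0 by (intro add_mono) auto
 then have "ln (1 + exp ((\<Sum>c<n. i (k ! c)) - \<mu>)) <= ln (2 * exp (?D\<^sup>2 / (4 * E)))"
 by (intro ln_mono) (auto intro: add_pos_pos)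
 then show ?thesis by (simp add: ln_mult_pos)
 qed
 have var: "(\<Sum>a\<in>UNIV. P a * (x a)\<^sup>2) <= h * L"
 proof -
 have "(\<Sum>a\<in>UNIV. P a * (x a)\<^sup>2) = (\<Sum>a\<in>UNIV. P a * (i a)\<^sup>2 - 2 * m * (P a * i a) + m\<^sup>2 * P a)"
 by (simp add: x_def power2_diff algebra_simps)
 also have "... = (\<Sum>a\<in>UNIV. P a * (i a)\<^sup>2) - m\<^sup>2"
 unfolding sum.distrib sum_subtractf sum_distrib_left[symmetric] pmf_on_sum[OF P] by (simp add: m_def[symmetric] power2_eq_square)
 also have "... <= (\<Sum>a\<in>UNIV. P a * (i a)\<^sup>2)" by simp
 also have "... <= (\<Sum>a\<in>UNIV. (P a * i a) * L)"
 proof (intro sum_mono)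
 fix a show "P a * (i a)\<^sup>2 <= P a * i a * L"
 proof (cases "P a = 0")
 case False
 then have "0 < P a" using pmf_on_nonneg[OF P, of a] by simp
 then show ?thesis using i(1,2)[of a] by (simp add: power2_eq_square mult_left_mono)
 qed simp
 qed
 also have "... <= h * L" unfolding sum_distrib_right[symmetric] using i(3) L by (intro mult_right_mono) auto
 finally show ?thesis .
 qed
 have "(\<Sum>k\<in>seqs n. ?PP k * ln (1 + exp ((\<Sum>c<n. i (k ! c)) - \<mu>))) <= (\<Sum>k\<in>seqs n. ?PP k * (ln 2 + (\<Sum>c<n. x (k ! c))\<^sup>2 / (4 * E)))"
 by (intro sum_mono mult_left_mono pt PP0)
 also have "... = ln 2 + (\<Sum>k\<in>seqs n. ?PP k * (\<Sum>c<n. x (k ! c))\<^sup>2) / (4 * E)"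
 unfolding distrib_left sum.distrib sum_distrib_right[symmetric] one by (simp add: sum_divide_distrib)
 also have "... <= ln 2 + real n * (h * L) / (4 * E)"
 unfolding variance_sum_seqs[OF P mx] using var E by (intro add_left_mono divide_right_mono mult_left_mono) auto
 finally show ?thesis .
qed



section \<open>The Chernoff sum over sets of confused slots\<close>

lemma exp_le_quadratic: "0 <= u ==> u <= 1 ==> exp u <= 1 + u + 3 / 4 * u\<^sup>2" for u :: real
proof -
 assume u: "0 <= u" "u <= 1"
 obtain t where t: "\<bar>t\<bar> <= \<bar>u\<bar>" "exp u = (\<Sum>m<5. u ^ m / fact m) + exp t / fact 5 * u ^ 5"
 using Maclaurin_exp_le[of u 5] by blast
 have "exp t <= exp 1" using t u by auto
 then have "exp t <= 3" using exp_le by linarith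
 then have "exp t / fact 5 * u ^ 5 <= 3 / fact 5 * u ^ 5" using u by (intro mult_right_mono divide_right_mono) auto
 moreover have "u ^ 3 <= u\<^sup>2" "u ^ 4 <= u\<^sup>2" "u ^ 5 <= u\<^sup>2" using u by (intro power_decreasing; simp)+
 moreover have "(\<Sum>m<5. u ^ m / fact m) = 1 + u + u\<^sup>2 / 2 + u ^ 3 / 6 + u ^ 4 / 24"
 by (simp add: eval_nat_numeral fact_numeral)
 moreover have "3 / fact 5 * u ^ 5 = u ^ 5 / 40" by (simp add: eval_nat_numeral fact_numeral)
 moreover have "0 <= u\<^sup>2" by simp
 moreover define R where "R = exp t / fact 5 * u ^ 5"
 ultimately show ?thesis using t(2) unfolding R_def[symmetric] by linarith
qed

lemma exp_1_ge: "27/10 <= exp (1::real)"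
proof -
 obtain t where t: "exp 1 = (\<Sum>m<5. 1 ^ m / fact m) + exp t / fact 5 * (1::real) ^ 5"
 using Maclaurin_exp_le[of 1 5] by blast
 moreover have "0 <= exp t / fact 5 * (1::real) ^ 5" by simp
 moreover have "(\<Sum>m<5. (1::real) ^ m / fact m) = 65 / 24" by (simp add: eval_nat_numeral fact_numeral)
 ultimately show ?thesis by linarith
qed

text \<open>A single binomial probability with parameter \<open>\<theta> = r / T\<close> is at most
  1, and \<open>(1 - \<theta>) * ln (1 / (1 - \<theta>)) <= \<theta>\<close> simplifies the second
  factor. The second bound exchanges \<open>r\<close> and \<open>T - r\<close>.\<close>

lemma choose_le_exp:
 assumes r: "0 < r" "r < T"
 shows "real (T choose r) <= exp (real r * (1 + ln (real T / real r)))"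
 "real (T choose r) <= exp (real (T - r) * (1 + ln (real T / real (T - r))))"
proof -
 have G: "real (T choose r) <= exp (real r * (1 + ln (real T / real r)))" if r: "0 < r" "r < T" for r
 proof -
 define \<theta> where "\<theta> = real r / real T"
 have \<theta>: "0 < \<theta>" "\<theta> < 1" using r by (auto simp: \<theta>_def)
 have "real (T choose r) * \<theta> ^ r * (1 - \<theta>) ^ (T - r) <= (\<Sum>k\<le>T. real (T choose k) * \<theta> ^ k * (1 - \<theta>) ^ (T - k))"
 using \<theta> r by (intro member_le_sum[where f="%k. real (T choose k) * \<theta> ^ k * (1 - \<theta>) ^ (T - k)"]) auto
 also have "... = 1" using binomial_ring[of \<theta> "1 - \<theta>" T] by simp
 finally have le: "real (T choose r) * (\<theta> ^ r * (1 - \<theta>) ^ (T - r)) <= 1" by (simp only: mult.assoc)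
 have "exp (- (real r * (1 + ln (real T / real r)))) <= \<theta> ^ r * (1 - \<theta>) ^ (T - r)"
 proof -
 have "ln (1 / (1 - \<theta>)) <= 1 / (1 - \<theta>) - 1" using \<theta> by (intro ln_le_minus_one) simp
 then have "(1 - \<theta>) * ln (1 / (1 - \<theta>)) <= (1 - \<theta>) * (1 / (1 - \<theta>) - 1)" using \<theta> by (intro mult_left_mono) auto
 also have "... = \<theta>" using \<theta> by (simp add: right_diff_distrib)
 finally have "real T * ((1 - \<theta>) * ln (1 / (1 - \<theta>))) <= real T * \<theta>" by (intro mult_left_mono) auto
 moreover have T\<theta>: "real T * \<theta> = real r" "real T * (1 - \<theta>) = real (T - r)" using r by (auto simp: \<theta>_def field_simps of_nat_diff)
 ultimately have "real (T - r) * ln (1 / (1 - \<theta>)) <= real r" by (simp only: mult.assoc[symmetric])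
 then have "- (real r * (1 + ln (real T / real r))) <= real r * ln \<theta> + real (T - r) * ln (1 - \<theta>)"
 using \<theta> r by (simp add: \<theta>_def ln_div distrib_left right_diff_distrib)
 then have "exp (- (real r * (1 + ln (real T / real r)))) <= exp (real r * ln \<theta> + real (T - r) * ln (1 - \<theta>))" by simp
 also have "... = \<theta> ^ r * (1 - \<theta>) ^ (T - r)" using \<theta> by (simp add: exp_add exp_of_nat_mult)
 finally show ?thesis .
 qed
 then have "real (T choose r) * exp (- (real r * (1 + ln (real T / real r)))) <= 1"
 by (intro order_trans[OF mult_left_mono le]) auto
 then show ?thesis by (simp only: exp_minus inverse_eq_divide times_divide_eq_right mult_1_right divide_le_eq_1_pos[OF exp_gt_zero])
 qed
 show "real (T choose r) <= exp (real r * (1 + ln (real T / real r)))" by (rule G[OF r])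
 show "real (T choose r) <= exp (real (T - r) * (1 + ln (real T / real (T - r))))"
 using G[of "T - r"] r by (simp add: binomial_symmetric[of r T])
qed

text \<open>The concave left side lies below each of its tangents; \<open>c\<close> is the slope, to
  be matched to a linear term in the exponent.\<close>

lemma entropy_tangent:
 assumes "0 < x" shows "x * (1 + ln (1 / x)) <= c * x + exp (- (c::real))"
proof -
 have "ln (exp (- c) / x) <= exp (- c) / x - 1" using assms by (intro ln_le_minus_one) simp
 then have "x * (1 + ln (exp (- c) / x)) <= x * (exp (- c) / x)" using assms by (intro mult_left_mono) auto
 then show ?thesis using assms by (simp add: ln_div algebra_simps)
qed

text \<open>\<open>b\<close> plays the role of \<open>ln (1 / \<phi>)\<close>. A slot hashes
  \<open>t * (l * h + E)\<close> nats, where \<open>h\<close> bounds the mean information of a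
  position, \<open>L\<close> bounds it pointwise, and \<open>E\<close> is the margin per codeword.
  The hypotheses \<open>K\<close> make the ratio \<open>\<kappa>\<close> of the margin of a slot to
  \<open>L\<close> large.\<close>

locale chernoff =
 fixes l t T :: nat and a b h E L :: real
 assumes l: "134 <= l" and t: "1 <= t" and a: "a = ln (real l + 1)" "27 * a <= real l" "24/5 <= a"
 and b: "8/5 <= b" and h: "0 < h" "h <= b - 1"
 and E: "13 * a * h <= E" "3 * a * b <= real t * E" and L: "1 <= L" "L <= real t * (real l)\<^sup>2"
 and K: "7 * L <= real t * E" "9/5 * min a b * L <= real t * E"
 and T: "(real l)\<^sup>2 * exp b <= real T" "real T <= 2 * (real l)\<^sup>2 * exp b"
begin

definition q :: real where "q = real t * real l * h / L"
definition \<eta> :: real where "\<eta> = E / (real l * h)"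
definition \<zeta> :: real where "\<zeta> = exp (- b) / (2 * h)"
definition \<kappa> :: real where "\<kappa> = real t * E / L"

lemma pos: "0 < E" "0 < q" "0 < \<eta>" "0 < \<zeta>" "0 < \<kappa>" "0 < real l" "0 < real T" "0 < real t"
proof -
 have "0 < 13 * a * h" using a h by simp
 then show E: "0 < E" using E by linarith
 show l': "0 < real l" and t': "0 < real t" using l t by auto
 have "0 < (real l)\<^sup>2 * exp b" using l' by simp
 then show "0 < real T" using T by linarith
 show "0 < q" "0 < \<eta>" "0 < \<zeta>" "0 < \<kappa>" using E h l' t' L by (auto simp: q_def \<eta>_def \<zeta>_def \<kappa>_def)
qed

lemma q\<eta>: "q * \<eta> = \<kappa>" using pos h L by (simp add: q_def \<eta>_def \<kappa>_def)

lemma \<kappa>: "7 <= \<kappa>" "9/5 * min a b <= \<kappa>" using K L by (auto simp: \<kappa>_def le_divide_eq)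

lemma \<eta>: "13 * a / real l <= \<eta>" using E(1) pos h by (simp add: \<eta>_def field_simps)

text \<open>The Chernoff exponent per slot for a fraction \<theta> of confused slots and tilt
  \<open>u = s * L\<close>: the hashes contribute linearly in \<theta>, the freed positions subtract
  quadratically, and \<zeta> stems from the allowance \<open>C\<close>.\<close>

definition rate :: "real => real => real" where
 "rate \<theta> u = q * (u * (\<theta> * (1 + \<eta>) + \<zeta>) - \<theta>\<^sup>2 * (exp u - 1))"

lemma exponent_eq:
 assumes "0 < r"
 shows "u / L * (- real r * (real t * (real l * h + E)) - real l * exp (- b) * real T * real t / 2)
 + real (T * (t * l)) * (real r / real T)\<^sup>2 * (h / L * (exp (u / L * L) - 1))
 = - (real T * rate (real r / real T) u)"
proof -
 have nz: "real T ~= 0" "L ~= 0" "h ~= 0" "real l ~= 0" using pos h L by auto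
 show ?thesis using nz by (simp add: rate_def q_def \<eta>_def \<zeta>_def field_simps power2_eq_square)
qed

text \<open>For small \<theta> the tilt is half of \<open>ln (1 / \<theta>)\<close>, capped at
  \<open>L\<close> because \<open>s <= 1\<close>. For large \<theta> it maximises the lower bound
  obtained from \<open>exp u - 1 <= u + 3/4 * u\<^sup>2\<close>, capped at 1 where that estimate
  ends.\<close>

definition tilt :: "real => real" where
 "tilt \<theta> = (if \<theta> < 1/4 then min (ln (1 / \<theta>) / 2) L else min 1 ((\<theta> * \<eta> + \<theta> * (1 - \<theta>) + \<zeta>) / (3/2 * \<theta>\<^sup>2)))"

text \<open>At this tilt \<open>exp u\<close> is at most the inverse square root
  \<open>1 / v\<close> of \<theta>, so the quadratic loss is at most \<open>\<theta> * u\<close> and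
  cancels against the main term. The gain from the margin remains and beats the binomial
  coefficient.\<close>

lemma small_\<theta>:
 assumes r: "0 < r" "real r / real T < 1/4"
 defines "u \<equiv> tilt (real r / real T)"
 shows "0 < u" "u <= L" "real (T choose r) * exp (- (real T * rate (real r / real T) u)) * (L / u) <= 3/2 * L * (1/2) ^ r"
proof -
 define \<theta> where "\<theta> = real r / real T"
 define w where "w = ln (1 / \<theta>)"
 have \<theta>: "0 < \<theta>" "\<theta> < 1/4" using r pos by (auto simp: \<theta>_def)
 have u: "u = min (w / 2) L" using \<theta> by (simp add: u_def tilt_def w_def \<theta>_def)
 have "ln 4 <= w" unfolding w_def using \<theta> by (intro ln_mono) (auto simp: field_simps)
 moreover have "ln (4::real) = 2 * ln 2" using ln_realpow[of 2 2] by simp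
 ultimately have w: "2 * ln 2 <= w" by simp
 have ln2: "2/3 <= ln (2::real)" by (rule ln2_ge_two_thirds)
 have u23: "2/3 <= u" using w ln2 L by (auto simp: u)
 then show u0: "0 < u" by simp
 show uL: "u <= L" by (simp add: u)
 have T\<theta>: "real T * \<theta> = real r" using pos by (simp add: \<theta>_def)
 define v where "v = exp (- (w / 2))"
 have v: "v * v = \<theta>" "0 < v" using \<theta> by (auto simp: v_def w_def exp_add[symmetric] ln_div)
 have v2: "v <= 1/2"
 proof (rule ccontr)
 assume "\<not> v <= 1/2"
 then have "1/2 * (1/2) <= v * v" by (intro mult_mono) auto
 then show False using v \<theta> by simp
 qed
 have "exp u <= exp (w / 2)" by (simp add: u)
 also have "exp (w / 2) = 1 / v" by (simp add: v_def exp_minus inverse_eq_divide)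
 finally have eu: "exp u <= 1 / v" .
 have "\<theta>\<^sup>2 * (exp u - 1) <= \<theta>\<^sup>2 * (1 / v)" using eu by (intro mult_left_mono) auto
 also have "... = \<theta> * v" using v by (simp add: power2_eq_square flip: v(1))
 also have "... <= \<theta> * u" using v2 u23 \<theta> by (intro mult_left_mono) auto
 finally have "u * (\<theta> * \<eta>) <= u * (\<theta> * (1 + \<eta>) + \<zeta>) - \<theta>\<^sup>2 * (exp u - 1)"
 using mult_pos_pos[OF u0 pos(4)] by (simp add: algebra_simps)
 then have "q * (u * (\<theta> * \<eta>)) <= rate \<theta> u" unfolding rate_def using pos by (intro mult_left_mono) auto
 then have rt: "\<theta> * (\<kappa> * u) <= rate \<theta> u" unfolding q\<eta>[symmetric] by (simp only: mult_ac)
 have "real T * (\<theta> * (\<kappa> * u)) <= real T * rate \<theta> u" by (intro mult_left_mono rt) auto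
 then have R: "real r * (\<kappa> * u) <= real T * rate \<theta> u" unfolding T\<theta>[symmetric] by (simp only: mult_ac)
 \<comment> \<open>The binomial coefficient costs \<open>1 + w\<close> per confused slot; the
   further 1 leaves the geometric factor \<open>exp (- 1) ^ r\<close>.\<close>
 have key: "1 + w + 1 <= \<kappa> * u"
 proof (cases "w / 2 <= L")
 case True
 have "7 * (w / 2) <= \<kappa> * u" using True \<kappa> w ln2 by (auto simp: u intro!: mult_mono)
 then show ?thesis using w ln2 by linarith
 next
 case False
 \<comment> \<open>With the tilt capped at \<open>L\<close> the gain is \<open>t * E\<close>, while
   \<open>w\<close> is at most \<open>ln T\<close>, hence at most
   \<open>2 * a + b + 1\<close>.\<close>
 have "\<kappa> * u = real t * E" using False L by (simp add: u \<kappa>_def)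
 moreover have "w <= ln (real T)"
 proof -
 have "1 / \<theta> <= real T" using r pos by (simp add: \<theta>_def field_simps)
 then show ?thesis unfolding w_def using \<theta> by (intro ln_mono) auto
 qed
 moreover have "ln (real T) <= ln (2 * (real l)\<^sup>2 * exp b)" using T pos by (intro ln_mono) auto
 moreover have "ln (2 * (real l)\<^sup>2 * exp b) = ln 2 + 2 * ln (real l) + b" using pos by (simp add: ln_mult_pos ln_realpow)
 moreover have "ln (real l) <= a" unfolding a using pos by (intro ln_mono) auto
 moreover have "ln (2::real) <= 1" using ln_2_less_1 by simp
 moreover have "2 * (a * (8/5)) <= 2 * (a * b)" "24/5 * b <= a * b" using a b by (auto intro!: mult_left_mono mult_right_mono)
 moreover have "3 * (a * b) <= real t * E" using E(2) by (simp only: mult.assoc)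
 ultimately show ?thesis using a(3) b by linarith
 qed
 have "real (T choose r) <= exp (real r * (1 + ln (real T / real r)))"
 proof (rule choose_le_exp)
 have "real r < real T" using r pos by (simp add: field_simps)
 then show "r < T" by simp
 qed (fact r(1))
 also have "ln (real T / real r) = w" by (simp add: w_def \<theta>_def)
 finally have "real (T choose r) * exp (- (real T * rate \<theta> u)) <= exp (real r * (1 + w)) * exp (- (real r * (\<kappa> * u)))"
 using R by (intro mult_mono) auto
 also have "... = exp (real r * (1 + w - \<kappa> * u))" by (simp add: exp_add[symmetric] algebra_simps)
 also have "... <= exp (real r * (- 1))" using key by (intro iffD2[OF exp_le_cancel_iff] mult_left_mono) auto
 also have "... = exp (- 1) ^ r" by (simp only: exp_of_nat_mult)
 also have "... <= (1/2) ^ r"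
 proof (intro power_mono)
 have "2 <= exp (1::real)" using exp_ge_add_one_self[of "1::real"] by simp
 then show "exp (- 1) <= (1/2 :: real)" by (simp add: exp_minus field_simps)
 qed auto
 finally have "real (T choose r) * exp (- (real T * rate \<theta> u)) * (L / u) <= (1/2) ^ r * (L / u)" using u0 L by (intro mult_right_mono) auto
 also have "L / u <= L / (2/3)" using u23 L by (intro divide_left_mono) auto
 then have "(1/2) ^ r * (L / u) <= (1/2) ^ r * (L / (2/3))" by (intro mult_left_mono) auto
 finally show "real (T choose r) * exp (- (real T * rate (real r / real T) u)) * (L / u) <= 3/2 * L * (1/2) ^ r"
 by (simp add: \<theta>_def mult_ac)
qed

text \<open>The intercept of \<open>entropy_tangent\<close> at slope \<open>2/3 * \<kappa>\<close>
  must be paid by the margin. For \<open>b <= a\<close> the allowance term with \<zeta> is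
  comparable to it; otherwise it is below \<open>1 / l\<close> and the term with \<eta>
  pays.\<close>

lemma exp_\<kappa>: "exp (- (2/3 * \<kappa>)) + a / real l <= \<kappa> * \<eta> / 3 + 2/3 * (\<kappa> * \<zeta>)"
proof -
 have "7 * (13 * a / real l) <= \<kappa> * \<eta>" using \<kappa> \<eta> a pos by (intro mult_mono) auto
 moreover have al: "0 <= a / real l" using a pos by simp
 ultimately have ke: "2 * (a / real l) <= \<kappa> * \<eta> / 3" unfolding times_divide_eq_right[symmetric] by linarith
 show ?thesis
 proof (cases "b <= a")
 case True
 have "exp (- (2/3 * \<kappa>)) <= exp (- (6/5 * b))" using \<kappa>(2) True by simp
 also have "... = exp (- b) * exp (- (b / 5))" by (simp add: exp_add[symmetric])
 also have "... <= exp (- b) * (7 / (3 * h))"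
 proof (intro mult_left_mono)
 have "b / 5 <= exp (b / 5 - 1)" using exp_ge_add_one_self[of "b / 5 - 1"] by simp
 moreover have "exp (b / 5) = exp (b / 5 - 1) * exp 1" by (simp add: exp_add[symmetric])
 moreover note exp_1_ge
 moreover have "27/10 * (b / 5) <= exp 1 * exp (b / 5 - 1)" using b calculation(1,3) by (intro mult_mono) auto
 ultimately have "27/10 * (b / 5) <= exp (b / 5)" by (simp add: mult.commute)
 then have "3 * h <= 7 * exp (b / 5)" using h b by linarith
 then show "exp (- (b / 5)) <= 7 / (3 * h)" using h by (simp add: exp_minus field_simps)
 qed auto
 also have "... <= \<kappa> * (exp (- b) / (3 * h))" using \<kappa>(1) h by (simp add: divide_right_mono mult_right_mono)
 also have "... = 2/3 * (\<kappa> * \<zeta>)" by (simp add: \<zeta>_def)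
 finally show ?thesis using ke al by linarith
 next
 case False
 have "exp (- (2/3 * \<kappa>)) <= exp (- a)" using \<kappa>(2) False a by simp
 also have "... = 1 / (real l + 1)" using pos by (simp add: a exp_minus inverse_eq_divide)
 also have "... <= 1 / real l" using pos by (intro divide_left_mono) auto
 also have "... <= a / real l" using a(3) by (intro divide_right_mono) auto
 finally show ?thesis using ke mult_pos_pos[OF pos(5,4)] by linarith
 qed
qed

text \<open>Near \<open>\<theta> = 1\<close> the main terms cancel, so the exponent comes from
  \<open>x = 1 - \<theta>\<close>, \<eta> and \<zeta> only. The binomial coefficient is bounded
  through \<open>T - r\<close>.\<close>

lemma large_\<theta>:
 assumes r: "r <= T" "1/4 <= real r / real T"
 defines "u \<equiv> tilt (real r / real T)"
 shows "0 < u" "u <= L" "real (T choose r) * exp (- (real T * rate (real r / real T) u)) * (L / u) <= exp (- (real T * (a / real l))) * (L * real l)"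
proof -
 define \<theta> where "\<theta> = real r / real T"
 define x where "x = 1 - \<theta>"
 define P where "P = \<theta> * \<eta> + \<theta> * x + \<zeta>"
 have \<theta>: "1/4 <= \<theta>" "\<theta> <= 1" using r pos by (auto simp: \<theta>_def divide_le_eq_1)
 have x: "0 <= x" using \<theta> by (simp add: x_def)
 have th2: "0 < \<theta>\<^sup>2" using \<theta> by simp
 have "0 <= \<theta> * x" "0 < \<theta> * \<eta>" using \<theta> x pos by auto
 then have P0: "0 < P" "\<theta> * \<eta> <= P" using pos(4) unfolding P_def by linarith+
 have u: "u = min 1 (P / (3/2 * \<theta>\<^sup>2))" using \<theta> by (simp add: u_def tilt_def P_def x_def \<theta>_def)
 have al: "a / real l <= 1/27" "0 <= a / real l" using a pos by (auto simp: field_simps)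
 show u0: "0 < u" using P0 th2 by (simp add: u)
 have u1: "u <= 1" by (simp add: u)
 then show "u <= L" using L by simp
 have eu: "exp u - 1 <= u + 3/4 * u\<^sup>2" using exp_le_quadratic[of u] u0 u1 by simp
 have "\<theta>\<^sup>2 * (exp u - 1) <= \<theta>\<^sup>2 * (u + 3/4 * u\<^sup>2)" using eu by (intro mult_left_mono) auto
 then have "u * P - 3/4 * \<theta>\<^sup>2 * u\<^sup>2 <= u * (\<theta> * (1 + \<eta>) + \<zeta>) - \<theta>\<^sup>2 * (exp u - 1)"
 by (simp add: P_def x_def algebra_simps power2_eq_square)
 then have rt: "q * (u * P - 3/4 * \<theta>\<^sup>2 * u\<^sup>2) <= rate \<theta> u" unfolding rate_def using pos by (intro mult_left_mono) auto
 have main: "real (T choose r) * exp (- (real T * rate \<theta> u)) <= exp (- (real T * (a / real l))) & L / u <= L * real l"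
 proof (cases "P <= 3/2 * \<theta>\<^sup>2")
 case True
 then have uP: "u = P / (3/2 * \<theta>\<^sup>2)" using th2 by (simp add: u)
 have "u * P - 3/4 * \<theta>\<^sup>2 * u\<^sup>2 = (P / \<theta>)\<^sup>2 / 3"
 unfolding uP using \<theta> by (simp add: field_simps power2_eq_square)
 moreover have "\<eta> + x + \<zeta> <= P / \<theta>"
 proof -
 have "\<zeta> <= \<zeta> / \<theta>" using \<theta> pos by (simp add: le_divide_eq mult_left_le)
 then show ?thesis using \<theta> by (simp add: P_def add_divide_distrib)
 qed
 then have "(\<eta> + x + \<zeta>)\<^sup>2 <= (P / \<theta>)\<^sup>2" using pos x by (intro power_mono) auto
 moreover have "\<eta> * \<eta> + 2 * (\<eta> * x) + 2 * (\<eta> * \<zeta>) <= (\<eta> + x + \<zeta>)\<^sup>2"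
 using pos x mult_nonneg_nonneg[of x \<zeta>] by (simp add: power2_eq_square algebra_simps)
 ultimately have "(\<eta> * \<eta> + 2 * (\<eta> * x) + 2 * (\<eta> * \<zeta>)) / 3 <= u * P - 3/4 * \<theta>\<^sup>2 * u\<^sup>2"
 by (simp only: divide_le_cancel) linarith
 then have "q * ((\<eta> * \<eta> + 2 * (\<eta> * x) + 2 * (\<eta> * \<zeta>)) / 3) <= q * (u * P - 3/4 * \<theta>\<^sup>2 * u\<^sup>2)" using pos by (intro mult_left_mono) auto
 then have "q * ((\<eta> * \<eta> + 2 * (\<eta> * x) + 2 * (\<eta> * \<zeta>)) / 3) <= rate \<theta> u" using rt by linarith
 moreover have "q * ((\<eta> * \<eta> + 2 * (\<eta> * x) + 2 * (\<eta> * \<zeta>)) / 3) = \<kappa> * \<eta> / 3 + 2/3 * \<kappa> * x + 2/3 * (\<kappa> * \<zeta>)"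
 by (simp add: q\<eta>[symmetric] algebra_simps)
 ultimately have G: "2/3 * \<kappa> * x + exp (- (2/3 * \<kappa>)) + a / real l <= rate \<theta> u" using exp_\<kappa> by linarith
 \<comment> \<open>The tangent slope is chosen equal to the coefficient of \<open>x\<close> in the
   exponent, so that these terms cancel exactly.\<close>
 have ch: "real (T choose r) <= exp (real T * (2/3 * \<kappa> * x + exp (- (2/3 * \<kappa>))))"
 proof (cases "r = T")
 case True
 then have "x = 0" using pos by (simp add: x_def \<theta>_def)
 then show ?thesis using True by simp
 next
 case False
 then have rT: "r < T" "0 < r" using r \<theta> by (auto simp: \<theta>_def intro: Nat.gr0I)
 have Tx: "real (T - r) = real T * x" using r pos by (simp add: x_def \<theta>_def of_nat_diff field_simps)
 then have x0: "0 < x" using rT pos by (metis of_nat_0_less_iff zero_less_diff zero_less_mult_pos)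
 have "real (T choose r) <= exp (real (T - r) * (1 + ln (real T / real (T - r))))" by (rule choose_le_exp[OF rT(2,1)])
 also have "real (T - r) * (1 + ln (real T / real (T - r))) = real T * (x * (1 + ln (1 / x)))" using pos by (simp add: Tx)
 also have "exp ... <= exp (real T * (2/3 * \<kappa> * x + exp (- (2/3 * \<kappa>))))"
 by (intro iffD2[OF exp_le_cancel_iff] mult_left_mono entropy_tangent x0) auto
 finally show ?thesis .
 qed
 have "real (T choose r) * exp (- (real T * rate \<theta> u)) <= exp (real T * (2/3 * \<kappa> * x + exp (- (2/3 * \<kappa>))))
 * exp (- (real T * (2/3 * \<kappa> * x + exp (- (2/3 * \<kappa>)) + a / real l)))"
 using G ch by (intro mult_mono iffD2[OF exp_le_cancel_iff] le_imp_neg_le mult_left_mono) auto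
 also have "... = exp (- (real T * (a / real l)))" by (simp add: exp_add[symmetric] distrib_left)
 finally have 1: "real (T choose r) * exp (- (real T * rate \<theta> u)) <= exp (- (real T * (a / real l)))" .
 have "L / u = L * (3/2 * \<theta>\<^sup>2 / P)" by (simp add: uP)
 also have "3/2 * \<theta>\<^sup>2 / P <= 3/2 * \<theta>\<^sup>2 / (\<theta> * \<eta>)" using P0 \<theta> pos by (intro divide_left_mono) auto
 also have "... = 3/2 * \<theta> / \<eta>" using \<theta> by (simp add: power2_eq_square)
 also have "... <= real l"
 proof -
 have "3/2 * \<theta> <= 3/2" using \<theta> by simp
 also have "... <= 13 * a" using a by simp
 also have "... <= real l * \<eta>" using \<eta> pos by (simp add: field_simps)
 finally show ?thesis using pos by (simp add: field_simps)
 qed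
 finally have "L / u <= L * real l" using L by simp
 then show ?thesis using 1 by simp
 next
 case False
 \<comment> \<open>With the tilt capped at 1 the exponent is at least \<open>7/8\<close> per slot,
   enough against the crude count \<open>2 ^ T\<close>.\<close>
 then have u1: "u = 1" using th2 by (simp add: u min_def le_divide_eq)
 have "\<theta> * \<eta> / 2 <= u * P - 3/4 * \<theta>\<^sup>2 * u\<^sup>2" using False P0 by (simp add: u1)
 then have "q * (\<theta> * \<eta> / 2) <= q * (u * P - 3/4 * \<theta>\<^sup>2 * u\<^sup>2)" using pos by (intro mult_left_mono) auto
 then have "q * (\<theta> * \<eta> / 2) <= rate \<theta> u" using rt by linarith
 moreover have "q * (\<theta> * \<eta> / 2) = \<kappa> * \<theta> / 2" by (simp add: q\<eta>[symmetric])
 moreover have "7 * (1/4) <= \<kappa> * \<theta>" using \<kappa> \<theta> by (intro mult_mono) auto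
 ultimately have "7/8 <= rate \<theta> u" by linarith
 then have G: "real T * (7/8) <= real T * rate \<theta> u" by (intro mult_left_mono) auto
 have "real (T choose r) <= 2 ^ T" using binomial_le_pow2[of T r] by (metis of_nat_le_iff of_nat_numeral of_nat_power)
 also have "(2::real) ^ T = exp (real T * ln 2)" by (simp add: exp_of_nat_mult)
 finally have "real (T choose r) * exp (- (real T * rate \<theta> u)) <= exp (real T * ln 2) * exp (- (real T * (7/8)))"
 using G by (intro mult_mono) auto
 also have "... = exp (real T * (ln 2 - 7/8))" by (simp add: exp_add[symmetric] algebra_simps)
 also have "... <= exp (real T * (- (a / real l)))"
 proof (intro iffD2[OF exp_le_cancel_iff] mult_left_mono)
 show "ln 2 - 7/8 <= - (a / real l)" using al ln2_le_25_over_36 by linarith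
 qed auto
 finally have 1: "real (T choose r) * exp (- (real T * rate \<theta> u)) <= exp (- (real T * (a / real l)))" by simp
 have "L * 1 <= L * real l" using L l by (intro mult_left_mono) auto
 then show ?thesis using 1 u1 by simp
 qed
 have "real (T choose r) * exp (- (real T * rate \<theta> u)) * (L / u) <= exp (- (real T * (a / real l))) * (L * real l)"
 using main u0 L by (intro mult_mono) auto
 then show "real (T choose r) * exp (- (real T * rate (real r / real T) u)) * (L / u) <= exp (- (real T * (a / real l))) * (L * real l)"
 by (simp only: \<theta>_def)
qed

theorem chernoff_sum:
 "\<exists>s. (\<forall>r. 0 < r & r <= T --> 0 < s r & s r <= 1) \<and>
 (\<Sum>r=1..T. real (T choose r) * (exp (s r * (- real r * (real t * (real l * h + E)) - real l * exp (- b) * real T * real t / 2)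
 + real (T * (t * l)) * (real r / real T)\<^sup>2 * (h / L * (exp (s r * L) - 1))) / s r)) <= real l * exp (- b) * real T * real t / 10"
proof -
 define s where "s r = tilt (real r / real T) / L" for r :: nat
 have s: "0 < s r" "s r <= 1" if "0 < r" "r <= T" for r
 using small_\<theta>(1,2)[of r] large_\<theta>(1,2)[of r] that L by (cases "real r / real T < 1/4"; simp add: s_def divide_le_eq)+
 let ?X = "exp (- (real T * (a / real l))) * (L * real l)"
 have ex: "0 <= ?X" using L by simp
 have "(\<Sum>r=1..T. real (T choose r) * (exp (s r * (- real r * (real t * (real l * h + E)) - real l * exp (- b) * real T * real t / 2)
 + real (T * (t * l)) * (real r / real T)\<^sup>2 * (h / L * (exp (s r * L) - 1))) / s r)) <= (\<Sum>r=1..T. 3/2 * L * (1/2) ^ r + ?X)"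
 proof (intro sum_mono)
 fix r assume "r \<in> {1..T}"
 then have r: "0 < r" "r <= T" by auto
 have "real (T choose r) * (exp (s r * (- real r * (real t * (real l * h + E)) - real l * exp (- b) * real T * real t / 2)
 + real (T * (t * l)) * (real r / real T)\<^sup>2 * (h / L * (exp (s r * L) - 1))) / s r)
 = real (T choose r) * exp (- (real T * rate (real r / real T) (tilt (real r / real T)))) * (L / tilt (real r / real T))"
 unfolding s_def exponent_eq[OF r(1)] by simp
 also have "... <= 3/2 * L * (1/2) ^ r + ?X"
 proof (cases "real r / real T < 1/4")
 case True
 show ?thesis using small_\<theta>(3)[OF r(1) True] ex by linarith
 next
 case False
 have "0 <= 3/2 * L * (1/2) ^ r" using L by simp
 then show ?thesis using large_\<theta>(3)[OF r(2)] False by linarith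
 qed
 finally show "real (T choose r) * (exp (s r * (- real r * (real t * (real l * h + E)) - real l * exp (- b) * real T * real t / 2)
 + real (T * (t * l)) * (real r / real T)\<^sup>2 * (h / L * (exp (s r * L) - 1))) / s r) <= 3/2 * L * (1/2) ^ r + ?X" .
 qed
 also have "... = 3/2 * L * (\<Sum>r=1..T. (1/2) ^ r) + real T * ?X" by (simp only: sum.distrib sum_distrib_left[symmetric] sum_constant card_atLeastAtMost) simp
 also have "... <= 3/2 * L * 1 + real T * ?X"
 proof -
 have "(\<Sum>r=1..T. (1/2 :: real) ^ r) = 1 - (1/2) ^ T" by (induction T) auto
 then show ?thesis using L by (intro add_right_mono mult_left_mono) auto
 qed
 \<comment> \<open>Since \<open>T >= l\<^sup>2 * exp b\<close>, the geometric part is a twentieth of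
   the unit \<open>l * exp (- b) * T * t\<close>, and the part exponentially small in
   \<open>T * a / l\<close> takes another twentieth.\<close>
 also have "... <= real l * exp (- b) * real T * real t / 10"
 proof -
 have one: "(real l)\<^sup>2 <= exp (- b) * real T" using T(1) by (simp add: exp_minus field_simps)
 have l20: "134 <= real l" using l by simp
 have "3/2 * L <= 3/2 * (real t * (real l)\<^sup>2)" using L by simp
 also have "... <= real l * real t / 20 * (real l)\<^sup>2" using l20 pos by (auto intro!: mult_right_mono)
 also have "... <= real l * real t / 20 * (exp (- b) * real T)" using one by (intro mult_left_mono) auto
 finally have 1: "3/2 * L <= real l * exp (- b) * real T * real t / 20" by (simp add: mult_ac)
 have "real l * a * exp b <= real T * (a / real l)"
 proof -
 have "(real l)\<^sup>2 * exp b * (a / real l) <= real T * (a / real l)" using T(1) a pos by (intro mult_right_mono) auto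
 then show ?thesis using pos by (simp add: power2_eq_square mult_ac)
 qed
 moreover have "real l * a * (1 + b) <= real l * a * exp b" using a pos by (intro mult_left_mono exp_ge_add_one_self) auto
 moreover have "3 * a + b <= real l * a * (1 + b)"
 proof -
 have "3 * a <= real l * a" using l20 a by (intro mult_right_mono) auto
 moreover have "1 * b <= real l * a * b" using l20 a b mult_mono[of 1 "real l" 1 a] by (intro mult_right_mono) auto
 ultimately show ?thesis by (simp add: distrib_left)
 qed
 ultimately have "- (real T * (a / real l)) <= - (3 * a) + - b" by linarith
 then have "exp (- (real T * (a / real l))) <= exp (- (3 * a) + - b)" by simp
 also have "... = exp (- b) / (real l + 1) ^ 3"
 proof -
 have "exp (3 * a) = (real l + 1) ^ 3" using pos exp_of_nat_mult[of 3 a] by (simp add: a)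
 moreover have "exp (- (3 * a) + - b) = exp (- b) * inverse (exp (3 * a))" by (simp only: exp_add exp_minus mult.commute)
 ultimately show ?thesis by (simp add: divide_inverse)
 qed
 finally have "?X <= exp (- b) / (real l + 1) ^ 3 * (L * real l)" using L by (intro mult_right_mono) auto
 also have "... <= exp (- b) / (real l + 1) ^ 3 * (real t * (real l)\<^sup>2 * real l)" using L by (intro mult_left_mono mult_right_mono) auto
 also have "... = exp (- b) * real t * ((real l) ^ 3 / (real l + 1) ^ 3)" by (simp add: power3_eq_cube power2_eq_square)
 also have "... <= exp (- b) * real t * (real l / 20)"
 proof (intro mult_left_mono)
 have "(real l) ^ 3 / (real l + 1) ^ 3 <= 1" by (simp add: divide_le_eq_1 power_mono)
 then show "(real l) ^ 3 / (real l + 1) ^ 3 <= real l / 20" using l20 by linarith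
 qed auto
 finally have "real T * ?X <= real T * (exp (- b) * real t * (real l / 20))" by (intro mult_left_mono) auto
 then have "real T * ?X <= real l * exp (- b) * real T * real t / 20" by (simp add: mult_ac)
 then show ?thesis using 1 by simp
 qed
 finally show ?thesis using s by (intro exI[of _ s]) auto
qed

end



section \<open>Entropy bounds and smoothing of laws\<close>

definition ent :: "('a::finite => real) => real" where "ent p = - (\<Sum>x\<in>UNIV. p x * ln (p x))"

lemma info_entropy_ent: "1 < b ==> ln b * info_entropy b p = ent p"
 by (simp add: info_entropy_def ent_def plogq_eq log_def sum_distrib_left)

lemma ent_le_card:
 fixes p :: "'a::finite => real"
 assumes p: "pmf_on p" and A: "!!x. 0 < p x ==> x \<in> A"
 shows "A ~= {}" "ent p <= ln (real (card A))"
proof -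
 show A0: "A ~= {}"
 proof
 assume "A = {}"
 then have "p x = 0" for x using A[of x] pmf_on_nonneg[OF p, of x] by (auto simp: less_le)
 then show False using pmf_on_sum[OF p] by simp
 qed
 then have n: "0 < real (card A)" by (simp add: card_gt_0_iff)
 have out: "p x = 0" if "x \<notin> A" for x using A[of x] that pmf_on_nonneg[OF p, of x] by (auto simp: less_le)
 have "- (p x * ln (p x)) - p x * ln (real (card A)) <= of_bool (x \<in> A) / real (card A) - p x" for x
 proof (cases "p x = 0")
 case False
 then have x: "0 < p x" "x \<in> A" using out[of x] pmf_on_nonneg[OF p, of x] by auto
 have "ln (1 / (real (card A) * p x)) <= 1 / (real (card A) * p x) - 1" using x n by (intro ln_le_minus_one) simp
 then have "p x * ln (1 / (real (card A) * p x)) <= p x * (1 / (real (card A) * p x) - 1)" using x by (intro mult_left_mono) auto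
 moreover have "ln (1 / (N * p x)) = - ln N - ln (p x)" if "0 < N" for N using x that by (simp add: ln_div ln_mult_pos)
 from this[OF n] have "p x * ln (1 / (real (card A) * p x)) = - (p x * ln (p x)) - p x * ln (real (card A))" by (simp only:) (simp add: right_diff_distrib)
 moreover have gen: "p x * (1 / (N * p x) - 1) = 1 / N - p x" if "0 < N" for N using x that by (simp add: right_diff_distrib)
 have "p x * (1 / (real (card A) * p x) - 1) = of_bool (x \<in> A) / real (card A) - p x" using x(2) gen[OF n] by (simp only: of_bool_eq)
 ultimately show ?thesis by linarith
 qed simp
 then have "(\<Sum>x\<in>UNIV. - (p x * ln (p x)) - p x * ln (real (card A))) <= (\<Sum>x\<in>UNIV. of_bool (x \<in> A) / real (card A) - p x)"
 by (intro sum_mono)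
 also have "... = real (card A) / real (card A) - 1"
 unfolding sum_subtractf pmf_on_sum[OF p] sum_divide_distrib[symmetric] by simp
 also have "... = 0" using n A0 by simp
 finally have "ent p - ln (real (card A)) <= 0"
 unfolding sum_subtractf sum_distrib_right[symmetric] pmf_on_sum[OF p] by (simp add: ent_def sum_negf)
 then show "ent p <= ln (real (card A))" by simp
qed

lemma ent_nonneg: "pmf_on p ==> 0 <= ent p"
proof -
 assume p: "pmf_on p"
 have "p x * ln (p x) <= 0" for x
 using pmf_on_nonneg[OF p, of x] pmf_on_le_1[OF p, of x] by (cases "p x = 0") (auto intro!: mult_nonneg_nonpos)
 then show ?thesis unfolding ent_def by (simp add: sum_nonpos)
qed

lemma ent_push_le:
 fixes p :: "'a::finite => real" and g :: "'a => 'b::finite"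
 assumes p: "pmf_on p" shows "ent (push p g) <= ent p"
proof -
 have "ent (push p g) = - (\<Sum>x\<in>UNIV. p x * ln (push p g (g x)))" by (simp add: ent_def sum_push)
 also have "... <= ent p" unfolding ent_def
 proof (intro le_imp_neg_le sum_mono)
 fix x
 show "p x * ln (p x) <= p x * ln (push p g (g x))"
 proof (cases "p x = 0")
 case False
 then have x: "0 < p x" using pmf_on_nonneg[OF p, of x] by simp
 have "p x <= push p g (g x)" unfolding push_def
 by (rule member_le_sum) (auto simp: pmf_on_nonneg[OF p])
 then show ?thesis using x by (intro mult_left_mono ln_mono) auto
 qed simp
 qed
 finally show ?thesis .
qed

text \<open>Mixing in the uniform law on \<open>R\<close> with weight \<open>1 / l\<close> caps the
  information of a letter at \<open>ln (card R) + ln l\<close>, while the mean rises only by order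
  \<open>1 / l\<close>.\<close>

lemma smoothed:
 fixes p :: "'k::finite => real" and l :: nat
 assumes p: "pmf_on p" and R: "!!x. 0 < p x ==> x \<in> R" and l: "134 <= l"
 defines "Pt \<equiv> %x. (1 - 1 / real l) * p x + of_bool (x \<in> R) / (real l * real (card R))"
 shows "pmf_on Pt" "!!x. 0 < p x ==> 0 < Pt x" "!!x. 0 < p x ==> 0 <= - ln (Pt x)"
 "!!x. 0 < p x ==> - ln (Pt x) <= ln (real (card R)) + ln (real l)"
 "(\<Sum>x\<in>UNIV. p x * (- ln (Pt x))) <= ent p + 101/100 / real l"
proof -
 have n: "0 < real (card R)" using ent_le_card(1)[OF p R] by (simp add: card_gt_0_iff)
 have l': "134 <= real l" using l by simp
 have l1: "1 / real l <= 1 / 134" "0 < real l" using l' by (auto simp: field_simps)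
 have nn: "0 <= (1 - 1 / real l) * p x" for x using l1 pmf_on_nonneg[OF p, of x] by (intro mult_nonneg_nonneg) auto
 have "sum Pt UNIV = (1 - 1 / real l) * sum p UNIV + (\<Sum>x\<in>UNIV. of_bool (x \<in> R)) / (real l * real (card R))"
 by (simp only: Pt_def sum.distrib sum_distrib_left sum_divide_distrib)
 also have "... = (1 - 1 / real l) * sum p UNIV + real (card R) / (real l * real (card R))" by simp
 also have "... = 1" using n l1 ent_le_card(1)[OF p R] by (simp add: pmf_on_sum[OF p])
 finally show pm: "pmf_on Pt" using nn l1 by (auto simp: pmf_on_def Pt_def intro!: add_nonneg_nonneg)
 show P0: "0 < Pt x" if "0 < p x" for x
 proof -
 have "0 < (1 - 1 / real l) * p x" using that l1 by (intro mult_pos_pos) auto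
 then show ?thesis using l1 by (auto simp: Pt_def intro!: add_pos_nonneg)
 qed
 show "0 <= - ln (Pt x)" if "0 < p x" for x
 using P0[OF that] pmf_on_le_1[OF pm, of x] by simp
 show "- ln (Pt x) <= ln (real (card R)) + ln (real l)" if "0 < p x" for x
 proof -
 have "1 / (real l * real (card R)) <= Pt x" using nn[of x] R[OF that] by (simp add: Pt_def)
 then have "ln (1 / (real l * real (card R))) <= ln (Pt x)" using n l1 by (intro ln_mono) auto
 then show ?thesis using n l1 ent_le_card(1)[OF p R] by (simp add: ln_div ln_mult_pos)
 qed
 have "p x * (- ln (Pt x)) <= - (p x * ln (p x)) + p x * (101/100 / real l)" for x
 proof (cases "p x = 0")
 case False
 then have x: "0 < p x" using pmf_on_nonneg[OF p, of x] by simp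
 have "(1 - 1 / real l) * p x <= Pt x" using l1 by (simp add: Pt_def)
 then have "ln ((1 - 1 / real l) * p x) <= ln (Pt x)" using x l1 by (intro ln_mono mult_pos_pos) auto
 then have a: "ln (1 - 1 / real l) + ln (p x) <= ln (Pt x)" using x l1 by (simp add: ln_mult_pos)
 have "ln (1 / (1 - 1 / real l)) <= 1 / (1 - 1 / real l) - 1" using l1 by (intro ln_le_minus_one) simp
 \<comment> \<open>The left side is \<open>1 / (l - 1)\<close>; the bound holds because
   \<open>l\<close> is at least 134.\<close>
 also have "... <= 101/100 / real l" using l' by (simp add: field_simps)
 finally have "- ln (1 - 1 / real l) <= 101/100 / real l" using l1 by (simp add: ln_div)
 then have "- ln (Pt x) <= - ln (p x) + 101/100 / real l" using a by linarith
 then have "p x * (- ln (Pt x)) <= p x * (- ln (p x) + 101/100 / real l)" using x by (intro mult_left_mono) auto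
 then show ?thesis by (simp only: distrib_left mult_minus_right)
 qed simp
 then have "(\<Sum>x\<in>UNIV. p x * (- ln (Pt x))) <= (\<Sum>x\<in>UNIV. - (p x * ln (p x)) + p x * (101/100 / real l))" by (intro sum_mono)
 also have "... = ent p + 101/100 / real l"
 unfolding sum.distrib sum_distrib_right[symmetric] pmf_on_sum[OF p] by (simp add: ent_def sum_negf)
 finally show "(\<Sum>x\<in>UNIV. p x * (- ln (Pt x))) <= ent p + 101/100 / real l" .
qed

context receiver
begin

text \<open>The channel itself is admissible in \<open>Er\<close> with divergence 0, so a positive
  exponent gives rate plus exponent at most the mutual information of \<open>U\<close> and
  \<open>Y\<close>. The chain rule adds \<open>I\<close>, and the total is at most the output
  entropy. A one-letter \<open>U\<close> has mutual information 0, which excludes a positive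
  rate.\<close>

lemma Er_chain:
 assumes b: "1 < b" and pU: "pmf_on pU" and pos: "0 < Er b R pU PY"
 shows "ln b * (R + Er b R pU PY) + I <= ln (real CARD('y))" "0 < R ==> 1 < CARD('u)"
proof -
 define MI where "MI = mutual_info b (%(u, y). pU u * PY u y)"
 define QY where "QY y = (\<Sum>u\<in>UNIV. pU u * PY u y)" for y
 have lb: "0 < ln b" using b by simp
 have PY1: "(\<Sum>y\<in>UNIV. PY u y) = 1" for u using stoch_sum[OF stoch_PY] .
 have le: "pU u * PY u y <= QY y" for u y unfolding QY_def
 by (rule member_le_sum[where f="%u. pU u * PY u y"]) (auto simp: pmf_on_nonneg[OF pU] PY_nonneg)
 have "sum QY UNIV = (\<Sum>u\<in>UNIV. pU u * (\<Sum>y\<in>UNIV. PY u y))"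
 unfolding QY_def sum_distrib_left by (rule sum.swap)
 then have QY: "pmf_on QY" using pmf_on_sum[OF pU]
 by (auto simp: pmf_on_def PY1 QY_def intro!: sum_nonneg mult_nonneg_nonneg pmf_on_nonneg[OF pU] PY_nonneg)
 have "plogq b x (x / x) = 0" for x by (simp add: plogq_def)
 then have cd: "cond_div b PY PY pU = 0" unfolding cond_div_def by (simp only: sum.neutral_const mult_zero_right)
 have "Er b R pU PY <= cond_div b PY PY pU + max 0 (mutual_info b (%(u, y). pU u * PY u y) - R)"
 by (rule Er_le[OF b stoch_PY]) (auto simp: PY_nonneg PY1 pmf_on_nonneg[OF pU])
 then have E: "Er b R pU PY <= max 0 (MI - R)" by (simp add: cd MI_def)
 then have E': "R + Er b R pU PY <= MI" using pos by simp
 have f: "push (%(u, y). pU u * PY u y) fst u = pU u" for u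
 unfolding push_fst_pair by (simp add: sum_distrib_left[symmetric] PY1)
 have s: "push (%(u, y). pU u * PY u y) snd y = QY y" for y
 unfolding push_snd_pair by (simp add: QY_def)
 have tm: "ln b * plogq b (pU u * PY u y) (pU u * PY u y / (pU u * QY y)) = pU u * PY u y * ln (PY u y / QY y)" for u y
 using lb by (cases "pU u = 0") (simp_all add: plogq_eq log_def)
 have MI: "ln b * MI = (\<Sum>u\<in>UNIV. \<Sum>y\<in>UNIV. pU u * PY u y * ln (PY u y / QY y))"
 unfolding MI_def mutual_info_def sum_distrib_left by (simp only: sum_UNIV_pair[symmetric] prod.case fst_conv snd_conv f s tm)
 have MI3: "ln b * MI = (\<Sum>u\<in>UNIV. \<Sum>v\<in>UNIV. \<Sum>y\<in>UNIV. pU u * (pV v * PVY u v y) * ln (PY u y / QY y))"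
 unfolding MI
 proof (intro sum.cong refl)
 fix u
 have "(\<Sum>y\<in>UNIV. pU u * PY u y * ln (PY u y / QY y)) = (\<Sum>y\<in>UNIV. \<Sum>v\<in>UNIV. pU u * (pV v * PVY u v y) * ln (PY u y / QY y))"
 unfolding PY_def[of u] sum_distrib_left[where r="pU u"] sum_distrib_right by (intro sum.cong refl)
 then show "(\<Sum>y\<in>UNIV. pU u * PY u y * ln (PY u y / QY y)) = (\<Sum>v\<in>UNIV. \<Sum>y\<in>UNIV. pU u * (pV v * PVY u v y) * ln (PY u y / QY y))"
 by (subst sum.swap)
 qed
 have PVY1: "PVY u v y <= 1" for u v y
 using member_le_sum[of y UNIV "PVY u v"] PVY_nonneg sum_PVY[of u v] by simp
 have "ln b * MI + I = (\<Sum>u\<in>UNIV. \<Sum>v\<in>UNIV. \<Sum>y\<in>UNIV. pU u * (pV v * PVY u v y) * (ln (PY u y / QY y) + ln (\<omega> u v y)))"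
 unfolding MI3 I_def Iu_def sum_distrib_left distrib_left sum.distrib by (simp add: mult.assoc)
 also have "... <= (\<Sum>u\<in>UNIV. \<Sum>v\<in>UNIV. \<Sum>y\<in>UNIV. pU u * (pV v * PVY u v y) * (- ln (QY y)))"
 proof (intro sum_mono)
 fix u v y
 show "pU u * (pV v * PVY u v y) * (ln (PY u y / QY y) + ln (\<omega> u v y)) <= pU u * (pV v * PVY u v y) * (- ln (QY y))"
 proof (cases "pU u * (pV v * PVY u v y) = 0")
 case False
 then have p: "0 < pU u" "0 < pV v" "0 < PVY u v y"
 using pmf_on_nonneg[OF pU, of u] pmf_on_nonneg[OF pV, of v] PVY_nonneg[of u v y] by (auto simp: less_le)
 then have "0 < pV v * PVY u v y" by simp
 then have py: "0 < PY u y" using PVY_le[of v u y] by linarith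
 then have "0 < pU u * PY u y" using p by simp
 then have qy: "0 < QY y" using le[of u y] by linarith
 have "ln (PVY u v y) <= 0" using p PVY1[of u v y] by simp
 then have "ln (PY u y / QY y) + ln (\<omega> u v y) <= - ln (QY y)" using p py qy by (simp add: \<omega>_def ln_div)
 then show ?thesis using p by (intro mult_left_mono) auto
 qed (simp only: mult_zero_left order_refl)
 qed
 also have "... = (\<Sum>u\<in>UNIV. \<Sum>y\<in>UNIV. pU u * PY u y * (- ln (QY y)))"
 proof (intro sum.cong refl)
 fix u
 have "(\<Sum>y\<in>UNIV. pU u * PY u y * (- ln (QY y))) = (\<Sum>y\<in>UNIV. \<Sum>v\<in>UNIV. pU u * (pV v * PVY u v y) * (- ln (QY y)))"
 unfolding PY_def[of u] sum_distrib_left[where r="pU u"] sum_distrib_right by (intro sum.cong refl)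
 then show "(\<Sum>v\<in>UNIV. \<Sum>y\<in>UNIV. pU u * (pV v * PVY u v y) * (- ln (QY y))) = (\<Sum>y\<in>UNIV. pU u * PY u y * (- ln (QY y)))"
 by (subst sum.swap) simp
 qed
 also have "... = ent QY" unfolding ent_def
 by (subst sum.swap) (simp add: QY_def sum_distrib_right sum_negf)
 also have "... <= ln (real CARD('y))" using ent_le_card(2)[OF QY, of UNIV] by simp
 finally have c: "ln b * MI + I <= ln (real CARD('y))" .
 have "ln b * (R + Er b R pU PY) <= ln b * MI" using E' lb by (intro mult_left_mono) auto
 then show "ln b * (R + Er b R pU PY) + I <= ln (real CARD('y))" using c by linarith
 show "1 < CARD('u)" if R: "0 < R"
 proof (rule ccontr)
 assume "\<not> 1 < CARD('u)"
 moreover have "0 < CARD('u)" by simp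
 ultimately have "CARD('u) = 1" by linarith
 then obtain u0 :: 'u where u0: "UNIV = {u0}" by (rule card_1_singletonE)
 have "sum pU {u0} = 1" using pmf_on_sum[OF pU] unfolding u0 .
 then have "pU u0 = 1" by simp
 then have q: "QY y = PY u0 y" for y by (simp add: QY_def u0)
 have z: "pU u0 * PY u0 y * ln (PY u0 y / QY y) = 0" for y unfolding q by (cases "PY u0 y = 0") simp_all
 have "ln b * MI = 0" unfolding MI
 proof (intro sum.neutral ballI)
 fix u y
 have "u = u0" using u0 by auto
 then show "pU u * PY u y * ln (PY u y / QY y) = 0" using z by blast
 qed
 then have "MI = 0" using lb by simp
 then show False using E' R pos by linarith
 qed
qed

text \<open>The uniform part makes the kernel positive. Where \<open>\<kappa>'\<close> agrees with
  \<kappa> the smoothing costs at most \<open>2 * \<eta>\<close>; where it differs, the uniform part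
  bounds the loss by \<open>ln CARD('s) + ln (1 / \<eta>)\<close>.\<close>

lemma smoothed_kernel:
 fixes \<kappa>' :: "'s \<times> 't => 'k"
 assumes \<eta>: "0 < \<eta>" "\<eta> <= 1/2" and pne: "(\<Sum>z\<in>UNIV. WS z * of_bool (\<kappa>' z ~= \<kappa> z)) <= pne"
 defines "ak \<equiv> %s k. (1 - \<eta>) * a s k + \<eta> / real CARD('s)"
 shows "!!s k. 0 < ak s k" "!!k. (\<Sum>s\<in>UNIV. ak s k) <= 1"
 "- (\<Sum>z\<in>UNIV. WS z * ln (ak (fst z) (\<kappa>' z))) <= HS + 2 * \<eta> + pne * (ln (real CARD('s)) + ln (1 / \<eta>))"
proof -
 let ?n = "real CARD('s)"
 have n: "1 <= ?n" by (simp add: Suc_le_eq)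
 have g: "0 <= (1 - \<eta>) * a s k" for s k using \<eta> a_nonneg by simp
 show ak0: "0 < ak s k" for s k using g[of s k] \<eta> n by (auto simp: ak_def intro!: add_nonneg_pos)
 show "(\<Sum>s\<in>UNIV. ak s k) <= 1" for k
 proof -
 have "(\<Sum>s\<in>UNIV. ak s k) = (1 - \<eta>) * (\<Sum>s\<in>UNIV. a s k) + \<eta>" by (simp add: ak_def sum.distrib sum_distrib_left)
 also have "... <= (1 - \<eta>) * 1 + \<eta>" using \<eta> sum_a_le_1 by (intro add_right_mono mult_left_mono) auto
 finally show ?thesis by simp
 qed
 let ?c = "ln ?n + ln (1 / \<eta>)"
 have c0: "0 <= ln ?n" "0 <= ln (1 / \<eta>)" using n \<eta> by auto
 have "- (WS z * ln (ak (fst z) (\<kappa>' z))) <= - (WS z * ln (a (fst z) (\<kappa> z))) + 2 * \<eta> * WS z + WS z * of_bool (\<kappa>' z ~= \<kappa> z) * ?c" for z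
 proof (cases "WS z = 0")
 case False
 then have W: "0 < WS z" using pmf_on_nonneg[OF WS, of z] by simp
 have "- ln (ak (fst z) (\<kappa>' z)) <= - ln (a (fst z) (\<kappa> z)) + 2 * \<eta> + of_bool (\<kappa>' z ~= \<kappa> z) * ?c"
 proof (cases "\<kappa>' z = \<kappa> z")
 case True
 have a0: "0 < a (fst z) (\<kappa> z)" using a_pos[of "fst z" "snd z"] W by simp
 have "(1 - \<eta>) * a (fst z) (\<kappa> z) <= ak (fst z) (\<kappa>' z)" using True \<eta> by (simp add: ak_def)
 then have "ln ((1 - \<eta>) * a (fst z) (\<kappa> z)) <= ln (ak (fst z) (\<kappa>' z))" using a0 \<eta> by (intro ln_mono) auto
 then have 1: "ln (1 - \<eta>) + ln (a (fst z) (\<kappa> z)) <= ln (ak (fst z) (\<kappa>' z))" using a0 \<eta> by (simp add: ln_mult_pos)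
 have "ln (1 / (1 - \<eta>)) <= 1 / (1 - \<eta>) - 1" using \<eta> by (intro ln_le_minus_one) simp
 also have "... <= 2 * \<eta>"
 proof -
 have "1 / (1 - \<eta>) - 1 = \<eta> / (1 - \<eta>)" using \<eta> by (simp add: field_simps)
 also have "... <= \<eta> / (1/2)" using \<eta> by (intro divide_left_mono) auto
 finally show ?thesis by simp
 qed
 finally have "- ln (1 - \<eta>) <= 2 * \<eta>" using \<eta> by (simp add: ln_div)
 then show ?thesis using 1 True by simp
 next
 case False
 have "\<eta> / ?n <= ak (fst z) (\<kappa>' z)" using g[of "fst z" "\<kappa>' z"] by (simp add: ak_def)
 then have "ln (\<eta> / ?n) <= ln (ak (fst z) (\<kappa>' z))" using \<eta> n by (intro ln_mono) auto
 then have "- ln (ak (fst z) (\<kappa>' z)) <= ?c" using \<eta> n by (simp add: ln_div)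
 then show ?thesis using False ln_a_le_0[of "fst z" "\<kappa> z"] \<eta> by simp
 qed
 then have "WS z * - ln (ak (fst z) (\<kappa>' z)) <= WS z * (- ln (a (fst z) (\<kappa> z)) + 2 * \<eta> + of_bool (\<kappa>' z ~= \<kappa> z) * ?c)"
 using W by (intro mult_left_mono) auto
 then show ?thesis by (simp add: algebra_simps)
 qed simp
 then have "(\<Sum>z\<in>UNIV. - (WS z * ln (ak (fst z) (\<kappa>' z)))) <= (\<Sum>z\<in>UNIV. - (WS z * ln (a (fst z) (\<kappa> z))) + 2 * \<eta> * WS z + WS z * of_bool (\<kappa>' z ~= \<kappa> z) * ?c)"
 by (intro sum_mono)
 also have "... = HS + 2 * \<eta> + (\<Sum>z\<in>UNIV. WS z * of_bool (\<kappa>' z ~= \<kappa> z)) * ?c"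
 unfolding sum.distrib sum_distrib_right[symmetric] sum_distrib_left[symmetric] pmf_on_sum[OF WS] by (simp only: HS_def sum_negf mult_1_right)
 also have "... <= HS + 2 * \<eta> + pne * ?c" using pne c0 by (intro add_left_mono mult_right_mono) auto
 finally show "- (\<Sum>z\<in>UNIV. WS z * ln (ak (fst z) (\<kappa>' z))) <= HS + 2 * \<eta> + pne * ?c" by (simp only: sum_negf)
qed

end

section \<open>Mismatched slots and the code of a slot\<close>

text \<open>The map from \<open>k\<close> to \<open>1 - q ^ k\<close> is concave, so it lies below
  its tangent at \<open>l\<close>, and only the average pool size matters. The slope times
  \<open>l\<close> is at most \<open>1 - q ^ l\<close>, which gives the factor
  \<open>D\<close>.\<close>

lemma sum_one_minus_power_le:
 fixes q :: real and k :: "'a => nat"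
 assumes q: "0 < q" "q <= 1" and D: "1 <= D" and k: "(\<Sum>B\<in>S. real (k B)) <= D * real l * real (card S)" and S: "finite S"
 shows "(\<Sum>B\<in>S. 1 - q ^ k B) <= real (card S) * (D * (1 - q ^ l))"
proof -
 define v where "v = - ln q"
 have v: "0 <= v" using q by (simp add: v_def)
 have "exp (- v) = q" using q by (simp add: v_def)
 then have qp: "q ^ n = exp (- (real n * v))" for n using exp_of_nat_mult[of n "- v"] by simp
 define c where "c = q ^ l * v"
 have c: "0 <= c" using q v by (simp add: c_def)
 have "1 - q ^ k B <= (1 - q ^ l) + c * (real (k B) - real l)" for B
 proof -
 have "q ^ l * (1 + (real l - real (k B)) * v) <= q ^ l * exp ((real l - real (k B)) * v)"
 using q by (intro mult_left_mono exp_ge_add_one_self) auto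
 also have "... = q ^ k B" unfolding qp by (simp add: exp_add[symmetric] algebra_simps)
 finally show ?thesis by (simp add: c_def algebra_simps)
 qed
 then have "(\<Sum>B\<in>S. 1 - q ^ k B) <= (\<Sum>B\<in>S. (1 - q ^ l) + c * (real (k B) - real l))" by (intro sum_mono)
 also have "... = real (card S) * (1 - q ^ l) + c * ((\<Sum>B\<in>S. real (k B)) - real (card S) * real l)"
 by (simp add: sum.distrib sum_subtractf sum_distrib_left[symmetric])
 also have "... <= real (card S) * (1 - q ^ l) + c * (D * real l * real (card S) - real (card S) * real l)"
 using k c by (intro add_left_mono mult_left_mono) auto
 also have "... = real (card S) * ((1 - q ^ l) + (D - 1) * (c * real l))" by (simp add: algebra_simps)
 also have "... <= real (card S) * ((1 - q ^ l) + (D - 1) * (1 - q ^ l))"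
 proof (intro mult_left_mono add_left_mono)
 have "1 + real l * v <= exp (real l * v)" by (rule exp_ge_add_one_self)
 then have "exp (- (real l * v)) * (1 + real l * v) <= exp (- (real l * v)) * exp (real l * v)" by (intro mult_left_mono) auto
 then show "c * real l <= 1 - q ^ l" unfolding c_def qp by (simp add: exp_minus field_simps)
 qed (use D in auto)
 finally show ?thesis by (simp add: algebra_simps)
qed

text \<open>A pool matches iff all its letters do, which has probability \<open>1 - pne\<close> to
  the power of its size; \<open>sum_one_minus_power_le\<close> averages over the slots.\<close>

lemma (in slots) mismatch_sum:
 fixes l0 :: nat
 defines "pne \<equiv> \<Sum>z\<in>UNIV. WS z * of_bool (f (fst z) ~= f' (snd z))"
 assumes p: "pne < 1" and D: "1 <= Dm" and k: "(\<Sum>B<T. real (card (pool B))) <= Dm * real l0 * real T"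
 shows "(\<Sum>s\<in>seqs l. \<Sum>t\<in>seqs l. (\<Prod>i<l. WS (s ! i, t ! i)) * (\<Sum>B<T. of_bool (\<not> match s t B))) <= real T * (Dm * (1 - (1 - pne) ^ l0))"
proof -
 have "0 <= pne" unfolding pne_def by (intro sum_nonneg) (simp add: pmf_on_nonneg[OF WS])
 then have q: "0 < 1 - pne" "1 - pne <= 1" using p by auto
 have one: "(\<Sum>s\<in>seqs l. \<Sum>t\<in>seqs l. \<Prod>i<l. WS (s ! i, t ! i)) = 1" using WS by (intro sum_seqs_pair_iid)
 have B: "(\<Sum>s\<in>seqs l. \<Sum>t\<in>seqs l. (\<Prod>i<l. WS (s ! i, t ! i)) * of_bool (\<not> match s t B)) = 1 - (1 - pne) ^ card (pool B)"
 if BT: "B < T" for B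
 proof -
 define g where "g c z = WS z * (if c \<in> pool B then of_bool (f (fst z) = f' (snd z)) else 1)" for c z
 have prod_if: "of_bool (match s t B) = (\<Prod>c<l. if c \<in> pool B then of_bool (f (s ! c) = f' (t ! c)) else 1 :: real)" for s t
 proof (cases "match s t B")
 case True
 then have "\<forall>c\<in>{..<l}. (if c \<in> pool B then of_bool (f (s ! c) = f' (t ! c)) else 1) = (1 :: real)" by (auto simp: match_def)
 then show ?thesis using True by (simp only: prod.neutral of_bool_eq)
 next
 case False
 then obtain c where "c \<in> pool B" "f (s ! c) ~= f' (t ! c)" by (auto simp: match_def)
 then have "\<exists>c\<in>{..<l}. (if c \<in> pool B then of_bool (f (s ! c) = f' (t ! c)) else 1 :: real) = 0" using pool[OF BT] by force
 then have "(\<Prod>c<l. if c \<in> pool B then of_bool (f (s ! c) = f' (t ! c)) else 1 :: real) = 0" by (intro prod_zero) auto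
 then show ?thesis using False by simp
 qed
 have "(\<Sum>s\<in>seqs l. \<Sum>t\<in>seqs l. (\<Prod>i<l. WS (s ! i, t ! i)) * of_bool (match s t B)) = (\<Sum>s\<in>seqs l. \<Sum>t\<in>seqs l. \<Prod>c<l. g c (s ! c, t ! c))"
 unfolding prod_if prod.distrib[symmetric] by (simp add: g_def cong: if_cong)
 also have "... = (\<Sum>zs\<in>seqs l. \<Prod>c<l. g c (zs ! c))"
 unfolding sum_seqs_zip by (intro sum.cong prod.cong refl) (auto simp: seqs_iff)
 also have "... = (\<Prod>c<l. \<Sum>z\<in>UNIV. g c z)" by (rule sum_seqs_prod)
 also have "... = (\<Prod>c<l. if c \<in> pool B then 1 - pne else 1)"
 proof (intro prod.cong refl)
 fix c
 have "(\<Sum>z\<in>UNIV. WS z * of_bool (f (fst z) = f' (snd z))) = (\<Sum>z\<in>UNIV. WS z - WS z * of_bool (f (fst z) ~= f' (snd z)))"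
 by (intro sum.cong refl) simp
 then show "(\<Sum>z\<in>UNIV. g c z) = (if c \<in> pool B then 1 - pne else 1)"
 unfolding g_def by (cases "c \<in> pool B") (simp_all add: sum_subtractf pmf_on_sum[OF WS] pne_def)
 qed
 also have "... = (\<Prod>c\<in>pool B. 1 - pne)" using pool[OF BT] by (intro prod.mono_neutral_cong_right) auto
 finally have m: "(\<Sum>s\<in>seqs l. \<Sum>t\<in>seqs l. (\<Prod>i<l. WS (s ! i, t ! i)) * of_bool (match s t B)) = (1 - pne) ^ card (pool B)" by simp
 have "(\<Sum>s\<in>seqs l. \<Sum>t\<in>seqs l. (\<Prod>i<l. WS (s ! i, t ! i)) * of_bool (\<not> match s t B))
 = (\<Sum>s\<in>seqs l. \<Sum>t\<in>seqs l. (\<Prod>i<l. WS (s ! i, t ! i)) - (\<Prod>i<l. WS (s ! i, t ! i)) * of_bool (match s t B))"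
 by (intro sum.cong refl) (simp add: of_bool_not_iff right_diff_distrib del: prod_zero_iff)
 then show ?thesis by (simp only: sum_subtractf one m)
 qed
 have "(\<Sum>s\<in>seqs l. \<Sum>t\<in>seqs l. (\<Prod>i<l. WS (s ! i, t ! i)) * (\<Sum>B<T. of_bool (\<not> match s t B)))
 = (\<Sum>B<T. \<Sum>s\<in>seqs l. \<Sum>t\<in>seqs l. (\<Prod>i<l. WS (s ! i, t ! i)) * of_bool (\<not> match s t B))"
 proof -
 have "(\<Sum>s\<in>seqs l. \<Sum>t\<in>seqs l. (\<Prod>i<l. WS (s ! i, t ! i)) * (\<Sum>B<T. of_bool (\<not> match s t B)))
 = (\<Sum>s\<in>seqs l. \<Sum>B<T. \<Sum>t\<in>seqs l. (\<Prod>i<l. WS (s ! i, t ! i)) * of_bool (\<not> match s t B))"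
 unfolding sum_distrib_left by (intro sum.cong refl sum.swap)
 then show ?thesis by (simp only: sum.swap[of _ "{..<T}"])
 qed
 also have "... = (\<Sum>B<T. 1 - (1 - pne) ^ card (pool B))" using B by (intro sum.cong) auto
 also have "... <= real T * (Dm * (1 - (1 - pne) ^ l0))"
 using sum_one_minus_power_le[OF q D, where S="{..<T}" and k="%B. card (pool B)" and l=l0] k by simp
 finally show ?thesis .
qed

text \<open>Position \<open>p\<close> belongs to slot \<open>p div (t * l)\<close>. Inside the slot
  the \<open>t\<close> hash symbols are sent one after the other, each by a codeword of length
  \<open>l\<close>.\<close>

definition slot_code :: "(nat => 'u list) => nat => nat => nat => (nat => 'k list => nat list) => 'k list => 'u list" where
 "slot_code c l t T H k = map (%p. c (H (p div (t * l)) k ! (p mod (t * l) div l)) ! (p mod l)) [0..<T * (t * l)]"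

definition slot_dec :: "('y list => nat) => nat => nat => 'y list => nat list" where
 "slot_dec d l t y = map (%i. d (blk l i y)) [0..<t]"

lemma block_index: "B < T ==> i < t ==> B * t + i < T * (t :: nat)"
proof -
 assume "B < T" "i < t"
 then have "B * t + i < Suc B * t" by simp
 also have "... <= T * t" using \<open>B < T\<close> by (intro mult_le_mono1) auto
 finally show ?thesis .
qed

lemma slot_code_nth:
 assumes "B < T" "i < t" "j < l"
 shows "slot_code c l t T H k ! (B * (t * l) + (i * l + j)) = c (H B k ! i) ! j"
proof -
 have r: "i * l + j < t * l" by (rule block_index[OF assms(2,3)])
 have p: "B * (t * l) + (i * l + j) < T * (t * l)" by (rule block_index[OF assms(1) r])
 have quot: "(B * w + r) div w = B" "(B * w + r) mod w = r" if "r < w" for w r :: nat using that by auto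
 have d: "(B * (t * l) + (i * l + j)) div (t * l) = B" "(B * (t * l) + (i * l + j)) mod (t * l) = i * l + j"
 using quot[OF r] by simp_all
 have m: "(B * (t * l) + (i * l + j)) mod l = j"
 proof -
 have "B * (t * l) + (i * l + j) = (B * t + i) * l + j" by (simp add: algebra_simps)
 then show ?thesis using assms(3) by (simp only: mod_mult_self3 mod_less)
 qed
 show ?thesis unfolding slot_code_def using p assms(3) by (simp add: d m mod_less[OF r])
qed

lemma card_blocks: fixes m l :: nat shows "card {p. p < m * l & P p} = (\<Sum>t<m. card {i. i < l & P (t * l + i)})"
proof (induction m)
 case (Suc m)
 have "{p. p < Suc m * l & P p} = {p. p < m * l & P p} \<union> (%i. m * l + i) ` {i. i < l & P (m * l + i)}"
 proof (intro set_eqI iffI)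
 fix p assume p: "p \<in> {p. p < Suc m * l & P p}"
 show "p \<in> {p. p < m * l & P p} \<union> (%i. m * l + i) ` {i. i < l & P (m * l + i)}"
 proof (cases "p < m * l")
 case False
 then show ?thesis using p by (intro UnI2 image_eqI[of _ _ "p - m * l"]) auto
 qed (use p in auto)
 qed auto
 then have "card {p. p < Suc m * l & P p} = card {p. p < m * l & P p} + card ((%i. m * l + i) ` {i. i < l & P (m * l + i)})"
 by (simp only:) (rule card_Un_disjoint; auto)
 then show ?case by (simp add: Suc.IH card_image)
qed simp

lemma slot_code_comp:
 assumes c: "!!m. m < M ==> real (card {i. i < l & c m ! i = u}) = real l * pu"
 and H: "length (H B k) = t" "!!m. m \<in> set (H B k) ==> m < M" and B: "B < T"
 shows "real (card {i. i < t * l & slot_code c l t T H k ! (B * (t * l) + i) = u}) = real (t * l) * pu"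
proof -
 have "real (card {i. i < t * l & slot_code c l t T H k ! (B * (t * l) + i) = u})
 = (\<Sum>i<t. real (card {j. j < l & slot_code c l t T H k ! (B * (t * l) + (i * l + j)) = u}))"
 unfolding card_blocks[of t l "%i. slot_code c l t T H k ! (B * (t * l) + i) = u"] by simp
 also have "... = (\<Sum>i<t. real l * pu)"
 proof (intro sum.cong refl)
 fix i assume i: "i \<in> {..<t}"
 have "{j. j < l & slot_code c l t T H k ! (B * (t * l) + (i * l + j)) = u} = {j. j < l & c (H B k ! i) ! j = u}"
 using slot_code_nth[OF B, of i t _ l c H k] i by auto
 then show "real (card {j. j < l & slot_code c l t T H k ! (B * (t * l) + (i * l + j)) = u}) = real l * pu"
 using c[of "H B k ! i"] H i by simp
 qed
 finally show ?thesis by (simp add: mult.assoc)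
qed

text \<open>Union bound over the \<open>t\<close> codewords of a slot, each of which is decoded on
  its own.\<close>

lemma slot_dec_error:
 fixes P :: "'u => 'y::finite => real"
 assumes P: "stoch P" and H: "length (H B k) = t" and B: "B < T"
 shows "(\<Sum>y\<in>seqs (t * l). (\<Prod>i<t * l. P (slot_code c l t T H k ! (B * (t * l) + i)) (y ! i)) * of_bool (slot_dec d l t y ~= H B k))
 <= (\<Sum>i<t. \<Sum>y\<in>seqs l. seq_prob P (c (H B k ! i)) y * of_bool (d y ~= H B k ! i))"
proof -
 let ?g = "%i b. seq_prob P (c (H B k ! i)) b"
 have g0: "0 <= ?g i b" for i b unfolding seq_prob_def by (intro prod_nonneg) (simp add: stoch_nonneg[OF P])
 have g1: "(\<Sum>b\<in>seqs l. ?g i b) = 1" for i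
 proof -
 have "(\<Sum>b\<in>seqs l. ?g i b) = (\<Sum>b\<in>seqs l. \<Prod>j<l. P (c (H B k ! i) ! j) (b ! j))"
 by (intro sum.cong) (auto simp: seq_prob_def seqs_iff)
 also have "... = 1" using P by (intro sum_seqs_iid) (simp add: stoch_def)
 finally show ?thesis .
 qed
 have pr: "(\<Prod>i<t * l. P (slot_code c l t T H k ! (B * (t * l) + i)) (y ! i)) = (\<Prod>i<t. ?g i (blk l i y))" if y: "y \<in> seqs (t * l)" for y
 proof -
 have "(\<Prod>i<t * l + 0. P (slot_code c l t T H k ! (B * (t * l) + i)) (y ! i)) = (\<Prod>i<t. \<Prod>j<l. P (slot_code c l t T H k ! (B * (t * l) + (i * l + j))) (y ! (i * l + j)))"
 using prod_blocks[of "%i. P (slot_code c l t T H k ! (B * (t * l) + i)) (y ! i)" t l 0] by simp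
 also have "... = (\<Prod>i<t. ?g i (blk l i y))"
 proof (intro prod.cong refl)
 fix i assume i: "i \<in> {..<t}"
 have "length (blk l i y) = l" using y i length_blk[of i t y l 0] by (simp add: seqs_iff)
 then show "(\<Prod>j<l. P (slot_code c l t T H k ! (B * (t * l) + (i * l + j))) (y ! (i * l + j))) = ?g i (blk l i y)"
 unfolding seq_prob_def using slot_code_nth[OF B, of i t _ l c H k] blk_nth[of i t _ l y 0] i y
 by (intro prod.cong) (auto simp: seqs_iff)
 qed
 finally show ?thesis by simp
 qed
 have un: "of_bool (slot_dec d l t y ~= H B k) <= (\<Sum>i<t. of_bool (d (blk l i y) ~= H B k ! i) :: real)" for y
 proof (cases "slot_dec d l t y = H B k")
 case False
 then obtain i where i: "i < t" "d (blk l i y) ~= H B k ! i" using H by (auto simp: slot_dec_def list_eq_iff_nth_eq)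
 then have "of_bool (d (blk l i y) ~= H B k ! i) <= (\<Sum>i<t. of_bool (d (blk l i y) ~= H B k ! i) :: real)"
 by (intro member_le_sum[where f="%i. of_bool (d (blk l i y) ~= H B k ! i)"]) auto
 then show ?thesis using False i by simp
 qed (simp add: sum_nonneg)
 have "(\<Sum>y\<in>seqs (t * l). (\<Prod>i<t * l. P (slot_code c l t T H k ! (B * (t * l) + i)) (y ! i)) * of_bool (slot_dec d l t y ~= H B k))
 <= (\<Sum>y\<in>seqs (t * l). (\<Prod>i<t. ?g i (blk l i y)) * (\<Sum>i<t. of_bool (d (blk l i y) ~= H B k ! i)))"
 by (intro sum_mono) (simp only: pr, intro mult_left_mono un prod_nonneg g0)
 also have "... = (\<Sum>i<t. \<Sum>y\<in>seqs (t * l). (\<Prod>i<t. ?g i (blk l i y)) * of_bool (d (blk l i y) ~= H B k ! i))"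
 unfolding sum_distrib_left by (rule sum.swap)
 also have "... = (\<Sum>i<t. \<Sum>y\<in>seqs l. ?g i y * of_bool (d y ~= H B k ! i))"
 proof (rule sum.cong[OF refl])
 fix i assume i: "i \<in> {..<t}"
 define G where "G i' b = ?g i' b * (if i' = i then of_bool (d b ~= H B k ! i) else 1)" for i' b
 have "(\<Prod>i<t. ?g i (blk l i y)) * of_bool (d (blk l i y) ~= H B k ! i) = (\<Prod>i'<t. G i' (blk l i' y))" for y
 proof -
 have "(\<Prod>i'<t. if i' = i then of_bool (d (blk l i' y) ~= H B k ! i) else 1) = (of_bool (d (blk l i y) ~= H B k ! i) :: real)"
 using i by (simp add: prod.delta)
 then show ?thesis unfolding G_def prod.distrib by simp
 qed
 then have "(\<Sum>y\<in>seqs (t * l). (\<Prod>i<t. ?g i (blk l i y)) * of_bool (d (blk l i y) ~= H B k ! i)) = (\<Sum>y\<in>seqs (t * l + 0). (\<Prod>i'<t. G i' (blk l i' y)) * 1)"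
 by simp
 also have "... = (\<Prod>i'<t. \<Sum>b\<in>seqs l. G i' b)" using sum_seqs_blocks[where m=t and l=l and r=0 and g=G and h="%_. 1"] by simp
 also have "... = (\<Prod>i'<t. if i' = i then (\<Sum>y\<in>seqs l. ?g i y * of_bool (d y ~= H B k ! i)) else 1)"
 by (intro prod.cong refl) (simp add: G_def g1)
 also have "... = (\<Sum>y\<in>seqs l. ?g i y * of_bool (d y ~= H B k ! i))" using i by (simp add: prod.delta)
 finally show "(\<Sum>y\<in>seqs (t * l). (\<Prod>i<t. ?g i (blk l i y)) * of_bool (d (blk l i y) ~= H B k ! i)) = (\<Sum>y\<in>seqs l. ?g i y * of_bool (d y ~= H B k ! i))" .
 qed
 finally show ?thesis .
qed



section \<open>Numerical inequalities and the gain of a superletter\<close>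

text \<open>Reduces rational lower bounds on logarithms to integer powers, using that the base of
  the natural logarithm is below 2.72.\<close>

lemma ln_ge_quotient:
 assumes "0 < q" "0 < x" "(272/100) ^ p <= x ^ q"
 shows "real p / real q <= ln x"
proof -
 have "ln (exp 1) <= ln (272/100 :: real)" using e_less_272 by (intro ln_mono) auto
 then have "real p * 1 <= real p * ln (272/100)" by (intro mult_left_mono) auto
 also have "... = ln ((272/100) ^ p)" by (simp add: ln_realpow)
 also have "... <= ln (x ^ q)" using assms by (intro ln_mono) auto
 also have "... = real q * ln x" using assms by (simp add: ln_realpow)
 finally show ?thesis using assms by (simp add: field_simps)
qed

text \<open>The tangent of \<open>exp\<close> at \<open>5/4\<close> has slope \<open>c\<close>
  between 3.48 and 4 and intercept \<open>- c / 4\<close>, which the summand 1 compensates.\<close>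

lemma exp_plus_1_ge: "348/100 * y <= 1 + exp (y::real)"
proof -
 define c where "c = exp (5/4 :: real)"
 obtain t where t: "c = (\<Sum>m<6. (5/4) ^ m / fact m) + exp t / fact 6 * (5/4 :: real) ^ 6"
 unfolding c_def using Maclaurin_exp_le[of "5/4" 6] by blast
 moreover have "0 <= exp t / fact 6 * (5/4 :: real) ^ 6" by simp
 moreover have "348/100 <= (\<Sum>m<6. (5/4 :: real) ^ m / fact m)" by (simp add: eval_nat_numeral fact_numeral)
 ultimately have c1: "348/100 <= c" by linarith
 have "c = exp 1 * exp (1/4)" by (simp add: c_def exp_add[symmetric])
 also have "... <= 272/100 * (1 + 1/4 + (1/4)\<^sup>2)" using e_less_272 by (intro mult_mono exp_bound) auto
 also have "... <= 4" by (simp add: power2_eq_square)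
 finally have c2: "c <= 4" .
 have "c * (1 + (y - 5/4)) <= c * exp (y - 5/4)" using c1 by (intro mult_left_mono exp_ge_add_one_self) auto
 also have "... = exp y" by (simp add: c_def exp_add[symmetric])
 finally have e: "c * y - c / 4 <= exp y" by (simp add: algebra_simps)
 show ?thesis
 proof (cases "0 <= y")
 case True
 then have "348/100 * y <= c * y" using c1 by (intro mult_right_mono) auto
 then show ?thesis using e c2 by linarith
 next
 case False
 then show ?thesis using exp_gt_zero[of y] by linarith
 qed
qed

lemma mult_exp_minus_le: "d * exp (- d) <= 10/27" for d :: real
proof -
 have "d <= exp (d - 1)" using exp_ge_add_one_self[of "d - 1"] by simp
 then have "d * exp (- d) <= exp (d - 1) * exp (- d)" by (intro mult_right_mono) auto
 also have "... = inverse (exp 1)" by (simp add: exp_add[symmetric] exp_minus[symmetric])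
 also have "... <= inverse (27/10)" using exp_1_ge by (intro le_imp_inverse_le) auto
 finally show ?thesis by simp
qed

text \<open>For \<open>y <= b\<close> the exponential is at most 2.72; for larger \<open>y\<close>
  it decays faster than the powers of \<open>y - b\<close> grow.\<close>

lemma shifted_exp_bounds:
 fixes b y :: real
 assumes b: "2/3 <= b" "b <= y + 1" and y: "0 <= y"
 shows "y * exp (b - y) <= 272/100 * b" "y\<^sup>2 * exp (b - y) <= 335/100 * b\<^sup>2"
proof -
 have "y * exp (b - y) <= 272/100 * b & y\<^sup>2 * exp (b - y) <= 335/100 * b\<^sup>2"
 proof (cases "y <= b")
 case True
 have "exp (b - y) <= exp 1" using b by simp
 then have e: "exp (b - y) <= 272/100" using e_less_272 by linarith
 have "y * exp (b - y) <= b * (272/100)" using True b e y by (intro mult_mono) auto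
 moreover have "y\<^sup>2 * exp (b - y) <= b\<^sup>2 * (335/100)" using True b e y by (intro mult_mono power_mono) auto
 ultimately show ?thesis by simp
 next
 case False
 define d where "d = y - b"
 have d: "0 <= d" using False by (simp add: d_def)
 have ed: "exp (- d) <= 1" using d by simp
 have d1: "d * exp (- d) <= 10/27" by (rule mult_exp_minus_le)
 have d2: "d\<^sup>2 * exp (- d) <= (20/27)\<^sup>2"
 proof -
 have h: "d / 2 * exp (- (d / 2)) <= 10/27" by (rule mult_exp_minus_le)
 have "d\<^sup>2 * exp (- d) = (2 * (d / 2 * exp (- (d / 2))))\<^sup>2" by (simp add: power2_eq_square exp_add[symmetric])
 also have "... <= (20/27)\<^sup>2" using h d by (intro power_mono) auto
 finally show ?thesis .
 qed
 have eq: "exp (b - y) = exp (- d)" "y = b + d" by (auto simp: d_def)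
 have "(b + d) * exp (- d) <= b * 1 + 10/27" unfolding distrib_right using ed b d1 by (intro add_mono mult_left_mono) auto
 also have "... <= 272/100 * b" using b by simp
 finally have 1: "(b + d) * exp (- d) <= 272/100 * b" .
 have bb: "2/3 * b <= b * b" "4/9 <= b * b" using b mult_mono[of "2/3" b "2/3" b] by (auto intro: mult_right_mono)
 have "(b + d)\<^sup>2 * exp (- d) = b\<^sup>2 * exp (- d) + 2 * b * (d * exp (- d)) + d\<^sup>2 * exp (- d)" by (simp add: power2_eq_square algebra_simps)
 also have "... <= b\<^sup>2 * 1 + 2 * b * (10/27) + (20/27)\<^sup>2" using ed d1 d2 b by (intro add_mono mult_left_mono) auto
 also have "... <= 335/100 * b\<^sup>2" using bb by (simp add: power2_eq_square)
 finally have 2: "(b + d)\<^sup>2 * exp (- d) <= 335/100 * b\<^sup>2" .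
 show ?thesis unfolding eq(1) unfolding eq(2) using 1 2 by blast
 qed
 then show "y * exp (b - y) <= 272/100 * b" "y\<^sup>2 * exp (b - y) <= 335/100 * b\<^sup>2" by blast+
qed

text \<open>The chord of an exponential through 0 and \<open>1/2\<close>: the constant comes from
  \<open>2 * ln 2 <= 25/18\<close>.\<close>

lemma minus_ln_one_minus_le:
 fixes x :: real
 assumes "0 <= x" "x <= 1/2" shows "- ln (1 - x) <= 139/100 * x"
proof -
 have "exp (- ln 2 * (2 * x)) <= 1 + 2 * x / 1 * (exp (- ln 2 * 1) - 1)" using assms by (intro exp_chord) auto
 also have "... = 1 - x" by (simp add: exp_minus)
 finally have "ln (exp (- ln 2 * (2 * x))) <= ln (1 - x)" by (intro ln_mono) auto
 then have "- ln (1 - x) <= 2 * (x * ln 2)" by (simp add: mult_ac)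
 also have "x * ln 2 <= x * (25/36)" using assms ln2_le_25_over_36 by (intro mult_left_mono)
 finally show ?thesis using assms by linarith
qed

definition h2 :: "real => real" where "h2 x = - (x * ln x + (1 - x) * ln (1 - x))"

text \<open>Gibbs' inequality replaces the logarithms at \<open>p\<close> by those at
  \<open>q\<close>; the resulting expression is linear in \<open>p\<close> and increasing because
  \<open>q <= 1/2\<close>.\<close>

lemma h2_mono:
 assumes p: "0 < p" "p <= q" "q <= 1/2" shows "h2 p <= h2 q"
proof -
 have "p * ln (q / p) <= p * (q / p - 1)" using p by (intro mult_left_mono ln_le_minus_one) auto
 moreover have "(1 - p) * ln ((1 - q) / (1 - p)) <= (1 - p) * ((1 - q) / (1 - p) - 1)" using p by (intro mult_left_mono ln_le_minus_one) auto
 moreover have "p * (q / p - 1) + (1 - p) * ((1 - q) / (1 - p) - 1) = 0" using p by (simp add: field_simps)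
 ultimately have "p * ln (q / p) + (1 - p) * ln ((1 - q) / (1 - p)) <= 0" by linarith
 then have "h2 p <= - (p * ln q) - (1 - p) * ln (1 - q)" using p by (simp add: h2_def ln_div algebra_simps)
 moreover have "p * (ln (1 - q) - ln q) <= q * (ln (1 - q) - ln q)" using p by (intro mult_right_mono) auto
 ultimately show ?thesis by (simp add: h2_def algebra_simps)
qed

lemma h2_ge:
 assumes p: "0 < p" "p <= 1/2" shows "p * (ln (1 / p) + 1 - p) <= h2 p"
proof -
 have "ln (1 - p) <= - p" using ln_le_minus_one[of "1 - p"] p by simp
 then have "(1 - p) * p <= (1 - p) * - ln (1 - p)" using p by (intro mult_left_mono) auto
 then show ?thesis using p by (simp add: h2_def ln_div algebra_simps)
qed

text \<open>The per-receiver balance: every correction to the rate condition is dominated by the gain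
 that the binary entropies and the alphabet terms of the condition leave over.\<close>

lemma gain_pos:
 fixes l t T \<phi> \<phi>j b \<xi> :: real
 assumes \<phi>: "0 < \<phi>" "\<phi> <= \<phi>j" "\<phi>j <= 1/2" "b = ln (1 / \<phi>)" and l: "134 <= l" and t: "1 <= t" and T: "1 <= T"
 and \<xi>: "0 <= \<xi>" "\<xi> <= \<phi>" and B: "0 <= B" and I: "0 <= I" "I <= \<nu>" and \<sigma>: "0 <= \<sigma>j" and D: "0 <= D"
 and cond: "HS + \<beta> + h2 \<phi>j / l + \<phi>j * \<sigma>j + h2 \<phi>j + \<phi>j * \<nu> < I"
 and lam: "0 <= lam" "lam <= t * G"
 and HA: "HA <= HS + 2 * (\<phi> / l\<^sup>2) + pne * (\<sigma>j + ln (1 / (\<phi> / l\<^sup>2)))" "l * pne <= 139/100 * \<xi>"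
 and x: "x <= T * t * l * \<beta> + x'"
 and A: "2 * B * (b + t * G) <= \<phi>j * (1 + \<sigma>j)"
 and N: "x' / (T * t) + \<phi> * (2 * D * b / t + D * (G + l * I) + 278/100 + 2 / l + 139/100 * (\<sigma>j + b + 2 * ln l))
 <= l * \<phi> * (b + 1 - \<phi>) + (l - 1) * \<phi> * \<sigma>j + l * \<phi> * I"
 shows "0 < 2 * T * ln (1 - \<phi>) + T * (t * l) * I - T * D * \<xi> * (2 * b + lam + t * l * I) - T * t * (2 * B) * (b + lam) - T * (t * l) * HA - x"
proof -
 have Tt: "0 < T * t" using t T by simp
 have t0: "0 < t" and T0: "0 < T" and l0: "0 < l" using t T l by auto
 have b0: "2/3 <= b"
 proof -
 have "ln 2 <= ln (1 / \<phi>)" using \<phi> by (intro ln_mono) (auto simp: field_simps)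
 then show ?thesis using ln2_ge_two_thirds \<phi>(4) by linarith
 qed
 have 1: "- (2 * T * ln (1 - \<phi>)) <= T * t * (278/100 * \<phi>)"
 proof -
 have "- ln (1 - \<phi>) <= 139/100 * \<phi>" using \<phi> by (intro minus_ln_one_minus_le) auto
 then have "2 * T * - ln (1 - \<phi>) <= 2 * T * (139/100 * \<phi>)" using T by (intro mult_left_mono) auto
 also have "... = T * 1 * (278/100 * \<phi>)" by simp
 also have "... <= T * t * (278/100 * \<phi>)" using T t \<phi> by (intro mult_right_mono mult_left_mono) auto
 finally show ?thesis by simp
 qed
 have 2: "T * D * \<xi> * (2 * b + lam + t * l * I) <= T * t * (\<phi> * (2 * D * b / t + D * (G + l * I)))"
 proof -
 have "T * D * \<xi> * (2 * b + lam + t * l * I) <= T * D * \<phi> * (2 * b + t * G + t * l * I)"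
 using \<xi> T D lam b0 I t l \<phi> by (intro mult_mono mult_left_mono add_mono) auto
 also have "... = T * t * (\<phi> * (2 * D * b / t + D * (G + l * I)))" using t0 by (simp add: field_simps)
 finally show ?thesis .
 qed
 have 3: "T * t * (2 * B) * (b + lam) <= T * t * (\<phi>j * (1 + \<sigma>j))"
 proof -
 have "T * t * (2 * B) * (b + lam) <= T * t * (2 * B) * (b + t * G)" using Tt B lam by (intro mult_left_mono add_mono) auto
 also have "... = T * t * (2 * B * (b + t * G))" by simp
 also have "... <= T * t * (\<phi>j * (1 + \<sigma>j))" using A Tt by (intro mult_left_mono) auto
 finally show ?thesis .
 qed
 have 4: "T * (t * l) * HA <= T * t * (l * HS + \<phi> * (2 / l) + 139/100 * \<phi> * (\<sigma>j + b + 2 * ln l))"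
 proof -
 have e: "ln (1 / (\<phi> / l\<^sup>2)) = b + 2 * ln l" using \<phi> l0 by (simp add: ln_div ln_mult_pos ln_realpow)
 have s0: "0 <= \<sigma>j + b + 2 * ln l" using \<sigma> b0 l by simp
 have "l * HA <= l * (HS + 2 * (\<phi> / l\<^sup>2) + pne * (\<sigma>j + ln (1 / (\<phi> / l\<^sup>2))))" using HA l0 by (intro mult_left_mono) auto
 also have "... = l * HS + \<phi> * (2 / l) + l * pne * (\<sigma>j + b + 2 * ln l)" unfolding e using l0 by (simp add: power2_eq_square algebra_simps)
 also have "... <= l * HS + \<phi> * (2 / l) + 139/100 * \<phi> * (\<sigma>j + b + 2 * ln l)"
 using HA(2) \<xi> s0 by (intro add_left_mono mult_right_mono) auto
 finally have "T * t * (l * HA) <= T * t * (l * HS + \<phi> * (2 / l) + 139/100 * \<phi> * (\<sigma>j + b + 2 * ln l))" using Tt by (intro mult_left_mono) auto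
 then show ?thesis by (simp only: mult.assoc)
 qed
 have 5: "x <= T * t * (l * \<beta> + x' / (T * t))"
 using x t0 T0 by (simp add: distrib_left mult.assoc)
 \<comment> \<open>After multiplication by \<open>l\<close>, the term \<open>h2 \<phi>j\<close> pays
   for one \<phi>j, and one of the \<open>l\<close> copies of \<open>\<phi>j * \<sigma>j\<close> is
   set aside; together they cover the decoding failures bounded by \<open>A\<close>. The other terms
   meet the hypothesis \<open>N\<close>.\<close>
 have key: "l * HS + l * \<beta> + x' / (T * t) + \<phi> * (2 * D * b / t + D * (G + l * I) + 278/100 + 2 / l + 139/100 * (\<sigma>j + b + 2 * ln l)) + \<phi>j * (1 + \<sigma>j) < l * I"
 proof -
 have hj: "\<phi>j <= h2 \<phi>j"
 proof -
 have "ln 2 <= ln (1 / \<phi>j)" using \<phi> by (intro ln_mono) (auto simp: field_simps)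
 then have "1 <= ln (1 / \<phi>j) + 1 - \<phi>j" using \<phi>(3) ln2_ge_two_thirds by linarith
 then have "\<phi>j * 1 <= \<phi>j * (ln (1 / \<phi>j) + 1 - \<phi>j)" using \<phi> by (intro mult_left_mono) auto
 then show ?thesis using h2_ge[of \<phi>j] \<phi> by linarith
 qed
 have "\<phi> * (b + 1 - \<phi>) <= h2 \<phi>j" using h2_ge[of \<phi>] h2_mono[of \<phi> \<phi>j] \<phi> by simp
 then have h: "l * (\<phi> * (b + 1 - \<phi>)) <= l * h2 \<phi>j" using l0 by (intro mult_left_mono) auto
 have "l * (HS + \<beta> + h2 \<phi>j / l + \<phi>j * \<sigma>j + h2 \<phi>j + \<phi>j * \<nu>) < l * I" using cond l0 by (intro mult_strict_left_mono) auto
 then have c: "l * HS + l * \<beta> + h2 \<phi>j + l * (\<phi>j * \<sigma>j) + l * h2 \<phi>j + l * (\<phi>j * \<nu>) < l * I" using l0 by (simp add: distrib_left)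
 have s: "(l - 1) * (\<phi> * \<sigma>j) + \<phi>j * \<sigma>j <= l * (\<phi>j * \<sigma>j)"
 proof -
 have "(l - 1) * (\<phi> * \<sigma>j) <= (l - 1) * (\<phi>j * \<sigma>j)" using l \<phi> \<sigma> by (intro mult_left_mono mult_right_mono) auto
 then show ?thesis by (simp add: algebra_simps)
 qed
 have v: "l * (\<phi> * I) <= l * (\<phi>j * \<nu>)" using l0 \<phi> I by (intro mult_left_mono mult_mono) auto
 have N': "x' / (T * t) + \<phi> * (2 * D * b / t + D * (G + l * I) + 278/100 + 2 / l + 139/100 * (\<sigma>j + b + 2 * ln l))
 <= l * (\<phi> * (b + 1 - \<phi>)) + (l - 1) * (\<phi> * \<sigma>j) + l * (\<phi> * I)" using N by (simp only: mult.assoc)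
 have "\<phi>j * (1 + \<sigma>j) = \<phi>j + \<phi>j * \<sigma>j" by (simp add: distrib_left)
 then show ?thesis using N' h c s v hj by linarith
 qed
 let ?R = "l * HS + l * \<beta> + x' / (T * t) + \<phi> * (2 * D * b / t + D * (G + l * I) + 278/100 + 2 / l + 139/100 * (\<sigma>j + b + 2 * ln l)) + \<phi>j * (1 + \<sigma>j)"
 have "T * t * ?R < T * t * (l * I)" using key Tt by (intro mult_strict_left_mono) auto
 moreover have "T * t * ?R = T * t * (278/100 * \<phi>) + T * t * (\<phi> * (2 * D * b / t + D * (G + l * I))) + T * t * (\<phi>j * (1 + \<sigma>j))
 + T * t * (l * HS + \<phi> * (2 / l) + 139/100 * \<phi> * (\<sigma>j + b + 2 * ln l)) + T * t * (l * \<beta> + x' / (T * t))"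
 by (simp add: distrib_left distrib_right algebra_simps del: times_divide_eq_right times_divide_eq_left)
 moreover have "T * t * (l * I) = T * (t * l) * I" by simp
 ultimately show ?thesis using 1 2 3 4 5 by linarith
qed

section \<open>Numerical consequences of the block-length condition\<close>

text \<open>All quantities are in nats: \<open>y\<close> is the logarithm of the larger output
  alphabet, \<open>U\<close> the size of the auxiliary alphabet, and \<open>lst\<close> the
  logarithmic form of the lower bound on \<open>l\<close>.\<close>

locale numbers =
 fixes l :: nat and a y \<rho> U :: real
 assumes l0: "1 <= l" and a: "a = ln (real l + 1)" and ey: "2 <= exp y" and U: "2 <= U"
 and lst: "2 * U * (1 + exp y) * a <= real l * \<rho> / 2" and \<rho>: "\<rho> <= y"
begin

lemma y: "2/3 <= y"
proof -
 have "ln 2 <= ln (exp y)" using ey by (intro ln_mono) auto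
 then show ?thesis using ln2_ge_two_thirds by simp
qed

lemma a0: "2/3 <= a"
proof -
 have "ln 2 <= a" unfolding a using l0 by (intro ln_mono) auto
 then show ?thesis using ln2_ge_two_thirds by linarith
qed

lemma ly: "8 * ((1 + exp y) * a) <= real l * y"
proof -
 have "2 * 2 * ((1 + exp y) * a) <= 2 * U * ((1 + exp y) * a)" using U a0 by (intro mult_right_mono) (auto intro: add_nonneg_nonneg)
 moreover have "real l * \<rho> <= real l * y" using \<rho> by (intro mult_left_mono) auto
 moreover have "2 * U * ((1 + exp y) * a) <= real l * \<rho> / 2" using lst by (simp only: mult.assoc)
 ultimately show ?thesis by linarith
qed

text \<open>Combines \<open>ly\<close> with \<open>exp_plus_1_ge\<close>; the constant is 8 times
  3.48.\<close>

lemma la: "2784/100 * a <= real l"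
proof -
 have "348/100 * y * a <= (1 + exp y) * a" using exp_plus_1_ge a0 by (intro mult_right_mono) auto
 moreover have "y * (2784/100 * a) = 8 * (348/100 * y * a)" "y * real l = real l * y" by simp_all
 ultimately have "y * (2784/100 * a) <= y * real l" using ly by linarith
 then show ?thesis using y by (simp add: mult_le_cancel_left)
qed

text \<open>Bootstrapping: a lower bound on \<open>a\<close> gives one on \<open>l\<close> by
  \<open>la\<close>, which improves the bound on the logarithm \<open>a\<close>. Five rounds reach
  134.\<close>

lemma a_ge: "24/5 <= a" and l_ge: "134 <= l"
proof -
 have x0: "0 < real l + 1" by simp
 have s: "real p / real q <= a" if "0 < q" "(272/100) ^ p <= c ^ q" "0 <= c" "c <= real l + 1" for p q c
 unfolding a using that by (intro ln_ge_quotient order_trans[OF that(2)] power_mono) auto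
 have 1: "18 <= real l" using la a0 by linarith
 have "real 5 / real 2 <= a" by (rule s[where c=19]) (use 1 in \<open>simp_all add: eval_nat_numeral\<close>)
 then have 2: "69 <= real l" using la by simp
 have "real 4 / real 1 <= a" by (rule s[where c=70]) (use 2 in \<open>simp_all add: eval_nat_numeral\<close>)
 then have 3: "111 <= real l" using la by simp
 have "real 23 / real 5 <= a" by (rule s[where c=112]) (use 3 in \<open>simp_all add: power_divide\<close>)
 then have 4: "128 <= real l" using la by simp
 have "real 24 / real 5 <= a" by (rule s[where c=129]) (use 4 in \<open>simp_all add: power_divide\<close>)
 then show 5: "24/5 <= a" by simp
 have "133 < real l" using la 5 by linarith
 then show "134 <= l" by linarith
qed

text \<open>For \<open>y <= a\<close>, \<open>ly\<close> yields \<open>8 * exp y <= l\<close>, and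
  \<open>ln 8\<close> exceeds 2. The case \<open>y > a\<close> contradicts \<open>ly\<close>,
  because \<open>exp y\<close> would then outgrow \<open>l * y / a\<close>.\<close>

lemma y_le: "y <= a - 2"
proof (cases "y <= a")
 case True
 have "y * (8 * (1 + exp y)) <= a * (8 * (1 + exp y))" using True by (intro mult_right_mono) (auto intro: add_nonneg_nonneg)
 then have "y * (8 * (1 + exp y)) <= y * real l" using ly by (simp add: mult_ac)
 then have "8 * (1 + exp y) <= real l" using y by (simp add: mult_le_cancel_left)
 then have "ln (8 * exp y) <= a" unfolding a by (intro ln_mono) auto
 moreover have "ln (8 * exp y) = 3 * ln 2 + y" using ln_realpow[of 2 3] by (simp add: ln_mult_pos)
 ultimately show ?thesis using ln2_ge_two_thirds by linarith
next
 case False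
 have ea: "real l <= exp a" by (simp add: a add_pos_nonneg)
 have "8 * (exp y * a) <= 8 * ((1 + exp y) * a)" using a0 by (intro mult_left_mono mult_right_mono) auto
 also have "... <= real l * y" by (rule ly)
 also have "... <= exp a * y" using ea y by (intro mult_right_mono) auto
 finally have "8 * (exp y * a) * exp (- a) <= exp a * y * exp (- a)" by (intro mult_right_mono) auto
 then have "8 * a * exp (y - a) <= y" by (simp add: exp_diff exp_minus field_simps)
 moreover have "8 * a * (1 + (y - a)) <= 8 * a * exp (y - a)" using a0 by (intro mult_left_mono exp_ge_add_one_self) auto
 ultimately have "8 * a * (1 + (y - a)) <= y" by (rule order_trans[rotated])
 moreover have "1 + (y - a) + 7 * a <= 8 * a * (1 + (y - a))"
 proof -
 have "0 <= (8 * a - 1) * (y - a)" using a_ge False by simp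
 then show ?thesis using a_ge by (simp add: algebra_simps)
 qed
 ultimately have "1 + (y - a) + 7 * a <= y" by (rule order_trans[rotated])
 then show ?thesis using a_ge by linarith
qed

text \<open>Twice the logarithm of the type-counting factor of the code. It is at most half of
  \<open>l * \<rho>\<close>, so a hash margin of this size still leaves room for that
  factor.\<close>

definition E0 :: real where "E0 = 2 * U * (1 + exp y) * a"

lemma E0: "E0 <= real l * \<rho> / 2" "383/100 * ((1 + exp y) * a) <= E0 - 12/5" "133/10 * a * y <= E0 - 12/5"
proof -
 show "E0 <= real l * \<rho> / 2" using lst by (simp add: E0_def)
 have "2 * 2 * ((1 + exp y) * a) <= 2 * U * ((1 + exp y) * a)" using U a0 by (intro mult_right_mono) (auto intro: add_nonneg_nonneg)
 then have 4: "4 * ((1 + exp y) * a) <= E0" by (simp add: E0_def mult.assoc)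
 have "3 * (24/5) <= (1 + exp y) * a" using a_ge ey by (intro mult_mono) auto
 then show 1: "383/100 * ((1 + exp y) * a) <= E0 - 12/5" using 4 by linarith
 have "348/100 * y * a <= (1 + exp y) * a" using exp_plus_1_ge a0 by (intro mult_right_mono) auto
 moreover have "0 <= a * y" using a0 y by simp
 moreover have "348/100 * y * a = 348/100 * (a * y)" "133/10 * a * y = 133/10 * (a * y)" by simp_all
 ultimately show "133/10 * a * y <= E0 - 12/5" using 1 by linarith
qed

end



section \<open>The balance of gains and losses in the two regimes\<close>

lemma balance_scaled:
 fixes \<phi> x' :: real
 assumes "0 <= \<phi>" "x' / (T * t) <= \<phi> * X"
 and "X + (2 * D * b / t + D * (G + l * I) + 278/100 + 2 / l + 139/100 * (\<sigma>j + b + 2 * ln l)) <= l * (b + 1 - \<phi>) + (l - 1) * \<sigma>j + l * I"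
 shows "x' / (T * t) + \<phi> * (2 * D * b / t + D * (G + l * I) + 278/100 + 2 / l + 139/100 * (\<sigma>j + b + 2 * ln l))
 <= l * \<phi> * (b + 1 - \<phi>) + (l - 1) * \<phi> * \<sigma>j + l * \<phi> * I"
proof -
 have "\<phi> * (X + (2 * D * b / t + D * (G + l * I) + 278/100 + 2 / l + 139/100 * (\<sigma>j + b + 2 * ln l))) <= \<phi> * (l * (b + 1 - \<phi>) + (l - 1) * \<sigma>j + l * I)"
 using assms(1,3) by (intro mult_left_mono)
 also have "... = l * \<phi> * (b + 1 - \<phi>) + (l - 1) * \<phi> * \<sigma>j + l * \<phi> * I" by (simp add: algebra_simps)
 finally show ?thesis using assms(2) unfolding distrib_left[of \<phi> X] by linarith
qed

text \<open>Products and quotients are replaced by variables, \<open>lS\<close> for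
  \<open>l * S\<close> and so on, which makes the balance linear. The next two lemmas have the same
  purpose.\<close>

lemma balance1:
 fixes l :: real
 assumes "2 * E' <= lS" "134 * S <= lS" "134 * w <= lw" "v <= 2/134" "2 * lp <= l" "\<alpha> <= a - 2" "g <= a" "2784/100 * a <= l"
 "\<sigma>j = S - b + \<alpha> + w" "b <= S" "2/3 <= b" "134 <= l" "0 <= w"
 shows "24/100 * l + 46/100 * lS + (2 * b + (l\<alpha> + E' + lI) + 278/100 + v + 139/100 * (\<sigma>j + b + 2 * g)) <= lS + l\<alpha> + lw + l - lp - \<sigma>j + lI"
 using assms by argo

lemma balance2:
 fixes l :: real
 assumes "l\<alpha> + l\<rho> + lI <= ly" "2 * E' <= l\<rho>" "ly + l <= lb" "134 * w <= lw" "v <= 2/134" "4 * lp <= l" "\<alpha> <= a - 2" "g <= a"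
 "2784/100 * a <= l" "\<sigma>j = \<alpha> + w" "b <= 22/5 * y" "y <= a - 2" "134 <= l" "0 <= w"
 shows "3/5 * l + (4 * b + 2 * (l\<alpha> + E' + lI) + 278/100 + v + 139/100 * (\<sigma>j + b + 2 * g)) <= lb + l + (l\<alpha> + lw) - lp - \<sigma>j + lI"
 using assms by argo

lemma balance3:
 fixes l :: real
 assumes "X <= 10/11 * lb + 10/11 * ls" "v <= 2/134" "4 * lp <= l" "0 <= lI" "g <= a" "2784/100 * a <= l" "24/5 <= a"
 "134 * b <= lb" "134 * \<sigma>j <= ls" "0 <= b" "0 <= \<sigma>j"
 shows "3/5 * l + (4 * b + X + 278/100 + v + 139/100 * (\<sigma>j + b + 2 * g)) <= lb + l + ls - lp - \<sigma>j + lI"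
 using assms by argo

text \<open>Here \<open>b\<close> is \<open>ln (1 / \<phi>)\<close>, \<sigma> the logarithm of the
  number of possible common letters, \<open>h\<close> a bound on the smoothed entropy of the common
  part and \<alpha> the amount per position that the hash carries.\<close>

locale scheme_numbers = numbers +
 fixes b \<sigma> \<alpha> h :: real
 assumes b: "2/3 <= b" "b <= real l * y" "exp (- b) <= 1/2" and \<alpha>: "0 <= \<alpha>" "\<alpha> <= \<sigma>" "\<alpha> + \<rho> <= y" and \<rho>0: "0 <= \<rho>" and h: "0 < h" "h <= y"
begin

definition L :: real where "L = \<sigma> + ln (real l)"

lemma lreal: "134 <= real l" using l_ge by simp

lemma lnl: "0 <= ln (real l)" "ln (real l) <= a" "1 <= ln (real l)"
proof -
 show "ln (real l) <= a" unfolding a using lreal by (intro ln_mono) auto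
 have "real 4 / real 1 <= ln (real l)" by (rule ln_ge_quotient) (use lreal in \<open>simp_all add: eval_nat_numeral\<close>)
 then show "1 <= ln (real l)" "0 <= ln (real l)" by auto
qed

lemma \<sigma>0: "0 <= \<sigma>" using \<alpha> by linarith

lemma L_le: "L <= \<sigma> + a" "1 <= L" using lnl \<sigma>0 by (auto simp: L_def)

lemma y_l: "real l * y <= (real l)\<^sup>2"
proof -
 have "real l * y <= real l * real l" using y_le la a_ge by (intro mult_left_mono) auto
 then show ?thesis by (simp add: power2_eq_square)
qed

lemma four: "4 * (real l) ^ 3 <= (real l + 1) ^ 4" "2 * (real l)\<^sup>2 <= (real l) ^ 3"
proof -
 have "4 * (real l) ^ 3 <= real l * (real l) ^ 3" using lreal by (intro mult_right_mono) auto
 also have "... = (real l) ^ 4" by (simp add: eval_nat_numeral)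
 also have "... <= (real l + 1) ^ 4" by (intro power_mono) auto
 finally show "4 * (real l) ^ 3 <= (real l + 1) ^ 4" .
 have "2 * (real l)\<^sup>2 <= real l * (real l)\<^sup>2" using lreal by (intro mult_right_mono) auto
 then show "2 * (real l)\<^sup>2 <= (real l) ^ 3" by (simp add: eval_nat_numeral)
qed

text \<open>The code errs with a polynomial factor that is smaller by \<open>(l + 1) ^ 4\<close>
  than the one in the rate condition. This surplus outweighs the cost of a wrongly decoded slot,
  which is polynomial in \<open>l\<close>.\<close>

lemma absorb:
 assumes E: "E' <= E0" and t: "1 <= t" "t = 1 \<or> 11/5 * y * t <= b + \<sigma>" and \<sigma>j: "\<sigma> <= \<sigma>j" and B: "0 <= B" "B * (real l + 1) ^ 4 <= \<phi>j"
 shows "2 * B * (b + t * (real l * \<alpha> + E')) <= \<phi>j * (1 + \<sigma>j)"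
proof -
 have "real l * (\<alpha> + \<rho>) <= real l * y" using \<alpha> by (intro mult_left_mono) auto
 moreover have "0 <= real l * \<rho>" using \<rho>0 by simp
 ultimately have G: "real l * \<alpha> + E' <= real l * y" using E E0(1) by (simp add: distrib_left)
 have "b + t * (real l * \<alpha> + E') <= 2 * (real l) ^ 3 * (1 + \<sigma>j)"
 proof -
 have "t * (real l * \<alpha> + E') <= t * (real l * y)" using G t by (intro mult_left_mono) auto
 also have "... <= (real l)\<^sup>2 + real l * (b + \<sigma>)"
 proof (cases "t = 1")
 case True
 have "0 <= real l * (b + \<sigma>)" using b \<sigma>0 by simp
 then show ?thesis using True y_l by simp
 next
 case False
 then have "real l * (11/5 * y * t) <= real l * (b + \<sigma>)" using t by (intro mult_left_mono) auto
 moreover have "0 <= t * (real l * y)" using t y by simp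
 moreover have "real l * (11/5 * y * t) = 11/5 * (t * (real l * y))" by simp
 ultimately show ?thesis using zero_le_power2[of "real l"] by linarith
 qed
 finally have 1: "b + t * (real l * \<alpha> + E') <= (real l)\<^sup>2 + (real l)\<^sup>2 + real l * (b + \<sigma>)" using b y_l by linarith
 have "b <= (real l)\<^sup>2" using b y_l by linarith
 then have "real l * b <= real l * (real l)\<^sup>2" by (intro mult_left_mono) auto
 then have 2: "real l * b <= (real l) ^ 3" by (simp add: eval_nat_numeral)
 have "real l <= (real l) ^ 3" using self_le_power[of "real l" 3] lreal by simp
 moreover have "0 <= (real l) ^ 3" by simp
 ultimately have l3: "real l <= 2 * (real l) ^ 3" by linarith
 have "real l * \<sigma> <= 2 * (real l) ^ 3 * \<sigma>j" using \<sigma>j \<sigma>0 by (intro mult_mono l3) auto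
 then show ?thesis using 1 2 four(2) by (simp add: distrib_left)
 qed
 then have "B * (2 * (b + t * (real l * \<alpha> + E'))) <= B * (4 * (real l) ^ 3 * (1 + \<sigma>j))" using B by (intro mult_left_mono) auto
 also have "... <= B * ((real l + 1) ^ 4 * (1 + \<sigma>j))" using B four \<sigma>0 \<sigma>j by (intro mult_left_mono mult_right_mono) auto
 also have "... = B * (real l + 1) ^ 4 * (1 + \<sigma>j)" by simp
 also have "... <= \<phi>j * (1 + \<sigma>j)" using B \<sigma>0 \<sigma>j by (intro mult_right_mono) auto
 finally show ?thesis by (simp add: mult_ac)
qed

text \<open>With one slot the residual \<open>ln 2\<close> and the variance term must be of order
  \<open>l * \<phi>\<close>. This holds because \<open>exp b\<close> is at most a constant times
  \<open>exp y\<close>, and \<open>exp y\<close> is small compared with \<open>l\<close>.\<close>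

lemma regime1:
 assumes by1: "b <= y + 1"
 shows "\<exists>E. 0 < E & E + 12/5 <= E0 & (\<forall>I \<sigma>j. 0 <= I --> \<sigma> <= \<sigma>j -->
 (ln 2 + real l * (h * L) / (4 * E)) / (1 * 1) + exp (- b) * (2 * 1 * b / 1 + 1 * (real l * \<alpha> + (E + 12/5) + real l * I) + 278/100 + 2 / real l
 + 139/100 * (\<sigma>j + b + 2 * ln (real l))) <= real l * exp (- b) * (b + 1 - exp (- b)) + (real l - 1) * exp (- b) * \<sigma>j + real l * exp (- b) * I)"
proof -
 define S where "S = b + \<sigma> - \<alpha>"
 \<comment> \<open>A large margin lowers the variance term, but it may exceed neither the spare
   rate, whence \<open>E0\<close>, nor half of the gain \<open>l * S\<close>, since a mismatched
   slot loses its hash. The \<open>12/5\<close> is reserved for rounding and smoothing.\<close>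
 define E where "E = min E0 (real l * S / 2) - 12/5"
 have S: "b <= S" "2/3 <= S" using \<alpha> b by (auto simp: S_def)
 have lS: "134 * S <= real l * S" using lreal S by (intro mult_right_mono) auto
 have ll: "134 <= real l" using lreal .
 have ya: "y <= a" using y_le by simp
 have a0: "0 < a" using a_ge by linarith
 \<comment> \<open>Replaces the cap \<sigma> + a by a multiple of \<open>S\<close>. If \<sigma>
   exceeds \<open>a\<close>, this uses \<open>b <= a\<close> and
   \<open>\<alpha> <= y <= a\<close>.\<close>
 have Z: "b * (\<sigma> + a) <= 2 * S * a"
 proof (cases "\<sigma> <= a")
 case True
 have "b * (\<sigma> + a) <= S * (2 * a)" using True S b \<sigma>0 a0 by (intro mult_mono) auto
 then show ?thesis by simp
 next
 case False
 have ba: "b <= a" using by1 y_le by linarith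
 have "0 <= (a - b) * (\<sigma> - a) + a * (a - y)" using ba False ya a0 by (intro add_nonneg_nonneg mult_nonneg_nonneg) auto
 then have "b * \<sigma> <= a * (b + \<sigma> - y)" by (simp add: algebra_simps)
 also have "... <= a * S" using \<alpha> \<rho>0 a0 by (intro mult_left_mono) (auto simp: S_def)
 finally have "b * \<sigma> <= a * S" .
 moreover have "b * a <= a * S" using S a0 by simp
 ultimately show ?thesis by (simp add: algebra_simps)
 qed
 have hL: "h * L <= y * (\<sigma> + a)" using h L_le y \<sigma>0 a0 by (intro mult_mono) auto
 have eb: "exp b = exp y * exp (b - y)" by (simp add: exp_add[symmetric])
 have y0: "0 <= y" "0 < y" using y by auto
 note sb = shifted_exp_bounds[OF b(1) by1 y0(1)]
 have E: "0 < E & h * L * exp b <= 184/100 * S * E"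
 proof (cases "E0 <= real l * S / 2")
 case True
 then have "383/100 * ((1 + exp y) * a) <= E" using E0 by (simp add: E_def)
 moreover have p: "0 < (1 + exp y) * a" using a0 by (intro mult_pos_pos add_pos_pos) auto
 ultimately have E1: "0 < E" by linarith
 have "h * L * exp b <= y * (\<sigma> + a) * exp b" using hL by (intro mult_right_mono) auto
 also have "... = y * exp (b - y) * ((\<sigma> + a) * exp y)" by (simp add: eb)
 also have "... <= 272/100 * b * ((\<sigma> + a) * exp y)" using sb(1) \<sigma>0 a0 by (intro mult_right_mono) auto
 also have "... = 272/100 * exp y * (b * (\<sigma> + a))" by simp
 also have "... <= 272/100 * exp y * (2 * S * a)" using Z by (intro mult_left_mono) auto
 also have "... = 544/100 * S * (exp y * a)" by simp
 also have "... <= 544/100 * S * ((1 + exp y) * a)" using S a0 by (intro mult_left_mono mult_right_mono) auto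
 also have "... <= 184/100 * S * (383/100 * ((1 + exp y) * a))"
 proof -
 have "0 <= S * ((1 + exp y) * a)" using S p by (intro mult_nonneg_nonneg less_imp_le[OF p]) auto
 then have "544/100 * (S * ((1 + exp y) * a)) <= 184/100 * (383/100) * (S * ((1 + exp y) * a))" by (intro mult_right_mono) auto
 moreover have "544/100 * S * Q = 544/100 * (S * Q)" "184/100 * S * (383/100 * Q) = 184/100 * (383/100) * (S * Q)" for Q by simp_all
 ultimately show ?thesis by (simp only:)
 qed
 also have "... <= 184/100 * S * E" using S \<open>383/100 * ((1 + exp y) * a) <= E\<close> by (intro mult_left_mono) auto
 finally show ?thesis using E1 by simp
 next
 case False
 then have "E = real l * S / 2 - 12/5" by (simp add: E_def)
 then have E1: "4731/10000 * (real l * S) <= E" using lS S by linarith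
 then have E2: "0 < E" using lS S by linarith
 have "y * (h * L * exp b) <= y * (y * (\<sigma> + a) * exp b)" using hL y0 by (intro mult_left_mono mult_right_mono) auto
 also have "... = y\<^sup>2 * exp (b - y) * ((\<sigma> + a) * exp y)" by (simp add: eb power2_eq_square)
 also have "... <= 335/100 * b\<^sup>2 * ((\<sigma> + a) * exp y)" using sb(2) \<sigma>0 a0 by (intro mult_right_mono) auto
 also have "... = 335/100 * b * exp y * (b * (\<sigma> + a))" by (simp add: power2_eq_square)
 also have "... <= 335/100 * b * exp y * (2 * S * a)" using Z b by (intro mult_left_mono) auto
 also have "... = 670/100 * S * (exp y * a) * b" by simp
 also have "... <= 670/100 * S * (exp y * a) * S" using S a0 by (intro mult_left_mono) auto
 also have "... <= 670/100 * S * ((1 + exp y) * a) * S" using S a0 by (intro mult_left_mono mult_right_mono) auto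
 also have "... = 670/800 * S * S * (8 * ((1 + exp y) * a))" by simp
 also have "... <= 670/800 * S * S * (real l * y)" using ly S by (intro mult_left_mono) auto
 also have "... = y * (670/800 * S * (real l * S))" by simp
 finally have "h * L * exp b <= 670/800 * S * (real l * S)" using y0(2) by (simp add: mult_le_cancel_left)
 also have "... <= 184/100 * S * (4731/10000 * (real l * S))" using S lS by simp
 also have "... <= 184/100 * S * E" using E1 S by (intro mult_left_mono) auto
 finally show ?thesis using E2 by simp
 qed
 have Emin: "E + 12/5 <= E0" "E + 12/5 <= real l * S / 2" by (auto simp: E_def)
 define \<phi> where "\<phi> = exp (- b)"
 have \<phi>: "0 < \<phi>" "\<phi> <= 1/2" "\<phi> * exp b = 1" using b by (auto simp: \<phi>_def exp_add[symmetric])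
 have x1: "ln 2 <= \<phi> * (24/100 * real l)"
 proof -
 have "exp b <= exp (y + 1)" using by1 by simp
 also have "... = exp y * exp 1" by (simp add: exp_add)
 also have "... <= exp y * (272/100)" using e_less_272 by (intro mult_left_mono) auto
 finally have eb': "exp b <= 272/100 * exp y" by simp
 have "8 * (exp y * a) <= 8 * ((1 + exp y) * a)" using a0 by (intro mult_left_mono mult_right_mono) auto
 also have "... <= real l * y" by (rule ly)
 also have "... <= real l * a" using ya by (intro mult_left_mono) auto
 finally have "a * (8 * exp y) <= a * real l" by (simp add: mult_ac)
 then have "8 * exp y <= real l" using a0 by (simp add: mult_le_cancel_left)
 then have e: "exp b <= 34/100 * real l" using eb' by linarith
 have "ln 2 * exp b <= 25/36 * (34/100 * real l)" using e ln2_le_25_over_36 by (intro mult_mono) auto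
 also have "... <= 24/100 * real l" by simp
 finally have "\<phi> * (ln 2 * exp b) <= \<phi> * (24/100 * real l)" using \<phi> by (intro mult_left_mono) auto
 moreover have "\<phi> * (ln 2 * exp b) = ln 2 * (\<phi> * exp b)" by simp
 ultimately show ?thesis using \<phi>(3) by simp
 qed
 have x2: "real l * (h * L) / (4 * E) <= \<phi> * (46/100 * (real l * S))"
 proof -
 have "\<phi> * real l * (h * L * exp b) <= \<phi> * real l * (184/100 * S * E)" using E \<phi> by (intro mult_left_mono) auto
 moreover have q: "\<phi> * real l * (h * L * exp b) = real l * (h * L) * (\<phi> * exp b)" by (simp only: mult_ac)
 ultimately have "real l * (h * L) <= \<phi> * real l * (184/100 * S * E)" unfolding q \<phi>(3) mult_1_right by blast
 also have "... = \<phi> * (46/100 * (real l * S)) * (4 * E)" by simp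
 finally have "real l * (h * L) <= \<phi> * (46/100 * (real l * S)) * (4 * E)" .
 moreover have "0 < 4 * E" using E by simp
 ultimately show ?thesis by (simp only: pos_divide_le_eq)
 qed
 show ?thesis
 proof (intro exI[of _ E] conjI allI impI)
 show "0 < E" "E + 12/5 <= E0" using E Emin by auto
 fix I \<sigma>j :: real assume I: "0 <= I" "\<sigma> <= \<sigma>j"
 show "(ln 2 + real l * (h * L) / (4 * E)) / (1 * 1) + exp (- b) * (2 * 1 * b / 1 + 1 * (real l * \<alpha> + (E + 12/5) + real l * I) + 278/100 + 2 / real l
 + 139/100 * (\<sigma>j + b + 2 * ln (real l))) <= real l * exp (- b) * (b + 1 - exp (- b)) + (real l - 1) * exp (- b) * \<sigma>j + real l * exp (- b) * I"
 unfolding \<phi>_def[symmetric]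
 proof (rule balance_scaled)
 show "(ln 2 + real l * (h * L) / (4 * E)) / (1 * 1) <= \<phi> * (24/100 * real l + 46/100 * (real l * S))"
 by (simp only: mult_1 div_by_1 distrib_left) (use x1 x2 in linarith)
 define w where "w = \<sigma>j - \<sigma>"
 have w: "0 <= w" "\<sigma>j = \<sigma> + w" using I by (auto simp: w_def)
 have lw: "134 * w <= real l * w" using ll w by (intro mult_right_mono) auto
 have l2: "2 / real l <= 2 / 134" using ll by (intro divide_left_mono) auto
 have "real l * (2 * \<phi>) <= real l * 1" using \<phi> by (intro mult_left_mono) auto
 then have lphi: "2 * (real l * \<phi>) <= real l" by simp
 have sS: "\<sigma> = S - b + \<alpha>" by (simp add: S_def)
 have al: "\<alpha> <= a - 2" using \<alpha> \<rho>0 y_le by linarith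
 have e1: "real l * (b + 1 - \<phi>) + (real l - 1) * \<sigma>j = real l * S + real l * \<alpha> + real l * w + real l - real l * \<phi> - \<sigma>j"
 by (simp add: w(2) sS algebra_simps)
 have "24/100 * real l + 46/100 * (real l * S) + (2 * b + (real l * \<alpha> + (E + 12/5) + real l * I) + 278/100 + 2 / real l + 139/100 * (\<sigma>j + b + 2 * ln (real l)))
 <= real l * S + real l * \<alpha> + real l * w + real l - real l * \<phi> - \<sigma>j + real l * I"
 by (rule balance1[OF _ lS lw l2 lphi al lnl(2) la _ S(1) b(1) ll w(1)]) (use Emin(2) w(2) sS in simp_all)
 then show "24/100 * real l + 46/100 * (real l * S) + (2 * 1 * b / 1 + 1 * (real l * \<alpha> + (E + 12/5) + real l * I) + 278/100 + 2 / real l + 139/100 * (\<sigma>j + b + 2 * ln (real l)))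
 <= real l * (b + 1 - \<phi>) + (real l - 1) * \<sigma>j + real l * I"
 unfolding e1 by simp
 qed (use \<phi> in simp)
 qed
qed

text \<open>Many slots with two slots per position: a pool has \<open>2 * t * l\<close> positions on
  average, so mismatches are inflated by \<open>D = 2 * t\<close>. The gain of order
  \<open>l * (b + \<sigma>)\<close> limits \<open>t\<close> from above, the Chernoff bound from
  below.\<close>

lemma regime2:
 assumes by1: "y + 1 <= b"
 shows "\<exists>(t::nat) (T::nat). 1 <= t & 1 <= T & (real t = 1 \<or> 11/5 * y * real t <= b + \<sigma>) & chernoff l t T a b h (E0 - 12/5) L & (\<forall>I \<sigma>j. 0 <= I --> \<alpha> + \<rho> + I <= y --> \<sigma> <= \<sigma>j -->
 (3/5 * (real l * exp (- b) * real T * real t)) / (real T * real t) + exp (- b) * (2 * (2 * real t) * b / real t + 2 * real t * (real l * \<alpha> + E0 + real l * I) + 278/100 + 2 / real l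
 + 139/100 * (\<sigma>j + b + 2 * ln (real l))) <= real l * exp (- b) * (b + 1 - exp (- b)) + (real l - 1) * exp (- b) * \<sigma>j + real l * exp (- b) * I)"
proof -
 have y0: "0 < y" using y by linarith
 have a0: "0 < a" using a_ge by linarith
 have b53: "5/3 <= b" using by1 y by linarith
 have ay: "0 < a * y" using a0 y0 by simp
 \<comment> \<open>The constant \<open>11/5\<close> makes the mismatch cost
   \<open>2 * t * l * y\<close> at most \<open>10/11\<close> of \<open>l * (b + \<sigma>)\<close>
   once \<open>t >= 2\<close>; rounding \<open>z\<close> down loses at most a factor
   \<open>3/2\<close>, so \<open>t * E\<close> remains of order
   \<open>a * (b + \<sigma>)\<close>.\<close>
 define z where "z = (b + \<sigma>) / (11/5 * y)"
 have z0: "0 <= z" using b \<sigma>0 y0 by (simp add: z_def)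
 have zy: "z * (11/5 * y) = b + \<sigma>" using y0 by (simp add: z_def)
 define t where "t = max 1 (nat \<lfloor>z\<rfloor>)"
 define E where "E = E0 - 12/5"
 have E: "133/10 * (a * y) <= E" unfolding E_def mult.assoc[symmetric] by (rule E0(3))
 have t1: "1 <= t" by (simp add: t_def)
 have cases_t: "(t = 1 & b + \<sigma> <= 22/5 * y) \<or> (2 <= t & 11/5 * y * real t <= b + \<sigma> & b + \<sigma> <= 33/10 * y * real t & 22/5 * y <= b + \<sigma>)"
 proof (cases "z < 2")
 case True
 then have "t = 1" by (simp add: t_def) linarith
 moreover have "z * (11/5 * y) <= 2 * (11/5 * y)" using True y0 by (intro mult_right_mono) auto
 then have "b + \<sigma> <= 22/5 * y" unfolding zy by simp
 ultimately show ?thesis by simp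
 next
 case False
 then have "2 <= \<lfloor>z\<rfloor>" by linarith
 then have "2 <= nat \<lfloor>z\<rfloor>" by (simp only: le_nat_iff)
 then have rt: "real t = of_int \<lfloor>z\<rfloor>" "2 <= t" using \<open>2 <= \<lfloor>z\<rfloor>\<close> by (auto simp: t_def)
 then have tz: "real t <= z" "z <= 3/2 * real t" "2 <= z" using False by linarith+
 have "real t * (11/5 * y) <= z * (11/5 * y)" "z * (11/5 * y) <= 3/2 * real t * (11/5 * y)" "2 * (11/5 * y) <= z * (11/5 * y)"
 using tz y0 by (intro mult_right_mono; simp)+
 then show ?thesis using zy rt by (simp add: mult_ac)
 qed
 have tE1: "133/10 * (a * y) <= real t * E" if "t = 1" using E that by simp
 have tE2: "4 * (a * (b + \<sigma>)) <= real t * E" if "t ~= 1"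
 proof -
 have c: "b + \<sigma> <= 33/10 * y * real t" using cases_t that by auto
 have "4 * (a * (b + \<sigma>)) <= 4 * (a * (33/10 * y * real t))" using c a0 by (intro mult_left_mono) auto
 also have "... = real t * (132/10 * (a * y))" by simp
 also have "... <= real t * E" by (intro mult_left_mono) (use E ay in linarith)+
 finally show ?thesis .
 qed
 \<comment> \<open>So many slots that \<open>T * \<phi>\<close> is at least
   \<open>l\<^sup>2\<close>; residuals that do not grow with \<open>T\<close> then disappear in the
   balance.\<close>
 define T where "T = nat \<lceil>(real l)\<^sup>2 * exp b\<rceil>"
 have P1: "1 <= (real l)\<^sup>2 * exp b"
 proof -
 have "1 * 1 <= (real l)\<^sup>2 * exp b" using lreal b by (intro mult_mono) auto
 then show ?thesis by simp
 qed
 have T: "(real l)\<^sup>2 * exp b <= real T" "real T <= 2 * (real l)\<^sup>2 * exp b" using P1 by (simp_all add: T_def) linarith+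
 have T1: "1 <= T" using T P1 by linarith
 have ch: "chernoff l t T a b h E L"
 proof
 show "134 <= l" "1 <= t" "a = ln (real l + 1)" "27 * a <= real l" "24/5 <= a" "8/5 <= b" "0 < h" "h <= b - 1" "1 <= L"
 using l_ge t1 a la a_ge b53 h by1 L_le by auto
 show "13 * a * h <= E"
 proof -
 have "a * h <= a * y" using h a0 by (intro mult_left_mono) auto
 then have "13 * (a * h) <= E" using E ay by linarith
 then show ?thesis by (simp only: mult.assoc)
 qed
 show "3 * a * b <= real t * E"
 proof (cases "t = 1")
 case True
 then have "b <= 22/5 * y" using cases_t \<sigma>0 by auto
 then have "a * b <= a * (22/5 * y)" using a0 by (intro mult_left_mono) auto
 also have "... = 22/5 * (a * y)" by simp
 finally have "3 * (a * b) <= real t * E" using tE1[OF True] ay by linarith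
 then show ?thesis by (simp only: mult.assoc)
 next
 case False
 have "0 <= a * \<sigma>" "0 <= a * b" using a0 \<sigma>0 b by auto
 then show ?thesis using tE2[OF False] by (simp add: distrib_left)
 qed
 show "L <= real t * (real l)\<^sup>2"
 proof -
 have "\<sigma> <= real t * (22/5 * a)"
 proof (cases "t = 1")
 case True
 then show ?thesis using cases_t y_le b by simp
 next
 case False
 then have "\<sigma> <= 33/10 * y * real t" using cases_t b by auto
 also have "... <= 22/5 * a * real t" using y_le y0 by (intro mult_right_mono) auto
 finally show ?thesis by (simp add: mult_ac)
 qed
 moreover have "1 * a <= real t * a" using t1 a0 by (intro mult_right_mono) auto
 ultimately have "L <= real t * (27/5 * a)" using L_le by (simp add: distrib_left)
 also have "... <= real t * (real l)\<^sup>2"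
 proof (intro mult_left_mono)
 have "real l <= (real l)\<^sup>2" using self_le_power[of "real l" 2] lreal by simp
 then show "27/5 * a <= (real l)\<^sup>2" using la a0 by linarith
 qed auto
 finally show ?thesis .
 qed
 show "7 * L <= real t * E"
 proof (cases "t = 1")
 case True
 then have s: "\<sigma> <= 17/5 * y - 1" using cases_t by1 by auto
 have "2/3 * (133/10 * a - 119/5) <= y * (133/10 * a - 119/5)" using y a_ge by (intro mult_right_mono) auto
 moreover have "y * (133/10 * a - 119/5) = 133/10 * (a * y) - 119/5 * y" by (simp add: algebra_simps)
 ultimately have "7 * (\<sigma> + a) <= 133/10 * (a * y)" using s a_ge by argo
 then show ?thesis using tE1[OF True] L_le by argo
 next
 case False
 have "(44/15 - b) * (4 * a - 7) <= \<sigma> * (4 * a - 7)"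
 using cases_t False y a_ge by (intro mult_right_mono) auto
 moreover have "(44/15 - b) * (4 * a - 7) = 176/15 * a - 308/15 - 4 * (a * b) + 7 * b" "\<sigma> * (4 * a - 7) = 4 * (a * \<sigma>) - 7 * \<sigma>"
 "4 * (a * (b + \<sigma>)) = 4 * (a * b) + 4 * (a * \<sigma>)" by (simp_all add: field_simps)
 ultimately have "7 * (\<sigma> + a) <= 4 * (a * (b + \<sigma>))" using a_ge b53 by argo
 then show ?thesis using tE2[OF False] L_le by argo
 qed
 show "9/5 * min a b * L <= real t * E"
 proof -
 have m0: "0 <= min a b" using a0 b by simp
 then have mL: "9/5 * min a b * L <= 9/5 * (min a b * (\<sigma> + a))" unfolding mult.assoc by (intro mult_left_mono L_le) auto
 show ?thesis
 proof (cases "t = 1")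
 case True
 then have s: "\<sigma> <= 22/5 * y - b" using cases_t by auto
 then have b4: "b <= 22/5 * y" using \<sigma>0 by linarith
 have "y * (min a b * (\<sigma> + a)) <= y * (73/10 * (a * y))"
 proof (cases "b <= a")
 case ba: True
 have "y * (b * \<sigma>) <= a * (b * (22/5 * y - b))"
 using y_le y0 s \<sigma>0 b b4 by (intro mult_mono) auto
 then have "y * (b * (\<sigma> + a)) <= a * (b * (27/5 * y - b))" by (simp add: algebra_simps)
 also have "b * (27/5 * y - b) <= (27/10 * y)\<^sup>2"
 using zero_le_power2[of "27/10 * y - b"] by (simp add: power2_eq_square algebra_simps)
 then have "a * (b * (27/5 * y - b)) <= a * (27/10 * y)\<^sup>2" using a0 by (intro mult_left_mono) auto
 also have "... <= y * (73/10 * (a * y))" using mult_pos_pos[OF ay y0] by (simp add: power2_eq_square mult_ac)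
 finally show ?thesis unfolding min_absorb2[OF ba] .
 next
 case ba: False
 have "a * (\<sigma> + a) <= a * (73/10 * y)" using s ba a0 y0 by (intro mult_left_mono) auto
 then have "y * (a * (\<sigma> + a)) <= y * (a * (73/10 * y))" by (rule mult_left_mono) (use y0 in simp)
 moreover have "min a b = a" using ba by simp
 ultimately show ?thesis by (simp add: mult_ac)
 qed
 then have "min a b * (\<sigma> + a) <= 73/10 * (a * y)" using y0 by (simp only: mult_le_cancel_left_pos)
 then show ?thesis using mL tE1[OF True] ay by argo
 next
 case False
 have "min a b * (\<sigma> + a) <= a * (b + \<sigma>)"
 proof (cases "b <= a")
 case True
 have "b * \<sigma> <= a * \<sigma>" using True \<sigma>0 by (intro mult_right_mono) auto
 then show ?thesis unfolding min_absorb2[OF True] by (simp add: algebra_simps)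
 next
 case F: False
 have "a * (\<sigma> + a) <= a * (b + \<sigma>)" using F a0 by (intro mult_left_mono) auto
 moreover have "min a b = a" using F by simp
 ultimately show ?thesis by simp
 qed
 moreover have "0 <= a * (b + \<sigma>)" using a0 b \<sigma>0 by simp
 ultimately show ?thesis using mL tE2[OF False] by argo
 qed
 qed
 show "(real l)\<^sup>2 * exp b <= real T" "real T <= 2 * (real l)\<^sup>2 * exp b" by (fact T)+
 qed
 define \<phi> where "\<phi> = exp (- b)"
 have \<phi>: "0 < \<phi>" "\<phi> <= 1/4"
 proof -
 have "1 + b + b\<^sup>2 / 2 <= exp b" using b by (intro exp_lower_Taylor_quadratic) auto
 moreover have "5/3 * (5/3) <= b * b" using b53 by (intro mult_mono) auto
 ultimately have "4 <= exp b" using b53 by (simp add: power2_eq_square)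
 then show "\<phi> <= 1/4" by (simp add: \<phi>_def exp_minus field_simps)
 qed (simp add: \<phi>_def)
 show ?thesis
 proof (rule exI[of _ t], rule exI[of _ T], intro conjI allI impI)
 show "1 <= t" "1 <= T" "chernoff l t T a b h (E0 - 12/5) L" using t1 T1 ch by (auto simp: E_def)
 show "real t = 1 \<or> 11/5 * y * real t <= b + \<sigma>" using cases_t by auto
 fix I \<sigma>j :: real assume I: "0 <= I" "\<alpha> + \<rho> + I <= y" "\<sigma> <= \<sigma>j"
 show "(3/5 * (real l * exp (- b) * real T * real t)) / (real T * real t) + exp (- b) * (2 * (2 * real t) * b / real t + 2 * real t * (real l * \<alpha> + E0 + real l * I) + 278/100 + 2 / real l
 + 139/100 * (\<sigma>j + b + 2 * ln (real l))) <= real l * exp (- b) * (b + 1 - exp (- b)) + (real l - 1) * exp (- b) * \<sigma>j + real l * exp (- b) * I"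
 unfolding \<phi>_def[symmetric]
 proof (rule balance_scaled)
 show "(3/5 * (real l * \<phi> * real T * real t)) / (real T * real t) <= \<phi> * (3/5 * real l)" using t1 T1 by simp
 define w where "w = \<sigma>j - \<alpha>"
 have w: "0 <= w" "\<sigma>j = \<alpha> + w" using I \<alpha> by (auto simp: w_def)
 have lw: "134 * w <= real l * w" using lreal w by (intro mult_right_mono) auto
 have l2: "2 / real l <= 2 / 134" using lreal by (intro divide_left_mono) auto
 have "real l * (4 * \<phi>) <= real l * 1" using \<phi> by (intro mult_left_mono) auto
 then have lphi: "4 * (real l * \<phi>) <= real l" by simp
 have al: "\<alpha> <= a - 2" using \<alpha> \<rho>0 y_le by linarith
 have D4: "2 * (2 * real t) * b / real t = 4 * b" using t1 by simp
 have lI: "0 <= real l * I" using I by simp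
 have "real l * (\<alpha> + \<rho> + I) <= real l * y" using I by (intro mult_left_mono) auto
 then have G: "real l * \<alpha> + real l * \<rho> + real l * I <= real l * y" by (simp add: distrib_left)
 have l\<rho>: "0 <= real l * \<rho>" using \<rho>0 by simp
 have e1: "real l * (b + 1 - \<phi>) + (real l - 1) * \<sigma>j = real l * b + real l + real l * \<sigma>j - real l * \<phi> - \<sigma>j" by (simp add: algebra_simps)
 have "3/5 * real l + (4 * b + 2 * real t * (real l * \<alpha> + E0 + real l * I) + 278/100 + 2 / real l + 139/100 * (\<sigma>j + b + 2 * ln (real l)))
 <= real l * b + real l + real l * \<sigma>j - real l * \<phi> - \<sigma>j + real l * I"
 proof (cases "t = 1")
 case True
 have b4: "b <= 22/5 * y" using True cases_t \<sigma>0 by auto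
 have "real l * (y + 1) <= real l * b" using by1 by (intro mult_left_mono) auto
 then have lb: "real l * y + real l <= real l * b" by (simp add: distrib_left)
 have ls: "real l * \<sigma>j = real l * \<alpha> + real l * w" by (simp add: w distrib_left)
 have 2: "2 * real t * (real l * \<alpha> + E0 + real l * I) = 2 * (real l * \<alpha> + E0 + real l * I)" using True by simp
 have E2: "2 * E0 <= real l * \<rho>" using E0(1) by simp
 show ?thesis unfolding 2 ls by (rule balance2[OF G E2 lb lw l2 lphi al lnl(2) la w(2) b4 y_le lreal w(1)])
 next
 case False
 then have tt: "11/5 * y * real t <= b + \<sigma>" using cases_t by auto
 have "real l * \<alpha> + E0 + real l * I <= real l * y" using G E0(1) l\<rho> by linarith
 then have "2 * real t * (real l * \<alpha> + E0 + real l * I) <= 2 * real t * (real l * y)" by (intro mult_left_mono) auto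
 also have "... = 10/11 * (real l * (11/5 * y * real t))" by simp
 also have "... <= 10/11 * (real l * (b + \<sigma>j))" using tt I by (intro mult_left_mono) auto
 finally have 2: "2 * real t * (real l * \<alpha> + E0 + real l * I) <= 10/11 * (real l * b) + 10/11 * (real l * \<sigma>j)" by (simp add: distrib_left)
 have "134 * b <= real l * b" "134 * \<sigma>j <= real l * \<sigma>j" using lreal b I \<sigma>0 by (auto intro!: mult_right_mono)
 then show ?thesis by (intro balance3[OF 2 l2 lphi lI lnl(2) la a_ge]) (use b I \<sigma>0 in auto)
 qed
 then show "3/5 * real l + (2 * (2 * real t) * b / real t + 2 * real t * (real l * \<alpha> + E0 + real l * I) + 278/100 + 2 / real l + 139/100 * (\<sigma>j + b + 2 * ln (real l)))
 <= real l * (b + 1 - \<phi>) + (real l - 1) * \<sigma>j + real l * I"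
 unfolding e1 D4 by simp
 qed (use \<phi> in simp)
 qed
qed

end



section \<open>Assembling the code and the transmissibility proof\<close>

text \<open>Double counting of the incidences between positions and slots.\<close>

lemma sum_card_pools:
 fixes e :: "nat => nat set" and n T :: nat
 assumes "!!c. e c \<subseteq> {..<T}"
 shows "(\<Sum>B<T. real (card {c. c < n & B \<in> e c})) = (\<Sum>c<n. real (card (e c)))"
proof -
 have 1: "real (card {c. c < n & B \<in> e c}) = (\<Sum>c<n. of_bool (B \<in> e c))" for B
 proof -
 have "real (card {c. c < n & B \<in> e c}) = (\<Sum>c\<in>{c. c < n & B \<in> e c}. 1)" by simp
 also have "... = (\<Sum>c<n. of_bool (B \<in> e c))" by (rule sum.mono_neutral_cong_left) auto
 finally show ?thesis .
 qed
 have 2: "real (card (e c)) = (\<Sum>B<T. of_bool (B \<in> e c))" for c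
 proof -
 have "real (card (e c)) = (\<Sum>B\<in>e c. 1)" by simp
 also have "... = (\<Sum>B<T. of_bool (B \<in> e c))" using assms[of c] by (intro sum.mono_neutral_cong_left) auto
 finally show ?thesis .
 qed
 show ?thesis unfolding 1 2 by (rule sum.swap)
qed

lemma (in scheme_numbers) scheme_exists:
 fixes P i :: "'k::finite => real"
 assumes P: "pmf_on P" and i: "!!x. 0 < P x ==> 0 <= i x" "!!x. 0 < P x ==> i x <= L" "(\<Sum>x\<in>UNIV. P x * i x) <= h"
 shows "\<exists>(t::nat) (T::nat) (e :: nat => nat set) E D x'. 1 <= t & 1 <= T & 0 < E & E + 12/5 <= E0 & 1 <= D & (real t = 1 \<or> 11/5 * y * real t <= b + \<sigma>)
 & (\<forall>c. e c \<subseteq> {..<T}) & (\<Sum>B<T. real (card {c. c < T * (t * l) & B \<in> e c})) <= D * real l * real T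
 & (\<Sum>k\<in>seqs (T * (t * l)). (\<Prod>c<T * (t * l). P (k ! c)) * ln (\<Sum>A\<in>Pow {..<T}. exp (- real (card A) * (real t * (real l * h + E))) *
 (\<Prod>c<T * (t * l). if e c \<inter> {..<T} \<subseteq> A then exp (i (k ! c)) else 1))) <= x'
 & (\<forall>I \<sigma>j. 0 <= I --> \<alpha> + \<rho> + I <= y --> \<sigma> <= \<sigma>j -->
 x' / (real T * real t) + exp (- b) * (2 * D * b / real t + D * (real l * \<alpha> + (E + 12/5) + real l * I) + 278/100 + 2 / real l
 + 139/100 * (\<sigma>j + b + 2 * ln (real l))) <= real l * exp (- b) * (b + 1 - exp (- b)) + (real l - 1) * exp (- b) * \<sigma>j + real l * exp (- b) * I)"
proof (cases "b <= y + 1")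
 case True
 obtain E where E: "0 < E" "E + 12/5 <= E0" and N: "!!I \<sigma>j. 0 <= I ==> \<sigma> <= \<sigma>j ==>
 (ln 2 + real l * (h * L) / (4 * E)) / (1 * 1) + exp (- b) * (2 * 1 * b / 1 + 1 * (real l * \<alpha> + (E + 12/5) + real l * I) + 278/100 + 2 / real l
 + 139/100 * (\<sigma>j + b + 2 * ln (real l))) <= real l * exp (- b) * (b + 1 - exp (- b)) + (real l - 1) * exp (- b) * \<sigma>j + real l * exp (- b) * I"
 using regime1[OF True] by blast
 have L0: "0 < L" using L_le by linarith
 \<comment> \<open>With a single slot only the empty and the full set of confused slots
   remain.\<close>
 have ez: "(\<Sum>A\<in>Pow {..<1::nat}. exp (- real (card A) * (real 1 * (real l * h + E))) * (\<Prod>c<1 * (1 * l). if {0} \<inter> {..<1} \<subseteq> A then exp (i (k ! c)) else 1))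
 = 1 + exp ((\<Sum>c<l. i (k ! c)) - (real l * h + E))" for k
 proof -
 have P1: "Pow {..<1} = {{}, {0::nat}}" by auto
 show ?thesis unfolding P1 by (simp add: exp_sum[symmetric] exp_add[symmetric])
 qed
 have EX: "(\<Sum>k\<in>seqs l. (\<Prod>c<l. P (k ! c)) * ln (1 + exp ((\<Sum>c<l. i (k ! c)) - (real l * h + E)))) <= ln 2 + real l * (h * L) / (4 * E)"
 by (rule one_slot_bound[OF P i E(1) L0]) auto
 show ?thesis
 proof (rule exI[of _ 1], rule exI[of _ 1], rule exI[of _ "%_. {0}"], rule exI[of _ E], rule exI[of _ 1],
 rule exI[of _ "ln 2 + real l * (h * L) / (4 * E)"], intro conjI allI impI)
 show "(\<Sum>B<1. real (card {c. c < 1 * (1 * l) & B \<in> {0::nat}})) <= 1 * real l * real 1" by simp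
 show "(\<Sum>k\<in>seqs (1 * (1 * l)). (\<Prod>c<1 * (1 * l). P (k ! c)) * ln (\<Sum>A\<in>Pow {..<1}. exp (- real (card A) * (real 1 * (real l * h + E))) *
 (\<Prod>c<1 * (1 * l). if {0::nat} \<inter> {..<1} \<subseteq> A then exp (i (k ! c)) else 1))) <= ln 2 + real l * (h * L) / (4 * E)"
 unfolding ez using EX by simp
 fix I \<sigma>j :: real assume "0 <= I" "\<alpha> + \<rho> + I <= y" "\<sigma> <= \<sigma>j"
 then show "(ln 2 + real l * (h * L) / (4 * E)) / (real 1 * real 1) + exp (- b) * (2 * 1 * b / real 1 + 1 * (real l * \<alpha> + (E + 12/5) + real l * I) + 278/100 + 2 / real l
 + 139/100 * (\<sigma>j + b + 2 * ln (real l))) <= real l * exp (- b) * (b + 1 - exp (- b)) + (real l - 1) * exp (- b) * \<sigma>j + real l * exp (- b) * I"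
 using N by (simp only: of_nat_1)
 qed (use E in auto)
next
 case False
 then obtain t T :: nat where t: "1 <= t" "1 <= T" "real t = 1 \<or> 11/5 * y * real t <= b + \<sigma>" and ch: "chernoff l t T a b h (E0 - 12/5) L"
 and N: "!!I \<sigma>j. 0 <= I ==> \<alpha> + \<rho> + I <= y ==> \<sigma> <= \<sigma>j ==>
 (3/5 * (real l * exp (- b) * real T * real t)) / (real T * real t) + exp (- b) * (2 * (2 * real t) * b / real t + 2 * real t * (real l * \<alpha> + E0 + real l * I) + 278/100 + 2 / real l
 + 139/100 * (\<sigma>j + b + 2 * ln (real l))) <= real l * exp (- b) * (b + 1 - exp (- b)) + (real l - 1) * exp (- b) * \<sigma>j + real l * exp (- b) * I"
 using regime2 by (metis linorder_le_cases)
 \<comment> \<open>An allowance of half of \<open>l * \<phi>\<close> per codeword. The Chernoff sum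
   adds a tenth, which makes the \<open>3/5\<close> in the balance.\<close>
 let ?C = "real l * exp (- b) * real T * real t / 2"
 obtain s where s: "!!r. 0 < r ==> r <= T ==> 0 < s r" "!!r. 0 < r ==> r <= T ==> s r <= 1"
 and S: "(\<Sum>r=1..T. real (T choose r) * (exp (s r * (- real r * (real t * (real l * h + (E0 - 12/5))) - ?C)
 + real (T * (t * l)) * (real r / real T)\<^sup>2 * (h / L * (exp (s r * L) - 1))) / s r)) <= real l * exp (- b) * real T * real t / 10"
 using chernoff.chernoff_sum[OF ch] by blast
 have L0: "0 < L" using L_le by linarith
 have T0: "0 < T" using t by simp
 have C0: "0 <= ?C" by simp
 obtain e where e': "\<forall>c. e c \<subseteq> {..<T} & e c ~= {} & card (e c) <= 2"
 and EX: "(\<Sum>k\<in>seqs (T * (t * l)). (\<Prod>c<T * (t * l). P (k ! c)) * ln (\<Sum>A\<in>Pow {..<T}. exp (- real (card A) * (real t * (real l * h + (E0 - 12/5)))) *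
 (\<Prod>c<T * (t * l). if e c \<inter> {..<T} \<subseteq> A then exp (i (k ! c)) else 1)))
 <= ?C + (\<Sum>r=1..T. real (T choose r) * (exp (s r * (- real r * (real t * (real l * h + (E0 - 12/5))) - ?C)
 + real (T * (t * l)) * (real r / real T)\<^sup>2 * (h / L * (exp (s r * L) - 1))) / s r))"
 proof -
 show thesis
 by (rule random_pairs[where P=P and i=i and L=L and h=h and T=T and C="?C" and s=s and n="T * (t * l)"
 and \<mu>="real t * (real l * h + (E0 - 12/5))", THEN exE]; (fact P i L0 T0 C0 s | (elim conjE, rule that, assumption+)))
 qed
 have e: "e c \<subseteq> {..<T}" "card (e c) <= 2" for c using e' by auto
 have EX': "(\<Sum>k\<in>seqs (T * (t * l)). (\<Prod>c<T * (t * l). P (k ! c)) * ln (\<Sum>A\<in>Pow {..<T}. exp (- real (card A) * (real t * (real l * h + (E0 - 12/5)))) *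
 (\<Prod>c<T * (t * l). if e c \<inter> {..<T} \<subseteq> A then exp (i (k ! c)) else 1))) <= 3/5 * (real l * exp (- b) * real T * real t)"
 using EX S by linarith
 have E: "0 < E0 - 12/5"
 proof -
 have "0 < (1 + exp y) * a" using a_ge by (intro mult_pos_pos add_pos_pos) auto
 then show ?thesis using E0(2) by linarith
 qed
 have pools: "(\<Sum>B<T. real (card {c. c < T * (t * l) & B \<in> e c})) <= 2 * real t * real l * real T"
 proof -
 have "(\<Sum>c<T * (t * l). real (card (e c))) <= (\<Sum>c<T * (t * l). 2)" using e by (intro sum_mono) (simp add: numeral_eq_Suc)
 then show ?thesis unfolding sum_card_pools[OF e(1)] by (simp add: mult_ac)
 qed
 show ?thesis
 proof (rule exI[of _ t], rule exI[of _ T], rule exI[of _ e], rule exI[of _ "E0 - 12/5"], rule exI[of _ "2 * real t"],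
 rule exI[of _ "3/5 * (real l * exp (- b) * real T * real t)"], intro conjI allI impI)
 fix I \<sigma>j :: real assume "0 <= I" "\<alpha> + \<rho> + I <= y" "\<sigma> <= \<sigma>j"
 then show "3/5 * (real l * exp (- b) * real T * real t) / (real T * real t) + exp (- b) * (2 * (2 * real t) * b / real t + 2 * real t * (real l * \<alpha> + (E0 - 12/5 + 12/5) + real l * I) + 278/100 + 2 / real l
 + 139/100 * (\<sigma>j + b + 2 * ln (real l))) <= real l * exp (- b) * (b + 1 - exp (- b)) + (real l - 1) * exp (- b) * \<sigma>j + real l * exp (- b) * I"
 using N by (simp only: diff_add_cancel)
 qed (use t e E EX' pools in auto)
qed

text \<open>Lets the hash be shorter than the information it has to resolve by \<gamma> per slot: at
  most \<open>T\<close> slots are confused, so the deficit costs at most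
  \<open>T * \<gamma>\<close>.\<close>

lemma hash_expectation:
 fixes P Pt :: "'k::finite => real" and e :: "nat => nat set"
 assumes P: "pmf_on P" and supp: "!!x. 0 < P x ==> 0 < Pt x" and r: "0 < r" "r <= exp (\<gamma> - \<mu>)" "0 <= \<gamma>"
 shows "(\<Sum>k\<in>seqs n. (\<Prod>c<n. P (k ! c)) * ln (\<Sum>A\<in>Pow {..<T}. r ^ card A * (\<Prod>c<n. if e c \<inter> {..<T} \<subseteq> A then 1 / Pt (k ! c) else 1)))
 <= real T * \<gamma> + (\<Sum>k\<in>seqs n. (\<Prod>c<n. P (k ! c)) * ln (\<Sum>A\<in>Pow {..<T}. exp (- real (card A) * \<mu>) *
 (\<Prod>c<n. if e c \<inter> {..<T} \<subseteq> A then exp (- ln (Pt (k ! c))) else 1)))"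
proof -
 let ?PP = "%k. \<Prod>c<n. P (k ! c)"
 let ?S = "%k. \<Sum>A\<in>Pow {..<T}. exp (- real (card A) * \<mu>) * (\<Prod>c<n. if e c \<inter> {..<T} \<subseteq> A then exp (- ln (Pt (k ! c))) else 1)"
 let ?R = "%k. \<Sum>A\<in>Pow {..<T}. r ^ card A * (\<Prod>c<n. if e c \<inter> {..<T} \<subseteq> A then 1 / Pt (k ! c) else 1)"
 have one: "(\<Sum>k\<in>seqs n. ?PP k) = 1" using sum_seqs_iid[of n "%_. P"] P by simp
 have PP0: "0 <= ?PP k" for k by (intro prod_nonneg) (simp add: pmf_on_nonneg[OF P])
 have "?PP k * ln (?R k) <= ?PP k * (real T * \<gamma> + ln (?S k))" for k
 proof (cases "?PP k = 0")
 case False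
 have Pt0: "0 < Pt (k ! c)" if "c < n" for c
 proof -
 have "P (k ! c) ~= 0" using False that by (auto simp: prod_zero_iff)
 then show ?thesis using supp pmf_on_nonneg[OF P, of "k ! c"] by (simp add: less_le)
 qed
 have ie: "(\<Prod>c<n. if e c \<inter> {..<T} \<subseteq> A then exp (- ln (Pt (k ! c))) else 1) = (\<Prod>c<n. if e c \<inter> {..<T} \<subseteq> A then 1 / Pt (k ! c) else 1)" for A
 using Pt0 by (intro prod.cong) (auto simp: exp_minus inverse_eq_divide)
 have p0: "0 < (\<Prod>c<n. if e c \<inter> {..<T} \<subseteq> A then 1 / Pt (k ! c) else 1)" for A
 using Pt0 by (intro prod_pos) auto
 have "?R k <= (\<Sum>A\<in>Pow {..<T}. exp (real T * \<gamma>) * (exp (- real (card A) * \<mu>) * (\<Prod>c<n. if e c \<inter> {..<T} \<subseteq> A then 1 / Pt (k ! c) else 1)))"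
 proof (intro sum_mono)
 fix A assume "A \<in> Pow {..<T}"
 then have cA: "card A <= T" using card_mono[of "{..<T}" A] by simp
 have "r ^ card A <= exp (\<gamma> - \<mu>) ^ card A" using r by (intro power_mono) auto
 also have "... = exp (real (card A) * \<gamma> + - real (card A) * \<mu>)" unfolding exp_of_nat_mult[symmetric] by (simp add: algebra_simps)
 also have "... <= exp (real T * \<gamma> + - real (card A) * \<mu>)" using cA r by (intro iffD2[OF exp_le_cancel_iff] add_right_mono mult_right_mono) auto
 also have "... = exp (real T * \<gamma>) * exp (- real (card A) * \<mu>)" by (rule exp_add)
 finally have "r ^ card A <= exp (real T * \<gamma>) * exp (- real (card A) * \<mu>)" .
 then show "r ^ card A * (\<Prod>c<n. if e c \<inter> {..<T} \<subseteq> A then 1 / Pt (k ! c) else 1)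
 <= exp (real T * \<gamma>) * (exp (- real (card A) * \<mu>) * (\<Prod>c<n. if e c \<inter> {..<T} \<subseteq> A then 1 / Pt (k ! c) else 1))"
 unfolding mult.assoc[symmetric] using p0[of A] by (intro mult_right_mono) auto
 qed
 then have le: "?R k <= exp (real T * \<gamma>) * ?S k" unfolding ie sum_distrib_left .
 have R0: "0 < ?R k" using r p0 by (intro sum_pos) auto
 have S0: "0 < ?S k" unfolding ie using p0 by (intro sum_pos) auto
 have "ln (?R k) <= ln (exp (real T * \<gamma>) * ?S k)" using le R0 by (intro ln_mono) auto
 also have "... = real T * \<gamma> + ln (?S k)" using S0 by (simp only: ln_mult_pos exp_gt_zero ln_exp)
 finally show ?thesis using PP0 by (intro mult_left_mono)
 qed (simp only: mult_zero_left order_refl)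
 then have "(\<Sum>k\<in>seqs n. ?PP k * ln (?R k)) <= (\<Sum>k\<in>seqs n. ?PP k * (real T * \<gamma> + ln (?S k)))" by (intro sum_mono)
 also have "... = real T * \<gamma> + (\<Sum>k\<in>seqs n. ?PP k * ln (?S k))"
 unfolding distrib_left sum.distrib sum_distrib_right[symmetric] one by (simp only: mult_1)
 finally show ?thesis .
qed

text \<open>The law of a message drawn from a uniformly random code block.\<close>

definition block_law :: "nat => nat => 'a set => ('a => real) => (nat => 'a => nat list) => nat => real" where
 "block_law T t S Q H m = (\<Sum>k\<in>S. Q k * (\<Sum>B<T. \<Sum>i<t. of_bool (H B k ! i = m))) / (real T * real t)"

lemma block_law_sum:
 fixes Q :: "'a => real" and g :: "nat => real"
 assumes H: "!!B k i. B < T ==> k \<in> S ==> i < t ==> H B k ! i < M" and T: "0 < T" "0 < t"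
 shows "(\<Sum>m<M. block_law T t S Q H m * g m) * (real T * real t) = (\<Sum>k\<in>S. Q k * (\<Sum>B<T. \<Sum>i<t. g (H B k ! i)))"
proof -
 have gen: "x / (real T * real t) * y * (real T * real t) = x * y" for x y using T by simp
 have "(\<Sum>m<M. block_law T t S Q H m * g m) * (real T * real t) = (\<Sum>m<M. block_law T t S Q H m * g m * (real T * real t))"
 by (rule sum_distrib_right)
 also have "... = (\<Sum>m<M. (\<Sum>k\<in>S. Q k * (\<Sum>B<T. \<Sum>i<t. of_bool (H B k ! i = m))) * g m)" by (simp only: block_law_def gen)
 also have "... = (\<Sum>m<M. \<Sum>k\<in>S. Q k * (\<Sum>B<T. \<Sum>i<t. of_bool (H B k ! i = m) * g m))"
 by (simp only: sum_distrib_right mult.assoc)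
 also have "... = (\<Sum>k\<in>S. Q k * (\<Sum>m<M. \<Sum>B<T. \<Sum>i<t. of_bool (H B k ! i = m) * g m))"
 by (subst sum.swap) (simp only: sum_distrib_left)
 also have "... = (\<Sum>k\<in>S. Q k * (\<Sum>B<T. \<Sum>i<t. g (H B k ! i)))"
 proof (rule sum.cong[OF refl], rule arg_cong2[where f="(*)", OF refl])
 fix k assume k: "k \<in> S"
 have "(\<Sum>m<M. \<Sum>B<T. \<Sum>i<t. of_bool (H B k ! i = m) * g m) = (\<Sum>B<T. \<Sum>i<t. \<Sum>m<M. of_bool (H B k ! i = m) * g m)"
 by (subst sum.swap, intro sum.cong refl sum.swap)
 also have "... = (\<Sum>B<T. \<Sum>i<t. g (H B k ! i))"
 proof (rule sum.cong[OF refl], rule sum.cong[OF refl])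
 fix B i assume "B \<in> {..<T}" "i \<in> {..<t}"
 then have h: "H B k ! i \<in> {..<M}" using H k by simp
 have "(\<Sum>m<M. of_bool (H B k ! i = m) * g m) = (\<Sum>m<M. g m * of_bool (m = H B k ! i))"
 by (intro sum.cong refl) (simp add: eq_commute[of "H B k ! i"] mult.commute)
 also have "... = g (H B k ! i)" using h by (intro sum_of_bool_eq) auto
 finally show "(\<Sum>m<M. of_bool (H B k ! i = m) * g m) = g (H B k ! i)" .
 qed
 finally show "(\<Sum>m<M. \<Sum>B<T. \<Sum>i<t. of_bool (H B k ! i = m) * g m) = (\<Sum>B<T. \<Sum>i<t. g (H B k ! i))" .
 qed
 finally show ?thesis .
qed



text \<open>From \<open>(1 - p) ^ l <= exp (- l * p)\<close>, the product \<open>l * p\<close> is at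
  most \<open>- ln\<close> of one minus the block mismatch probability.\<close>

lemma mismatch_linear:
 fixes p :: real
 assumes p: "0 <= p" "p < 1" and \<xi>: "1 - (1 - p) ^ l <= 1/2"
 shows "real l * p <= 139/100 * (1 - (1 - p) ^ l)"
proof -
 have "1 - p <= exp (- p)" using exp_ge_add_one_self[of "- p"] by simp
 then have "(1 - p) ^ l <= exp (- p) ^ l" using p by (intro power_mono) auto
 also have "... = exp (- (real l * p))" unfolding exp_of_nat_mult[symmetric] by simp
 finally have "ln ((1 - p) ^ l) <= ln (exp (- (real l * p)))" using p by (intro ln_mono) auto
 then have "real l * p <= - ln (1 - (1 - (1 - p) ^ l))" by simp
 also have "... <= 139/100 * (1 - (1 - p) ^ l)" using p \<xi> by (intro minus_ln_one_minus_le) (auto intro: power_le_one)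
 finally show ?thesis .
qed

lemma push_push: "push (push p f) g = push p (%x. g (f x))"
 for p :: "'a::finite => real" and f :: "'a => 'b::finite" and g :: "'b => 'c"
 by (intro ext) (subst push_eq, subst sum_push, subst push_eq, rule refl)

lemma (in receiver) rate_nats:
 assumes b: "1 < b" and \<phi>: "0 < \<phi>" "\<phi> <= 1/2"
 and rate: "cond_entropy b (push WS (%z. (fst z, \<kappa> z))) + \<beta> + Ll b l \<phi> CARD('s) < I / ln b - Ll b 1 \<phi> CARD('v)"
 shows "HS + ln b * \<beta> + h2 \<phi> / real l + \<phi> * ln (real CARD('s)) + h2 \<phi> + \<phi> * ln (real CARD('v)) < I"
proof -
 have lb: "0 < ln b" using b by simp
 have hb: "hbin b \<phi> * ln b = h2 \<phi>"
 using \<phi> lb by (simp add: hbin_def plogq_def log_def h2_def field_simps)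
 have "(cond_entropy b (push WS (%z. (fst z, \<kappa> z))) + \<beta> + Ll b l \<phi> CARD('s)) * ln b < (I / ln b - Ll b 1 \<phi> CARD('v)) * ln b"
 using rate lb by (rule mult_strict_right_mono)
 moreover have "(cond_entropy b (push WS (%z. (fst z, \<kappa> z))) + \<beta> + Ll b l \<phi> CARD('s)) * ln b
 = HS + ln b * \<beta> + h2 \<phi> / real l + \<phi> * ln (real CARD('s))"
 using lb by (simp add: HS_cond_entropy[OF b] Ll_def hb[symmetric] log_def algebra_simps)
 moreover have "(I / ln b - Ll b 1 \<phi> CARD('v)) * ln b = I - h2 \<phi> - \<phi> * ln (real CARD('v))"
 using lb by (simp add: Ll_def hb[symmetric] log_def algebra_simps)
 ultimately show ?thesis by simp
qed

text \<open>A non-positive exponent would make the error bound at least 1.\<close>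

lemma Er_pos:
 assumes b: "1 < b" and g: "(real l + 1) ^ k * b powr (- real l * e) <= 1/2"
 shows "0 < e"
proof (rule ccontr)
 assume "\<not> 0 < e"
 then have "1 * 1 <= (real l + 1) ^ k * b powr (- real l * e)"
 using b by (intro mult_mono) (auto intro!: ge_one_powr_ge_zero mult_nonneg_nonpos simp: mult_nonneg_nonpos)
 then show False using g by simp
qed

theorem theorem11:
  fixes b :: real
    and WS :: "'s1::finite \<times> 's2::finite \<Rightarrow> real"
    and W :: "'x1::finite \<times> 'x2::finite \<Rightarrow> 'y1::finite \<times> 'y2::finite \<Rightarrow> real"
    and f1 :: "'s1 \<Rightarrow> 'k::finite" and f2 :: "'s2 \<Rightarrow> 'k"
    and \<alpha> \<beta> \<rho> \<delta> :: real and l :: nat and a :: nat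
    and pU :: "'u::finite \<Rightarrow> real" and pV1 :: "'v1::finite \<Rightarrow> real" and pV2 :: "'v2::finite \<Rightarrow> real"
    and pX1 :: "'u \<times> 'v1 \<Rightarrow> 'x1 \<Rightarrow> real" and pX2 :: "'u \<times> 'v2 \<Rightarrow> 'x2 \<Rightarrow> real"
  defines "J \<equiv> joint7 pU pV1 pV2 pX1 pX2 W"
    and "Ka \<equiv> (\<lambda>(s1,s2). if a = 1 then f1 s1 else f2 s2)"
    and "\<phi>1 \<equiv> (real l + 1) ^ (2 * CARD('u) * CARD('y1)) * b powr (- real l * Er b (\<alpha> + \<rho>) pU ((\<lambda>u y. push (joint7 pU pV1 pV2 pX1 pX2 W) (\<lambda>(u,v1,v2,x1,x2,y1,y2). (u,y1)) (u,y) / pU u)))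
             + xi l (push WS (\<lambda>(s1,s2). f1 s1 \<noteq> f2 s2) True) + tau b l \<delta> (push WS (\<lambda>(s1,s2). if a = 1 then f1 s1 else f2 s2))"
    and "\<phi>2 \<equiv> (real l + 1) ^ (2 * CARD('u) * CARD('y2)) * b powr (- real l * Er b (\<alpha> + \<rho>) pU ((\<lambda>u y. push (joint7 pU pV1 pV2 pX1 pX2 W) (\<lambda>(u,v1,v2,x1,x2,y1,y2). (u,y2)) (u,y) / pU u)))
             + xi l (push WS (\<lambda>(s1,s2). f1 s1 \<noteq> f2 s2) True) + tau b l \<delta> (push WS (\<lambda>(s1,s2). if a = 1 then f1 s1 else f2 s2))"
  assumes base: "b > 1"
    and src: "pmf_on WS"
    and chan: "stoch W"
    and params: "\<alpha> \<ge> 0" "\<beta> \<ge> 0" "\<rho> > 0" "\<delta> > 0"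
    and l_ge: "l \<ge> max (lstar b CARD('u) CARD('y1) \<rho>) (lstar b CARD('u) CARD('y2) \<rho>)"
    and pmfs: "pmf_on pU" "pmf_on pV1" "pmf_on pV2" "stoch pX1" "stoch pX2"
    and type_U: "is_type l pU"
    and a_in: "a \<in> {1, 2}"
    and rate: "(1 + \<delta>) * info_entropy b (push WS Ka) \<le> \<alpha> + \<beta>"
    and cond1: "cond_entropy b (push WS (\<lambda>(s1,s2). (s1, Ka (s1,s2)))) + \<beta> + Ll b l \<phi>1 CARD('s1)
               < cond_mutual_info b (push J (\<lambda>(u,v1,v2,x1,x2,y1,y2). (v1,y1,u))) - Ll b 1 \<phi>1 CARD('v1)"
    and cond2: "cond_entropy b (push WS (\<lambda>(s1,s2). (s2, Ka (s1,s2)))) + \<beta> + Ll b l \<phi>2 CARD('s2)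
               < cond_mutual_info b (push J (\<lambda>(u,v1,v2,x1,x2,y1,y2). (v2,y2,u))) - Ll b 1 \<phi>2 CARD('v2)"
    and small: "\<phi>1 \<le> 1/2" "\<phi>2 \<le> 1/2"
  shows "transmissible WS W"
proof -
 define p where "p = push WS Ka"
 define D1 where "D1 u c = pV1 (fst c) * pX1 (u, fst c) (snd c)" for u c
 define D2 where "D2 u c = pV2 (fst c) * pX2 (u, fst c) (snd c)" for u c
 define V1 where "V1 = (%(c1 :: 'v1 \<times> 'x1, c2 :: 'v2 \<times> 'x2). W (snd c1, snd c2))"
 \<comment> \<open>The mirrored channel, source and common part present the second receiver as a
   first receiver.\<close>
 define V2 where "V2 = (%(c2, c1) (z, y). V1 (c1, c2) (y, z))"
 define WS' where "WS' = (%(t, s). WS (s, t))"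
 define Ka' where "Ka' = (%(t, s). Ka (s, t))"
 obtain n :: "'u => nat" where n: "!!u. real (n u) = real l * pU u" "(\<Sum>u\<in>UNIV. n u) = l"
 using composition_type[OF pmfs(1) type_U] by blast
 have l0: "0 < l" using lstar_ge(1)[OF base params(3)] l_ge by (metis max.bounded_iff)
 have pn: "(%u. real (n u) / real l) = pU" using n l0 by auto
 have V1_eq: "V1 (c, d) = W (snd c, snd d)" for c d by (simp add: V1_def)
 have V2_eq: "V2 (d, c) (z, y) = W (snd c, snd d) (y, z)" for c d y z by (simp add: V2_def V1_eq)
 have stV1: "stoch V1" using chan by (auto simp: V1_def stoch_def)
 have pmfD: "pmf_on (D1 u)" "pmf_on (D2 u)" for u
 proof -
 have "sum (D1 u) UNIV = (\<Sum>v\<in>UNIV. pV1 v * (\<Sum>x\<in>UNIV. pX1 (u, v) x))"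
 by (simp add: D1_def sum_UNIV_pair[symmetric] sum_distrib_left)
 then show "pmf_on (D1 u)" using pmfs by (simp add: pmf_on_def D1_def stoch_sum stoch_nonneg)
 have "sum (D2 u) UNIV = (\<Sum>v\<in>UNIV. pV2 v * (\<Sum>x\<in>UNIV. pX2 (u, v) x))"
 by (simp add: D2_def sum_UNIV_pair[symmetric] sum_distrib_left)
 then show "pmf_on (D2 u)" using pmfs by (simp add: pmf_on_def D2_def stoch_sum stoch_nonneg)
 qed
 have pWS': "pmf_on WS'"
 proof -
 have "sum WS' UNIV = sum WS UNIV" unfolding WS'_def
 by (rule sum.reindex_bij_witness[where i=prod.swap and j=prod.swap]) auto
 then show ?thesis using src by (auto simp: pmf_on_def WS'_def split: prod.splits)
 qed
 have stV2: "stoch V2"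
 proof -
 have "(\<Sum>x\<in>UNIV. V2 c x) = (\<Sum>x\<in>UNIV. V1 (prod.swap c) x)" for c
 unfolding V2_def by (cases c) (auto intro!: sum.reindex_bij_witness[where i=prod.swap and j=prod.swap])
 then show ?thesis using stV1 by (auto simp: stoch_def pmf_on_def V2_def split: prod.splits)
 qed
 have kap: "(\<forall>z. Ka z = f1 (fst z)) \<or> (\<forall>z. Ka z = f2 (snd z))" using a_in by (auto simp: Ka_def)
 then have kap': "(\<forall>z. Ka' z = f2 (fst z)) \<or> (\<forall>z. Ka' z = f1 (snd z))" by (auto simp: Ka'_def)
 have comp: "real (card {i. i < l & us ! i = u}) = real l * pU u" if "us \<in> tclass l n" for us u
 proof -
 have "length us = l" "count (mset us) = n" using that by (auto simp: tclass_def seqs_iff)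
 then show ?thesis using n(1)[of u] count_mset_card[of us u] by simp
 qed
 \<comment> \<open>A constant codebook instantiates \<open>receiver\<close> provisionally: mutual
   information, source entropy and output law do not depend on the code and are needed before it is
   built.\<close>
 obtain us0 where us0: "us0 \<in> tclass l n" using tclass_pos[OF n(2)] by (metis all_not_in_conv card.empty less_irrefl)
 interpret R0: receiver WS pV1 pX1 D2 V1 f1 f2 Ka l "%_. us0" pU
 by standard (use src pmfs pmfD stV1 kap comp[OF us0] in auto)
 interpret Q0: receiver WS' pV2 pX2 D1 V2 f2 f1 Ka' l "%_. us0" pU
 by standard (use pWS' pmfs pmfD stV2 kap' comp[OF us0] in auto)

 have J1: "push J (%(u,v1,v2,x1,x2,y1,y2). (v1,y1,u)) (v, y, u) = pU u * pV1 v * R0.PVY u v y" for u v y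
 proof -
 have "push J (%(u,v1,v2,x1,x2,y1,y2). (v1,y1,u)) (v, y, u)
 = (\<Sum>e\<in>UNIV. J (case e of (x, d, z) => (u, v, fst d, x, snd d, y, z)))"
 by (rule push_bij[where k="%(u,v1,v2,x1,x2,y1,y2). (x1,(v2,x2),y2)"]) auto
 then show ?thesis
 by (simp add: sum_UNIV_pair[symmetric] R0.PVY_def sum_distrib_left J_def joint7_def D2_def V1_eq mult_ac)
 qed
 have J2: "push J (%(u,v1,v2,x1,x2,y1,y2). (v2,y2,u)) (v, y, u) = pU u * pV2 v * Q0.PVY u v y" for u v y
 proof -
 have "push J (%(u,v1,v2,x1,x2,y1,y2). (v2,y2,u)) (v, y, u)
 = (\<Sum>e\<in>UNIV. J (case e of (x, d, z) => (u, fst d, v, snd d, x, z, y)))"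
 by (rule push_bij[where k="%(u,v1,v2,x1,x2,y1,y2). (x2,(v1,x1),y1)"]) auto
 then show ?thesis
 by (simp add: sum_UNIV_pair[symmetric] Q0.PVY_def sum_distrib_left J_def joint7_def D1_def V2_eq mult_ac)
 qed
 have E1: "Er b (\<alpha> + \<rho>) pU (%u y. push J (%(u,v1,v2,x1,x2,y1,y2). (u,y1)) (u,y) / pU u) = Er b (\<alpha> + \<rho>) pU R0.PY"
 proof (rule Er_cong)
 fix u y assume "0 < pU u"
 have "push J (%(u,v1,v2,x1,x2,y1,y2). (u,y1)) (u, y)
 = (\<Sum>e\<in>UNIV. J (case e of (v, x, d, z) => (u, v, fst d, x, snd d, y, z)))"
 by (rule push_bij[where k="%(u,v1,v2,x1,x2,y1,y2). (v1,x1,(v2,x2),y2)"]) auto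
 also have "... = pU u * R0.PY u y"
 by (simp add: sum_UNIV_pair[symmetric] R0.PY_def R0.PVY_def sum_distrib_left J_def joint7_def D2_def V1_eq mult_ac)
 finally show "push J (%(u,v1,v2,x1,x2,y1,y2). (u,y1)) (u,y) / pU u = R0.PY u y" using \<open>0 < pU u\<close> by simp
 qed (simp add: pmf_on_nonneg[OF pmfs(1)])
 have E2: "Er b (\<alpha> + \<rho>) pU (%u y. push J (%(u,v1,v2,x1,x2,y1,y2). (u,y2)) (u,y) / pU u) = Er b (\<alpha> + \<rho>) pU Q0.PY"
 proof (rule Er_cong)
 fix u y assume "0 < pU u"
 have "push J (%(u,v1,v2,x1,x2,y1,y2). (u,y2)) (u, y)
 = (\<Sum>e\<in>UNIV. J (case e of (v, x, d, z) => (u, fst d, v, snd d, x, z, y)))"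
 by (rule push_bij[where k="%(u,v1,v2,x1,x2,y1,y2). (v2,x2,(v1,x1),y1)"]) auto
 also have "... = pU u * Q0.PY u y"
 by (simp add: sum_UNIV_pair[symmetric] Q0.PY_def Q0.PVY_def sum_distrib_left J_def joint7_def D1_def V2_eq mult_ac)
 finally show "push J (%(u,v1,v2,x1,x2,y1,y2). (u,y2)) (u,y) / pU u = Q0.PY u y" using \<open>0 < pU u\<close> by simp
 qed (simp add: pmf_on_nonneg[OF pmfs(1)])
 have xi1: "xi l (push WS (%(s1,s2). f1 s1 ~= f2 s2) True) = R0.\<xi>"
 by (simp add: xi_def R0.\<xi>_def push_eq case_prod_unfold)
 have xi2: "xi l (push WS (%(s1,s2). f1 s1 ~= f2 s2) True) = Q0.\<xi>"
 proof -
 have "(\<Sum>z\<in>UNIV. WS' z * of_bool (f2 (fst z) ~= f1 (snd z))) = (\<Sum>z\<in>UNIV. WS z * of_bool (f1 (fst z) ~= f2 (snd z)))"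
 unfolding WS'_def by (rule sum.reindex_bij_witness[where i=prod.swap and j=prod.swap]) (auto simp: eq_commute[of "f2 _"])
 then show ?thesis using xi1 by (simp add: R0.\<xi>_def Q0.\<xi>_def)
 qed
 have p_eq: "push WS (%(s1,s2). if a = 1 then f1 s1 else f2 s2) = p" by (simp add: p_def Ka_def)
 define g1 where "g1 = (real l + 1) ^ (2 * CARD('u) * CARD('y1)) * b powr (- real l * Er b (\<alpha> + \<rho>) pU R0.PY)"
 define g2 where "g2 = (real l + 1) ^ (2 * CARD('u) * CARD('y2)) * b powr (- real l * Er b (\<alpha> + \<rho>) pU Q0.PY)"
 have phi1: "\<phi>1 = g1 + R0.\<xi> + tau b l \<delta> p"
 unfolding \<phi>1_def p_eq xi1[symmetric] g1_def E1[symmetric, unfolded J_def] ..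
 have phi2: "\<phi>2 = g2 + Q0.\<xi> + tau b l \<delta> p"
 unfolding \<phi>2_def p_eq xi2[symmetric] g2_def E2[symmetric, unfolded J_def] ..
 have g0: "0 < g1" "0 < g2" using base by (simp_all add: g1_def g2_def)
 have xi_nonneg: "0 <= R0.\<xi>" "0 <= Q0.\<xi>"
 proof -
 have "0 <= push WS (%(s1,s2). f1 s1 ~= f2 s2) True" "push WS (%(s1,s2). f1 s1 ~= f2 s2) True <= 1"
 using pmf_on_push[OF src, of "%(s1,s2). f1 s1 ~= f2 s2"] by (simp_all add: pmf_on_nonneg pmf_on_le_1)
 then have "0 <= xi l (push WS (%(s1,s2). f1 s1 ~= f2 s2) True)"
 unfolding xi_def by (simp add: power_le_one)
 then show "0 <= R0.\<xi>" "0 <= Q0.\<xi>" using xi1 xi2 by auto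
 qed
 have tau0: "0 <= tau b l \<delta> p" by (simp add: tau_def)
 have phi0: "0 < \<phi>1" "0 < \<phi>2" using g0 xi_nonneg tau0 by (simp_all add: phi1 phi2)
 have I1: "R0.I = ln b * cond_mutual_info b (push J (%(u,v1,v2,x1,x2,y1,y2). (v1,y1,u)))"
 by (rule R0.I_cond_mutual_info[OF base pmfs(1) J1])
 have I2: "Q0.I = ln b * cond_mutual_info b (push J (%(u,v1,v2,x1,x2,y1,y2). (v2,y2,u)))"
 by (rule Q0.I_cond_mutual_info[OF base pmfs(1) J2])
 have H1: "push WS (%z. (fst z, Ka z)) = push WS (%(s1,s2). (s1, Ka (s1,s2)))"
 by (simp add: case_prod_unfold)
 have H2: "push WS' (%z. (fst z, Ka' z)) = push WS (%(s1,s2). (s2, Ka (s1,s2)))"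
 unfolding WS'_def Ka'_def by (intro ext, subst push_swap) simp

 have lb: "0 < ln b" using base by simp
 have tau_le: "g1 + R0.\<xi> <= \<phi>1" "g2 + R0.\<xi> <= \<phi>2" using tau0 xi1 xi2 by (simp_all add: phi1 phi2)
 have c1: "R0.HS + ln b * \<beta> + h2 \<phi>1 / real l + \<phi>1 * ln (real CARD('s1)) + h2 \<phi>1 + \<phi>1 * ln (real CARD('v1)) < R0.I"
 by (rule R0.rate_nats[OF base phi0(1) small(1)]) (use cond1 base in \<open>simp add: I1 H1\<close>)
 have c2: "Q0.HS + ln b * \<beta> + h2 \<phi>2 / real l + \<phi>2 * ln (real CARD('s2)) + h2 \<phi>2 + \<phi>2 * ln (real CARD('v2)) < Q0.I"
 by (rule Q0.rate_nats[OF base phi0(2) small(2)]) (use cond2 base in \<open>simp add: I2 H2\<close>)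
 have h2p: "0 <= h2 \<phi>1" "0 <= h2 \<phi>2"
 proof -
 have "0 <= q * (ln (1 / q) + 1 - q)" if "0 < q" "q <= 1/2" for q :: real
 proof -
 have "0 <= ln (1 / q)" using that by simp
 then have "0 <= ln (1 / q) + 1 - q" using that by linarith
 then show ?thesis using that by simp
 qed
 then show "0 <= h2 \<phi>1" "0 <= h2 \<phi>2" using h2_ge phi0 small by (meson order_trans)+
 qed
 have \<beta>I: "ln b * \<beta> <= R0.I" "ln b * \<beta> <= Q0.I" "0 <= ln b * \<beta>"
 proof -
 have "0 <= h2 \<phi>1 / real l" "0 <= h2 \<phi>2 / real l" "0 <= \<phi>1 * ln (real CARD('s1))" "0 <= \<phi>2 * ln (real CARD('s2))"
 "0 <= \<phi>1 * ln (real CARD('v1))" "0 <= \<phi>2 * ln (real CARD('v2))"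
 using h2p phi0 by (auto intro!: mult_nonneg_nonneg ln_ge_zero simp: Suc_le_eq)
 then show "ln b * \<beta> <= R0.I" "ln b * \<beta> <= Q0.I" using c1 c2 h2p R0.HS_nonneg Q0.HS_nonneg by linarith+
 show "0 <= ln b * \<beta>" using lb params by simp
 qed
 then have I0: "0 <= R0.I" "0 <= Q0.I" by linarith+
 have g12: "g1 <= 1/2" "g2 <= 1/2" using tau_le small xi_nonneg by linarith+
 have Er1: "0 < Er b (\<alpha> + \<rho>) pU R0.PY" by (rule Er_pos[OF base g12(1)[unfolded g1_def]])
 have Er2: "0 < Er b (\<alpha> + \<rho>) pU Q0.PY" by (rule Er_pos[OF base g12(2)[unfolded g2_def]])
 define Y where "Y = max (real CARD('y1)) (real CARD('y2))"
 define y where "y = ln Y"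
 define U where "U = real CARD('u)"
 define \<alpha>n where "\<alpha>n = ln b * \<alpha>"
 define \<rho>n where "\<rho>n = ln b * \<rho>"
 define la where "la = ln (real l + 1)"
 have n0: "0 <= \<alpha>n" "0 < \<rho>n" using lb params by (auto simp: \<alpha>n_def \<rho>n_def)
 have Y1: "1 <= real CARD('y1)" "1 <= real CARD('y2)" by (auto simp: Suc_le_eq)
 have lnY: "ln (real CARD('y1)) <= y" "ln (real CARD('y2)) <= y" unfolding y_def using Y1 by (auto simp: Y_def intro!: ln_mono)
 have ch1: "\<alpha>n + \<rho>n + ln b * Er b (\<alpha> + \<rho>) pU R0.PY + R0.I <= ln (real CARD('y1))"
 using R0.Er_chain(1)[OF base pmfs(1) Er1] by (simp add: \<alpha>n_def \<rho>n_def distrib_left)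
 have ch2: "\<alpha>n + \<rho>n + ln b * Er b (\<alpha> + \<rho>) pU Q0.PY + Q0.I <= ln (real CARD('y2))"
 using Q0.Er_chain(1)[OF base pmfs(1) Er2] by (simp add: \<alpha>n_def \<rho>n_def distrib_left)
 have lE: "0 < ln b * Er b (\<alpha> + \<rho>) pU R0.PY" "0 < ln b * Er b (\<alpha> + \<rho>) pU Q0.PY" using lb Er1 Er2 by auto
 have U2: "2 <= U" using R0.Er_chain(2)[OF base pmfs(1) Er1] params by (simp add: U_def)
 have Yj2: "2 <= CARD('y1)" "2 <= CARD('y2)"
 proof -
 have "0 < ln (real CARD('y1))" "0 < ln (real CARD('y2))" using ch1 ch2 lE n0 I0 by linarith+
 then have "1 < real CARD('y1)" "1 < real CARD('y2)" using Y1 by (auto simp: ln_gt_zero_iff)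
 then show "2 <= CARD('y1)" "2 <= CARD('y2)" by auto
 qed
 have Y2: "2 <= Y" using Yj2 by (auto simp: Y_def)
 have ey: "exp y = Y" using Y2 by (simp add: y_def)
 have la0: "2/3 <= la"
 proof -
 have "ln 2 <= la" unfolding la_def using l0 by (intro ln_mono) auto
 then show ?thesis using ln2_ge_two_thirds by linarith
 qed
 have lst: "2 * U * (1 + Y) * la <= real l * \<rho>n / 2"
 proof -
 have st: "(2 * U + 2 * U * real B) * la <= real l * \<rho>n / 2" if "2 * (real l + 1) ^ (2 * CARD('u) + 2 * CARD('u) * B) <= b powr (real l * \<rho> / 2)" for B
 proof -
 have "1 * (real l + 1) ^ (2 * CARD('u) + 2 * CARD('u) * B) <= b powr (real l * \<rho> / 2)"
 by (rule order_trans[OF mult_right_mono that]) auto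
 then have "ln (1 * (real l + 1) ^ (2 * CARD('u) + 2 * CARD('u) * B)) <= ln (b powr (real l * \<rho> / 2))" by (intro ln_mono) auto
 then show ?thesis using base by (simp add: ln_realpow ln_powr la_def \<rho>n_def U_def mult_ac)
 qed
 have "l \<ge> lstar b CARD('u) CARD('y1) \<rho>" "l \<ge> lstar b CARD('u) CARD('y2) \<rho>" using l_ge by auto
 from st[OF lstar_ge(2)[OF base params(3) this(1)]] st[OF lstar_ge(2)[OF base params(3) this(2)]]
 have "(2 * U + 2 * U * Y) * la <= real l * \<rho>n / 2" by (cases "real CARD('y1) <= real CARD('y2)") (simp_all add: Y_def max_def)
 then show ?thesis by (simp add: algebra_simps)
 qed
 interpret N0: numbers l la y \<rho>n U
 by standard (use l0 la_def Y2 U2 lst ey ch1 lnY lE I0 n0 in auto)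
 have l134: "134 <= l" by (rule N0.l_ge)

 define pne where "pne = (\<Sum>z\<in>UNIV. WS z * of_bool (f1 (fst z) ~= f2 (snd z)))"
 have \<xi>: "R0.\<xi> = 1 - (1 - pne) ^ l" by (simp add: R0.\<xi>_def pne_def)
 have W0: "0 <= WS z" for z using pmf_on_nonneg[OF src] .
 have \<xi>h: "R0.\<xi> <= 1/2" using tau_le small g0 by linarith
 have pne: "0 <= pne" "pne < 1"
 proof -
 show "0 <= pne" unfolding pne_def by (intro sum_nonneg) (simp add: W0)
 have "pne <= sum WS UNIV" unfolding pne_def by (intro sum_mono) (simp add: W0)
 then have "pne <= 1" using pmf_on_sum[OF src] by simp
 moreover have "pne ~= 1" using \<xi>h l0 by (auto simp: \<xi> power_0_left)
 ultimately show "pne < 1" by simp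
 qed
 have lpne: "real l * pne <= 139/100 * R0.\<xi>" unfolding \<xi> by (rule mismatch_linear[OF pne]) (use \<xi>h \<xi> in simp)
 \<comment> \<open>Only symbols that both users can produce are worth hashing. Their number is at
   most the size of either source alphabet, so the alphabet terms of both receivers can pay for
   \<sigma>.\<close>
 define Rs where "Rs = range f1 \<inter> range f2"
 have Rs: "Rs ~= {}"
 proof
 assume "Rs = {}"
 then have "f1 s ~= f2 s'" for s s' by (auto simp: Rs_def)
 then have "pne = sum WS UNIV" by (simp add: pne_def)
 then show False using pne pmf_on_sum[OF src] by simp
 qed
 then obtain k0 where k0: "k0 \<in> Rs" by blast
 \<comment> \<open>Symbols outside \<open>Rs\<close> are sent to an arbitrary one inside. The common
   part changes only where the users disagree anyway, hence with probability at most
   \<open>pne\<close>.\<close>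
 define mg where "mg k = (if k \<in> Rs then k else k0)" for k
 have mg: "mg k \<in> Rs" for k using k0 by (simp add: mg_def)
 define fh1 where "fh1 s = mg (f1 s)" for s
 define fh2 where "fh2 s = mg (f2 s)" for s
 define Kh where "Kh z = mg (Ka z)" for z
 define Kh' where "Kh' z = mg (Ka' z)" for z
 have sw: "(\<Sum>z\<in>UNIV. WS' z * h z) = (\<Sum>z\<in>UNIV. WS z * h (snd z, fst z))" for h :: "'s2 \<times> 's1 => real"
 unfolding WS'_def by (rule sum.reindex_bij_witness[where i=prod.swap and j=prod.swap]) auto
 define P where "P = push WS Kh"
 have P: "pmf_on P" unfolding P_def by (rule pmf_on_push[OF src])
 have P2: "push WS' Kh' = P"
 unfolding P_def WS'_def Kh'_def Kh_def Ka'_def by (intro ext, subst push_swap) (simp add: case_prod_unfold)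
 have PR: "x \<in> Rs" if "0 < P x" for x
 proof (rule ccontr)
 assume "x \<notin> Rs"
 then have "Kh z ~= x" for z using mg by (auto simp: Kh_def)
 then have "P x = 0" by (simp add: P_def push_eq)
 then show False using that by simp
 qed
 have Kdiff: "(\<Sum>z\<in>UNIV. WS z * of_bool (Kh z ~= Ka z)) <= pne" unfolding pne_def
 proof (intro sum_mono mult_left_mono W0)
 fix z
 have "f1 (fst z) ~= f2 (snd z)" if "Kh z ~= Ka z"
 proof
 assume e: "f1 (fst z) = f2 (snd z)"
 then have "Ka z = f1 (fst z)" "Ka z = f2 (snd z)" using kap e by (cases z; force)+
 then have "Ka z \<in> Rs" unfolding Rs_def by (metis IntI rangeI)
 then show False using that by (simp add: Kh_def mg_def)
 qed
 then show "of_bool (Kh z ~= Ka z) <= (of_bool (f1 (fst z) ~= f2 (snd z)) :: real)" by auto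
 qed
 have Kdiff': "(\<Sum>z\<in>UNIV. WS' z * of_bool (Kh' z ~= Ka' z)) <= pne"
 unfolding sw using Kdiff by (simp add: Kh'_def Ka'_def Kh_def)
 define pneh where "pneh = (\<Sum>z\<in>UNIV. WS z * of_bool (fh1 (fst z) ~= fh2 (snd z)))"
 have pneh: "pneh <= pne" unfolding pneh_def pne_def
 by (intro sum_mono mult_left_mono W0) (auto simp: fh1_def fh2_def)
 have pneh': "(\<Sum>z\<in>UNIV. WS' z * of_bool (fh2 (fst z) ~= fh1 (snd z))) = pneh"
 unfolding sw pneh_def by (intro sum.cong refl) auto
 define Hh where "Hh = ent P"
 have Hh: "Hh <= \<alpha>n + ln b * \<beta>"
 proof -
 have e: "push (push WS Ka) mg = P" unfolding push_push P_def Kh_def ..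
 have "Hh <= ent (push WS Ka)" unfolding Hh_def e[symmetric] by (rule ent_push_le[OF pmf_on_push[OF src]])
 also have "... <= ln b * ((1 + \<delta>) * info_entropy b (push WS Ka))"
 proof -
 have i: "ln b * info_entropy b (push WS Ka) = ent (push WS Ka)" by (rule info_entropy_ent[OF base])
 have "0 <= \<delta> * ent (push WS Ka)" using params ent_nonneg[OF pmf_on_push[OF src, of Ka]] by simp
 then show ?thesis unfolding i[symmetric] by (simp add: algebra_simps)
 qed
 also have "... <= ln b * (\<alpha> + \<beta>)" using rate lb by (intro mult_left_mono) auto
 finally show ?thesis by (simp add: \<alpha>n_def distrib_left)
 qed
 have Hh0: "0 <= Hh" unfolding Hh_def by (rule ent_nonneg[OF P])
 define \<sigma> where "\<sigma> = ln (real (card Rs))"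
 have H\<sigma>: "Hh <= \<sigma>" unfolding Hh_def \<sigma>_def by (rule ent_le_card(2)[OF P PR])
 have \<sigma>1: "\<sigma> <= ln (real CARD('s1))" "\<sigma> <= ln (real CARD('s2))"
 proof -
 have "0 < card Rs" using Rs by (simp add: card_gt_0_iff)
 moreover have "card Rs <= card (range f1)" "card Rs <= card (range f2)" by (auto simp: Rs_def intro!: card_mono)
 moreover have "card (range f1) <= CARD('s1)" "card (range f2) <= CARD('s2)" by (auto intro!: card_image_le)
 ultimately show "\<sigma> <= ln (real CARD('s1))" "\<sigma> <= ln (real CARD('s2))" unfolding \<sigma>_def by (auto intro!: ln_mono)
 qed
 \<comment> \<open>The hash carries no more than the entropy of the projected common part.\<close>
 define \<alpha>' where "\<alpha>' = min \<alpha>n Hh"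
 \<comment> \<open>The second summand is the loss from \<open>smoothed\<close>.\<close>
 define h where "h = Hh + 101/100 / real l"
 have lr: "134 <= real l" using l134 by simp
 have h0: "0 < h" using Hh0 lr by (auto simp: h_def intro!: add_nonneg_pos)
 have l\<rho>: "101/100 <= real l * \<rho>n"
 proof -
 have "2 * 2 * 3 * (2/3) <= 2 * U * (1 + Y) * la" using U2 Y2 la0 by (intro mult_mono) auto
 then show ?thesis using lst by linarith
 qed
 have hy: "h <= y"
 proof -
 have "101/100 / real l <= \<rho>n" using l\<rho> lr by (simp add: divide_le_eq mult.commute)
 then show ?thesis unfolding h_def using Hh \<beta>I ch1 lE lnY by linarith
 qed
 \<comment> \<open>One failure parameter for both receivers: it is at most each \<phi>j, yet it
   dominates the mismatch probability \<xi>.\<close>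
 define \<phi> where "\<phi> = R0.\<xi> + min g1 g2"
 have \<phi>: "0 < \<phi>" "\<phi> <= \<phi>1" "\<phi> <= \<phi>2" "R0.\<xi> <= \<phi>" "\<phi> <= 1/2"
 using g0 xi_nonneg tau_le small by (auto simp: \<phi>_def min_def)
 define B where "B = ln (1 / \<phi>)"
 have eB: "exp (- B) = \<phi>" using \<phi> by (simp add: B_def ln_div)
 have B23: "2/3 <= B"
 proof -
 have "ln 2 <= B" unfolding B_def using \<phi> by (intro ln_mono) (auto simp: field_simps)
 then show ?thesis using ln2_ge_two_thirds by linarith
 qed
 \<comment> \<open>The exponents are at most \<open>y\<close> by \<open>Er_chain\<close>, so \<phi>
   cannot be smaller than \<open>exp (- l * y)\<close>.\<close>
 have By: "B <= real l * y"
 proof -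
 have pw: "exp (- (real l * y)) <= (real l + 1) ^ k * b powr (- real l * e)" if "ln b * e <= y" for k e
 proof -
 have "real l * (ln b * e) <= real l * y" using that by (intro mult_left_mono) auto
 then have "exp (- (real l * y)) <= b powr (- real l * e)" using base by (simp add: powr_def mult_ac)
 also have "1 * b powr (- real l * e) <= (real l + 1) ^ k * b powr (- real l * e)" by (intro mult_right_mono) auto
 finally show ?thesis by simp
 qed
 have ly: "ln b * Er b (\<alpha> + \<rho>) pU R0.PY <= y" "ln b * Er b (\<alpha> + \<rho>) pU Q0.PY <= y" using ch1 ch2 n0 I0 lnY by linarith+
 have "exp (- (real l * y)) <= g1" unfolding g1_def by (rule pw[OF ly(1)])
 moreover have "exp (- (real l * y)) <= g2" unfolding g2_def by (rule pw[OF ly(2)])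
 ultimately have "exp (- (real l * y)) <= \<phi>" using xi_nonneg by (auto simp: \<phi>_def)
 then have "ln (exp (- (real l * y))) <= ln \<phi>" by (intro ln_mono) auto
 then show ?thesis using \<phi> by (simp add: B_def ln_div)
 qed
 interpret N: scheme_numbers l la y \<rho>n U B \<sigma> \<alpha>' h
 by standard (use B23 By eB \<phi> n0 Hh0 H\<sigma> ch1 lE I0 lnY h0 hy in \<open>auto simp: \<alpha>'_def min_def\<close>)
 define Pt where "Pt = (%x. (1 - 1 / real l) * P x + of_bool (x \<in> Rs) / (real l * real (card Rs)))"
 have L: "N.L = ln (real (card Rs)) + ln (real l)" by (simp only: N.L_def) (simp only: \<sigma>_def)
 have sm1: "pmf_on Pt" unfolding Pt_def by (rule smoothed(1)[OF P PR l134])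
 have sm2: "!!x. 0 < P x ==> 0 < Pt x" unfolding Pt_def by (rule smoothed(2)[OF P PR l134])
 have sm3: "!!x. 0 < P x ==> 0 <= - ln (Pt x)" unfolding Pt_def by (rule smoothed(3)[OF P PR l134])
 have sm4: "!!x. 0 < P x ==> - ln (Pt x) <= N.L" unfolding Pt_def L by (rule smoothed(4)[OF P PR l134])
 have sm5: "(\<Sum>x\<in>UNIV. P x * - ln (Pt x)) <= h" unfolding Pt_def h_def Hh_def by (rule smoothed(5)[OF P PR l134])
 obtain t T :: nat and e :: "nat => nat set" and E D x' :: real
 where t: "1 <= t" and T: "1 <= T" and E: "0 < E" "E + 12/5 <= N0.E0" and D: "1 <= D" and tt: "real t = 1 \<or> 11/5 * y * real t <= B + \<sigma>"
 and e: "\<forall>c. e c \<subseteq> {..<T}" and pools: "(\<Sum>B<T. real (card {c. c < T * (t * l) & B \<in> e c})) <= D * real l * real T"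
 and EX: "(\<Sum>k\<in>seqs (T * (t * l)). (\<Prod>c<T * (t * l). P (k ! c)) * ln (\<Sum>A\<in>Pow {..<T}. exp (- real (card A) * (real t * (real l * h + E))) *
 (\<Prod>c<T * (t * l). if e c \<inter> {..<T} \<subseteq> A then exp (- ln (Pt (k ! c))) else 1))) <= x'"
 and bal': "\<forall>I \<sigma>j. 0 <= I --> \<alpha>' + \<rho>n + I <= y --> \<sigma> <= \<sigma>j -->
 x' / (real T * real t) + exp (- B) * (2 * D * B / real t + D * (real l * \<alpha>' + (E + 12/5) + real l * I) + 278/100 + 2 / real l
 + 139/100 * (\<sigma>j + B + 2 * ln (real l))) <= real l * exp (- B) * (B + 1 - exp (- B)) + (real l - 1) * exp (- B) * \<sigma>j + real l * exp (- B) * I"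
 proof -
 show thesis
 by (rule N.scheme_exists[where P=P and i="%x. - ln (Pt x)", THEN exE]; (fact P sm3 sm4 sm5 | (elim exE conjE, rule that, assumption+)))
 qed
 note bal = bal'[rule_format]
 have tT: "0 < t" "0 < T" using t T by auto
 define n' where "n' = T * (t * l)"
 have n'0: "0 < n'" using tT l0 by (simp add: n'_def)
 \<comment> \<open>The logarithm of the number of messages of one codeword. The \<open>12/5\<close>
   covers the smoothing loss 1.01, a factor 2 from rounding \<open>exp G\<close> down and a factor 2
   from \<open>hash_pair_bound\<close>.\<close>
 define G where "G = real l * \<alpha>' + (E + 12/5)"
 have G0: "0 <= G" using E n0 Hh0 by (auto simp: G_def \<alpha>'_def)
 define M where "M = nat \<lfloor>exp G\<rfloor>"
 have eG: "1 <= exp G" using G0 by simp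
 have M: "1 <= real M" "real M <= exp G" "exp G <= 2 * real M"
 proof -
 have "1 <= \<lfloor>exp G\<rfloor>" using eG by (simp add: le_floor_iff)
 then have "real M = of_int \<lfloor>exp G\<rfloor>" by (simp add: M_def)
 moreover have "1 <= real_of_int \<lfloor>exp G\<rfloor>" using \<open>1 <= \<lfloor>exp G\<rfloor>\<close> by simp
 ultimately show "1 <= real M" "real M <= exp G" "exp G <= 2 * real M" by linarith+
 qed
 define C where "C = {xs. set xs \<subseteq> {..<M} & length xs = t}"
 have cC: "card C = M ^ t" unfolding C_def by (simp add: card_lists_length_eq)
 have finC: "finite C" unfolding C_def by (simp add: finite_lists_length_eq)
 have Cne: "C ~= {}" using cC M by (metis card.empty of_nat_0 power_eq_0_iff not_one_le_zero)
 define Q where "Q k = (\<Prod>c<n'. P (k ! c))" for k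
 have Q0: "0 <= Q k" for k unfolding Q_def by (intro prod_nonneg) (simp add: pmf_on_nonneg[OF P])
 have Q1: "(\<Sum>k\<in>seqs n'. Q k) = 1" unfolding Q_def using sum_seqs_iid[of n' "%_. P"] P by simp
 have QPt: "0 < (\<Prod>c<n'. Pt (k ! c))" if "0 < Q k" for k
 proof (intro prod_pos ballI)
 fix c assume c: "c \<in> {..<n'}"
 have "P (k ! c) ~= 0"
 proof
 assume "P (k ! c) = 0"
 then have "Q k = 0" unfolding Q_def using c by (intro prod_zero) auto
 then show False using that by simp
 qed
 then show "0 < Pt (k ! c)" using sm2 pmf_on_nonneg[OF P, of "k ! c"] by (simp add: less_le)
 qed
 have QPt': "!!k. k \<in> seqs n' ==> 0 < Q k ==> 0 < (\<Prod>c<n'. Pt (k ! c))" using QPt by blast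
 define pool where "pool B = {c. c < n' & B \<in> e c}" for B
 obtain H :: "nat => 'k list => nat list" and Xf where H': "\<forall>B<T. \<forall>k. H B k \<in> C"
 and Hp': "\<forall>B<T. \<forall>k k'. (\<forall>c\<in>pool B. k ! c = k' ! c) --> H B k = H B k'"
 and HX': "\<forall>k V. k \<in> seqs n' --> 0 < (\<Prod>c<n'. Pt (k ! c)) --> V \<subseteq> {..<T} -->
 (\<Sum>k'\<in>seqs n'. (\<Prod>c<n'. Pt (k' ! c)) * of_bool (\<forall>B<T. B \<notin> V --> H B k' = H B k))
 <= (\<Prod>c<n'. Pt (k ! c)) * exp (Xf k + real (card V) * ln (real (card C)))"
 and HE: "(\<Sum>k\<in>seqs n'. Q k * Xf k) <= (\<Sum>k\<in>seqs n'. Q k * ln (\<Sum>A\<in>Pow {..<T}. (2 / real (card C)) ^ card A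
 * (\<Prod>c<n'. if e c \<inter> {..<T} \<subseteq> A then 1 / Pt (k ! c) else 1)))"
 proof -
 show thesis
 by (rule hash_exists[where Pt=Pt and C=C and Q=Q and n=n' and T=T and e=e, folded pool_def, THEN exE]; (fact sm1 finC Cne Q0 QPt' | (elim exE conjE, rule that, assumption+)))
 qed
 note H = H'[rule_format] and Hp = Hp'[rule_format] and HX = HX'[rule_format]
 \<comment> \<open>The part of the entropy of a slot that its hash leaves out, later paid by
   \<beta>.\<close>
 define \<gamma> where "\<gamma> = real t * real l * (Hh - \<alpha>')"
 have \<gamma>0: "0 <= \<gamma>" by (simp add: \<gamma>_def \<alpha>'_def)
 have r: "2 / real (card C) <= exp (\<gamma> - real t * (real l * h + E))"
 proof -
 have "(exp G) ^ t <= (2 * real M) ^ t" using M by (intro power_mono) auto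
 then have "exp (real t * G) <= 2 ^ t * real (card C)" by (simp add: exp_of_nat_mult power_mult_distrib cC)
 then have "2 / real (card C) <= 2 * 2 ^ t * exp (- (real t * G))"
 using M by (simp add: cC exp_minus field_simps)
 also have "2 * 2 ^ t * exp (- (real t * G)) = exp (ln 2 + real t * ln 2 - real t * G)"
 by (simp add: exp_add exp_diff exp_minus exp_of_nat_mult field_simps)
 also have "... <= exp (\<gamma> - real t * (real l * h + E))"
 proof (intro iffD2[OF exp_le_cancel_iff])
 have "real l * h = real l * Hh + 101/100" using lr by (simp add: h_def distrib_left)
 then have e1: "\<gamma> - real t * (real l * h + E) = - (real t * G) + 139/100 * real t"
 by (simp add: \<gamma>_def G_def algebra_simps)
 have "1 * ln 2 <= real t * ln 2" using t by (intro mult_right_mono) auto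
 then have a1: "ln 2 <= real t * ln 2" by simp
 have "real t * ln 2 <= real t * (139/200)" using ln2_le_25_over_36 by (intro mult_left_mono) auto
 then have a2: "real t * ln 2 <= 139/200 * real t" by simp
 show "ln 2 + real t * ln 2 - real t * G <= \<gamma> - real t * (real l * h + E)" unfolding e1 using a1 a2 by linarith
 qed
 finally show ?thesis .
 qed
 have EXf: "(\<Sum>k\<in>seqs n'. Q k * Xf k) <= real T * \<gamma> + x'"
 proof -
 have c0: "0 < 2 / real (card C)" using cC M by simp
 have "(\<Sum>k\<in>seqs n'. (\<Prod>c<n'. P (k ! c)) * ln (\<Sum>A\<in>Pow {..<T}. (2 / real (card C)) ^ card A * (\<Prod>c<n'. if e c \<inter> {..<T} \<subseteq> A then 1 / Pt (k ! c) else 1)))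
 <= real T * \<gamma> + (\<Sum>k\<in>seqs n'. (\<Prod>c<n'. P (k ! c)) * ln (\<Sum>A\<in>Pow {..<T}. exp (- real (card A) * (real t * (real l * h + E))) *
 (\<Prod>c<n'. if e c \<inter> {..<T} \<subseteq> A then exp (- ln (Pt (k ! c))) else 1)))"
 by (rule hash_expectation[OF P sm2 c0 r \<gamma>0])
 then show ?thesis using HE EX unfolding Q_def n'_def[symmetric] by linarith
 qed
 define lam where "lam = ln (real (card C))"
 have lam: "0 <= lam" "lam <= real t * G"
 proof -
 have e: "lam = real t * ln (real M)" using M by (simp add: lam_def cC ln_realpow)
 show "0 <= lam" unfolding e using M by simp
 have "ln (real M) <= ln (exp G)" using M by (intro ln_mono) auto
 then show "lam <= real t * G" unfolding e by (intro mult_left_mono) auto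
 qed
 have Hlen: "length (H B k) = t" "!!m. m \<in> set (H B k) ==> m < M" if "B < T" for B k using H[OF that, of k] by (auto simp: C_def)
 have Hi: "H B k ! i < M" if "B < T" "i < t" for B i and k :: "'k list"
 proof -
 have "H B k ! i \<in> set (H B k)" using Hlen(1)[OF that(1)] that(2) by (intro nth_mem) simp
 then show ?thesis by (rule Hlen(2)[OF that(1)])
 qed
 \<comment> \<open>The code is designed for the law of the messages that the hashes actually
   produce.\<close>
 define \<pi> where "\<pi> = block_law T t (seqs n') Q H"
 have \<pi>0: "0 <= \<pi> m" for m unfolding \<pi>_def block_law_def by (intro divide_nonneg_nonneg sum_nonneg mult_nonneg_nonneg Q0) auto
 have bls: "(\<Sum>m<M. \<pi> m * g m) * (real T * real t) = (\<Sum>k\<in>seqs n'. Q k * (\<Sum>B<T. \<Sum>i<t. g (H B k ! i)))" for g :: "nat => real"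
 unfolding \<pi>_def by (rule block_law_sum) (use Hi tT in auto)
 have \<pi>1: "(\<Sum>m<M. \<pi> m) <= 1"
 proof -
 have "(\<Sum>m<M. \<pi> m * 1) * (real T * real t) = (\<Sum>k\<in>seqs n'. Q k * (real T * real t))" unfolding bls by simp
 also have "... = 1 * (real T * real t)" by (simp only: sum_distrib_right[symmetric] Q1)
 finally show ?thesis using tT by simp
 qed
 let ?B1 = "real (l + 1) ^ (CARD('u) * CARD('y1)) * b powr (- real l * Er b (\<alpha> + \<rho>) pU R0.PY)"
 let ?B2 = "real (l + 1) ^ (CARD('u) * CARD('y2)) * b powr (- real l * Er b (\<alpha> + \<rho>) pU Q0.PY)"
 \<comment> \<open>Of the spare \<open>l * \<rho>\<close>, the margin takes at most a half by
   \<open>E0\<close> and the type-counting factor at most a quarter by \<open>lst\<close>.\<close>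
 have Mb: "real M * real (l + 1) ^ (CARD('u) + CARD('u) * Yj) <= b powr (real l * (\<alpha> + \<rho>))" if Yj: "real Yj <= Y" for Yj :: nat
 proof -
 have "real M * real (l + 1) ^ (CARD('u) + CARD('u) * Yj) <= exp G * exp (real (CARD('u) + CARD('u) * Yj) * la)"
 proof (intro mult_mono)
 have "exp (real (CARD('u) + CARD('u) * Yj) * la) = exp la ^ (CARD('u) + CARD('u) * Yj)" by (rule exp_of_nat_mult)
 then show "real (l + 1) ^ (CARD('u) + CARD('u) * Yj) <= exp (real (CARD('u) + CARD('u) * Yj) * la)"
 by (simp add: la_def add.commute)
 qed (use M in auto)
 also have "... = exp (G + real (CARD('u) + CARD('u) * Yj) * la)" by (simp only: exp_add)
 also have "... <= exp (real l * (ln b * \<alpha> + ln b * \<rho>))"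
 proof (intro iffD2[OF exp_le_cancel_iff])
 have "real (CARD('u) + CARD('u) * Yj) * la = U * (1 + real Yj) * la" by (simp add: U_def distrib_left)
 also have "... <= U * (1 + Y) * la" using Yj U2 la0 by (intro mult_right_mono mult_left_mono) auto
 finally have u: "real (CARD('u) + CARD('u) * Yj) * la <= U * (1 + Y) * la" .
 have "2 * U * (1 + Y) * la = 2 * (U * (1 + Y) * la)" by simp
 moreover have "real l * \<alpha>' <= real l * \<alpha>n" by (intro mult_left_mono) (auto simp: \<alpha>'_def)
 moreover have "0 <= real l * \<rho>n" using n0 by simp
 ultimately have "G + real (CARD('u) + CARD('u) * Yj) * la <= real l * \<alpha>n + real l * \<rho>n"
 using u lst E(2) N0.E0(1) unfolding G_def by linarith
 then show "G + real (CARD('u) + CARD('u) * Yj) * la <= real l * (ln b * \<alpha> + ln b * \<rho>)"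
 by (simp only: \<alpha>n_def \<rho>n_def distrib_left)
 qed
 also have "... = b powr (real l * (\<alpha> + \<rho>))" using base by (simp add: powr_def algebra_simps)
 finally show ?thesis .
 qed
 have YY: "real CARD('y1) <= Y" "real CARD('y2) <= Y" by (auto simp: Y_def)
 have "\<exists>c d1 d2. (\<forall>m<M. c m \<in> tclass l n) \<and>
 (\<Sum>m<M. \<pi> m * (\<Sum>ys\<in>seqs l. seq_prob R0.PY (c m) ys * of_bool (d1 ys ~= m))) <= 2 * ?B1 \<and>
 (\<Sum>m<M. \<pi> m * (\<Sum>ys\<in>seqs l. seq_prob Q0.PY (c m) ys * of_bool (d2 ys ~= m))) <= 2 * ?B2"
 by (rule constant_composition_code[OF base l0 n(2) R0.stoch_PY Q0.stoch_PY Mb[OF YY(1)] Mb[OF YY(2)] \<pi>0 \<pi>1, unfolded pn])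
 then obtain c d1 d2 where c: "!!m. m < M ==> c m \<in> tclass l n"
 and e1: "(\<Sum>m<M. \<pi> m * (\<Sum>ys\<in>seqs l. seq_prob R0.PY (c m) ys * of_bool (d1 ys ~= m))) <= 2 * ?B1"
 and e2: "(\<Sum>m<M. \<pi> m * (\<Sum>ys\<in>seqs l. seq_prob Q0.PY (c m) ys * of_bool (d2 ys ~= m))) <= 2 * ?B2"
 by blast
 define Cb where "Cb = slot_code c l t T H"
 define w where "w = t * l"
 have n'w: "n' = T * w" by (simp add: n'_def w_def)
 have compB: "real (card {i. i < w & Cb k ! (B * w + i) = u}) = real w * pU u" if "B < T" for B k u
 unfolding Cb_def w_def by (rule slot_code_comp[where M=M]) (use comp c Hlen that in auto)
 have compT: "real (card {i. i < n' & Cb k ! i = u}) = real n' * pU u" for k u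
 proof -
 have "real (card {i. i < n' & Cb k ! i = u}) = (\<Sum>B<T. real (card {i. i < w & Cb k ! (B * w + i) = u}))"
 unfolding n'w card_blocks[of T w "%i. Cb k ! i = u"] by simp
 also have "... = (\<Sum>B<T. real w * pU u)" by (intro sum.cong refl compB) auto
 finally show ?thesis by (simp add: n'w)
 qed
 have Cbp: "Cb k ! (B * w + i) = Cb k' ! (B * w + i)" if B: "B < T" and i: "i < w" and k: "\<forall>c\<in>pool B. k ! c = k' ! c" for B i k k'
 proof -
 have lt: "B * w + i < T * (t * l)" using block_index[OF B i] by (simp add: w_def)
 have quot: "(B * v + i) div v = B" if "i < v" for v using that by auto
 have dv: "(B * w + i) div (t * l) = B" unfolding w_def by (rule quot) (use i in \<open>simp add: w_def\<close>)
 have Hk: "H B k = H B k'" using Hp' B k by blast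
 show ?thesis unfolding Cb_def slot_code_def using lt by (simp add: dv Hk)
 qed
 \<comment> \<open>Small enough that smoothing the kernel costs \<open>2 * \<phi> / l\<close> per
   codeword, yet with \<open>ln (1 / \<eta>)\<close> only \<open>B + 2 * ln l\<close>.\<close>
 define \<eta> where "\<eta> = \<phi> / (real l)\<^sup>2"
 have l2: "1 <= (real l)\<^sup>2" using lr by (simp add: one_le_power)
 have \<eta>: "0 < \<eta>" "\<eta> <= 1/2"
 proof -
 have "\<phi> * 1 <= 1/2 * (real l)\<^sup>2" using \<phi> l2 by (intro mult_mono) auto
 then show "\<eta> <= 1/2" using l2 by (simp add: \<eta>_def divide_le_eq)
 show "0 < \<eta>" unfolding \<eta>_def using \<phi>(1) lr by (intro divide_pos_pos zero_less_power) auto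
 qed
 define a1 where "a1 s k = (1 - \<eta>) * R0.a s k + \<eta> / real CARD('s1)" for s k
 define a2 where "a2 s k = (1 - \<eta>) * Q0.a s k + \<eta> / real CARD('s2)" for s k
 note ak1 = R0.smoothed_kernel[OF \<eta> Kdiff, folded a1_def]
 note ak2 = Q0.smoothed_kernel[OF \<eta> Kdiff', folded a2_def]
 have supp: "0 < Pt (Kh z)" if "0 < WS z" for z
 proof -
 have "WS z <= P (Kh z)" unfolding P_def push_def by (rule member_le_sum) (auto simp: W0)
 then show ?thesis using that by (intro sm2) linarith
 qed
 have supp': "0 < Pt (Kh' z)" if "0 < WS' z" for z
 using supp[of "(snd z, fst z)"] that by (cases z) (simp add: WS'_def Kh'_def Kh_def Ka'_def)
 have kh: "(\<forall>z. Kh z = fh1 (fst z)) \<or> (\<forall>z. Kh z = fh2 (snd z))" using kap unfolding Kh_def fh1_def fh2_def by (elim disjE; simp)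
 have kh': "(\<forall>z. Kh' z = fh2 (fst z)) \<or> (\<forall>z. Kh' z = fh1 (snd z))" using kap' unfolding Kh'_def fh1_def fh2_def by (elim disjE; simp)
 have poolsub: "pool B \<subseteq> {..<n'}" for B by (auto simp: pool_def)
 \<comment> \<open>The slots run on the projected maps, whereas the entropies in \<open>R0\<close>
   and \<open>Q0\<close> refer to \<open>Ka\<close>; \<open>smoothed_kernel\<close> relates the
   two.\<close>
 interpret S1: slots WS pV1 pX1 D2 V1 fh1 fh2 Kh n' Cb pU T w pool H "%_. slot_dec d1 l t" a1 Pt \<phi> Xf lam
 by (unfold_locales; ((fact src pmfs pmfD stV1 kh n'w sm1 ak1(1) ak1(2) \<phi>) | (rule compT) | (rule poolsub) | (rule Cbp, assumption+) | (rule compB, assumption) | (rule HX[folded lam_def], assumption+) | (rule supp, assumption)))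
 interpret S2: slots WS' pV2 pX2 D1 V2 fh2 fh1 Kh' n' Cb pU T w pool H "%_. slot_dec d2 l t" a2 Pt \<phi> Xf lam
 by (unfold_locales; ((fact pWS' pmfs pmfD stV2 kh' n'w sm1 ak2(1) ak2(2) \<phi>) | (rule compT) | (rule poolsub) | (rule Cbp, assumption+) | (rule compB, assumption) | (rule HX[folded lam_def], assumption+) | (rule supp', assumption)))
 have D_eq: "S1.D = D1" "S2.D = D2" by (intro ext; simp add: S1.D_def S2.D_def D1_def D2_def)+
 have F: "S2.F' = S1.F" "S2.F = S1.F'" by (intro ext; simp add: S1.F_def S1.F'_def S2.F_def S2.F'_def)+
 have pools': "(\<Sum>B<T. real (card (pool B))) <= D * real l * real T" using pools by (simp add: pool_def n'_def)
 have \<xi>mono: "1 - (1 - pneh) ^ l <= R0.\<xi>" unfolding \<xi> using pneh pne by (simp add: power_mono)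
 have mm: "real T * (D * (1 - (1 - pneh) ^ l)) <= real T * D * R0.\<xi>" unfolding mult.assoc using \<xi>mono D by (intro mult_left_mono) auto
 have mis1: "(\<Sum>s\<in>seqs n'. \<Sum>t\<in>seqs n'. (\<Prod>i<n'. WS (s ! i, t ! i)) * (\<Sum>B<T. of_bool (\<not> S1.match s t B))) <= real T * D * R0.\<xi>"
 by (rule order_trans[OF S1.mismatch_sum[where ?l0.0=l, folded pneh_def, OF _ D pools'] mm]) (use pneh pne in linarith)
 have mis2: "(\<Sum>s\<in>seqs n'. \<Sum>t\<in>seqs n'. (\<Prod>i<n'. WS' (s ! i, t ! i)) * (\<Sum>B<T. of_bool (\<not> S2.match s t B))) <= real T * D * R0.\<xi>"
 by (rule order_trans[OF S2.mismatch_sum[where ?l0.0=l, unfolded pneh', OF _ D pools'] mm]) (use pneh pne in linarith)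
 have fail1: "(\<Sum>k\<in>seqs n'. (\<Prod>i<n'. push WS Kh (k ! i)) * (\<Sum>B<T. S1.pf B k)) <= real T * real t * (2 * ?B1)"
 proof -
 have "(\<Sum>k\<in>seqs n'. Q k * (\<Sum>B<T. S1.pf B k)) <= (\<Sum>k\<in>seqs n'. Q k * (\<Sum>B<T. \<Sum>i<t. \<Sum>ys\<in>seqs l. seq_prob R0.PY (c (H B k ! i)) ys * of_bool (d1 ys ~= H B k ! i)))"
 unfolding S1.pf_def unfolding w_def Cb_def
 by (rule sum_mono, rule mult_left_mono[OF _ Q0], rule sum_mono, rule slot_dec_error[where H=H and P="R0.PY" and t=t and T=T, OF R0.stoch_PY]) (auto simp: Hlen)
 also have "... <= 2 * ?B1 * (real T * real t)" unfolding bls[symmetric, where g="%m. \<Sum>ys\<in>seqs l. seq_prob R0.PY (c m) ys * of_bool (d1 ys ~= m)"]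
 using e1 by (intro mult_right_mono) auto
 finally show ?thesis by (simp only: Q_def P_def mult_ac)
 qed
 have fail2: "(\<Sum>k\<in>seqs n'. (\<Prod>i<n'. push WS' Kh' (k ! i)) * (\<Sum>B<T. S2.pf B k)) <= real T * real t * (2 * ?B2)"
 proof -
 have "(\<Sum>k\<in>seqs n'. Q k * (\<Sum>B<T. S2.pf B k)) <= (\<Sum>k\<in>seqs n'. Q k * (\<Sum>B<T. \<Sum>i<t. \<Sum>ys\<in>seqs l. seq_prob Q0.PY (c (H B k ! i)) ys * of_bool (d2 ys ~= H B k ! i)))"
 unfolding S2.pf_def unfolding w_def Cb_def
 by (rule sum_mono, rule mult_left_mono[OF _ Q0], rule sum_mono, rule slot_dec_error[where H=H and P="Q0.PY" and t=t and T=T, OF Q0.stoch_PY]) (auto simp: Hlen)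
 also have "... <= 2 * ?B2 * (real T * real t)" unfolding bls[symmetric, where g="%m. \<Sum>ys\<in>seqs l. seq_prob Q0.PY (c m) ys * of_bool (d2 ys ~= m)"]
 using e2 by (intro mult_right_mono) auto
 finally show ?thesis unfolding P2 by (simp only: Q_def mult_ac)
 qed
 have EX1: "(\<Sum>k\<in>seqs n'. (\<Prod>i<n'. push WS Kh (k ! i)) * Xf k) <= real T * \<gamma> + x'" using EXf by (simp only: Q_def P_def)
 have EX2: "(\<Sum>k\<in>seqs n'. (\<Prod>i<n'. push WS' Kh' (k ! i)) * Xf k) <= real T * \<gamma> + x'" unfolding P2 using EXf by (simp only: Q_def)
 \<comment> \<open>The hypothesis on the entropy of the common part enters here through
   \<open>Hh\<close>: what exceeds \<alpha> is at most \<beta>.\<close>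
 have \<gamma>\<beta>: "real T * \<gamma> + x' <= real T * real t * real l * (ln b * \<beta>) + x'"
 proof -
 have "Hh - \<alpha>' <= ln b * \<beta>" using Hh \<beta>I by (auto simp: \<alpha>'_def)
 then have "real t * real l * (Hh - \<alpha>') <= real t * real l * (ln b * \<beta>)" by (intro mult_left_mono) auto
 then have "real T * \<gamma> <= real T * (real t * real l * (ln b * \<beta>))" unfolding \<gamma>_def by (rule mult_left_mono) simp
 then show ?thesis by (simp only: mult.assoc)
 qed
 \<comment> \<open>The exponent in \<phi>j is twice that of the code, and both alphabets have at
   least two letters, which frees the factor \<open>(l + 1) ^ 4\<close> required by
   \<open>absorb\<close>.\<close>
 have absb: "real (l + 1) ^ k * z * (real l + 1) ^ 4 <= (real l + 1) ^ (2 * k) * z" if "4 <= k" "0 <= z" for k and z :: real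
 proof -
 have e: "real (l + 1) = real l + 1" by simp
 have pw: "(real l + 1) ^ (2 * k) = (real l + 1) ^ k * (real l + 1) ^ k" by (simp only: power_even_eq power2_eq_square)
 have "(real l + 1) ^ 4 <= (real l + 1) ^ k" using that by (intro power_increasing) auto
 then have "(real l + 1) ^ k * z * (real l + 1) ^ 4 <= (real l + 1) ^ k * z * (real l + 1) ^ k" using that by (intro mult_left_mono) auto
 also have "... = (real l + 1) ^ k * (real l + 1) ^ k * z" by (simp only: mult_ac)
 finally show ?thesis unfolding e pw .
 qed
 have u2: "2 <= CARD('u)" using U2 by (simp add: U_def)
 have k4: "4 <= CARD('u) * CARD('y1)" "4 <= CARD('u) * CARD('y2)"
 using mult_le_mono[OF u2 Yj2(1)] mult_le_mono[OF u2 Yj2(2)] by simp_all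
 have b1: "?B1 * (real l + 1) ^ 4 <= g1" unfolding g1_def mult.assoc[of 2 "CARD('u)"] by (rule absb[OF k4(1)]) simp
 have b2: "?B2 * (real l + 1) ^ 4 <= g2" unfolding g2_def mult.assoc[of 2 "CARD('u)"] by (rule absb[OF k4(2)]) simp
 have B1: "0 <= ?B1" "?B1 * (real l + 1) ^ 4 <= \<phi>1"
 proof -
 show "?B1 * (real l + 1) ^ 4 <= \<phi>1" using b1 tau_le(1) xi_nonneg(1) by linarith
 qed simp
 have B2: "0 <= ?B2" "?B2 * (real l + 1) ^ 4 <= \<phi>2"
 proof -
 show "?B2 * (real l + 1) ^ 4 <= \<phi>2" using b2 tau_le(2) xi_nonneg(1) by linarith
 qed simp
 have \<sigma>0: "0 <= ln (real CARD('s1))" "0 <= ln (real CARD('s2))" by (auto intro!: ln_ge_zero simp: Suc_le_eq)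
 have tr: "1 <= real t" "1 <= real T" using t T by auto
 have ya: "\<alpha>' + \<rho>n + R0.I <= y" "\<alpha>' + \<rho>n + Q0.I <= y"
 proof -
 have "\<alpha>' <= \<alpha>n" by (simp add: \<alpha>'_def)
 then show "\<alpha>' + \<rho>n + R0.I <= y" "\<alpha>' + \<rho>n + Q0.I <= y" using ch1 ch2 lE lnY by linarith+
 qed
 have D0: "0 <= D" using D by simp
 have HA1: "S1.HA <= R0.HS + 2 * (\<phi> / (real l)\<^sup>2) + pne * (ln (real CARD('s1)) + ln (1 / (\<phi> / (real l)\<^sup>2)))"
 using ak1(3) by (simp only: S1.HA_def \<eta>_def)
 have HA2: "S2.HA <= Q0.HS + 2 * (\<phi> / (real l)\<^sup>2) + pne * (ln (real CARD('s2)) + ln (1 / (\<phi> / (real l)\<^sup>2)))"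
 using ak2(3) by (simp only: S2.HA_def \<eta>_def)
 have nn: "real n' = real T * (real t * real l)" "real w = real t * real l" by (simp_all add: n'_def w_def)
 have gain1: "0 < 2 * real T * ln (1 - \<phi>) + real T * (real t * real l) * R0.I - real T * D * R0.\<xi> * (2 * B + lam + real t * real l * R0.I)
 - real T * real t * (2 * ?B1) * (B + lam) - real T * (real t * real l) * S1.HA - (real T * \<gamma> + x')"
 by (rule gain_pos[OF \<phi>(1,2) small(1) B_def lr tr xi_nonneg(1) \<phi>(4) B1(1) I0(1) R0.I_le[OF pmfs(1)] \<sigma>0(1) D0 c1 lam HA1 lpne \<gamma>\<beta>
 N.absorb[OF E(2) tr(1) tt \<sigma>1(1) B1, folded G_def] bal[OF I0(1) ya(1) \<sigma>1(1), unfolded eB, folded G_def]])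
 have gain2: "0 < 2 * real T * ln (1 - \<phi>) + real T * (real t * real l) * Q0.I - real T * D * R0.\<xi> * (2 * B + lam + real t * real l * Q0.I)
 - real T * real t * (2 * ?B2) * (B + lam) - real T * (real t * real l) * S2.HA - (real T * \<gamma> + x')"
 by (rule gain_pos[OF \<phi>(1,3) small(2) B_def lr tr xi_nonneg(1) \<phi>(4) B2(1) I0(2) Q0.I_le[OF pmfs(1)] \<sigma>0(2) D0 c2 lam HA2 lpne \<gamma>\<beta>
 N.absorb[OF E(2) tr(1) tt \<sigma>1(2) B2, folded G_def] bal[OF I0(2) ya(2) \<sigma>1(2), unfolded eB, folded G_def]])
 have pos1: "0 < (\<Sum>s\<in>seqs n'. \<Sum>t\<in>seqs n'. \<Sum>c\<in>seqs n'. \<Sum>d\<in>seqs n'. \<Sum>y\<in>seqs n'. \<Sum>z\<in>seqs n'.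
 sup_law WS S1.D D2 V1 S1.F S1.F' s t c d y z * ln (S1.sm s c y))"
 by (rule less_le_trans[OF gain1[unfolded B_def] S1.expected_ln_sm[OF lam(1) I0(1) mis1 fail1 EX1, unfolded nn]])
 have pos2: "0 < (\<Sum>s\<in>seqs n'. \<Sum>t\<in>seqs n'. \<Sum>c\<in>seqs n'. \<Sum>d\<in>seqs n'. \<Sum>y\<in>seqs n'. \<Sum>z\<in>seqs n'.
 sup_law WS' S2.D D1 V2 S2.F S2.F' s t c d y z * ln (S2.sm s c y))"
 by (rule less_le_trans[OF gain2[unfolded B_def] S2.expected_ln_sm[OF lam(1) I0(2) mis2 fail2 EX2, unfolded nn]])
 show "transmissible WS W"
 \<comment> \<open>The superletter has length \<open>n'\<close>, and \<open>snd\<close> extracts the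
   channel letter from a codeword letter.\<close>
 proof (rule superletter_coding[where l=n' and W=W and ?D1.0=D1 and ?D2.0=D2 and ?X1.0=snd and ?X2.0=snd and ?F1.0=S1.F and ?F2.0=S1.F'
 and ?t1.0="S1.sm" and ?t2.0="S2.sm", folded V1_def])
 show "(\<Sum>s\<in>seqs n'. \<Sum>c\<in>seqs n'. seq_wt D1 (S1.F s) c * S1.sm s c y) <= 1" if "y \<in> seqs n'" for y
 unfolding D_eq(1)[symmetric] by (rule S1.sm_normalised[OF that])
 show "(\<Sum>s\<in>seqs n'. \<Sum>c\<in>seqs n'. seq_wt D2 (S1.F' s) c * S2.sm s c y) <= 1" if "y \<in> seqs n'" for y
 unfolding D_eq(2)[symmetric] F(2)[symmetric] by (rule S2.sm_normalised[OF that])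
 show "0 < (\<Sum>s1\<in>seqs n'. \<Sum>s2\<in>seqs n'. \<Sum>c1\<in>seqs n'. \<Sum>c2\<in>seqs n'. \<Sum>y1\<in>seqs n'. \<Sum>y2\<in>seqs n'.
 sup_law WS D1 D2 V1 S1.F S1.F' s1 s2 c1 c2 y1 y2 * ln (S1.sm s1 c1 y1))"
 using pos1 by (simp only: D_eq)
 show "0 < (\<Sum>s1\<in>seqs n'. \<Sum>s2\<in>seqs n'. \<Sum>c1\<in>seqs n'. \<Sum>c2\<in>seqs n'. \<Sum>y1\<in>seqs n'. \<Sum>y2\<in>seqs n'.
 sup_law WS D1 D2 V1 S1.F S1.F' s1 s2 c1 c2 y1 y2 * ln (S2.sm s2 c2 y2))"
 unfolding sup_law_swap using pos2 by (simp only: D_eq F WS'_def V2_def)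
 qed (use src chan pmfD n'0 S1.sm_pos S2.sm_pos in auto)
qed

end
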